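(* Assume that $\dim\mathfrak{A}_1<\infty$, that $\sigma_1\subset\Delta_0$, that there is an admissible contour $\Gamma\subset D^\pm$ with $\mathcal{V}_0(B,\Gamma)<\frac14d^2(\Gamma)$, and that there is $c_0>0$ such that $$\langle K_B'(\mu)x,x\rangle\ge c_0\|x\|^2\quad\text{for any }\mu\in\Delta_0\cap\mathcal{O}_{r_0(B)}(\sigma_1)\text{ and any }x\in\mathfrak{A}_1.$$ Let $l\in\{+1,-1\}$, let $\Gamma^l\subset D^l$ be an admissible contour with $\mathcal{V}_0(B,\Gamma^l)<\frac14d^2(\Gamma^l)$, and set $Z^{(l)}=A_1+X^{(l)}$. Then the spectrum of $Z^{(l)}$ consists only of a finite number of isolated eigenvalues of finite algebraic multiplicity, and none of these eigenvalues is real.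
   Context: Let $A_0$, $A_1$ be self-adjoint operators in complex Hilbert spaces $\mathfrak{A}_0$, $\mathfrak{A}_1$, with spectra $\sigma_0$, $\sigma_1$, and let $B$ be a bounded operator from $\mathfrak{A}_1$ to $\mathfrak{A}_0$. $\mathcal{B}(\mathfrak{A}_1)$ denotes the bounded operators on $\mathfrak{A}_1$. Standing assumption: the whole spectrum $\sigma_0$ is absolutely continuous and equals the closure of a single interval $\Delta_0=(\mu_0^{(1)},\mu_0^{(2)})$, $-\infty\le\mu_0^{(1)}<\mu_0^{(2)}\le\infty$. Let $\mathsf{E}^0(\mu)=\mathsf{E}_{A_0}((-\infty,\mu))$ be the spectral function of $A_0$ and $K_B(\mu)=B^*\mathsf{E}^0(\mu)B$. It is assumed that $K_B$ is differentiable on $\Delta_0$ in operator norm and that its derivative $K_B'$ admits analytic continuation from $\Delta_0$ to a simply connected domain $D^-\subset\mathbb{C}^-$ (lower half-plane) whose boundary includes $\Delta_0$. Then $K_B'$ also continues analytically to the domain $D^+\subset\mathbb{C}^+$ symmetric to $D^-$ about the real axis, with $[K_B'(\mu)]^*=K_B'(\bar\mu)$ on $D^\pm$. If an end point $\mu_0^{(k)}$ is finite, it is assumed that $\|K_B'(\mu)\|\le C|\mu-\mu_0^{(k)}|^\gamma$ for $\mu\in D^\pm$ near $\mu_0^{(k)}$, with some $C>0$, $\gamma\in(-1,0]$. The index $l=\pm1$ in $D^l$ is identified with the sign $\pm$. A contour $\Gamma^l$ is a rectifiable Jordan curve obtained by a continuous deformation of $\Delta_0$, lying in $D^l$, with the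 (finite) end points fixed, oriented from $\mu_0^{(1)}$ to $\mu_0^{(2)}$. It is called admissible if $\mathcal{V}_0(B,\Gamma^l):=\int_{\Gamma^l}|d\mu|\,\|K_B'(\mu)\|<\infty$ ($|d\mu|$ is arc length). Put $d(\Gamma^l)=\operatorname{dist}(\sigma_1,\Gamma^l)$. For $Z=A_1+X$, $X\in\mathcal{B}(\mathfrak{A}_1)$, with spectrum not intersecting $\Gamma^l$, set $W_1(Z,\Gamma^l)=-\int_{\Gamma^l}d\mu\,K_B'(\mu)(Z-\mu)^{-1}$. If $\mathcal{V}_0(B,\Gamma^l)<\frac14d^2(\Gamma^l)$, the operator $X^{(l)}$ is the unique solution $X\in\mathcal{B}(\mathfrak{A}_1)$ of $X=W_1(A_1+X,\Gamma^l)$ with $\|X\|\le r_{\min}(\Gamma^l)$, where $r_{\min}(\Gamma^l)=\frac{d(\Gamma^l)}2-\sqrt{\frac{d^2(\Gamma^l)}4-\mathcal{V}_0(B,\Gamma^l)}$; for fixed $l$ it does not depend on the choice of such a contour. Further, $$r_0(B)=\inf\{r_{\min}(\Gamma^l)\,:\,\Gamma^l\subset D^l\text{ admissible},\ d^2(\Gamma^l)-4\mathcal{V}_0(B,\Gamma^l)>0\}$$ (by symmetry this does not depend on $l$). For $r\ge0$, $\mathcal{O}_r(\sigma)=\{z\in\mathbb{C}:\operatorname{dist}(z,\sigma)\le r\}$.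
   Formalization: If Δ_0 has an infinite end point, the deformation of Δ_0 into a contour is also required to run to infinity uniformly there and to sweep a region where ‖K_B'(μ)‖ ≤ exp(C|μ|^ρ) for some ρ<1; without such a condition the claim fails. For bounded Δ_0 nothing is added. *)

theory Defs
  imports "HOL-Analysis.Analysis"
begin

class complex_normed_vector = real_normed_vector +
  fixes scaleC :: "complex \<Rightarrow> 'a \<Rightarrow> 'a" (infixr "*\<^sub>C" 75)
  assumes scaleC_add_right: "c *\<^sub>C (x + y) = c *\<^sub>C x + c *\<^sub>C y"
    and scaleC_add_left: "(b + c) *\<^sub>C x = b *\<^sub>C x + c *\<^sub>C x"
    and scaleC_scaleC: "b *\<^sub>C c *\<^sub>C x = (b * c) *\<^sub>C x"
    and scaleC_one: "1 *\<^sub>C x = x"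
    and scaleR_scaleC: "r *\<^sub>R x = complex_of_real r *\<^sub>C x"
    and norm_scaleC: "norm (c *\<^sub>C x) = cmod c * norm x"

text \<open>The inner product is linear in its first argument.\<close>

class complex_hilbert = complex_normed_vector + complete_space +
  fixes cinner :: "'a \<Rightarrow> 'a \<Rightarrow> complex"
  assumes cinner_add_left: "cinner (x + y) z = cinner x z + cinner y z"
    and cinner_scaleC_left: "cinner (c *\<^sub>C x) y = c * cinner x y"
    and cinner_commute: "cinner x y = cnj (cinner y x)"
    and cinner_norm: "cinner x x = complex_of_real ((norm x)\<^sup>2)"

interpretation complex_vector: vector_space "scaleC :: complex \<Rightarrow> 'a \<Rightarrow> 'a::complex_normed_vector"
  by unfold_locales (simp_all add: scaleC_add_right scaleC_add_left scaleC_scaleC scaleC_one)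

definition finite_cdim :: "'a::complex_normed_vector set \<Rightarrow> bool" where
  "finite_cdim V \<longleftrightarrow> (\<exists>S. finite S \<and> V \<subseteq> complex_vector.span S)"

definition bounded_clinear :: "('a::complex_normed_vector \<Rightarrow> 'b::complex_normed_vector) \<Rightarrow> bool" where
  "bounded_clinear f \<longleftrightarrow> bounded_linear f \<and> (\<forall>c x. f (c *\<^sub>C x) = c *\<^sub>C f x)"

typedef (overloaded) ('a, 'b) cblinfun =
    "{f :: 'a::complex_normed_vector \<Rightarrow> 'b::complex_normed_vector. bounded_clinear f}"
  morphisms cblinfun_apply Abs_cblinfun
  by (rule exI[of _ "\<lambda>_. 0"])
    (simp add: bounded_clinear_def bounded_linear_zero complex_vector.scale_zero_right)

notation cblinfun_apply (infixr "*\<^sub>V" 75)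

setup_lifting type_definition_cblinfun

instantiation cblinfun :: (complex_normed_vector, complex_normed_vector) complex_normed_vector
begin

lift_definition zero_cblinfun :: "('a, 'b) cblinfun" is "\<lambda>_. 0"
  by (simp add: bounded_clinear_def bounded_linear_zero complex_vector.scale_zero_right)

lift_definition plus_cblinfun :: "('a, 'b) cblinfun \<Rightarrow> ('a, 'b) cblinfun \<Rightarrow> ('a, 'b) cblinfun"
  is "\<lambda>f g x. f x + g x"
  by (simp add: bounded_clinear_def bounded_linear_add scaleC_add_right)

lift_definition minus_cblinfun :: "('a, 'b) cblinfun \<Rightarrow> ('a, 'b) cblinfun \<Rightarrow> ('a, 'b) cblinfun"
  is "\<lambda>f g x. f x - g x"
  by (simp add: bounded_clinear_def bounded_linear_sub complex_vector.scale_right_diff_distrib)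

lift_definition uminus_cblinfun :: "('a, 'b) cblinfun \<Rightarrow> ('a, 'b) cblinfun"
  is "\<lambda>f x. - f x"
  by (simp add: bounded_clinear_def bounded_linear_minus)

lift_definition scaleR_cblinfun :: "real \<Rightarrow> ('a, 'b) cblinfun \<Rightarrow> ('a, 'b) cblinfun"
  is "\<lambda>r f x. r *\<^sub>R f x"
proof -
  fix r :: real and f :: "'a \<Rightarrow> 'b"
  assume "bounded_clinear f"
  moreover have "r *\<^sub>R c *\<^sub>C y = c *\<^sub>C r *\<^sub>R y" for c and y :: 'b
    by (simp add: scaleR_scaleC scaleC_scaleC mult.commute)
  ultimately show "bounded_clinear (\<lambda>x. r *\<^sub>R f x)"
    by (simp add: bounded_clinear_def bounded_linear_const_scaleR)
qed

lift_definition scaleC_cblinfun :: "complex \<Rightarrow> ('a, 'b) cblinfun \<Rightarrow> ('a, 'b) cblinfun"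
  is "\<lambda>c f x. c *\<^sub>C f x"
proof -
  fix c :: complex and f :: "'a \<Rightarrow> 'b"
  assume f: "bounded_clinear f"
  have "bounded_linear (\<lambda>y::'b. c *\<^sub>C y)"
    by (rule bounded_linear_intro[of _ "cmod c"])
      (simp_all add: scaleC_add_right scaleR_scaleC scaleC_scaleC mult.commute norm_scaleC)
  with f show "bounded_clinear (\<lambda>x. c *\<^sub>C f x)"
    by (auto simp: bounded_clinear_def scaleC_scaleC mult.commute intro: bounded_linear_compose)
qed

lift_definition norm_cblinfun :: "('a, 'b) cblinfun \<Rightarrow> real" is onorm .

definition dist_cblinfun :: "('a, 'b) cblinfun \<Rightarrow> ('a, 'b) cblinfun \<Rightarrow> real" where
  "dist_cblinfun S T = norm (S - T)"

definition sgn_cblinfun :: "('a, 'b) cblinfun \<Rightarrow> ('a, 'b) cblinfun" where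
  "sgn_cblinfun T = scaleR (inverse (norm T)) T"

definition uniformity_cblinfun :: "(('a, 'b) cblinfun \<times> ('a, 'b) cblinfun) filter" where
  [code del]: "uniformity_cblinfun = (INF e\<in>{0 <..}. principal {(S, T). dist S T < e})"

definition open_cblinfun :: "('a, 'b) cblinfun set \<Rightarrow> bool" where
  [code del]: "open_cblinfun S = (\<forall>T\<in>S. \<forall>\<^sub>F (T', U) in uniformity. T' = T \<longrightarrow> U \<in> S)"

instance
proof
  fix S T U :: "('a, 'b) cblinfun" and a b :: real and c d :: complex
  show "dist S T = norm (S - T)" by (rule dist_cblinfun_def)
  show "sgn T = scaleR (inverse (norm T)) T" by (rule sgn_cblinfun_def)
  show "(uniformity :: (('a, 'b) cblinfun \<times> ('a, 'b) cblinfun) filter) =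
      (INF e\<in>{0 <..}. principal {(S, T). dist S T < e})"
    by (rule uniformity_cblinfun_def)
  show "open X = (\<forall>T\<in>X. \<forall>\<^sub>F (T', U) in uniformity. T' = T \<longrightarrow> U \<in> X)"
    for X :: "('a, 'b) cblinfun set"
    by (rule open_cblinfun_def)
  show "S + T + U = S + (T + U)" by transfer (simp add: add.assoc)
  show "S + T = T + S" by transfer (simp add: add.commute)
  show "0 + T = T" by transfer simp
  show "- T + T = 0" by transfer simp
  show "S - T = S + - T" by transfer simp
  show "a *\<^sub>R (S + T) = a *\<^sub>R S + a *\<^sub>R T" by transfer (simp add: scaleR_add_right)
  show "(a + b) *\<^sub>R T = a *\<^sub>R T + b *\<^sub>R T" by transfer (simp add: scaleR_add_left)
  show "a *\<^sub>R b *\<^sub>R T = (a * b) *\<^sub>R T" by transfer simp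
  show "1 *\<^sub>R T = T" by transfer simp
  show "(norm T = 0) = (T = 0)"
    by transfer (auto simp: bounded_clinear_def onorm_eq_0)
  show "norm (S + T) \<le> norm S + norm T"
    by transfer (auto simp: bounded_clinear_def intro: onorm_triangle)
  show "norm (a *\<^sub>R T) = \<bar>a\<bar> * norm T"
    by transfer (auto simp: bounded_clinear_def onorm_scaleR)
  show "c *\<^sub>C (S + T) = c *\<^sub>C S + c *\<^sub>C T" by transfer (simp add: scaleC_add_right)
  show "(c + d) *\<^sub>C T = c *\<^sub>C T + d *\<^sub>C T" by transfer (simp add: scaleC_add_left)
  show "c *\<^sub>C d *\<^sub>C T = (c * d) *\<^sub>C T" by transfer (simp add: scaleC_scaleC)
  show "1 *\<^sub>C T = T" by transfer (simp add: scaleC_one)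
  show "a *\<^sub>R T = complex_of_real a *\<^sub>C T" by transfer (simp add: scaleR_scaleC)
  have le: "norm (c *\<^sub>C T) \<le> cmod c * norm T" for c and T :: "('a, 'b) cblinfun"
  proof (transfer, rule onorm_bound)
    fix c :: complex and f :: "'a \<Rightarrow> 'b" and x
    assume f: "bounded_clinear f"
    then show "0 \<le> cmod c * onorm f"
      by (simp add: bounded_clinear_def onorm_pos_le)
    from f show "norm (c *\<^sub>C f x) \<le> cmod c * onorm f * norm x"
      by (simp add: bounded_clinear_def norm_scaleC mult.assoc mult_left_mono onorm)
  qed
  show "norm (c *\<^sub>C T) = cmod c * norm T"
  proof (cases "c = 0")
    case True
    have "norm ((0::complex) *\<^sub>C T) \<le> 0" using le[of 0 T] by simp
    moreover have "0 \<le> norm ((0::complex) *\<^sub>C T)"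
      by (transfer) (simp add: onorm_zero complex_vector.scale_zero_left)
    ultimately show ?thesis using True by simp
  next
    case False
    have "inverse c *\<^sub>C c *\<^sub>C T = T"
      using False by transfer (simp add: scaleC_scaleC scaleC_one)
    then have "norm T \<le> cmod (inverse c) * norm (c *\<^sub>C T)"
      using le[of "inverse c" "c *\<^sub>C T"] by simp
    then have "cmod c * norm T \<le> norm (c *\<^sub>C T)"
      using False by (simp add: norm_inverse norm_divide field_simps)
    with le[of c T] show ?thesis by simp
  qed
qed

end

lift_definition cblinfun_id :: "('a::complex_normed_vector, 'a) cblinfun" is "\<lambda>x. x"
  by (simp add: bounded_clinear_def bounded_linear_ident)

lift_definition cblinfun_compose :: "('b::complex_normed_vector, 'c::complex_normed_vector) cblinfun
    \<Rightarrow> ('a::complex_normed_vector, 'b) cblinfun \<Rightarrow> ('a, 'c) cblinfun" (infixl "\<circ>\<^sub>C" 67)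
  is "\<lambda>f g x. f (g x)"
  by (auto simp: bounded_clinear_def intro: bounded_linear_compose)

definition cblinfun_inv :: "('a::complex_normed_vector, 'a) cblinfun \<Rightarrow> ('a, 'a) cblinfun" where
  "cblinfun_inv T = (THE S. S \<circ>\<^sub>C T = cblinfun_id \<and> T \<circ>\<^sub>C S = cblinfun_id)"

definition cadjoint :: "('a::complex_hilbert, 'b::complex_hilbert) cblinfun \<Rightarrow> ('b, 'a) cblinfun" where
  "cadjoint T = (THE S. \<forall>x y. cinner (T *\<^sub>V x) y = cinner x (S *\<^sub>V y))"

text \<open>
  A possibly unbounded operator is a domain D together with a function A whose values outside D
  are irrelevant. Self-adjointness says that the graph of the adjoint is the graph of A.
\<close>

definition self_adjoint :: "'a::complex_hilbert set \<Rightarrow> ('a \<Rightarrow> 'a) \<Rightarrow> bool" where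
  "self_adjoint D A \<longleftrightarrow>
     complex_vector.subspace D \<and> closure D = UNIV \<and>
     (\<forall>x\<in>D. \<forall>y\<in>D. A (x + y) = A x + A y) \<and>
     (\<forall>c. \<forall>x\<in>D. A (c *\<^sub>C x) = c *\<^sub>C A x) \<and>
     (\<forall>y z. (\<forall>x\<in>D. cinner (A x) y = cinner x z) \<longleftrightarrow> y \<in> D \<and> z = A y)"

definition spectrum :: "'a::complex_normed_vector set \<Rightarrow> ('a \<Rightarrow> 'a) \<Rightarrow> complex set" where
  "spectrum D A = - {z. bij_betw (\<lambda>x. A x - z *\<^sub>C x) D UNIV \<and>
                        (\<exists>M. \<forall>x\<in>D. norm x \<le> M * norm (A x - z *\<^sub>C x))}"

definition bspectrum :: "('a::complex_normed_vector, 'a) cblinfun \<Rightarrow> complex set" where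
  "bspectrum T = spectrum UNIV (cblinfun_apply T)"

definition eigenvalue :: "('a::complex_normed_vector, 'a) cblinfun \<Rightarrow> complex \<Rightarrow> bool" where
  "eigenvalue T z \<longleftrightarrow> (\<exists>x. x \<noteq> 0 \<and> T *\<^sub>V x = z *\<^sub>C x)"

text \<open>The algebraic multiplicity of an eigenvalue is the dimension of its root subspace.\<close>

definition root_subspace :: "('a::complex_normed_vector, 'a) cblinfun \<Rightarrow> complex \<Rightarrow> 'a set" where
  "root_subspace T z = {x. \<exists>n. ((\<lambda>y. T *\<^sub>V y - z *\<^sub>C y) ^^ n) x = 0}"

definition projection_valued_measure :: "(real set \<Rightarrow> ('a::complex_hilbert, 'a) cblinfun) \<Rightarrow> bool" where
  "projection_valued_measure E \<longleftrightarrow>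
     (\<forall>M\<in>sets borel. E M \<circ>\<^sub>C E M = E M \<and> (\<forall>x y. cinner (E M *\<^sub>V x) y = cinner x (E M *\<^sub>V y))) \<and>
     E UNIV = cblinfun_id \<and>
     (\<forall>F::nat \<Rightarrow> real set. range F \<subseteq> sets borel \<longrightarrow> disjoint_family F \<longrightarrow>
        (\<forall>x. (\<lambda>n. E (F n) *\<^sub>V x) sums (E (\<Union>n. F n) *\<^sub>V x)))"

definition scalar_measure ::
    "(real set \<Rightarrow> ('a::complex_hilbert, 'a) cblinfun) \<Rightarrow> 'a \<Rightarrow> real measure" where
  "scalar_measure E x = measure_of UNIV (sets borel) (\<lambda>M. ennreal (Re (cinner (E M *\<^sub>V x) x)))"

text \<open>
  E is the spectral measure of the operator A with domain D, that is, A is the integral of t with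
  respect to E(dt). For linear A on a dense D, equality of the quadratic forms gives equality of
  the operators by polarization.
\<close>

definition spectral_measure ::
    "'a::complex_hilbert set \<Rightarrow> ('a \<Rightarrow> 'a) \<Rightarrow> (real set \<Rightarrow> ('a, 'a) cblinfun) \<Rightarrow> bool" where
  "spectral_measure D A E \<longleftrightarrow>
     projection_valued_measure E \<and>
     (\<forall>x. x \<in> D \<longleftrightarrow> integrable (scalar_measure E x) (\<lambda>t. t\<^sup>2)) \<and>
     (\<forall>x\<in>D. cinner (A x) x = complex_of_real (\<integral>t. t \<partial>scalar_measure E x))"

definition purely_absolutely_continuous ::
    "(real set \<Rightarrow> ('a::complex_hilbert, 'a) cblinfun) \<Rightarrow> bool" where
  "purely_absolutely_continuous E \<longleftrightarrow> (\<forall>x. absolutely_continuous lborel (scalar_measure E x))"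

definition K_B :: "(real set \<Rightarrow> ('a::complex_hilbert, 'a) cblinfun) \<Rightarrow> ('b::complex_hilbert, 'a) cblinfun
    \<Rightarrow> real \<Rightarrow> ('b, 'b) cblinfun" where
  "K_B E B t = cadjoint B \<circ>\<^sub>C E {..<t} \<circ>\<^sub>C B"

text \<open>Complex differentiability, for functions with values in a complex normed space; S is open.\<close>

definition vholomorphic_on :: "(complex \<Rightarrow> 'a::complex_normed_vector) \<Rightarrow> complex set \<Rightarrow> bool" where
  "vholomorphic_on F S \<longleftrightarrow> (\<forall>z\<in>S. \<exists>F'. (F has_derivative (\<lambda>h. h *\<^sub>C F')) (at z))"

text \<open>
  The interval is given by its end points a, b; K is the analytically continued derivative of the
  function \<open>K_B\<close>, defined on the interval and on both domains.
\<close>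

definition domain_of_sign :: "complex set \<Rightarrow> int \<Rightarrow> complex set" where
  "domain_of_sign Dm l = (if l = -1 then Dm else cnj ` Dm)"

definition is_end :: "ereal \<Rightarrow> ereal \<Rightarrow> real \<Rightarrow> bool" where
  "is_end a b c \<longleftrightarrow> ereal c = a \<or> ereal c = b"

text \<open>
  Behaviour of a deformation \<open>H\<close> along a filter \<open>F\<close> (\<open>at_bot\<close> or \<open>at_top\<close>) at an infinite end
  point: the curves run to infinity uniformly, and K has growth of order less than one on the part
  of the region they sweep. The latter is the Phragmen-Lindelof condition for a half-plane; it says
  in which sense a deformation keeps the end point at infinity. Without it, integrals over two
  admissible contours need not agree even if the integrand is holomorphic between them: for example
  \<open>exp (- exp (k z)) / (z\<^sup>2 + m\<^sup>2)\<close> with \<open>k = 2 \<pi> / h\<close>, \<open>m > h\<close>, is absolutely integrable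
  over the real line and over the line \<open>Im z = - h\<close>, but not over the lines in the middle of the
  strip between them.
\<close>

definition deformation_at_infinity ::
    "(complex \<Rightarrow> 'b::complex_normed_vector) \<Rightarrow> (real \<Rightarrow> real \<Rightarrow> complex) \<Rightarrow> real filter \<Rightarrow> bool" where
  "deformation_at_infinity K H F \<longleftrightarrow>
     (\<forall>R. \<forall>\<^sub>F t in F. \<forall>s\<in>{0..1}. R \<le> norm (H s t)) \<and>
     (\<exists>C \<rho>. \<rho> < 1 \<and>
        (\<forall>\<^sub>F t in F. \<forall>s\<in>{0..1}. norm (K (H s t)) \<le> exp (C * norm (H s t) powr \<rho>)))"

text \<open>
  H is a deformation, within the domain D and the interval itself, of the interval into the curve
  g; finite end points stay fixed. The first argument of H is the deformation parameter.
\<close>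

definition deformation_of_interval ::
    "(complex \<Rightarrow> 'b::complex_normed_vector) \<Rightarrow> complex set \<Rightarrow> ereal \<Rightarrow> ereal \<Rightarrow>
     (real \<Rightarrow> real \<Rightarrow> complex) \<Rightarrow> (real \<Rightarrow> complex) \<Rightarrow> bool" where
  "deformation_of_interval K D a b H g \<longleftrightarrow>
     continuous_on ({0..1} \<times> einterval a b) (\<lambda>(s, t). H s t) \<and>
     (\<forall>t\<in>einterval a b. H 0 t = complex_of_real t \<and> H 1 t = g t) \<and>
     (\<forall>s\<in>{0..1}. \<forall>t\<in>einterval a b. H s t \<in> D \<union> complex_of_real ` einterval a b) \<and>
     (\<forall>c. is_end a b c \<longrightarrow>
        uniform_limit {0..1} (\<lambda>t s. H s t) (\<lambda>_. complex_of_real c) (at c within einterval a b)) \<and>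
     (a = -\<infinity> \<longrightarrow> deformation_at_infinity K H at_bot) \<and>
     (b = \<infinity> \<longrightarrow> deformation_at_infinity K H at_top)"

text \<open>
  A contour is a (locally) rectifiable Jordan curve, represented by its arc length parametrization
  \<open>\<gamma>\<close> on the open interval from p to q: every such curve has one, and it is characterized by
  \<open>\<gamma>\<close> being 1-Lipschitz with a derivative of modulus 1 almost everywhere. The curve has finite
  length towards a finite end point, so p, respectively q, is finite there. The function \<open>\<phi>\<close>
  is an orientation preserving change of parameter.
\<close>

definition contour :: "(complex \<Rightarrow> 'b::complex_normed_vector) \<Rightarrow> complex set \<Rightarrow> ereal \<Rightarrow> ereal \<Rightarrow>
    ereal \<Rightarrow> ereal \<Rightarrow> (real \<Rightarrow> complex) \<Rightarrow> bool" where
  "contour K D a b p q \<gamma> \<longleftrightarrow>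
     p < q \<and>
     inj_on \<gamma> (einterval p q) \<and>
     \<gamma> ` einterval p q \<subseteq> D \<and>
     1-lipschitz_on (einterval p q) \<gamma> \<and>
     (AE s in lborel. s \<in> einterval p q \<longrightarrow>
        (\<exists>v. (\<gamma> has_vector_derivative v) (at s) \<and> norm v = 1)) \<and>
     (a \<noteq> -\<infinity> \<longrightarrow> p \<noteq> -\<infinity>) \<and> (b \<noteq> \<infinity> \<longrightarrow> q \<noteq> \<infinity>) \<and>
     (\<exists>H \<phi>. continuous_on (einterval a b) \<phi> \<and> strict_mono_on (einterval a b) \<phi> \<and>
        \<phi> ` einterval a b = einterval p q \<and>
        deformation_of_interval K D a b H (\<lambda>t. \<gamma> (\<phi> t)))"

definition V_0 :: "(complex \<Rightarrow> 'b::complex_normed_vector) \<Rightarrow> ereal \<Rightarrow> ereal \<Rightarrow> (real \<Rightarrow> complex) \<Rightarrow> real" where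
  "V_0 K p q \<gamma> = (LBINT s:einterval p q. norm (K (\<gamma> s)))"

text \<open>Set integrability expresses that the integral \<open>V_0\<close> is finite.\<close>

definition admissible :: "(complex \<Rightarrow> 'b::complex_normed_vector) \<Rightarrow> complex set \<Rightarrow> ereal \<Rightarrow> ereal \<Rightarrow>
    ereal \<Rightarrow> ereal \<Rightarrow> (real \<Rightarrow> complex) \<Rightarrow> bool" where
  "admissible K D a b p q \<gamma> \<longleftrightarrow>
     contour K D a b p q \<gamma> \<and> set_integrable lborel (einterval p q) (\<lambda>s. norm (K (\<gamma> s)))"

definition d_contour :: "complex set \<Rightarrow> ereal \<Rightarrow> ereal \<Rightarrow> (real \<Rightarrow> complex) \<Rightarrow> real" where
  "d_contour \<sigma> p q \<gamma> = setdist \<sigma> (\<gamma> ` einterval p q)"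

definition r_min :: "(complex \<Rightarrow> 'b::complex_normed_vector) \<Rightarrow> complex set \<Rightarrow>
    ereal \<Rightarrow> ereal \<Rightarrow> (real \<Rightarrow> complex) \<Rightarrow> real" where
  "r_min K \<sigma> p q \<gamma> =
     d_contour \<sigma> p q \<gamma> / 2 - sqrt ((d_contour \<sigma> p q \<gamma>)\<^sup>2 / 4 - V_0 K p q \<gamma>)"

definition r_0 :: "(complex \<Rightarrow> 'b::complex_normed_vector) \<Rightarrow> complex set \<Rightarrow> ereal \<Rightarrow> ereal \<Rightarrow>
    complex set \<Rightarrow> real" where
  "r_0 K D a b \<sigma> = Inf {r_min K \<sigma> p q \<gamma> | p q \<gamma>.
     admissible K D a b p q \<gamma> \<and> (d_contour \<sigma> p q \<gamma>)\<^sup>2 - 4 * V_0 K p q \<gamma> > 0}"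

definition closed_nbhd :: "real \<Rightarrow> complex set \<Rightarrow> complex set" where
  "closed_nbhd r \<sigma> = {z. infdist z \<sigma> \<le> r}"

definition W_1 :: "(complex \<Rightarrow> ('b::complex_hilbert, 'b) cblinfun) \<Rightarrow> ('b, 'b) cblinfun \<Rightarrow>
    ereal \<Rightarrow> ereal \<Rightarrow> (real \<Rightarrow> complex) \<Rightarrow> ('b, 'b) cblinfun" where
  "W_1 K Z p q \<gamma> = - integral (einterval p q) (\<lambda>s. vector_derivative \<gamma> (at s) *\<^sub>C
     (K (\<gamma> s) \<circ>\<^sub>C cblinfun_inv (Z - \<gamma> s *\<^sub>C cblinfun_id)))"

definition X_solution :: "(complex \<Rightarrow> ('b::complex_hilbert, 'b) cblinfun) \<Rightarrow> ('b, 'b) cblinfun \<Rightarrow>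
    ereal \<Rightarrow> ereal \<Rightarrow> (real \<Rightarrow> complex) \<Rightarrow> ('b, 'b) cblinfun" where
  "X_solution K A p q \<gamma> = (THE X. X = W_1 K (A + X) p q \<gamma> \<and> norm X \<le> r_min K (bspectrum A) p q \<gamma>)"

end

theory Submission
  imports Defs "HOL-Complex_Analysis.Complex_Analysis" "HOL-Real_Asymp.Real_Asymp"
begin

text \<open>
  Write \<open>X\<close> for the solution belonging to the contour, so that \<open>Z = A\<^sub>1 + X\<close> and \<open>X = W\<^sub>1(Z)\<close>. In finite dimension everything
  about the spectrum of \<open>Z\<close> is linear algebra, except that no eigenvalue is real. Suppose
  \<open>Z x = \<lambda> x\<close> with \<open>\<lambda>\<close> real and \<open>x \<noteq> 0\<close>, and put \<open>k(\<mu>) = \<langle>K'(\<mu>) x, x\<rangle>\<close>. On one hand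
  \<open>\<langle>X x, x\<rangle> = \<lambda> \<parallel>x\<parallel>\<^sup>2 - \<langle>A\<^sub>1 x, x\<rangle>\<close> is real. On the other hand it is minus the integral over the
  contour of \<open>k(\<mu>) / (\<lambda> - \<mu>)\<close>. This integral is the limit for \<open>y \<longlonglongrightarrow> 0\<close> of the same integral with
  \<open>\<lambda>\<close> replaced by the point \<open>\<lambda> - i l y\<close> on the other side of the real axis, and with such a
  pole the contour can be moved back to the interval \<open>\<Delta>\<^sub>0\<close>. There \<open>k \<ge> 0\<close>, because \<open>K\<^sub>B\<close> is
  nondecreasing, and the imaginary part is up to a sign \<open>\<pi>\<close> times a Poisson integral of \<open>k\<close>, which
  stays above a positive constant as \<open>y \<longlonglongrightarrow> 0\<close> if \<open>k\<close> is positive at \<open>\<lambda>\<close>. So the imaginary part cannot vanish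
  (\<open>poisson_lower_bound\<close>, \<open>no_real_eigenvalue\<close>).

  The hypothesis gives \<open>k(\<lambda>) > 0\<close> only if \<open>\<lambda>\<close> is in \<open>\<Delta>\<^sub>0\<close> and within distance \<open>r\<^sub>0\<close> of \<open>\<sigma>\<^sub>1\<close>. As
  \<open>A\<^sub>1\<close> is self-adjoint, the distance is at most the norm of \<open>X\<close>, so it has to be shown that
  this norm is at most \<open>r\<^sub>m\<^sub>i\<^sub>n\<close> of every other contour in the same half-plane
  (\<open>X_solution_le_r_min\<close>). This follows if \<open>W\<^sub>1\<close> is, up to a sign, the same for both contours (\<open>W_agree\<close>). The
  integrand contains the resolvent of \<open>Z\<close>, which may have singularities between the contours. They
  are dealt with by a translation: with \<open>g(\<mu> - \<zeta>)\<close> in place of \<open>g(\<mu>)\<close> both contour integrals are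
  holomorphic in \<open>\<zeta>\<close> near 0, and where \<open>\<zeta>\<close> has moved the singularities to the other side of the real
  axis both equal the integral over \<open>\<Delta>\<^sub>0\<close>. The identity theorem gives equality at \<open>\<zeta> = 0\<close>
  (\<open>form_integrals_agree\<close>).

  What remains is to move a contour to the interval for an integrand \<open>F\<close> holomorphic in \<open>D\<^sup>-\<close>; the
  case \<open>l = 1\<close> is reduced to it by complex conjugation. The domain is simply connected, so \<open>F\<close> has a
  primitive \<open>G\<close>, which extends continuously to \<open>\<Delta>\<^sub>0\<close>, and both integrals are differences of limits
  of \<open>G\<close>. These limits are compared along arcs of small circles about a finite end point, or large
  circles about 0, that join a point of the interval to a point of the curve. Such an arc stays
  in \<open>D\<^sup>-\<close> because the deformation passes over it: the image of the boundary of the parameter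
  rectangle has nonzero winding number about its points (\<open>arc_to_contour\<close>). At a finite end point the bound on \<open>K'\<close> makes the
  integral over the arc small; at an infinite one a Phragmen-Lindelof multiplier does
  (\<open>integral_interval_eq_curve\<close>).

  An arc starting near one end point of the interval may reach the curve near either of its ends, so
  this argument yields the integral over \<open>\<Delta>\<^sub>0\<close> only as \<open>\<sigma>\<close> times the contour integral with
  \<open>\<sigma> \<in> {0, 1, -1}\<close>, where \<open>\<sigma>\<close> does not depend on the integrand. The Poisson integral at a point of
  \<open>\<sigma>\<^sub>1\<close> excludes \<open>\<sigma> = 0\<close> (\<open>close_contour_represented\<close>), and a wrong sign is harmless: the estimate
  of solutions of \<open>X = W\<^sub>1(A\<^sub>1 + X)\<close> holds as well for those of \<open>X = - W\<^sub>1(A\<^sub>1 + X)\<close>.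
\<close>

section \<open>Winding numbers of rectangular loops\<close>

text \<open>
  The boundary of \<open>[0, 1] \<times> [u, v]\<close> as a loop from \<open>(0, u)\<close>; its first side is the one that a
  deformation maps to the undeformed interval.
\<close>

definition rect_loop :: "real \<Rightarrow> real \<Rightarrow> real \<Rightarrow> real \<times> real" where
  "rect_loop u v = linepath (0, u) (0, v) +++ linepath (0, v) (1, v) +++ linepath (1, v) (1, u) +++ linepath (1, u) (0, u)"

lemma rect_loop_simps:
  "path (rect_loop u v)" "pathfinish (rect_loop u v) = pathstart (rect_loop u v)"
  by (auto simp: rect_loop_def)

lemma closed_segment_axis_parallel:
  fixes a b u v :: real
  assumes "u \<le> v"
  shows "closed_segment (a, u) (a, v) = {a} \<times> {u..v}" "closed_segment (a, v) (a, u) = {a} \<times> {u..v}"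
    and "closed_segment (u, b) (v, b) = {u..v} \<times> {b}" "closed_segment (v, b) (u, b) = {u..v} \<times> {b}"
  using assms closed_segment_same_fst[of "(a, u)" "(a, v)"] closed_segment_same_snd[of "(u, b)" "(v, b)"]
  by (simp_all add: closed_segment_eq_real_ivl closed_segment_commute[of "(a, v)"] closed_segment_commute[of "(v, b)"])

lemma path_image_rect_loop:
  assumes "u \<le> v"
  shows "path_image (rect_loop u v) = {0} \<times> {u..v} \<union> {0..1} \<times> {v} \<union> {1} \<times> {u..v} \<union> {0..1} \<times> {u}"
  unfolding rect_loop_def using assms
  by (simp add: path_image_join closed_segment_axis_parallel Un_assoc)

text \<open>
  The rectangle is contractible, so the image of its boundary is null-homotopic within the
  image of the rectangle.
\<close>

lemma winding_number_outside_sweep: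
  fixes H :: "real \<Rightarrow> real \<Rightarrow> complex"
  assumes cont: "continuous_on ({0..1} \<times> {u..v}) (\<lambda>(s, t). H s t)" and "u \<le> v"
    and z: "z \<notin> (\<lambda>(s, t). H s t) ` ({0..1} \<times> {u..v})"
  shows "winding_number ((\<lambda>(s, t). H s t) \<circ> rect_loop u v) z = 0"
proof -
  let ?T = "{0..1::real} \<times> {u..v}" and ?h = "\<lambda>(s, t). H s t"
  have "convex ?T" by (intro convex_Times convex_real_interval)
  then have "simply_connected ?T" by (rule convex_imp_simply_connected)
  moreover have "path_image (rect_loop u v) \<subseteq> ?T"
    using \<open>u \<le> v\<close> by (auto simp: path_image_rect_loop)
  moreover have "(0, u) \<in> ?T" using \<open>u \<le> v\<close> by auto
  ultimately have "homotopic_loops ?T (rect_loop u v) (linepath (0,u) (0,u))"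
    unfolding simply_connected_def
    using rect_loop_simps by auto
  then have "homotopic_loops (- {z}) (?h \<circ> rect_loop u v) (?h \<circ> linepath (0,u) (0,u))"
    by (rule homotopic_loops_continuous_image[OF _ cont]) (use z in auto)
  then have "winding_number (?h \<circ> rect_loop u v) z = winding_number (?h \<circ> linepath (0,u) (0,u)) z"
    by (rule winding_number_homotopic_loops)
  also have "\<dots> = 0"
    using z \<open>u \<le> v\<close> by (intro winding_number_constI[of "H 0 u"]) (auto simp: linepath_def algebra_simps)
  finally show ?thesis .
qed

text \<open>
  Crossing the interval from above to below changes the winding number by one. Above it is 0, because
  the loop lies in the closed lower half-plane. The change is computed by replacing the first
  side of the loop by a path through \<open>W\<close> in the upper half-plane, that is, by adding the boundary of a
  triangle: the modified loop avoids a whole disc about \<open>t0\<close>, and the triangle contains exactly the upper half of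
  this disc.
\<close>

lemma winding_number_below_interval:
  fixes H :: "real \<Rightarrow> real \<Rightarrow> complex" and t0 :: real
  assumes cont: "continuous_on ({0..1} \<times> {u..v}) (\<lambda>(s, t). H s t)"
    and t0: "u < t0" "t0 < v"
    and H0: "\<And>t. t \<in> {u..v} \<Longrightarrow> H 0 t = of_real t"
    and H1: "\<And>t. t \<in> {u..v} \<Longrightarrow> Im (H 1 t) < 0"
    and Him: "\<And>s t. s \<in> {0..1} \<Longrightarrow> t \<in> {u..v} \<Longrightarrow> Im (H s t) \<le> 0"
    and sides: "\<And>s. s \<in> {0..1} \<Longrightarrow> H s u \<noteq> of_real t0 \<and> H s v \<noteq> of_real t0"
  obtains \<rho> where "\<rho> > 0"
    "\<And>z. Im z < 0 \<Longrightarrow> dist z (of_real t0) < \<rho> \<Longrightarrow>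
       z \<notin> path_image ((\<lambda>(s, t). H s t) \<circ> rect_loop u v) \<and>
       winding_number ((\<lambda>(s, t). H s t) \<circ> rect_loop u v) z \<noteq> 0"
proof -
  let ?h = "\<lambda>(s, t). H s t" 
  define U V W where "U = complex_of_real u" and "V = complex_of_real v" and "W = Complex t0 1"
  define R where "R = ?h \<circ> (linepath (0, v) (1, v) +++ linepath (1, v) (1, u) +++ linepath (1, u) (0, u))"
  define L where "L = ?h \<circ> rect_loop u v"
  define L1 where "L1 = linepath U V +++ R"
  define P where "P = linepath U W +++ linepath W V"
  define L2 where "L2 = P +++ R"
  have uv: "u \<le> v" using t0 by simp
  have im_rect: "path_image (rect_loop u v) \<subseteq> {0..1} \<times> {u..v}"
    using uv by (auto simp: path_image_rect_loop)
  have pathL: "path L"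
    unfolding L_def by (intro path_continuous_image rect_loop_simps continuous_on_subset[OF cont im_rect])
  have imL: "path_image L \<subseteq> {z. Im z \<le> 0}"
    using im_rect Him unfolding L_def path_image_compose by auto
  have Leq: "L x = L1 x" if "0 \<le> x" "x \<le> 1" for x
  proof -
    have "?h (linepath (0::real, u) (0, v) y) = linepath U V y" if "0 \<le> y" "y \<le> 1" for y
    proof -
      have "linepath (0::real, u) (0, v) y = (0, linepath u v y)" by (simp add: linepath_def)
      then have "?h (linepath (0::real, u) (0, v) y) = H 0 (linepath u v y)" by simp
      moreover have "linepath u v y \<in> {u..v}"
        using linepath_in_path[of y u v] that uv by (simp add: closed_segment_eq_real_ivl)
      ultimately show ?thesis using H0[of "linepath u v y"] by (simp add: U_def V_def linepath_def scaleR_conv_of_real)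
    qed
    then have *: "(?h \<circ> linepath (0, u) (0, v)) y = linepath U V y" if "0 \<le> y" "y \<le> 1" for y
      using that by simp
    have "L = (?h \<circ> linepath (0, u) (0, v)) +++ R"
      unfolding L_def rect_loop_def R_def by (rule path_compose_join)
    then show ?thesis using that * by (simp add: L1_def joinpaths_def)
  qed
  have wnL: "winding_number L z = winding_number L1 z" for z
    by (rule winding_number_cong) (use Leq in auto)
  have piL: "path_image L = path_image L1"
    using Leq by (auto simp: path_image_def)
  have "path (linepath (0, v) (1, v) +++ linepath (1, v) (1, u) +++ linepath (1, u) (0::real, u))" by simp
  moreover have imR': "path_image (linepath (0, v) (1, v) +++ linepath (1, v) (1, u) +++ linepath (1, u) (0::real, u)) 
      \<subseteq> {0..1} \<times> {v} \<union> {1} \<times> {u..v} \<union> {0..1} \<times> {u}"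
    using uv by (simp add: path_image_join closed_segment_axis_parallel Un_assoc)
  ultimately have pathR: "path R"
    unfolding R_def using uv
    by (intro path_continuous_image continuous_on_subset[OF cont]) auto
  have t0R: "of_real t0 \<notin> path_image R"
  proof
    assume "of_real t0 \<in> path_image R"
    then obtain w where "w \<in> path_image (linepath (0, v) (1, v) +++ linepath (1, v) (1, u) +++ linepath (1, u) (0::real, u))"
        and w: "?h w = of_real t0"
      unfolding R_def path_image_compose by (elim imageE) simp
    then have "w \<in> {0..1} \<times> {v} \<union> {1} \<times> {u..v} \<union> {0..1} \<times> {u}"
      using imR' by blast
    moreover obtain s t where "w = (s, t)" by (cases w)
    ultimately have "(s,t) \<in> {0..1} \<times> {v} \<union> {1} \<times> {u..v} \<union> {0..1} \<times> {u}" "H s t = of_real t0"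
      using w by simp_all
    then show False using sides H1[of t] by auto
  qed
  have R_ends: "pathstart R = V" "pathfinish R = U"
    using H0[of u] H0[of v] uv by (auto simp: R_def pathstart_def pathfinish_def joinpaths_def U_def V_def linepath_def)
  have P_ends: "pathstart P = U" "pathfinish P = V" "path P" by (auto simp: P_def)
  have not_seg: "Complex t0 d \<notin> closed_segment U W" "Complex t0 d \<notin> closed_segment W V" if "d < 1" for d
  proof -
    have "d = 1" if "Complex t0 d = (1 - r) *\<^sub>R U + r *\<^sub>R W" "0 \<le> r" "r \<le> 1" for r
    proof -
      have "t0 = (1 - r) * u + r * t0" "d = r" using that by (auto simp: complex_eq_iff U_def W_def)
      then have "(1 - r) * (t0 - u) = 0" by (simp add: algebra_simps)
      then show ?thesis using t0 \<open>d = r\<close> by auto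
    qed
    moreover have "d = 1" if "Complex t0 d = (1 - r) *\<^sub>R W + r *\<^sub>R V" "0 \<le> r" "r \<le> 1" for r
    proof -
      have "t0 = (1 - r) * t0 + r * v" "d = 1 - r" using that by (auto simp: complex_eq_iff V_def W_def)
      then have "r * (v - t0) = 0" by algebra
      then show ?thesis using t0 \<open>d = 1 - r\<close> by auto
    qed
    ultimately show "Complex t0 d \<notin> closed_segment U W" "Complex t0 d \<notin> closed_segment W V" 
      using \<open>d < 1\<close> by (auto simp: closed_segment_def)
  qed
  have t0P: "of_real t0 \<notin> path_image P"
    using not_seg[of 0] by (simp add: P_def path_image_join complex_of_real_def)
  have L2p: "path L2" "pathfinish L2 = pathstart L2"
    by (simp_all add: L2_def P_ends R_ends pathR)
  have "of_real t0 \<notin> path_image L2"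
    using t0P t0R by (simp add: L2_def path_image_join P_ends R_ends)
  moreover have "open (- path_image L2)"
    using closed_path_image[OF L2p(1)] by auto
  ultimately obtain \<rho>0 where \<rho>0: "\<rho>0 > 0" "ball (complex_of_real t0) \<rho>0 \<subseteq> - path_image L2"
    using open_contains_ball by blast
  define \<rho> where "\<rho> = min \<rho>0 1"
  have \<rho>: "\<rho> > 0" "ball (complex_of_real t0) \<rho> \<subseteq> - path_image L2" "\<rho> \<le> 1"
    using \<rho>0 by (auto simp: \<rho>_def)
  have ball_const: "winding_number L2 x = winding_number L2 y" if "x \<in> ball (of_real t0) \<rho>" "y \<in> ball (of_real t0) \<rho>" for x y
    by (rule winding_number_eq[OF L2p that]) (use \<rho> in auto)
  have L1_im: "path_image L1 = closed_segment U V \<union> path_image R"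
    by (simp add: L1_def path_image_join R_ends)
  have seg_real: "Im x = 0" if "x \<in> closed_segment U V" for x
    using that by (auto simp: closed_segment_def U_def V_def)
  have tri: "winding_number L2 z = winding_number L1 z + winding_number (linepath U W +++ linepath W V +++ linepath V U) z"
    if z: "z \<in> ball (of_real t0) \<rho>" "Im z \<noteq> 0" for z
  proof -
    have zP: "z \<notin> path_image P" and zR: "z \<notin> path_image R"
      using \<rho>(2) z by (auto simp: L2_def path_image_join P_ends R_ends)
    then have zs: "z \<notin> closed_segment U W" "z \<notin> closed_segment W V" "z \<notin> closed_segment U V"
      using z seg_real by (auto simp: P_def path_image_join)
    have "winding_number (linepath U W +++ linepath W V +++ linepath V U) z =
       winding_number (linepath U W) z + winding_number (linepath W V) z + winding_number (linepath V U) z"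
      using zs by (subst winding_number_join; simp add: path_image_join closed_segment_commute)+
    moreover have "winding_number (linepath V U) z = - winding_number (linepath U V) z"
      using winding_number_reversepath[of "linepath U V" z] zs by simp
    moreover have "winding_number L2 z = winding_number (linepath U W) z + winding_number (linepath W V) z + winding_number R z"
      unfolding L2_def using zP zR zs by (simp add: winding_number_join P_ends R_ends pathR) (simp add: P_def winding_number_join)
    moreover have "winding_number L1 z = winding_number (linepath U V) z + winding_number R z"
      unfolding L1_def using zR zs by (simp add: winding_number_join R_ends pathR)
    ultimately show ?thesis by simp
  qed
  define zp where "zp = Complex t0 (\<rho>/2)"
  have zp: "zp \<in> ball (of_real t0) \<rho>" "Im zp > 0" 
    using \<rho> by (auto simp: zp_def dist_norm complex_of_real_def cmod_def real_sqrt_divide)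
  have "winding_number L1 zp = 0"
  proof -
    have "winding_number L zp = 0"
    proof (rule winding_number_zero_outside[OF pathL, of "{z. Im z \<le> 0}"])
      show "convex {z. Im z \<le> 0}" by (rule convex_halfspace_Im_le)
      show "pathfinish L = pathstart L"
        unfolding L_def using rect_loop_simps by (metis pathfinish_compose pathstart_compose)
    qed (use zp imL in auto)
    then show ?thesis using wnL by simp
  qed
  moreover have "winding_number (linepath U W +++ linepath W V +++ linepath V U) zp \<noteq> 0"
  proof -
    have "zp \<in> convex hull {U, W, V}"
    proof -
      define l where "l = (t0 - u) / (v - u)"
      have "l * (v - u) = t0 - u" using t0 by (simp add: l_def)
      moreover have "0 \<le> l" "l \<le> 1" using t0 by (simp_all add: l_def field_simps)
      ultimately have l: "0 \<le> l" "l \<le> 1" "(1 - l) * u + l * v = t0"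
        by (simp_all add: algebra_simps)
      have "zp = ((1 - \<rho>/2) * (1 - l)) *\<^sub>R U + (\<rho>/2) *\<^sub>R W + ((1 - \<rho>/2) * l) *\<^sub>R V"
      proof -
        have "(1 - k) * (1 - l) * u + k * t0 + (1 - k) * l * v = t0" for k :: real
        proof -
          have "(1 - k) * (1 - l) * u + k * t0 + (1 - k) * l * v = (1 - k) * ((1 - l) * u + l * v) + k * t0"
            by (simp only: distrib_left mult.assoc add_ac)
          then show ?thesis unfolding l(3) by (simp add: algebra_simps)
        qed
        from this[of "\<rho>/2"] show ?thesis
          by (simp add: complex_eq_iff zp_def U_def V_def W_def)
      qed
      moreover have "(1 - k) * (1 - l) + k + (1 - k) * l = 1" for k :: real by (simp add: algebra_simps)
      ultimately show ?thesis using l \<rho> unfolding convex_hull_3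
        by (intro CollectI exI[of _ "(1 - \<rho>/2) * (1 - l)"] exI[of _ "\<rho>/2"] exI[of _ "(1 - \<rho>/2) * l"]) auto
    qed
    moreover have "zp \<notin> closed_segment U W" "zp \<notin> closed_segment W V" 
      using not_seg[of "\<rho>/2"] \<rho> by (auto simp: zp_def)
    moreover have "zp \<notin> closed_segment V U" using seg_real[of zp] zp by (auto simp: closed_segment_commute)
    ultimately have "zp \<in> interior (convex hull {U, W, V})"
      by (simp add: interior_of_triangle)
    from winding_number_triangle[OF this] show ?thesis by simp
  qed
  ultimately have wzp: "winding_number L2 zp \<noteq> 0" using tri[OF zp(1)] zp by auto
  show ?thesis
  proof
    show "\<rho> > 0" by fact
    fix z assume z: "Im z < 0" "dist z (of_real t0) < \<rho>"
    then have zb: "z \<in> ball (of_real t0) \<rho>" by (simp add: dist_commute)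
    have "z \<notin> path_image R" using \<rho>(2) zb by (auto simp: L2_def path_image_join P_ends R_ends)
    then have 1: "z \<notin> path_image L" using z seg_real unfolding piL L1_im by auto
    have "winding_number (linepath U W +++ linepath W V +++ linepath V U) z = 0"
    proof (rule winding_number_zero_outside[of _ "{z. Im z \<ge> 0}"])
      show "convex {z. Im z \<ge> 0}" by (rule convex_halfspace_Im_ge)
      have "closed_segment a b \<subseteq> {z. Im z \<ge> 0}" if "Im a \<ge> 0" "Im b \<ge> 0" for a b
        using that by (intro closed_segment_subset convex_halfspace_Im_ge) auto
      then show "path_image (linepath U W +++ linepath W V +++ linepath V U) \<subseteq> {z. Im z \<ge> 0}"
        by (simp add: path_image_join U_def V_def W_def)
    qed (use z in auto)
    then have "winding_number L1 z = winding_number L2 z" using tri[OF zb] z by auto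
    also have "\<dots> = winding_number L2 zp" using ball_const zb zp by blast
    finally show "z \<notin> path_image (?h \<circ> rect_loop u v) \<and> winding_number (?h \<circ> rect_loop u v) z \<noteq> 0"
      using 1 wzp wnL by (simp add: L_def)
  qed
qed

section \<open>The region swept by a deformation\<close>

text \<open>
  A deformation of the interval from \<open>a\<close> to \<open>b\<close> into a domain of the lower half-plane, without
  reference to a particular parametrization of the final curve.
\<close>

locale swept_interval =
  fixes D :: "complex set" and a b :: ereal and H :: "real \<Rightarrow> real \<Rightarrow> complex"
  assumes ab: "a < b"
    and D_open: "open D"
    and D_lower: "D \<subseteq> {z. Im z < 0}"
    and H_cont: "continuous_on ({0..1} \<times> einterval a b) (\<lambda>(s, t). H s t)"
    and H_0: "t \<in> einterval a b \<Longrightarrow> H 0 t = of_real t"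
    and H_1: "t \<in> einterval a b \<Longrightarrow> H 1 t \<in> D"
    and H_in: "s \<in> {0..1} \<Longrightarrow> t \<in> einterval a b \<Longrightarrow> H s t \<in> D \<union> of_real ` einterval a b"
    and H_finite_end: "is_end a b c \<Longrightarrow>
      uniform_limit {0..1} (\<lambda>t s. H s t) (\<lambda>_. complex_of_real c) (at c within einterval a b)"
    and H_bot: "a = -\<infinity> \<Longrightarrow> \<forall>\<^sub>F t in at_bot. \<forall>s\<in>{0..1}. R \<le> norm (H s t)"
    and H_top: "b = \<infinity> \<Longrightarrow> \<forall>\<^sub>F t in at_top. \<forall>s\<in>{0..1}. R \<le> norm (H s t)"
begin

abbreviation I :: "real set" where "I \<equiv> einterval a b"

definition swept :: "complex set" where "swept = (\<lambda>(s, t). H s t) ` ({0..1} \<times> I)"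

lemma H_lower: "s \<in> {0..1} \<Longrightarrow> t \<in> I \<Longrightarrow> Im (H s t) \<le> 0"
  using H_in[of s t] D_lower by auto

lemma H_1_lower: "t \<in> I \<Longrightarrow> Im (H 1 t) < 0"
  using H_1[of t] D_lower by auto

lemma I_between: "u \<in> I \<Longrightarrow> v \<in> I \<Longrightarrow> {u..v} \<subseteq> I"
  unfolding einterval_def
  by (auto intro: less_le_trans le_less_trans simp flip: ereal_less_eq(3))

text \<open>
  Uniform limits at a finite end and uniform divergence at an infinite one are used in the same way: a
  property of all points close to the end holds on a tail of the deformation.
\<close>

lemma left_tail:
  assumes P_fin: "\<And>e. ereal e = a \<Longrightarrow> \<exists>\<epsilon>>0. \<forall>t\<in>I. \<forall>s\<in>{0..1}. dist (H s t) (of_real e) < \<epsilon> \<longrightarrow> P s t"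
    and P_inf: "a = -\<infinity> \<Longrightarrow> \<forall>\<^sub>F t in at_bot. \<forall>s\<in>{0..1}. P s t"
    and t0: "t0 \<in> I"
  obtains u where "u \<in> I" "u < t0" "\<And>t s. t \<in> I \<Longrightarrow> t \<le> u \<Longrightarrow> s \<in> {0..1} \<Longrightarrow> P s t"
proof (cases a)
  case (real e)
  then have e: "is_end a b e" by (simp add: is_end_def)
  obtain \<epsilon> where \<epsilon>: "\<epsilon> > 0" "\<forall>t\<in>I. \<forall>s\<in>{0..1}. dist (H s t) (of_real e) < \<epsilon> \<longrightarrow> P s t" using P_fin[of e] real by auto
  have "\<forall>\<^sub>F t in at e within I. \<forall>s\<in>{0..1}. dist (H s t) (of_real e) < \<epsilon>"
    using uniform_limitD[OF H_finite_end[OF e] \<epsilon>(1)] .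
  then obtain d where d: "d > 0" "\<And>t s. t \<in> I \<Longrightarrow> t \<noteq> e \<Longrightarrow> dist t e < d \<Longrightarrow> s \<in> {0..1} \<Longrightarrow> dist (H s t) (of_real e) < \<epsilon>"
    unfolding eventually_at by metis
  define u where "u = min (e + d / 2) ((e + t0) / 2)"
  have et0: "e < t0" using t0 real by (auto simp: einterval_def)
  have "e < u" "u < t0" "u < e + d" using et0 d by (auto simp: u_def min_def)
  show ?thesis
  proof
    show "u < t0" by fact
    have "ereal u < b" using \<open>u < t0\<close> t0 by (auto simp: einterval_def intro: less_trans[of _ "ereal t0"])
    then show "u \<in> I" using \<open>e < u\<close> real by (auto simp: einterval_def)
    fix t s :: real assume t: "t \<in> I" "t \<le> u" "s \<in> {0..1}"
    then have "e < t" using real by (auto simp: einterval_def)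
    then have "dist (H s t) (of_real e) < \<epsilon>" using t \<open>u < e + d\<close> by (intro d(2)) (auto simp: dist_real_def)
    then show "P s t" using \<epsilon>(2) t by blast
  qed
next
  case MInf
  obtain N where N: "\<forall>t\<le>N. \<forall>s\<in>{0..1}. P s t"
    using P_inf[OF MInf] unfolding eventually_at_bot_linorder by blast
  define u where "u = min N (t0 - 1)"
  have u: "u < t0" "u \<le> N" by (auto simp: u_def)
  show ?thesis
  proof
    show "u < t0" by fact
    have "ereal u < b" using \<open>u < t0\<close> t0 by (auto simp: einterval_def intro: less_trans[of _ "ereal t0"])
    then show "u \<in> I" using MInf by (simp add: einterval_def)
  qed (use N u in auto)
next
  case PInf
  then show ?thesis using ab by auto
qed

lemma right_tail:
  assumes P_fin: "\<And>e. ereal e = b \<Longrightarrow> \<exists>\<epsilon>>0. \<forall>t\<in>I. \<forall>s\<in>{0..1}. dist (H s t) (of_real e) < \<epsilon> \<longrightarrow> P s t"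
    and P_inf: "b = \<infinity> \<Longrightarrow> \<forall>\<^sub>F t in at_top. \<forall>s\<in>{0..1}. P s t"
    and t0: "t0 \<in> I"
  obtains v where "v \<in> I" "t0 < v" "\<And>t s. t \<in> I \<Longrightarrow> v \<le> t \<Longrightarrow> s \<in> {0..1} \<Longrightarrow> P s t"
proof (cases b)
  case (real e)
  then have e: "is_end a b e" by (simp add: is_end_def)
  obtain \<epsilon> where \<epsilon>: "\<epsilon> > 0" "\<forall>t\<in>I. \<forall>s\<in>{0..1}. dist (H s t) (of_real e) < \<epsilon> \<longrightarrow> P s t" using P_fin[of e] real by auto
  have "\<forall>\<^sub>F t in at e within I. \<forall>s\<in>{0..1}. dist (H s t) (of_real e) < \<epsilon>"
    using uniform_limitD[OF H_finite_end[OF e] \<epsilon>(1)] .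
  then obtain d where d: "d > 0" "\<And>t s. t \<in> I \<Longrightarrow> t \<noteq> e \<Longrightarrow> dist t e < d \<Longrightarrow> s \<in> {0..1} \<Longrightarrow> dist (H s t) (of_real e) < \<epsilon>"
    unfolding eventually_at by metis
  define v where "v = max (e - d / 2) ((e + t0) / 2)"
  have et0: "t0 < e" using t0 real by (auto simp: einterval_def)
  have "v < e" "t0 < v" "e - d < v" using et0 d by (auto simp: v_def max_def)
  show ?thesis
  proof
    show "t0 < v" by fact
    have "a < ereal v" using \<open>t0 < v\<close> t0 by (auto simp: einterval_def intro: less_trans[of _ "ereal t0"])
    then show "v \<in> I" using \<open>v < e\<close> real by (auto simp: einterval_def)
    fix t s :: real assume t: "t \<in> I" "v \<le> t" "s \<in> {0..1}"
    then have "t < e" using real by (auto simp: einterval_def)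
    then have "dist (H s t) (of_real e) < \<epsilon>" using t \<open>e - d < v\<close> by (intro d(2)) (auto simp: dist_real_def)
    then show "P s t" using \<epsilon>(2) t by blast
  qed
next
  case PInf
  obtain N where N: "\<forall>t\<ge>N. \<forall>s\<in>{0..1}. P s t"
    using P_inf[OF PInf] unfolding eventually_at_top_linorder by blast
  define v where "v = max N (t0 + 1)"
  have v: "t0 < v" "N \<le> v" by (auto simp: v_def)
  show ?thesis
  proof
    show "t0 < v" by fact
    have "a < ereal v" using \<open>t0 < v\<close> t0 by (auto simp: einterval_def intro: less_trans[of _ "ereal t0"])
    then show "v \<in> I" using PInf by (simp add: einterval_def)
  qed (use N v in auto)
next
  case MInf
  then show ?thesis using ab by auto
qed

lemma tails_avoid_circle:
  assumes c: "\<And>e. is_end a b e \<Longrightarrow> \<bar>e - c\<bar> \<noteq> r" and t0: "t0 \<in> I"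
  obtains u v where "u \<in> I" "v \<in> I" "u < t0" "t0 < v"
    "\<And>t s. t \<in> I \<Longrightarrow> t \<le> u \<or> v \<le> t \<Longrightarrow> s \<in> {0..1} \<Longrightarrow> norm (H s t - of_real c) \<noteq> r"
proof -
  let ?Q = "\<lambda>z. norm (z - complex_of_real c) \<noteq> r"
  have 1: "\<exists>\<epsilon>>0. \<forall>z. dist z (of_real e) < \<epsilon> \<longrightarrow> ?Q z" if "is_end a b e" for e
  proof (intro exI[of _ "\<bar>\<bar>e - c\<bar> - r\<bar>"] conjI allI impI)
    show "\<bar>\<bar>e - c\<bar> - r\<bar> > 0" using c[OF that] by simp
    fix z assume "dist z (complex_of_real e) < \<bar>\<bar>e - c\<bar> - r\<bar>"
    moreover have "\<bar>norm (z - of_real c) - norm (complex_of_real e - of_real c)\<bar> \<le> norm (z - of_real e)"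
      using norm_triangle_ineq3[of "z - of_real c" "complex_of_real e - of_real c"] by simp
    moreover have "norm (complex_of_real e - of_real c) = \<bar>e - c\<bar>"
      by (metis norm_of_real of_real_diff)
    ultimately show "?Q z" by (auto simp: dist_norm)
  qed
  have 2: "?Q z" if "r + \<bar>c\<bar> + 1 \<le> norm z" for z
    using that norm_triangle_sub[of z "complex_of_real c"] by auto
  obtain u where "u \<in> I" "u < t0" "\<And>t s. t \<in> I \<Longrightarrow> t \<le> u \<Longrightarrow> s \<in> {0..1} \<Longrightarrow> ?Q (H s t)"
  proof (rule left_tail[OF _ _ t0, where P = "\<lambda>s t. ?Q (H s t)"])
    fix e assume "ereal e = a"
    then show "\<exists>\<epsilon>>0. \<forall>t\<in>I. \<forall>s\<in>{0..1}. dist (H s t) (of_real e) < \<epsilon> \<longrightarrow> ?Q (H s t)"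
      using 1[of e] by (auto simp: is_end_def)
  next
    assume "a = -\<infinity>"
    from H_bot[OF this, of "r + \<bar>c\<bar> + 1"] show "\<forall>\<^sub>F t in at_bot. \<forall>s\<in>{0..1}. ?Q (H s t)"
      by (rule eventually_mono) (use 2 in blast)
  qed blast
  moreover obtain v where "v \<in> I" "t0 < v" "\<And>t s. t \<in> I \<Longrightarrow> v \<le> t \<Longrightarrow> s \<in> {0..1} \<Longrightarrow> ?Q (H s t)"
  proof (rule right_tail[OF _ _ t0, where P = "\<lambda>s t. ?Q (H s t)"])
    fix e assume "ereal e = b"
    then show "\<exists>\<epsilon>>0. \<forall>t\<in>I. \<forall>s\<in>{0..1}. dist (H s t) (of_real e) < \<epsilon> \<longrightarrow> ?Q (H s t)"
      using 1[of e] by (auto simp: is_end_def)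
  next
    assume "b = \<infinity>"
    from H_top[OF this, of "r + \<bar>c\<bar> + 1"] show "\<forall>\<^sub>F t in at_top. \<forall>s\<in>{0..1}. ?Q (H s t)"
      by (rule eventually_mono) (use 2 in blast)
  qed blast
  ultimately show ?thesis using that by metis
qed

lemma cont_sub: "u \<in> I \<Longrightarrow> v \<in> I \<Longrightarrow> continuous_on ({0..1} \<times> {u..v}) (\<lambda>(s, t). H s t)"
  using I_between by (intro continuous_on_subset[OF H_cont]) auto

text \<open>
  Near a point of the interval the domain contains everything below the real axis: these points
  have nonzero winding number, so the deformation passes over them, and it meets nonreal points
  only in the domain.
\<close>

lemma lower_half_disc:
  assumes t0: "t0 \<in> I"
  obtains \<rho> where "\<rho> > 0" "\<And>z. Im z < 0 \<Longrightarrow> dist z (of_real t0) < \<rho> \<Longrightarrow> z \<in> D"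
proof -
  have "\<bar>e - t0\<bar> \<noteq> 0" if "is_end a b e" for e using that t0 by (auto simp: is_end_def einterval_def)
  then obtain u v where uv: "u \<in> I" "v \<in> I" "u < t0" "t0 < v"
    "\<And>t s. t \<in> I \<Longrightarrow> t \<le> u \<or> v \<le> t \<Longrightarrow> s \<in> {0..1} \<Longrightarrow> norm (H s t - of_real t0) \<noteq> 0"
    using tails_avoid_circle[OF _ t0, of t0 0] by metis
  let ?h = "(\<lambda>(s, t). H s t)"
  have sub: "{u..v} \<subseteq> I" by (rule I_between[OF uv(1,2)])
  obtain \<rho> where \<rho>: "\<rho> > 0" "\<And>z. Im z < 0 \<Longrightarrow> dist z (of_real t0) < \<rho> \<Longrightarrow>
       z \<notin> path_image (?h \<circ> rect_loop u v) \<and> winding_number (?h \<circ> rect_loop u v) z \<noteq> 0"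
  proof (rule winding_number_below_interval[OF cont_sub[OF uv(1,2)] uv(3,4)])
    show "H s u \<noteq> of_real t0 \<and> H s v \<noteq> of_real t0" if "s \<in> {0..1}" for s
      using uv(5)[of u s] uv(5)[of v s] uv(1,2) that by auto
    show "Im (H 1 t) < 0" if "t \<in> {u..v}" for t using H_1_lower sub that by auto
  qed (use H_0 H_lower sub in auto)
  show ?thesis
  proof
    fix z assume z: "Im z < 0" "dist z (of_real t0) < \<rho>"
    then have "z \<in> ?h ` ({0..1} \<times> {u..v})"
      using winding_number_outside_sweep[OF cont_sub[OF uv(1,2)], of z] \<rho>(2)[of z] uv(3,4) by linarith
    then obtain s t where "s \<in> {0..1}" "t \<in> {u..v}" "z = H s t" by auto
    moreover from this have "t \<in> I" using sub by blast
    ultimately show "z \<in> D" using H_in[of s t] z by auto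
  qed fact
qed

text \<open>
  With \<open>\<eta> = 1\<close> the lower half-circle is traversed from its right end, with \<open>\<eta> = -1\<close> from its left
  end; this treats left and right end points of the interval at once.
\<close>

lemma lower_arc_point:
  assumes "Im z < 0" "norm (z - of_real c) = r" "\<eta> = 1 \<or> \<eta> = -1"
  obtains \<theta> where "0 < \<theta>" "\<theta> < pi" "z = of_real c + of_real (\<eta> * r) * cis (- \<eta> * \<theta>)"
proof -
  define w where "w = z - of_real c"
  define \<alpha> where "\<alpha> = Arg w"
  have "w = of_real r * cis \<alpha>" using assms by (metis rcis_def rcis_cmod_Arg w_def \<alpha>_def)
  then have z: "z = of_real c + of_real r * cis \<alpha>" by (simp add: w_def algebra_simps)
  have "Im w < 0" using assms by (simp add: w_def)
  then have A: "\<alpha> < 0" "-pi < \<alpha>" using Arg_bounded[of w] by (simp_all add: \<alpha>_def Arg_neg_iff)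
  show ?thesis
  proof (cases "\<eta> = 1")
    case True
    show ?thesis by (rule that[of "- \<alpha>"]) (use A z True in simp_all)
  next
    case False
    then have \<eta>: "\<eta> = -1" using assms by auto
    have "cis (\<alpha> + pi) = - cis \<alpha>" by (simp add: cis_mult[symmetric])
    then show ?thesis by (intro that[of "\<alpha> + pi"]) (use A z \<eta> in simp_all)
  qed
qed

text \<open>
  Follow the lower half-circle from a point of the interval until it first meets the curve. On the
  way it does not meet the boundary of the swept region: the tails of the deformation avoid the
  circle, the interval is above it, and the curve has not been met yet. So the winding number is constant along
  the arc. Just below the interval it is nonzero, hence the whole arc is swept.
\<close>

lemma arc_to_contour:
  assumes r: "r > 0" and \<eta>: "\<eta> = 1 \<or> \<eta> = -1" and t0: "c + \<eta> * r \<in> I"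
    and c: "\<And>e. is_end a b e \<Longrightarrow> \<bar>e - c\<bar> \<noteq> r"
    and t1: "t1 \<in> I" "norm (H 1 t1 - of_real c) = r"
  obtains \<theta> t where "0 < \<theta>" "\<theta> < pi" "t \<in> I" "of_real c + of_real (\<eta> * r) * cis (- \<eta> * \<theta>) = H 1 t"
    "\<And>x. 0 < x \<Longrightarrow> x < \<theta> \<Longrightarrow> of_real c + of_real (\<eta> * r) * cis (- \<eta> * x) \<in> D \<inter> swept"
proof -
  let ?h = "(\<lambda>(s, t). H s t)"
  define t0 where "t0 = c + \<eta> * r"
  have t0I: "t0 \<in> I" using t0 by (simp add: t0_def)
  define A where "A x = of_real c + of_real (\<eta> * r) * cis (- \<eta> * x)" for x
  have A_norm: "norm (A x - of_real c) = r" for x using r \<eta> by (auto simp: A_def norm_mult)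
  have A_im: "Im (A x) = - r * sin x" for x using \<eta> by (auto simp: A_def)
  have contA: "continuous_on S A" for S unfolding A_def by (intro continuous_intros)
  obtain u v where uv: "u \<in> I" "v \<in> I" "u < t0" "t0 < v"
    and tails: "\<And>t s. t \<in> I \<Longrightarrow> t \<le> u \<or> v \<le> t \<Longrightarrow> s \<in> {0..1} \<Longrightarrow> norm (H s t - of_real c) \<noteq> r"
    using tails_avoid_circle[OF c t0I] by metis
  have sub: "{u..v} \<subseteq> I" by (rule I_between[OF uv(1,2)])
  have H1cont: "continuous_on {u..v} (H 1)"
  proof -
    have "continuous_on {u..v} (?h \<circ> (\<lambda>t. (1, t)))"
      by (rule continuous_on_compose) (auto intro!: continuous_intros continuous_on_subset[OF cont_sub[OF uv(1,2)]])
    then show ?thesis by (simp add: o_def)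
  qed
  define S where "S = {0..pi} \<inter> A -` (H 1 ` {u..v})"
  have "compact (H 1 ` {u..v})" using H1cont by (intro compact_continuous_image) auto
  then have "closed S" unfolding S_def
    by (intro continuous_closed_preimage contA compact_imp_closed) auto
  then have "compact S" 
    by (auto simp: compact_eq_bounded_closed S_def intro: bounded_subset[of "{0..pi}"])
  have "Im (H 1 t1) < 0" using H_1[OF t1(1)] D_lower by auto
  then obtain x1 where x1: "0 < x1" "x1 < pi" "H 1 t1 = A x1"
    using lower_arc_point[OF _ t1(2) \<eta>] unfolding A_def by metis
  have "t1 \<in> {u..v}" using tails[of t1 1] t1 by force
  then have "x1 \<in> S" using x1 by (auto simp: S_def image_iff intro!: bexI[of _ t1])
  then obtain \<theta> where \<theta>: "\<theta> \<in> S" "\<And>x. x \<in> S \<Longrightarrow> \<theta> \<le> x"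
    using compact_attains_inf[OF \<open>compact S\<close>] by blast
  then obtain t where t: "t \<in> {u..v}" "A \<theta> = H 1 t" by (auto simp: S_def)
  have "Im (A \<theta>) < 0" using t H_1_lower sub by auto
  then have "sin \<theta> > 0" using A_im r by (simp add: zero_less_mult_iff)
  moreover have "0 \<le> \<theta>" "\<theta> \<le> pi" using \<theta>(1) by (auto simp: S_def)
  ultimately have th: "0 < \<theta>" "\<theta> < pi" by (auto simp: less_le)
  obtain \<rho> where \<rho>: "\<rho> > 0" "\<And>z. Im z < 0 \<Longrightarrow> dist z (of_real t0) < \<rho> \<Longrightarrow>
       z \<notin> path_image (?h \<circ> rect_loop u v) \<and> winding_number (?h \<circ> rect_loop u v) z \<noteq> 0"
  proof (rule winding_number_below_interval[OF cont_sub[OF uv(1,2)] uv(3,4)])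
    have "norm (complex_of_real t0 - of_real c) = r"
      using A_norm[of 0] by (simp add: A_def t0_def)
    then show "H s u \<noteq> of_real t0 \<and> H s v \<noteq> of_real t0" if "s \<in> {0..1}" for s
      using tails[of u s] tails[of v s] uv(1,2) that by auto
    show "Im (H 1 t) < 0" if "t \<in> {u..v}" for t using H_1_lower sub that by auto
  qed (use H_0 H_lower sub in auto)
  let ?L = "?h \<circ> rect_loop u v"
  have pi_L: "path_image ?L = ?h ` ({0} \<times> {u..v} \<union> {0..1} \<times> {v} \<union> {1} \<times> {u..v} \<union> {0..1} \<times> {u})"
    using uv by (simp add: path_image_compose path_image_rect_loop)
  have pL: "path ?L"
    using uv by (intro path_continuous_image rect_loop_simps continuous_on_subset[OF cont_sub[OF uv(1,2)]])
      (auto simp: path_image_rect_loop)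
  have loopL: "pathfinish ?L = pathstart ?L"
    using rect_loop_simps by (metis pathfinish_compose pathstart_compose)
  have A_notin: "A x \<notin> path_image ?L" if x: "0 < x" "x < \<theta>" for x
  proof
    assume "A x \<in> path_image ?L"
    then obtain w where w: "w \<in> {0} \<times> {u..v} \<union> {0..1} \<times> {v} \<union> {1} \<times> {u..v} \<union> {0..1} \<times> {u}" "A x = ?h w"
      unfolding pi_L by (elim imageE) simp
    obtain s t where st: "w = (s, t)" by (cases w)
    have Ax: "A x = H s t" using w st by simp
    have "sin x > 0" using x th by (intro sin_gt_zero) auto
    then have "Im (A x) < 0" using A_im r by simp
    moreover have "A x \<noteq> H 1 t" if "t \<in> {u..v}" for t
    proof
      assume "A x = H 1 t"
      then have "x \<in> S" using that x th by (auto simp: S_def)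
      then show False using \<theta>(2) x by force
    qed
    moreover have "Im (H 0 t) = 0" if "t \<in> {u..v}" using H_0[of t] sub that by auto
    moreover have "A x \<noteq> H s u" "A x \<noteq> H s v" if "s \<in> {0..1}"
      using tails[OF uv(1), of s] tails[OF uv(2), of s] A_norm[of x] that by auto
    ultimately show False using w(1) st Ax by auto
  qed
  define T where "T = {z. Im z < 0} \<inter> ball (of_real t0) \<rho>"
  have "T \<inter> path_image ?L = {}" using \<rho>(2) by (auto simp: T_def dist_commute)
  moreover have "A ` {0<..<\<theta>} \<inter> path_image ?L = {}" using A_notin by auto
  ultimately have disj: "(T \<union> A ` {0<..<\<theta>}) \<inter> path_image ?L = {}" by auto
  have "\<exists>x. 0 < x \<and> x < \<theta> \<and> A x \<in> T"
  proof -
    have "continuous (at 0) A" using contA[of UNIV] by (simp add: continuous_on_eq_continuous_at)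
    then obtain d where d: "d > 0" "\<And>x. dist x 0 < d \<Longrightarrow> dist (A x) (A 0) < \<rho>"
      using \<rho>(1) unfolding continuous_at_eps_delta by metis
    define x where "x = min (d/2) (\<theta>/2)"
    have x: "0 < x" "x < \<theta>" "dist x 0 < d" using d th by (auto simp: x_def min_def)
    then have "Im (A x) < 0" using A_im r th sin_gt_zero[of x] by simp
    moreover have "dist (A x) (of_real t0) < \<rho>" using d(2)[OF x(3)] by (simp add: A_def t0_def)
    ultimately show ?thesis using x by (auto simp: T_def dist_commute)
  qed
  then obtain x0 where x0: "0 < x0" "x0 < \<theta>" "A x0 \<in> T" by auto
  have conn: "connected (T \<union> A ` {0<..<\<theta>})"
  proof (rule connected_Un)
    show "connected T" unfolding T_def
      by (intro convex_connected convex_Int convex_halfspace_Im_lt convex_ball)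
    show "connected (A ` {0<..<\<theta>})" by (intro connected_continuous_image contA) auto
    show "T \<inter> A ` {0<..<\<theta>} \<noteq> {}" using x0 by auto
  qed
  have "winding_number ?L (A x0) \<noteq> 0" using \<rho>(2)[of "A x0"] x0 by (auto simp: T_def dist_commute)
  have fin: "A x \<in> D \<inter> swept" if x: "0 < x" "x < \<theta>" for x
  proof -
    have "winding_number ?L (A x) = winding_number ?L (A x0)"
      by (rule winding_number_eq[OF pL loopL _ _ conn disj]) (use x x0 in auto)
    then have "A x \<in> ?h ` ({0..1} \<times> {u..v})"
      using winding_number_outside_sweep[OF cont_sub[OF uv(1,2)], of "A x"] \<open>winding_number ?L (A x0) \<noteq> 0\<close>
        less_imp_le[OF less_trans[OF uv(3,4)]] by metis
    then obtain s t where st: "s \<in> {0..1}" "t \<in> {u..v}" "A x = H s t" by auto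
    moreover from this have "t \<in> I" using sub by blast
    moreover have "Im (A x) < 0" using A_im r th sin_gt_zero[of x] x by simp
    ultimately show ?thesis using H_in[of s t] by (auto simp: swept_def)
  qed
  show ?thesis
    by (rule that[of \<theta> t]) (use th t sub fin in \<open>auto simp: A_def\<close>)
qed

end

section \<open>Integrals along curves parametrized by arc length\<close>

text \<open>
  A function that is Lipschitz at the points of a null set and differentiable elsewhere is an integral of its
  derivative. In the gauge integral this is seen directly: the null set enters a fine tagged division with
  arbitrarily small total length.
\<close>

lemma fundamental_theorem_of_calculus_ae:
  fixes f :: "real \<Rightarrow> 'a::banach"
  assumes "a \<le> b" and N: "negligible N"
    and der: "\<And>x. x \<in> {a..b} \<Longrightarrow> x \<notin> N \<Longrightarrow> (f has_vector_derivative f' x) (at x within {a..b})"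
    and lip: "\<And>x. x \<in> {a..b} \<Longrightarrow> x \<in> N \<Longrightarrow> \<exists>d>0. \<forall>y\<in>{a..b}. norm (y - x) < d \<longrightarrow> norm (f y - f x) \<le> B * norm (y - x)"
  shows "(f' has_integral (f b - f a)) {a..b}"
proof -
  define g where "g x = (if x \<in> N then 0 else f' x)" for x
  have "(g has_integral (f b - f a)) (cbox a b)"
    unfolding has_integral
  proof (intro allI impI)
    fix e :: real assume e: "e > 0"
    define e1 where "e1 = e / (2 * (b - a + 1))"
    define e2 where "e2 = e / (2 * (\<bar>B\<bar> + 1))"
    \<comment> \<open>The error allowed at a tag: small off the null set, the Lipschitz constant on it.\<close>
    define w where "w x = e1 + \<bar>B\<bar> * indicat_real N x" for x
    have e1: "e1 > 0" and e2: "e2 > 0" using e \<open>a \<le> b\<close> by (auto simp: e1_def e2_def)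
    have "\<exists>d>0. x \<in> {a..b} \<longrightarrow> (\<forall>y\<in>{a..b}. norm (y - x) < d \<longrightarrow> norm (f y - f x - (y - x) *\<^sub>R g x) \<le> w x * norm (y - x))" for x
    proof (cases "x \<in> {a..b}")
      case True
      show ?thesis
      proof (cases "x \<in> N")
        case xN: True
        obtain d where d: "d > 0" "\<And>y. y \<in> {a..b} \<Longrightarrow> norm (y - x) < d \<Longrightarrow> norm (f y - f x) \<le> B * norm (y - x)"
          using lip[OF True xN] by auto
        have "B * r \<le> w x * r" if "r \<ge> 0" for r
          using that xN e1 by (intro mult_right_mono) (auto simp: w_def)
        then have "norm (f y - f x - (y - x) *\<^sub>R g x) \<le> w x * norm (y - x)" if "y \<in> {a..b}" "norm (y - x) < d" for y
          using d(2)[OF that] xN by (simp add: g_def order_trans)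
        then show ?thesis using d(1) by blast
      next
        case False
        then have "(f has_vector_derivative g x) (at x within {a..b})" and "w x = e1" 
          using der True by (auto simp: g_def w_def)
        then show ?thesis using e1
          unfolding has_vector_derivative_def has_derivative_within_alt by auto
      qed
    qed (auto intro: exI[of _ 1])
    then obtain d where d: "\<And>x. 0 < d x" "\<And>x y. \<lbrakk>x \<in> {a..b}; y \<in> {a..b}; norm (y - x) < d x\<rbrakk>
                        \<Longrightarrow> norm (f y - f x - (y - x) *\<^sub>R g x) \<le> w x * norm (y - x)"
      by metis
    have "(indicat_real N has_integral 0) (cbox a b)" using N by (simp add: negligible)
    then obtain \<gamma> where \<gamma>: "gauge \<gamma>"
      "\<And>p. p tagged_division_of cbox a b \<Longrightarrow> \<gamma> fine p \<Longrightarrow> norm ((\<Sum>(x, k)\<in>p. measure lborel k *\<^sub>R indicat_real N x) - 0) < e2"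
      using e2 unfolding has_integral by metis
    show "\<exists>\<gamma>. gauge \<gamma> \<and> (\<forall>p. p tagged_division_of cbox a b \<and> \<gamma> fine p \<longrightarrow>
        norm ((\<Sum>(x, k)\<in>p. measure lborel k *\<^sub>R g x) - (f b - f a)) < e)"
    proof (intro exI[of _ "\<lambda>x. ball x (d x) \<inter> \<gamma> x"] conjI allI impI, goal_cases)
      case 1
      show ?case using d(1) \<gamma>(1) gauge_ball_dependent[of d] by (intro gauge_Int) auto
    next
      case (2 p)
      then have ptag: "p tagged_division_of cbox a b" and fine: "(\<lambda>x. ball x (d x)) fine p" "\<gamma> fine p"
        by (auto simp: fine_Int)
      have sums: "f b - f a = (\<Sum>(x,K)\<in>p. f (Sup K) - f (Inf K))"
        using additive_tagged_division_1[where f= f] \<open>a \<le> b\<close> ptag by auto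
      have len: "(\<Sum>(x,K)\<in>p. measure lborel K) = b - a"
        using additive_content_tagged_division[OF ptag] \<open>a \<le> b\<close> by simp
      have "norm (\<Sum>(x, K)\<in>p. measure lborel K *\<^sub>R g x - (f (Sup K) - f (Inf K))) \<le> (\<Sum>n\<in>p. case n of (x, K) \<Rightarrow> w x * measure lborel K)"
      proof (rule sum_norm_le, safe)
        fix x K assume xK: "(x, K) \<in> p"
        then obtain u v where k: "K = cbox u v" and "x \<in> K" and kab: "K \<subseteq> cbox a b"
          using ptag by blast
        have "u \<le> v" using \<open>x \<in> K\<close> unfolding k by auto
        have ball: "\<forall>y\<in>K. y \<in> ball x (d x)" using fine(1) xK by blast
        have uvK: "u \<in> K" "v \<in> K" by (simp_all add: \<open>u \<le> v\<close> k)
        have x: "x \<in> {a..b}" and uv: "u \<in> {a..b}" "v \<in> {a..b}" using \<open>x \<in> K\<close> uvK kab by auto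
        have "norm (measure lborel K *\<^sub>R g x - (f v - f u)) = norm ((f u - f x - (u - x) *\<^sub>R g x) - (f v - f x - (v - x) *\<^sub>R g x))"
          using \<open>u \<le> v\<close> by (simp add: k algebra_simps)
        also have "\<dots> \<le> norm (f u - f x - (u - x) *\<^sub>R g x) + norm (f v - f x - (v - x) *\<^sub>R g x)"
          by (rule norm_triangle_ineq4)
        also have "\<dots> \<le> w x * norm (u - x) + w x * norm (v - x)"
          using ball uvK by (intro add_mono d(2) x uv) (auto simp: dist_norm norm_minus_commute)
        also have "\<dots> = w x * measure lborel K"
          using \<open>x \<in> K\<close> \<open>u \<le> v\<close> by (simp add: k algebra_simps)
        finally show "norm (measure lborel K *\<^sub>R g x - (f (Sup K) - f (Inf K))) \<le> w x * measure lborel K"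
          using \<open>u \<le> v\<close> by (simp add: k)
      qed
      also have "\<dots> = e1 * (b - a) + \<bar>B\<bar> * (\<Sum>(x, K)\<in>p. measure lborel K *\<^sub>R indicat_real N x)"
        by (simp add: w_def split_def algebra_simps sum.distrib sum_distrib_left flip: len)
      also have "\<dots> \<le> e1 * (b - a) + \<bar>B\<bar> * e2"
        using \<gamma>(2)[OF ptag fine(2)] by (intro add_left_mono mult_left_mono) auto
      also have "\<dots> < e / 2 + e / 2"
      proof (rule add_less_le_mono)
        have "e * (b - a) < e * (b - a + 1)" using e by simp
        then show "e1 * (b - a) < e / 2" using \<open>a \<le> b\<close> by (simp add: e1_def field_simps)
        have "e * \<bar>B\<bar> \<le> e * (\<bar>B\<bar> + 1)" using e by simp
        then show "\<bar>B\<bar> * e2 \<le> e / 2" by (simp add: e2_def field_simps)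
      qed
      finally show ?case by (simp add: sums split_def sum_subtractf)
    qed
  qed
  then have "(g has_integral (f b - f a)) {a..b}" by simp
  then show ?thesis by (rule has_integral_spike[OF N, rotated]) (auto simp: g_def)
qed

text \<open>
  Stated with sequences, because the end points of arcs from the interval to the curve are chosen as
  sequences.
\<close>

lemma improper_integral_limits:
  fixes f g :: "real \<Rightarrow> complex" and p q :: ereal
  assumes pq: "p < q" and f: "f absolutely_integrable_on einterval p q"
    and g: "\<And>s t. s \<in> einterval p q \<Longrightarrow> t \<in> einterval p q \<Longrightarrow> s \<le> t \<Longrightarrow> (f has_integral g t - g s) {s..t}"
  obtains gp gq where "gq - gp = integral (einterval p q) f"
    "\<And>y. (\<And>n. y n \<in> einterval p q) \<Longrightarrow> (\<lambda>n. ereal (y n)) \<longlonglongrightarrow> p \<Longrightarrow> (\<lambda>n. g (y n)) \<longlonglongrightarrow> gp"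
    "\<And>y. (\<And>n. y n \<in> einterval p q) \<Longrightarrow> (\<lambda>n. ereal (y n)) \<longlonglongrightarrow> q \<Longrightarrow> (\<lambda>n. g (y n)) \<longlonglongrightarrow> gq"
proof -
  let ?E = "einterval p q"
  obtain s0 where s0: "s0 \<in> ?E" using einterval_nonempty[OF pq] by auto
  define R where "R = ?E \<inter> {s0..}"
  define L where "L = ?E \<inter> {..s0}"
  have sets: "R \<in> sets lebesgue" "L \<in> sets lebesgue" by (auto simp: R_def L_def)
  have fR: "f absolutely_integrable_on R" and fL: "f absolutely_integrable_on L"
    by (auto intro!: set_integrable_subset[OF f] sets) (auto simp: R_def L_def)
  then have iR: "f integrable_on R" "(\<lambda>x. norm (f x)) integrable_on R"
    and iL: "f integrable_on L" "(\<lambda>x. norm (f x)) integrable_on L"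
    by (simp_all add: absolutely_integrable_on_def)
  have "(f has_integral (integral L f + integral R f)) (L \<union> R)"
  proof (intro has_integral_Un integrable_integral iR iL)
    have "L \<inter> R \<subseteq> {s0}" by (auto simp: L_def R_def)
    then show "negligible (L \<inter> R)" by (rule negligible_subset[OF negligible_sing])
  qed
  moreover have "L \<union> R = ?E" by (auto simp: L_def R_def)
  ultimately have tot: "integral ?E f = integral L f + integral R f" by (simp add: integral_unique)
  have btw: "{s..t} \<subseteq> ?E" if "s \<in> ?E" "t \<in> ?E" for s t
    using that unfolding einterval_def
    by (auto intro: less_le_trans le_less_trans simp flip: ereal_less_eq(3))
  have lim: "(\<lambda>n. integral S (\<lambda>x. if x \<in> T n then f x else 0)) \<longlonglongrightarrow> integral S f"
    if S: "f integrable_on S" "(\<lambda>x. norm (f x)) integrable_on S"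
      and T: "\<And>n. f integrable_on (T n \<inter> S)" "\<And>x. x \<in> S \<Longrightarrow> \<forall>\<^sub>F n in sequentially. x \<in> T n" for S and T :: "nat \<Rightarrow> real set"
  proof (rule dominated_convergence(2)[where h = "\<lambda>x. norm (f x)"])
    show "(\<lambda>x. if x \<in> T k then f x else 0) integrable_on S" for k
      using T(1) by (simp add: integrable_restrict_Int)
    show "(\<lambda>k. if x \<in> T k then f x else 0) \<longlonglongrightarrow> f x" if "x \<in> S" for x
      by (rule tendsto_eventually, rule eventually_mono[OF T(2)[OF that]]) simp
  qed (use S in auto)
  show ?thesis
  proof (rule that[of "g s0 + integral R f" "g s0 - integral L f"])
    show "g s0 + integral R f - (g s0 - integral L f) = integral ?E f" by (simp add: tot)
  next
    fix y assume y: "\<And>n. y n \<in> ?E" "(\<lambda>n. ereal (y n)) \<longlonglongrightarrow> p"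
    have "(\<lambda>n. integral L (\<lambda>x. if x \<in> {y n..} then f x else 0)) \<longlonglongrightarrow> integral L f"
    proof (rule lim[OF iL])
      have "{y n..} \<inter> L = {y n..s0}" for n using btw[OF y(1) s0] by (auto simp: L_def)
      then show "f integrable_on {y n..} \<inter> L" for n
        using g[OF y(1)[of n] s0] has_integral_integrable by (cases "y n \<le> s0") auto
      fix x assume "x \<in> L"
      then have "p < ereal x" by (auto simp: L_def einterval_def)
      from order_tendstoD(2)[OF y(2) this] show "\<forall>\<^sub>F n in sequentially. x \<in> {y n..}"
        by (rule eventually_mono) simp
    qed
    moreover have "\<forall>\<^sub>F n in sequentially. integral L (\<lambda>x. if x \<in> {y n..} then f x else 0) = g s0 - g (y n)"
    proof -
      have "p < ereal s0" using s0 by (auto simp: einterval_def)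
      from order_tendstoD(2)[OF y(2) this] show ?thesis
      proof eventually_elim
        case (elim n)
        have "{y n..} \<inter> L = {y n..s0}" using btw[OF y(1) s0] by (auto simp: L_def)
        then show ?case using integral_unique[OF g[OF y(1)[of n] s0]] elim
            integral_restrict_Int[of L "{y n..}" f] by simp
      qed
    qed
    ultimately have "(\<lambda>n. g s0 - g (y n)) \<longlonglongrightarrow> integral L f"
      by (rule Lim_transform_eventually)
    from tendsto_diff[OF tendsto_const[of "g s0"] this] show "(\<lambda>n. g (y n)) \<longlonglongrightarrow> g s0 - integral L f" by simp
  next
    fix y assume y: "\<And>n. y n \<in> ?E" "(\<lambda>n. ereal (y n)) \<longlonglongrightarrow> q"
    have "(\<lambda>n. integral R (\<lambda>x. if x \<in> {..y n} then f x else 0)) \<longlonglongrightarrow> integral R f"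
    proof (rule lim[OF iR])
      have "{..y n} \<inter> R = {s0..y n}" for n using btw[OF s0 y(1)] by (auto simp: R_def)
      then show "f integrable_on {..y n} \<inter> R" for n
        using g[OF s0 y(1)[of n]] has_integral_integrable by (cases "s0 \<le> y n") auto
      fix x assume "x \<in> R"
      then have "ereal x < q" by (auto simp: R_def einterval_def)
      from order_tendstoD(1)[OF y(2) this] show "\<forall>\<^sub>F n in sequentially. x \<in> {..y n}"
        by (rule eventually_mono) simp
    qed
    moreover have "\<forall>\<^sub>F n in sequentially. integral R (\<lambda>x. if x \<in> {..y n} then f x else 0) = g (y n) - g s0"
    proof -
      have "ereal s0 < q" using s0 by (auto simp: einterval_def)
      from order_tendstoD(1)[OF y(2) this] show ?thesis
      proof eventually_elim
        case (elim n)
        have "{..y n} \<inter> R = {s0..y n}" using btw[OF s0 y(1)] by (auto simp: R_def)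
        then show ?case using integral_unique[OF g[OF s0 y(1)[of n]]] elim
            integral_restrict_Int[of R "{..y n}" f] by simp
      qed
    qed
    ultimately have "(\<lambda>n. g (y n) - g s0) \<longlonglongrightarrow> integral R f"
      by (rule Lim_transform_eventually)
    from tendsto_add[OF tendsto_const[of "g s0"] this] show "(\<lambda>n. g (y n)) \<longlonglongrightarrow> g s0 + integral R f" by simp
  qed
qed

locale unit_speed_curve =
  fixes p q :: ereal and \<gamma> :: "real \<Rightarrow> complex"
  assumes pq: "p < q"
    and lipschitz: "1-lipschitz_on (einterval p q) \<gamma>"
    and speed: "AE s in lborel. s \<in> einterval p q \<longrightarrow> (\<exists>v. (\<gamma> has_vector_derivative v) (at s) \<and> norm v = 1)"
begin

abbreviation E where "E \<equiv> einterval p q"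
abbreviation \<gamma>' where "\<gamma>' \<equiv> \<lambda>s. vector_derivative \<gamma> (at s)"

lemma \<gamma>_cont: "continuous_on E \<gamma>"
  using lipschitz by (rule lipschitz_on_continuous_on)

lemma E_between: "s \<in> E \<Longrightarrow> t \<in> E \<Longrightarrow> {s..t} \<subseteq> E"
  unfolding einterval_def
  by (auto intro: less_le_trans le_less_trans simp flip: ereal_less_eq(3))

lemma exceptional_set:
  obtains N where "negligible N" "\<And>s. s \<in> E \<Longrightarrow> s \<notin> N \<Longrightarrow> (\<gamma> has_vector_derivative \<gamma>' s) (at s)"
    "\<And>s. s \<in> E \<Longrightarrow> s \<notin> N \<Longrightarrow> norm (\<gamma>' s) = 1"
proof -
  from speed obtain N where N: "{s \<in> space lborel. \<not> (s \<in> E \<longrightarrow> (\<exists>v. (\<gamma> has_vector_derivative v) (at s) \<and> norm v = 1))} \<subseteq> N"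
    "emeasure lborel N = 0" "N \<in> sets lborel" by (rule AE_E)
  then have "N \<in> null_sets lebesgue" by (auto intro!: null_sets_completionI)
  then have "negligible N" by (simp add: negligible_iff_null_sets)
  moreover have "(\<gamma> has_vector_derivative \<gamma>' s) (at s) \<and> norm (\<gamma>' s) = 1" if s: "s \<in> E" "s \<notin> N" for s
  proof -
    obtain v where "(\<gamma> has_vector_derivative v) (at s)" "norm v = 1" using N(1) s by auto
    then show ?thesis using vector_derivative_at by metis
  qed
  ultimately show ?thesis using that by metis
qed

text \<open>
  A contour is differentiable only almost everywhere, but \<open>G \<circ> \<gamma>\<close> is Lipschitz at every point.
\<close>

lemma has_integral_along_curve:
  assumes G: "\<And>z. z \<in> \<gamma> ` E \<Longrightarrow> (G has_field_derivative F z) (at z)"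
    and F: "continuous_on (\<gamma> ` E) F"
    and st: "s \<in> E" "t \<in> E" "s \<le> t"
  shows "((\<lambda>x. \<gamma>' x * F (\<gamma> x)) has_integral G (\<gamma> t) - G (\<gamma> s)) {s..t}"
proof -
  obtain N where N: "negligible N" "\<And>s. s \<in> E \<Longrightarrow> s \<notin> N \<Longrightarrow> (\<gamma> has_vector_derivative \<gamma>' s) (at s)"
    using exceptional_set by metis
  have sub: "{s..t} \<subseteq> E" using E_between st by blast
  have "continuous_on {s..t} (\<lambda>x. F (\<gamma> x))"
    by (rule continuous_on_compose2[OF F continuous_on_subset[OF \<gamma>_cont sub]]) (use sub in auto)
  then have "bounded ((\<lambda>x. F (\<gamma> x)) ` {s..t})" by (intro compact_imp_bounded compact_continuous_image) auto
  then obtain M where "\<forall>w\<in>(\<lambda>x. F (\<gamma> x)) ` {s..t}. norm w \<le> M" unfolding bounded_iff ..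
  then have M: "norm (F (\<gamma> x)) \<le> M" if "x \<in> {s..t}" for x using that by blast
  show ?thesis
  proof (rule fundamental_theorem_of_calculus_ae[where f = "\<lambda>x. G (\<gamma> x)" and B = "M + 1", OF st(3) N(1)])
    fix x assume x: "x \<in> {s..t}" "x \<notin> N"
    have xE: "x \<in> E" using x(1) sub by (rule subsetD[rotated])
    have "(\<gamma> has_vector_derivative \<gamma>' x) (at x within {s..t})"
      by (rule has_vector_derivative_at_within[OF N(2)[OF xE x(2)]])
    moreover have "(G has_field_derivative F (\<gamma> x)) (at (\<gamma> x) within \<gamma> ` {s..t})"
      by (rule has_field_derivative_at_within[OF G[OF imageI[OF xE]]])
    ultimately have "(G \<circ> \<gamma> has_vector_derivative \<gamma>' x * F (\<gamma> x)) (at x within {s..t})"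
      by (rule field_vector_diff_chain_within)
    then show "((\<lambda>x. G (\<gamma> x)) has_vector_derivative \<gamma>' x * F (\<gamma> x)) (at x within {s..t})"
      by (simp add: o_def)
  next
    fix x assume x: "x \<in> {s..t}"
    have xE: "x \<in> E" using x sub by (rule subsetD[rotated])
    have "(G has_derivative (*) (F (\<gamma> x))) (at (\<gamma> x))"
      using G[OF imageI[OF xE]] by (simp add: has_field_derivative_def)
    then obtain d where d: "d > 0" "\<And>w. norm (w - \<gamma> x) < d \<Longrightarrow> norm (G w - G (\<gamma> x) - F (\<gamma> x) * (w - \<gamma> x)) \<le> 1 * norm (w - \<gamma> x)"
      unfolding has_derivative_at_alt by (metis zero_less_one)
    show "\<exists>d>0. \<forall>y\<in>{s..t}. norm (y - x) < d \<longrightarrow> norm (G (\<gamma> y) - G (\<gamma> x)) \<le> (M + 1) * norm (y - x)"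
    proof (intro exI[of _ d] conjI ballI impI)
      fix y assume y: "y \<in> {s..t}" "norm (y - x) < d"
      have yE: "y \<in> E" using y(1) sub by (rule subsetD[rotated])
      have lip: "norm (\<gamma> y - \<gamma> x) \<le> norm (y - x)"
        using lipschitz_onD[OF lipschitz yE xE] by (simp add: dist_norm)
      have "norm (G (\<gamma> y) - G (\<gamma> x)) \<le> norm (F (\<gamma> x) * (\<gamma> y - \<gamma> x)) + norm (\<gamma> y - \<gamma> x)"
        using d(2)[of "\<gamma> y"] lip y(2) norm_triangle_sub[of "G (\<gamma> y) - G (\<gamma> x)" "F (\<gamma> x) * (\<gamma> y - \<gamma> x)"] by auto
      also have "\<dots> = (norm (F (\<gamma> x)) + 1) * norm (\<gamma> y - \<gamma> x)" by (simp add: norm_mult distrib_right)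
      also have "\<dots> \<le> (M + 1) * norm (y - x)"
        using M[OF x] lip by (intro mult_mono) (auto intro: add_nonneg_nonneg order_trans[OF norm_ge_zero])
      finally show "norm (G (\<gamma> y) - G (\<gamma> x)) \<le> (M + 1) * norm (y - x)" .
    qed fact
  qed
qed

text \<open>
  By the previous lemma applied to the identity, the derivative is integrable on compact
  intervals.
\<close>

lemma measurable_\<gamma>': "\<gamma>' \<in> borel_measurable (lebesgue_on E)"
proof -
  obtain u l :: "nat \<Rightarrow> real" where ul: "E = (\<Union>i. {l i .. u i})" "incseq u" "decseq l" "\<And>i. l i < u i"
    by (rule einterval_Icc_approximation[OF pq]) blast
  define f where "f i x = (if x \<in> {l i..u i} then \<gamma>' x else 0)" for i x
  have meas: "f i \<in> borel_measurable lebesgue" for i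
  proof -
    have "l i \<in> E" "u i \<in> E" "l i \<le> u i" using ul(1) ul(4)[of i] by (auto intro!: exI[of _ i])
    then have "((\<lambda>x. \<gamma>' x * 1) has_integral \<gamma> (u i) - \<gamma> (l i)) {l i..u i}"
      by (intro has_integral_along_curve[where G = "\<lambda>z. z" and F = "\<lambda>_. 1"]) auto
    then have "\<gamma>' integrable_on {l i..u i}" by (auto simp: has_integral_integrable)
    then have "\<gamma>' \<in> borel_measurable (lebesgue_on {l i..u i})" by (rule integrable_imp_measurable)
    then show ?thesis unfolding f_def by (subst borel_measurable_if) auto
  qed
  have lim: "(\<lambda>i. f i x) \<longlonglongrightarrow> (if x \<in> E then \<gamma>' x else 0)" for x
  proof (cases "x \<in> E")
    case True
    then obtain i where i: "x \<in> {l i..u i}" using ul(1) by auto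
    have "x \<in> {l j..u j}" if "j \<ge> i" for j
      using i monoD[OF ul(2) that] decseqD[OF ul(3) that] by auto
    then show ?thesis using True by (auto simp: f_def intro!: tendsto_eventually eventually_sequentiallyI[of i])
  next
    case False
    then have "x \<notin> {l i..u i}" for i using ul(1) by auto
    then show ?thesis using False by (simp only: f_def if_False tendsto_const)
  qed
  have "(\<lambda>x. if x \<in> E then \<gamma>' x else 0) \<in> borel_measurable lebesgue"
    by (rule borel_measurable_LIMSEQ_metric[where f = f, OF meas lim])
  then show ?thesis by (subst (asm) borel_measurable_if) auto
qed

lemma curve_integral_bound:
  assumes F: "continuous_on (\<gamma> ` E) F" and k: "k integrable_on E"
    and le: "\<And>s. s \<in> E \<Longrightarrow> norm (F (\<gamma> s)) \<le> k s"
  shows "(\<lambda>s. \<gamma>' s * F (\<gamma> s)) absolutely_integrable_on E"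
    and "norm (integral E (\<lambda>s. \<gamma>' s * F (\<gamma> s))) \<le> integral E k"
proof -
  obtain N where N: "negligible N" "\<And>s. s \<in> E \<Longrightarrow> s \<notin> N \<Longrightarrow> norm (\<gamma>' s) = 1"
    using exceptional_set by metis
  have "N \<in> sets lebesgue" using N(1) by (rule negligible_imp_sets)
  then have S: "E - N \<in> sets lebesgue" by auto
  have "continuous_on E (\<lambda>s. F (\<gamma> s))"
    by (rule continuous_on_compose2[OF F \<gamma>_cont]) auto
  then have "(\<lambda>s. F (\<gamma> s)) \<in> borel_measurable (lebesgue_on E)"
    by (rule continuous_imp_measurable_on_sets_lebesgue) auto
  then have "(\<lambda>s. \<gamma>' s * F (\<gamma> s)) \<in> borel_measurable (lebesgue_on E)"
    using measurable_\<gamma>' by (intro borel_measurable_times)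
  then have meas: "(\<lambda>s. \<gamma>' s * F (\<gamma> s)) \<in> borel_measurable (lebesgue_on (E - N))"
    by (rule measurable_restrict_mono) auto
  have kS: "k integrable_on (E - N)"
    by (rule integrable_spike_set[OF k]) (auto intro: negligible_subset[OF N(1)])
  have bd: "norm (\<gamma>' s * F (\<gamma> s)) \<le> k s" if "s \<in> E - N" for s
    using le[of s] N(2)[of s] that by (auto simp: norm_mult)
  have "(\<lambda>s. \<gamma>' s * F (\<gamma> s)) absolutely_integrable_on (E - N)"
    by (rule measurable_bounded_by_integrable_imp_absolutely_integrable[OF meas S kS bd])
  then show ai: "(\<lambda>s. \<gamma>' s * F (\<gamma> s)) absolutely_integrable_on E"
    by (rule absolutely_integrable_spike_set) (auto intro: negligible_subset[OF N(1)])
  have "norm (integral (E - N) (\<lambda>s. \<gamma>' s * F (\<gamma> s))) \<le> integral (E - N) k"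
    by (rule Henstock_Kurzweil_Integration.integral_norm_bound_integral[OF _ kS bd])
      (use \<open>_ absolutely_integrable_on (E - N)\<close> in \<open>auto simp: absolutely_integrable_on_def\<close>)
  moreover have "integral (E - N) k = integral E k"
    by (rule integral_spike_set) (auto intro: negligible_subset[OF N(1)])
  moreover have "integral (E - N) (\<lambda>s. \<gamma>' s * F (\<gamma> s)) = integral E (\<lambda>s. \<gamma>' s * F (\<gamma> s))"
    by (rule integral_spike_set) (auto intro: negligible_subset[OF N(1)])
  ultimately show "norm (integral E (\<lambda>s. \<gamma>' s * F (\<gamma> s))) \<le> integral E k" by simp
qed

end

section \<open>Ends of a deformed contour\<close>

text \<open>
  Adds to a deformation the arc length parametrization of the final curve; \<open>\<phi>\<close> relates the two
  parameters.
\<close>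

locale deformed_contour = swept_interval D a b H + unit_speed_curve p q \<gamma>
  for D a b H p q \<gamma> +
  fixes \<phi> :: "real \<Rightarrow> real"
  assumes D_simply_connected: "simply_connected D"
    and \<phi>_mono: "strict_mono_on (einterval a b) \<phi>"
    and \<phi>_image: "\<phi> ` einterval a b = einterval p q"
    and H_1_curve: "t \<in> einterval a b \<Longrightarrow> H 1 t = \<gamma> (\<phi> t)"
begin

lemma curve_in_D: "\<gamma> ` E \<subseteq> D"
proof
  fix z assume "z \<in> \<gamma> ` E"
  then obtain t where "t \<in> I" "z = \<gamma> (\<phi> t)" using \<phi>_image by (metis imageE)
  then show "z \<in> D" using H_1[of t] H_1_curve[of t] by simp
qed

lemma continuous_on_H_1: "continuous_on I (H 1)"
proof -
  have "continuous_on I (\<lambda>t. (\<lambda>(s, t). H s t) (1, t))"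
    by (rule continuous_on_compose2[OF H_cont]) (auto intro!: continuous_intros)
  then show ?thesis by simp
qed

lemma connected_I: "connected I"
  using I_between by (intro is_interval_connected) (auto simp: is_interval_1 einterval_def
    intro: less_le_trans le_less_trans simp flip: ereal_less_eq(3))

lemma near_finite_end:
  assumes e: "is_end a b e" and "\<epsilon> > 0"
  shows "\<exists>t\<in>I. norm (H 1 t - of_real e) < \<epsilon>"
proof -
  have "\<forall>\<^sub>F t in at e within I. \<forall>s\<in>{0..1}. dist (H s t) (of_real e) < \<epsilon>"
    using uniform_limitD[OF H_finite_end[OF e] \<open>\<epsilon> > 0\<close>] .
  then obtain d where d: "d > 0" "\<And>t. t \<in> I \<Longrightarrow> t \<noteq> e \<Longrightarrow> dist t e < d \<Longrightarrow> dist (H 1 t) (of_real e) < \<epsilon>"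
    unfolding eventually_at by (metis atLeastAtMost_iff order_refl zero_le_one)
  obtain t0 where t0: "t0 \<in> I" using einterval_nonempty[OF ab] by auto
  have ne: "e \<notin> I" using e by (auto simp: is_end_def einterval_def)
  define x where "x = min (d / 2 / \<bar>t0 - e\<bar>) 1"
  have te: "\<bar>t0 - e\<bar> > 0" using t0 ne by auto
  have x: "0 < x" "x \<le> 1" "x * \<bar>t0 - e\<bar> \<le> d / 2" using d te by (auto simp: x_def min_def field_simps)
  define t where "t = e + x * (t0 - e)"
  have "t \<in> I"
  proof (cases "ereal e = a")
    case True
    then have "e < t0" using t0 by (auto simp: einterval_def)
    moreover have "x * (t0 - e) \<le> t0 - e" using x \<open>e < t0\<close> by (intro mult_left_le_one_le) auto
    moreover have "0 < x * (t0 - e)" using x \<open>e < t0\<close> by simp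
    ultimately have "e < t" "t \<le> t0" unfolding t_def by linarith+
    then show ?thesis using True t0 le_less_trans[of "ereal t" "ereal t0" b] by (auto simp: einterval_def simp flip: True)
  next
    case False
    then have eb: "ereal e = b" using e by (auto simp: is_end_def)
    then have "t0 < e" using t0 by (auto simp: einterval_def)
    have "x * (e - t0) \<le> e - t0" using x \<open>t0 < e\<close> by (intro mult_left_le_one_le) auto
    then have "x * (t0 - e) < 0" "x * (t0 - e) \<ge> t0 - e"
      using x \<open>t0 < e\<close> by (auto simp: mult_less_0_iff algebra_simps)
    then have "t < e" "t0 \<le> t" unfolding t_def by linarith+
    then show ?thesis using t0 less_le_trans[of a "ereal t0" "ereal t"] by (auto simp: einterval_def simp flip: eb)
  qed
  moreover have "dist t e < d" using x d by (simp add: t_def dist_real_def abs_mult)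
  moreover have "t \<noteq> e" using \<open>t \<in> I\<close> ne by auto
  ultimately show ?thesis using d(2)[of t] by (auto simp: dist_norm)
qed

lemma near_infinite_end:
  assumes "a = -\<infinity> \<or> b = \<infinity>"
  shows "\<exists>t\<in>I. R \<le> norm (H 1 t)"
proof -
  obtain t0 where t0: "t0 \<in> I" using einterval_nonempty[OF ab] by auto
  from assms show ?thesis
  proof
    assume a: "a = -\<infinity>"
    obtain N where N: "\<forall>t\<le>N. \<forall>s\<in>{0..1}. R \<le> norm (H s t)"
      using H_bot[OF a, of R] unfolding eventually_at_bot_linorder by blast
    have "min N t0 \<le> t0" by simp
    then have "min N t0 \<in> I"
      using t0 a le_less_trans[of "ereal (min N t0)" "ereal t0" b] unfolding einterval_def
      by (metis (mono_tags, lifting) MInfty_neq_ereal(1) ereal_infty_less(2) ereal_less_eq(3) mem_Collect_eq)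
    then show ?thesis using N by (intro bexI[of _ "min N t0"]) auto
  next
    assume b: "b = \<infinity>"
    obtain N where N: "\<forall>t\<ge>N. \<forall>s\<in>{0..1}. R \<le> norm (H s t)"
      using H_top[OF b, of R] unfolding eventually_at_top_linorder by blast
    have "t0 \<le> max N t0" by simp
    then have "max N t0 \<in> I"
      using t0 b less_le_trans[of a "ereal t0" "ereal (max N t0)"] unfolding einterval_def
      by (metis (mono_tags, lifting) PInfty_neq_ereal(1) ereal_infty_less(1) ereal_less_eq(3) mem_Collect_eq)
    then show ?thesis using N by (intro bexI[of _ "max N t0"]) auto
  qed
qed

lemma curve_meets_circle:
  assumes "t \<in> I" "norm (H 1 t - c) \<le> r" "t' \<in> I" "r \<le> norm (H 1 t' - c)"
  shows "\<exists>t\<in>I. norm (H 1 t - c) = r"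
proof -
  have "connected ((\<lambda>t. norm (H 1 t - c)) ` I)"
    by (intro connected_continuous_image connected_I continuous_intros continuous_on_H_1)
  then have "r \<in> (\<lambda>t. norm (H 1 t - c)) ` I"
    using connectedD_interval[of _ "norm (H 1 t - c)" "norm (H 1 t' - c)" r] assms by blast
  then show ?thesis by auto
qed

text \<open>
  The end \<open>e\<close> of the interval is linked to the end \<open>e'\<close> of the curve if arcs as in \<open>arc_to_contour\<close>
  join points \<open>x n\<close> of the interval tending to \<open>e\<close> to points \<open>H 1 (t n)\<close> of the curve with \<open>t n\<close>
  tending to \<open>e'\<close>. The circles shrink to a finite end point or expand about 0.
\<close>

definition linked :: "ereal \<Rightarrow> ereal \<Rightarrow> bool" where
  "linked e e' \<longleftrightarrow> (\<exists>x t \<theta> r c \<eta>.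
     (\<forall>n. x n \<in> I \<and> t n \<in> I \<and> r n > 0 \<and> 0 < \<theta> n \<and> x n = c + \<eta> * r n \<and>
       of_real c + of_real (\<eta> * r n) * cis (- \<eta> * \<theta> n) = H 1 (t n) \<and> \<theta> n < pi \<and>
       (\<forall>y. 0 < y \<longrightarrow> y < \<theta> n \<longrightarrow> of_real c + of_real (\<eta> * r n) * cis (- \<eta> * y) \<in> D \<inter> swept)) \<and>
     (\<eta> = 1 \<or> \<eta> = -1) \<and>
     (\<lambda>n. ereal (x n)) \<longlonglongrightarrow> e \<and> (\<lambda>n::nat. ereal (t n)) \<longlonglongrightarrow> e' \<and>
     (is_end a b c \<and> r \<longlonglongrightarrow> 0 \<or> c = 0 \<and> (a = -\<infinity> \<or> b = \<infinity>) \<and> filterlim r at_top sequentially))"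

text \<open>
  A subsequence of the parameters where the arcs reach the curve converges in the extended reals. The
  limit is an end: on a compact part of the parameter interval the curve keeps a positive distance from
  the real point \<open>c\<close> and is bounded, whereas the radii tend to 0 or to infinity.
\<close>

lemma linkedI:
  assumes r: "\<And>n::nat. r n > 0" and \<eta>: "\<eta> = 1 \<or> \<eta> = -1"
    and x: "\<And>n. c + \<eta> * r n \<in> I" and xe: "(\<lambda>n. ereal (c + \<eta> * r n)) \<longlonglongrightarrow> e"
    and c: "\<And>n e. is_end a b e \<Longrightarrow> \<bar>e - c\<bar> \<noteq> r n"
    and t1: "\<And>n. \<exists>t1\<in>I. norm (H 1 t1 - of_real c) = r n"
    and lim: "is_end a b c \<and> r \<longlonglongrightarrow> 0 \<or> c = 0 \<and> (a = -\<infinity> \<or> b = \<infinity>) \<and> filterlim r at_top sequentially"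
  shows "\<exists>e'\<in>{a, b}. linked e e'"
proof -
  have "\<exists>\<theta> t. 0 < \<theta> \<and> \<theta> < pi \<and> t \<in> I \<and> of_real c + of_real (\<eta> * r n) * cis (- \<eta> * \<theta>) = H 1 t \<and>
    (\<forall>x. 0 < x \<longrightarrow> x < \<theta> \<longrightarrow> of_real c + of_real (\<eta> * r n) * cis (- \<eta> * x) \<in> D \<inter> swept)" for n
  proof -
    obtain t1 where t1': "t1 \<in> I" "norm (H 1 t1 - of_real c) = r n" using t1[of n] by (elim bexE)
    show ?thesis
    proof (rule arc_to_contour[OF r \<eta> x _ t1'], goal_cases)
      case (2 \<theta> t)
      then show ?case by (intro exI[of _ \<theta>] exI[of _ t] conjI allI impI)
    qed (rule c)
  qed
  then obtain \<theta> t where \<theta>t: "\<And>n. 0 < \<theta> n" "\<And>n. \<theta> n < pi" "\<And>n. t n \<in> I" 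
    "\<And>n. of_real c + of_real (\<eta> * r n) * cis (- \<eta> * \<theta> n) = H 1 (t n)"
    "\<And>n x. 0 < x \<Longrightarrow> x < \<theta> n \<Longrightarrow> of_real c + of_real (\<eta> * r n) * cis (- \<eta> * x) \<in> D \<inter> swept"
    by metis
  have on_circle: "norm (H 1 (t n) - of_real c) = r n" for n
    using r[of n] \<eta> by (subst \<theta>t(4)[symmetric]) (auto simp: norm_mult)
  obtain l \<rho> where l: "strict_mono (\<rho> :: nat \<Rightarrow> nat)" "((\<lambda>n. ereal (t n)) \<circ> \<rho>) \<longlonglongrightarrow> l"
    using compact_complete_linorder[of "\<lambda>n. ereal (t n)"] by blast
  have tI: "a < ereal (t n)" "ereal (t n) < b" for n using \<theta>t(3)[of n] by (auto simp: einterval_def)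
  have al: "a \<le> l" by (rule LIMSEQ_le_const[OF l(2)]) (use tI in \<open>auto intro: less_imp_le\<close>)
  have lb: "l \<le> b" by (rule LIMSEQ_le_const2[OF l(2)]) (use tI in \<open>auto intro: less_imp_le\<close>)
  have "\<not> (a < l \<and> l < b)"
  proof
    assume "a < l \<and> l < b"
    then obtain u v where u: "a < ereal u" "ereal u < l" and v: "l < ereal v" "ereal v < b"
      using ereal_dense2[of a l] ereal_dense2[of l b] by blast
    have "u < v" using u(2) v(1) by (metis less_ereal.simps(1) less_trans)
    then have uvI: "u \<in> I" "v \<in> I"
      using u v less_trans[of "ereal u" "ereal v" b] less_trans[of a "ereal u" "ereal v"] by (auto simp: einterval_def)
    have sub: "{u..v} \<subseteq> I" by (rule I_between[OF uvI])
    have ev: "\<forall>\<^sub>F n in sequentially. t (\<rho> n) \<in> {u..v}"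
      using order_tendstoD(1)[OF l(2) u(2)] order_tendstoD(2)[OF l(2) v(1)]
      by eventually_elim auto
    have cont: "continuous_on {u..v} (\<lambda>t. norm (H 1 t - of_real c))"
      by (intro continuous_intros continuous_on_subset[OF continuous_on_H_1 sub])
    have ne: "{u..v} \<noteq> {}" using \<open>u < v\<close> by simp
    from lim consider "r \<longlonglongrightarrow> 0" | "filterlim r at_top sequentially" by blast
    then show False
    proof cases
      assume r0: "r \<longlonglongrightarrow> 0"
      obtain t0 where t0: "t0 \<in> {u..v}" "\<And>t. t \<in> {u..v} \<Longrightarrow> norm (H 1 t0 - of_real c) \<le> norm (H 1 t - of_real c)"
        using continuous_attains_inf[OF _ ne cont] by auto
      have "H 1 t0 \<noteq> of_real c" using H_1_lower[of t0] t0 sub by auto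
      then have pos: "norm (H 1 t0 - of_real c) > 0" by simp
      have "(\<lambda>n. r (\<rho> n)) \<longlonglongrightarrow> 0" using LIMSEQ_subseq_LIMSEQ[OF r0 l(1)] by (simp add: o_def)
      from order_tendstoD(2)[OF this pos] ev have "\<forall>\<^sub>F n in sequentially. False"
      proof eventually_elim
        case (elim n)
        then show ?case using t0(2)[of "t (\<rho> n)"] on_circle[of "\<rho> n"] by auto
      qed
      then show False by simp
    next
      assume "filterlim r at_top sequentially"
      then have "filterlim (\<lambda>n. r (\<rho> n)) at_top sequentially"
        using filterlim_compose[OF _ filterlim_subseq[OF l(1)]] by blast
      obtain t0 where t0: "t0 \<in> {u..v}" "\<And>t. t \<in> {u..v} \<Longrightarrow> norm (H 1 t - of_real c) \<le> norm (H 1 t0 - of_real c)"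
        using continuous_attains_sup[OF _ ne cont] by auto
      have "\<forall>\<^sub>F n in sequentially. norm (H 1 t0 - of_real c) < r (\<rho> n)"
        using \<open>filterlim (\<lambda>n. r (\<rho> n)) at_top sequentially\<close> by (simp add: filterlim_at_top_dense)
      with ev have "\<forall>\<^sub>F n in sequentially. False"
      proof eventually_elim
        case (elim n)
        then show ?case using t0(2)[of "t (\<rho> n)"] on_circle[of "\<rho> n"] by auto
      qed
      then show False by simp
    qed
  qed
  then have l_end: "l \<in> {a, b}" using al lb by auto
  have "linked e l"
    unfolding linked_def
  proof (rule exI[of _ "\<lambda>n. c + \<eta> * r (\<rho> n)"], rule exI[of _ "\<lambda>n. t (\<rho> n)"], rule exI[of _ "\<lambda>n. \<theta> (\<rho> n)"],
      rule exI[of _ "\<lambda>n. r (\<rho> n)"], rule exI[of _ c], rule exI[of _ \<eta>], intro conjI)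
    show "(\<lambda>n. ereal (c + \<eta> * r (\<rho> n))) \<longlonglongrightarrow> e" using LIMSEQ_subseq_LIMSEQ[OF xe l(1)] by (simp add: o_def)
    show "(\<lambda>n. ereal (t (\<rho> n))) \<longlonglongrightarrow> l" using l(2) by (simp add: o_def)
    show "is_end a b c \<and> (\<lambda>n. r (\<rho> n)) \<longlonglongrightarrow> 0 \<or> c = 0 \<and> (a = - \<infinity> \<or> b = \<infinity>) \<and> (LIM n sequentially. r (\<rho> n) :> at_top)"
      using lim LIMSEQ_subseq_LIMSEQ[OF _ l(1), of r 0] filterlim_compose[OF _ filterlim_subseq[OF l(1)], of r at_top]
      by (auto simp: o_def)
  qed (use \<theta>t x r \<eta> in auto)
  then show ?thesis using l_end by blast
qed

lemma linked_finite:
  fixes \<eta> :: real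
  assumes e: "ereal e = a \<and> \<eta> = 1 \<or> ereal e = b \<and> \<eta> = -1"
  shows "\<exists>e'\<in>{a, b}. linked (ereal e) e'"
proof -
  have end_e: "is_end a b e" using e by (auto simp: is_end_def)
  obtain t0 where t0: "t0 \<in> I" using einterval_nonempty[OF ab] by auto
  define w where "w = min \<bar>t0 - e\<bar> (norm (H 1 t0 - of_real e))"
  have "e \<notin> I" using end_e by (auto simp: is_end_def einterval_def)
  moreover have "H 1 t0 \<noteq> of_real e" using H_1_lower[OF t0] by auto
  ultimately have "w > 0" using t0 by (auto simp: w_def)
  define r where "r n = w / (real n + 2)" for n
  have r: "0 < r n" "r n < w" for n using \<open>w > 0\<close> by (auto simp: r_def field_simps add_pos_nonneg)
  have rw: "r n < \<bar>t0 - e\<bar>" "r n < norm (H 1 t0 - of_real e)" for n using r[of n] by (auto simp: w_def)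
  have x: "e + \<eta> * r n \<in> I" for n
  proof (cases "ereal e = a \<and> \<eta> = 1")
    case True
    then have "e < t0" using t0 by (auto simp: einterval_def)
    then have "e + r n < t0" using rw[of n] by auto
    then show ?thesis using True r[of n] t0 less_trans[of "ereal (e + r n)" "ereal t0" b]
      by (auto simp: einterval_def simp flip: conjunct1[OF True])
  next
    case False
    then have eb: "ereal e = b" "\<eta> = -1" using e by auto
    then have "t0 < e" using t0 by (auto simp: einterval_def)
    then have "t0 < e - r n" using rw[of n] by auto
    then show ?thesis using eb r[of n] t0 less_trans[of a "ereal t0" "ereal (e - r n)"]
      by (auto simp: einterval_def simp flip: eb(1))
  qed
  have r0: "r \<longlonglongrightarrow> 0" unfolding r_def by real_asymp
  show ?thesis
  proof (rule linkedI[where r = r and c = e and \<eta> = \<eta>])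
    have "(\<lambda>n. e + \<eta> * r n) \<longlonglongrightarrow> e + \<eta> * 0" by (intro tendsto_intros r0)
    then show "(\<lambda>n. ereal (e + \<eta> * r n)) \<longlonglongrightarrow> ereal e" by simp
    fix n
    show "\<bar>e' - e\<bar> \<noteq> r n" if "is_end a b e'" for e'
    proof
      assume "\<bar>e' - e\<bar> = r n"
      then have "e' = e + r n \<or> e' = e - r n" by auto
      moreover have "e' \<noteq> e" using \<open>\<bar>e' - e\<bar> = r n\<close> r[of n] by auto
      ultimately have "e' = e + \<eta> * r n \<or> ereal e' < a \<or> b < ereal e'" 
        using e r(1)[of n] by auto
      then show False using that x[of n] ab by (auto simp: is_end_def einterval_def)
    qed
    obtain t' where "t' \<in> I" "norm (H 1 t' - of_real e) < r n" using near_finite_end[OF end_e r(1)] by blast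
    then show "\<exists>t1\<in>I. norm (H 1 t1 - of_real e) = r n"
      using curve_meets_circle[of t' "of_real e" "r n" t0] t0 rw(2)[of n] by auto
  qed (use r x e end_e r0 in auto)
qed

lemma linked_infinite:
  fixes \<eta> :: real
  assumes e: "e = a \<and> a = -\<infinity> \<and> \<eta> = -1 \<or> e = b \<and> b = \<infinity> \<and> \<eta> = 1"
  shows "\<exists>e'\<in>{a, b}. linked e e'"
proof -
  obtain t0 where t0: "t0 \<in> I" using einterval_nonempty[OF ab] by auto
  have inf: "a = -\<infinity> \<or> b = \<infinity>" using e by auto
  define ra rb where "ra = real_of_ereal a" and "rb = real_of_ereal b"
  \<comment> \<open>Circles of larger radius enclose a finite end point and separate a point of the curve from infinity.\<close>
  define R where "R = 1 + \<bar>ra\<bar> + \<bar>rb\<bar> + norm (H 1 t0) + \<bar>t0\<bar>"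
  define r where "r n = R + real n" for n
  have r: "0 < r n" "norm (H 1 t0) \<le> r n" "\<bar>t0\<bar> < r n" "\<bar>ra\<bar> < r n" "\<bar>rb\<bar> < r n" for n
  proof -
    have "0 \<le> norm (H 1 t0)" "0 \<le> real n" by simp_all
    then show "0 < r n" "norm (H 1 t0) \<le> r n" "\<bar>t0\<bar> < r n" "\<bar>ra\<bar> < r n" "\<bar>rb\<bar> < r n"
      unfolding r_def R_def by linarith+
  qed
  have x: "\<eta> * r n \<in> I" for n
    using e
  proof (elim disjE conjE)
    assume "a = -\<infinity>" "\<eta> = -1"
    moreover have "- r n < t0" using r(3)[of n] by auto
    then have "ereal (- r n) < b" using t0 less_trans[of "ereal (- r n)" "ereal t0" b] by (auto simp: einterval_def)
    ultimately show ?thesis by (auto simp: einterval_def)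
  next
    assume "b = \<infinity>" "\<eta> = 1"
    moreover have "t0 < r n" using r(3)[of n] by auto
    then have "a < ereal (r n)" using t0 less_trans[of a "ereal t0" "ereal (r n)"] by (auto simp: einterval_def)
    ultimately show ?thesis by (auto simp: einterval_def)
  qed
  have rtop: "filterlim r at_top sequentially" unfolding r_def by real_asymp
  show ?thesis
  proof (rule linkedI[where r = r and c = 0 and \<eta> = \<eta>])
    show "(\<lambda>n. ereal (0 + \<eta> * r n)) \<longlonglongrightarrow> e"
      using e
    proof (elim disjE conjE)
      assume "e = a" "a = -\<infinity>" "\<eta> = -1"
      moreover have "filterlim (\<lambda>n. - r n) at_bot sequentially" using rtop by (simp add: filterlim_uminus_at_top)
      ultimately show ?thesis by (simp add: tendsto_MInfty filterlim_at_bot_dense)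
    next
      assume "e = b" "b = \<infinity>" "\<eta> = 1"
      then show ?thesis using rtop by (simp add: tendsto_PInfty filterlim_at_top_dense)
    qed
    fix n
    show "\<bar>e' - 0\<bar> \<noteq> r n" if "is_end a b e'" for e'
      using that r(4,5)[of n] unfolding is_end_def ra_def rb_def by auto
    obtain t' where "t' \<in> I" "r n \<le> norm (H 1 t')" using near_infinite_end[OF inf] by blast
    then show "\<exists>t1\<in>I. norm (H 1 t1 - of_real 0) = r n"
      using curve_meets_circle[of t0 "of_real 0" "r n" t'] t0 r(2)[of n] by auto
  qed (use r x e inf rtop in auto)
qed

lemma ends_linked: "e \<in> {a, b} \<Longrightarrow> \<exists>e'\<in>{a, b}. linked e e'"
proof -
  assume e: "e \<in> {a, b}"
  have "a \<noteq> \<infinity>" "b \<noteq> -\<infinity>" using ab by auto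
  show ?thesis
  proof (cases e)
    case (real r)
    then have "ereal r = a \<and> (1::real) = 1 \<or> ereal r = b \<and> (1::real) = -1
        \<or> ereal r = a \<and> (-1::real) = 1 \<or> ereal r = b \<and> (-1::real) = -1" using e by blast
    then show ?thesis using linked_finite[of r 1] linked_finite[of r "-1"] unfolding real by blast
  next
    case PInf
    then have "e = b" "b = \<infinity>" using e \<open>a \<noteq> \<infinity>\<close> by blast+
    then have "e = a \<and> a = -\<infinity> \<and> (1::real) = -1 \<or> e = b \<and> b = \<infinity> \<and> (1::real) = 1" by simp
    from linked_infinite[OF this] show ?thesis .
  next
    case MInf
    then have "e = a" "a = -\<infinity>" using e \<open>b \<noteq> -\<infinity>\<close> by blast+
    then have "e = a \<and> a = -\<infinity> \<and> (-1::real) = -1 \<or> e = b \<and> b = \<infinity> \<and> (-1::real) = 1" by simp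
    from linked_infinite[OF this] show ?thesis .
  qed
qed

end

section \<open>Primitives and the contour integral of a decaying function\<close>

context deformed_contour
begin

lemma small_half_disc:
  assumes t: "t \<in> I"
  obtains \<rho> where "\<rho> > 0" "\<And>z. Im z < 0 \<Longrightarrow> dist z (of_real t) < \<rho> \<Longrightarrow> z \<in> D"
    "\<And>x. \<bar>x - t\<bar> < \<rho> \<Longrightarrow> x \<in> I"
proof -
  obtain \<rho>1 where \<rho>1: "\<rho>1 > 0" "\<And>z. Im z < 0 \<Longrightarrow> dist z (of_real t) < \<rho>1 \<Longrightarrow> z \<in> D"
    by (rule lower_half_disc[OF t]) blast
  obtain \<rho>2 where \<rho>2: "\<rho>2 > 0" "ball t \<rho>2 \<subseteq> I"
    using open_contains_ball[of I] t open_einterval[of a b] by blast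
  show ?thesis
  proof (rule that[of "min \<rho>1 \<rho>2"])
    show "x \<in> I" if "\<bar>x - t\<bar> < min \<rho>1 \<rho>2" for x
      using that by (intro subsetD[OF \<rho>2(2)]) (auto simp: dist_real_def abs_minus_commute)
  qed (use \<rho>1 \<rho>2 in auto)
qed

lemma interval_point_nontrivial:
  assumes t: "t \<in> I"
  shows "at (complex_of_real t) within D \<noteq> bot"
proof -
  obtain \<rho> where \<rho>: "\<rho> > 0" "\<And>z. Im z < 0 \<Longrightarrow> dist z (of_real t) < \<rho> \<Longrightarrow> z \<in> D"
    by (rule lower_half_disc[OF t]) blast
  have "complex_of_real t islimpt D"
    unfolding islimpt_approachable
  proof (intro allI impI)
    fix e :: real assume "e > 0"
    define z where "z = Complex t (- min e \<rho> / 2)"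
    have "dist z (of_real t) = min e \<rho> / 2"
    proof -
      have "z - of_real t = - \<i> * of_real (min e \<rho> / 2)" by (simp add: z_def complex_eq_iff)
      then show ?thesis using \<open>e > 0\<close> \<rho>(1) by (simp only: dist_norm norm_mult norm_minus_cancel norm_ii norm_of_real)
    qed
    then show "\<exists>x'\<in>D. x' \<noteq> of_real t \<and> dist x' (of_real t) < e"
      using \<rho> \<open>e > 0\<close> by (intro bexI[of _ z] conjI \<rho>(2)) (auto simp: z_def complex_eq_iff min_def)
  qed
  then show ?thesis by (simp add: trivial_limit_within)
qed

text \<open>
  Near a point of the interval \<open>F\<close> also has a primitive on a closed half-disc. On the open half-disc it
  differs by a constant from the primitive on the domain, so it provides the boundary values of the latter and
  their derivative.
\<close>

lemma primitive_up_to_interval: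
  assumes hol: "F holomorphic_on D" and cont: "continuous_on (D \<union> of_real ` I) F"
  obtains G where "\<And>z. z \<in> D \<Longrightarrow> (G has_field_derivative F z) (at z)"
    "\<And>t. t \<in> I \<Longrightarrow> (G \<longlongrightarrow> G (of_real t)) (at (of_real t) within D)"
    "\<And>s t. s \<in> I \<Longrightarrow> t \<in> I \<Longrightarrow> s \<le> t \<Longrightarrow> ((\<lambda>x. F (of_real x)) has_integral G (of_real t) - G (of_real s)) {s..t}"
proof -
  obtain G0 where G0: "\<And>z. z \<in> D \<Longrightarrow> (G0 has_field_derivative F z) (at z)"
    using D_simply_connected simply_connected_eq_global_primitive[OF D_open] hol by blast
  define G where "G z = (if z \<in> D then G0 z else Lim (at z within D) G0)" for z
  have real_notin: "complex_of_real t \<notin> D" for t using D_lower by auto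
  have loc: "\<exists>\<rho> g k. \<rho> > 0 \<and> (\<forall>x. \<bar>x - t\<bar> < \<rho> \<longrightarrow> x \<in> I \<and> (G0 \<longlongrightarrow> g (complex_of_real x) + k) (at (of_real x) within D)) \<and>
     ((\<lambda>x. g (complex_of_real x)) has_vector_derivative F (of_real t)) (at t)" if t: "t \<in> I" for t
  proof -
    obtain \<rho> where \<rho>: "\<rho> > 0" "\<And>z. Im z < 0 \<Longrightarrow> dist z (of_real t) < \<rho> \<Longrightarrow> z \<in> D" "\<And>x. \<bar>x - t\<bar> < \<rho> \<Longrightarrow> x \<in> I"
      using small_half_disc[OF t] by metis
    define S where "S = {z. Im z \<le> 0} \<inter> ball (complex_of_real t) \<rho>"
    define U where "U = {z. Im z < 0} \<inter> ball (complex_of_real t) \<rho>"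
    have UD: "U \<subseteq> D" using \<rho>(2) by (auto simp: U_def dist_commute)
    have US: "U \<subseteq> S" by (auto simp: U_def S_def)
    have realS: "of_real x \<in> S" if "\<bar>x - t\<bar> < \<rho>" for x
    proof -
      have "dist (complex_of_real t) (of_real x) = \<bar>x - t\<bar>" by (simp add: dist_commute dist_real_def)
      then show ?thesis using that by (simp add: S_def)
    qed
    have SD: "S \<subseteq> D \<union> of_real ` I"
    proof
      fix z assume z: "z \<in> S"
      show "z \<in> D \<union> of_real ` I"
      proof (cases "Im z < 0")
        case True
        then show ?thesis using z UD by (auto simp: S_def U_def)
      next
        case False
        then have "z = of_real (Re z)" using z by (simp add: S_def complex_eq_iff)
        moreover have "\<bar>Re z - t\<bar> < \<rho>"
          using z abs_Re_le_cmod[of "z - of_real t"] by (auto simp: S_def dist_norm norm_minus_commute)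
        ultimately show ?thesis using \<rho>(3)[of "Re z"] by blast
      qed
    qed
    have convS: "convex S" unfolding S_def by (intro convex_Int convex_halfspace_Im_le convex_ball)
    have convU: "convex U" unfolding U_def by (intro convex_Int convex_halfspace_Im_lt convex_ball)
    have "interior S \<subseteq> U"
    proof
      fix z assume "z \<in> interior S"
      then obtain e where e: "e > 0" "ball z e \<subseteq> S" using mem_interior by blast
      have "z \<in> S" using \<open>z \<in> interior S\<close> interior_subset by blast
      have "dist z (z + \<i> * of_real (e / 2)) < e" using e(1) by (simp add: dist_norm norm_mult)
      then have "z + \<i> * of_real (e / 2) \<in> S" using e(2) by (intro subsetD[OF e(2)]) simp
      then have "Im z < 0" using e(1) by (simp add: S_def)
      then show "z \<in> U" using \<open>z \<in> S\<close> by (simp add: S_def U_def)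
    qed
    obtain g where g: "\<And>x. x \<in> S \<Longrightarrow> (g has_field_derivative F x) (at x within S)"
    proof (rule holomorphic_convex_primitive[OF convS _ continuous_on_subset[OF cont SD]])
      show "finite {}" by simp
      show "F field_differentiable at x" if "x \<in> interior S - {}" for x
        using holomorphic_on_imp_differentiable_at[OF hol D_open] that \<open>interior S \<subseteq> U\<close> UD by auto
    qed blast
    have openU: "open U" unfolding U_def by (intro open_Int open_halfspace_Im_lt open_ball)
    have "((\<lambda>z. G0 z - g z) has_field_derivative 0) (at z within U)" if "z \<in> U" for z
    proof -
      have "z \<in> D" "z \<in> S" using that UD US by blast+
      then have "((\<lambda>z. G0 z - g z) has_field_derivative F z - F z) (at z within U)"
        by (intro DERIV_diff has_field_derivative_at_within[OF G0] DERIV_subset[OF g US])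
      then show ?thesis by simp
    qed
    then obtain k where k: "\<And>z. z \<in> U \<Longrightarrow> G0 z - g z = k"
      using has_field_derivative_zero_constant[OF convU, of "\<lambda>z. G0 z - g z"] by blast
    have limG: "(G0 \<longlongrightarrow> g (of_real x) + k) (at (of_real x) within D)" if x: "\<bar>x - t\<bar> < \<rho>" for x
    proof -
      have xS: "of_real x \<in> S" by (rule realS[OF x])
      have "continuous (at (of_real x) within S) g"
        by (rule DERIV_continuous[OF g[OF xS]])
      then have "(g \<longlongrightarrow> g (of_real x)) (at (of_real x) within S)" by (simp add: continuous_within)
      then have "((\<lambda>z. g z + k) \<longlongrightarrow> g (of_real x) + k) (at (of_real x) within U)"
        by (intro tendsto_intros tendsto_within_subset[OF _ US])
      moreover have "\<forall>\<^sub>F z in at (of_real x) within U. g z + k = G0 z"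
        unfolding eventually_at_filter by (rule always_eventually) (use k in \<open>force simp: algebra_simps\<close>)
      ultimately have "(G0 \<longlongrightarrow> g (of_real x) + k) (at (of_real x) within U)"
        by (rule Lim_transform_eventually)
      moreover have "at (of_real x) within D = at (of_real x) within U"
      proof (rule at_within_nhd[of _ "ball (of_real t) \<rho>"])
        show "complex_of_real x \<in> ball (of_real t) \<rho>" using xS by (simp add: S_def)
        show "D \<inter> ball (of_real t) \<rho> - {of_real x} = U \<inter> ball (of_real t) \<rho> - {of_real x}"
          using D_lower UD by (auto simp: U_def)
      qed simp
      ultimately show ?thesis by simp
    qed
    have "((\<lambda>x. g (of_real x)) has_vector_derivative F (of_real t)) (at t)"
    proof -
      have tS: "of_real t \<in> S" using realS[of t] \<rho>(1) by simp
      have "of_real ` ball t \<rho> \<subseteq> S" using realS by (auto simp: dist_real_def abs_minus_commute)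
      then have "(g has_field_derivative F (of_real t)) (at (of_real t) within of_real ` ball t \<rho>)"
        using DERIV_subset[OF g[OF tS]] by blast
      moreover have "(of_real has_vector_derivative 1) (at t within ball t \<rho>)"
        by (auto intro!: derivative_eq_intros simp: has_vector_derivative_def scaleR_conv_of_real)
      ultimately have "(g \<circ> of_real has_vector_derivative 1 * F (of_real t)) (at t within ball t \<rho>)"
        by (intro field_vector_diff_chain_within) auto
      moreover have "at t within ball t \<rho> = at t" using \<rho>(1) by (intro at_within_open) auto
      ultimately show ?thesis by (simp add: o_def)
    qed
    then show ?thesis using \<rho> limG by blast
  qed
  have Glim: "(G0 \<longlongrightarrow> G (of_real t)) (at (of_real t) within D)" if t: "t \<in> I" for t
  proof -
    obtain \<rho> g k where "\<rho> > 0" "\<And>x. \<bar>x - t\<bar> < \<rho> \<Longrightarrow> (G0 \<longlongrightarrow> g (complex_of_real x) + k) (at (complex_of_real x) within D)"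
      using loc[OF t] by blast
    then have *: "(G0 \<longlongrightarrow> g (of_real t) + k) (at (of_real t) within D)" by simp
    then have "Lim (at (of_real t) within D) G0 = g (of_real t) + k"
      by (rule tendsto_Lim[OF interval_point_nontrivial[OF t]])
    then show ?thesis using * real_notin by (simp add: G_def)
  qed
  have Gder: "((\<lambda>x. G (of_real x)) has_vector_derivative F (of_real t)) (at t)" if t: "t \<in> I" for t
  proof -
    obtain \<rho> g k where \<rho>: "\<rho> > 0"
      and lim: "\<And>x. \<bar>x - t\<bar> < \<rho> \<Longrightarrow> x \<in> I \<and> (G0 \<longlongrightarrow> g (complex_of_real x) + k) (at (complex_of_real x) within D)"
      and g: "((\<lambda>x. g (of_real x)) has_vector_derivative F (of_real t)) (at t)"
      using loc[OF t] by blast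
    have eq: "g (of_real x) + k = G (of_real x)" if x: "x \<in> ball t \<rho>" for x
    proof -
      have "\<bar>x - t\<bar> < \<rho>" using x by (simp add: dist_real_def abs_minus_commute)
      from lim[OF this] have xI: "x \<in> I" and l: "(G0 \<longlongrightarrow> g (of_real x) + k) (at (complex_of_real x) within D)" by auto
      show ?thesis by (rule tendsto_unique[OF interval_point_nontrivial[OF xI] l Glim[OF xI]])
    qed
    have "((\<lambda>x. g (of_real x) + k) has_vector_derivative F (of_real t) + 0) (at t)"
      by (intro has_vector_derivative_add g has_vector_derivative_const)
    then have "((\<lambda>x. g (of_real x) + k) has_vector_derivative F (of_real t)) (at t)" by simp
    then show ?thesis
      by (rule has_vector_derivative_transform_within_open[where S = "ball t \<rho>"]) (use \<rho> eq in auto)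
  qed
  show ?thesis
  proof
    fix z assume z: "z \<in> D"
    show "(G has_field_derivative F z) (at z)"
      by (rule has_field_derivative_transform_within_open[OF G0[OF z] D_open z]) (simp add: G_def)
  next
    fix t assume t: "t \<in> I"
    have "\<forall>\<^sub>F z in at (of_real t) within D. G0 z = G z"
      unfolding eventually_at_filter by (rule always_eventually) (simp add: G_def)
    from Lim_transform_eventually[OF Glim[OF t] this]
    show "(G \<longlongrightarrow> G (of_real t)) (at (of_real t) within D)" .
  next
    fix s t assume st: "s \<in> I" "t \<in> I" "s \<le> t"
    show "((\<lambda>x. F (of_real x)) has_integral G (of_real t) - G (of_real s)) {s..t}"
    proof (rule fundamental_theorem_of_calculus[where f = "\<lambda>x. G (of_real x)", OF st(3)])
      fix x assume "x \<in> {s..t}"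
      then have "x \<in> I" using I_between[OF st(1,2)] by blast
      from has_vector_derivative_at_within[OF Gder[OF this]]
      show "((\<lambda>x. G (of_real x)) has_vector_derivative F (of_real x)) (at x within {s..t})" .
    qed
  qed
qed

text \<open>
  The bound \<open>m\<close> is one for \<open>r\<close> times the integrand, as the arc has length at most \<open>\<pi> r\<close>.
\<close>

lemma primitive_along_arc:
  assumes G: "\<And>z. z \<in> D \<Longrightarrow> (G has_field_derivative F z) (at z)"
    and G0: "(G \<longlongrightarrow> G (of_real x)) (at (of_real x) within D)"
    and r: "r > 0" and \<eta>: "\<eta> = 1 \<or> \<eta> = -1" and x: "x = c + \<eta> * r" and \<theta>: "0 < \<theta>" "\<theta> < pi"
    and A: "\<And>y. 0 < y \<Longrightarrow> y < \<theta> \<Longrightarrow> of_real c + of_real (\<eta> * r) * cis (- \<eta> * y) \<in> D"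
    and A\<theta>: "of_real c + of_real (\<eta> * r) * cis (- \<eta> * \<theta>) = w" "w \<in> D"
    and F: "\<And>y. 0 < y \<Longrightarrow> y < \<theta> \<Longrightarrow> r * norm (F (of_real c + of_real (\<eta> * r) * cis (- \<eta> * y))) \<le> m"
  shows "norm (G (of_real x) - G w) \<le> m * pi"
proof -
  define A where "A y = of_real c + of_real (\<eta> * r) * cis (- \<eta> * y)" for y
  have A': "(A has_vector_derivative (- \<i> * of_real r * cis (- \<eta> * y))) (at y)" for y
  proof -
    have "((\<lambda>w. of_real c + of_real (\<eta> * r) * exp (\<i> * of_real (- \<eta>) * w)) has_field_derivative
        of_real (\<eta> * r) * (\<i> * of_real (- \<eta>) * exp (\<i> * of_real (- \<eta>) * of_real y))) (at (of_real y))"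
      by (auto intro!: derivative_eq_intros)
    then have "((\<lambda>x. of_real c + of_real (\<eta> * r) * exp (\<i> * of_real (- \<eta>) * of_real x)) has_vector_derivative
        of_real (\<eta> * r) * (\<i> * of_real (- \<eta>) * exp (\<i> * of_real (- \<eta>) * of_real y))) (at y)"
      by (rule has_vector_derivative_real_field)
    moreover have "of_real (\<eta> * r) * (\<i> * of_real (- \<eta>) * w) = - \<i> * of_real r * w" for w
      using \<eta> by auto
    moreover have "exp (\<i> * of_real (- \<eta>) * of_real x) = cis (- \<eta> * x)" for x
      by (simp add: cis_conv_exp mult.assoc)
    ultimately show ?thesis unfolding A_def by (simp only:)
  qed
  have contA: "isCont A y" for y using A' has_vector_derivative_continuous by blast
  have AD: "A y \<in> D" if "0 < y" "y \<le> \<theta>" for y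
    using that A[of y] A\<theta> by (cases "y = \<theta>") (auto simp: A_def)
  have A0: "A 0 = of_real x" by (simp add: A_def x)
  have GA': "((\<lambda>y. G (A y)) has_vector_derivative (- \<i> * of_real r * cis (- \<eta> * y)) * F (A y)) (at y)" if "0 < y" "y \<le> \<theta>" for y
    using field_vector_diff_chain_at[OF A' G[OF AD[OF that]]] by (simp add: o_def)
  have "norm (G (A \<theta>) - G (A 0)) \<le> m * \<theta> - m * 0"
  proof (rule differentiable_bound_general[OF \<theta>(1)])
    show "continuous_on {0..\<theta>} (\<lambda>y. G (A y))"
      unfolding continuous_on_eq_continuous_within
    proof
      fix y assume y: "y \<in> {0..\<theta>}"
      show "continuous (at y within {0..\<theta>}) (\<lambda>y. G (A y))"
      proof (cases "y = 0")
        case False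
        then show ?thesis using y GA'[of y] has_vector_derivative_continuous continuous_at_imp_continuous_at_within by fastforce
      next
        case True
        have "filterlim A (at (of_real x) within D) (at 0 within {0..\<theta>})"
        proof (rule filterlim_at_withinI)
          show "filterlim A (nhds (of_real x)) (at 0 within {0..\<theta>})"
            using contA[of 0] A0 by (metis continuous_at_imp_continuous_at_within continuous_within)
          show "\<forall>\<^sub>F y in at 0 within {0..\<theta>}. A y \<in> D - {of_real x}"
            unfolding eventually_at_filter
          proof (rule always_eventually, intro allI impI)
            fix y assume "y \<noteq> 0" "y \<in> {0..\<theta>}"
            then have "A y \<in> D" using AD[of y] by auto
            moreover have "of_real x \<notin> D" using D_lower by auto
            ultimately show "A y \<in> D - {of_real x}" by auto
          qed
        qed
        from filterlim_compose[OF G0 this] show ?thesis using True A0 by (simp add: continuous_within)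
      qed
    qed
    show "continuous_on {0..\<theta>} (\<lambda>y. m * y)" by (intro continuous_intros)
    fix y assume y: "0 < y" "y < \<theta>"
    show "((\<lambda>y. G (A y)) has_vector_derivative (- \<i> * of_real r * cis (- \<eta> * y)) * F (A y)) (at y)"
      using GA' y by auto
    show "((\<lambda>y. m * y) has_vector_derivative m) (at y)"
      by (auto intro!: derivative_eq_intros simp: has_vector_derivative_def)
    show "norm ((- \<i> * of_real r * cis (- \<eta> * y)) * F (A y)) \<le> m"
      using F[OF y] r by (simp add: norm_mult A_def)
  qed
  moreover have "m \<ge> 0"
    using \<theta> r by (intro order_trans[OF _ F[of "\<theta> / 2"]]) auto
  ultimately have "norm (G (A \<theta>) - G (A 0)) \<le> m * pi"
    using \<theta> mult_left_mono[of \<theta> pi m] by linarith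
  then show ?thesis using A0 A\<theta> by (simp add: A_def norm_minus_commute)
qed

text \<open>
  Along the linking arcs \<open>r\<close> times the integrand tends to 0, at both kinds of ends.
\<close>

lemma linked_primitive_limit:
  assumes "linked e e'"
    and G: "\<And>z. z \<in> D \<Longrightarrow> (G has_field_derivative F z) (at z)"
    and G0: "\<And>t. t \<in> I \<Longrightarrow> (G \<longlongrightarrow> G (of_real t)) (at (of_real t) within D)"
    and F_fin: "\<And>c. is_end a b c \<Longrightarrow> ((\<lambda>z. (z - of_real c) * F z) \<longlongrightarrow> 0) (at (of_real c) within D)"
    and F_inf: "\<And>\<epsilon>. \<epsilon> > 0 \<Longrightarrow> a = -\<infinity> \<or> b = \<infinity> \<Longrightarrow> \<exists>R. \<forall>z\<in>D \<inter> swept. R \<le> norm z \<longrightarrow> norm z * norm (F z) \<le> \<epsilon>"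
  shows "\<exists>x t. (\<forall>n::nat. x n \<in> I \<and> t n \<in> I) \<and> (\<lambda>n. ereal (x n)) \<longlonglongrightarrow> e \<and> (\<lambda>n. ereal (t n)) \<longlonglongrightarrow> e' \<and>
    (\<lambda>n. G (of_real (x n)) - G (H 1 (t n))) \<longlonglongrightarrow> 0"
proof -
  from assms(1) obtain x t \<theta> r c \<eta> where
    L: "\<And>n. x n \<in> I" "\<And>n. t n \<in> I" "\<And>n. r n > 0" "\<And>n. 0 < \<theta> n" "\<And>n. x n = c + \<eta> * r n" "\<And>n. \<theta> n < pi"
      "\<And>n. of_real c + of_real (\<eta> * r n) * cis (- \<eta> * \<theta> n) = H 1 (t n)"
      "\<And>n y. 0 < y \<Longrightarrow> y < \<theta> n \<Longrightarrow> of_real c + of_real (\<eta> * r n) * cis (- \<eta> * y) \<in> D \<inter> swept"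
      "\<eta> = 1 \<or> \<eta> = -1" "(\<lambda>n. ereal (x n)) \<longlonglongrightarrow> e" "(\<lambda>n::nat. ereal (t n)) \<longlonglongrightarrow> e'"
    and lim: "is_end a b c \<and> r \<longlonglongrightarrow> 0 \<or> c = 0 \<and> (a = -\<infinity> \<or> b = \<infinity>) \<and> filterlim r at_top sequentially"
    unfolding linked_def by (elim exE conjE) blast
  let ?A = "\<lambda>n y. of_real c + of_real (\<eta> * r n) * cis (- \<eta> * y)"
  have normA: "norm (?A n y - of_real c) = r n" for n y using L(3)[of n] L(9) by (auto simp: norm_mult)
  have small: "\<forall>\<^sub>F n in sequentially. \<forall>y. 0 < y \<longrightarrow> y < \<theta> n \<longrightarrow> r n * norm (F (?A n y)) \<le> \<epsilon>" if \<epsilon>: "\<epsilon> > 0" for \<epsilon>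
    using lim
  proof (elim disjE[of "is_end a b c \<and> r \<longlonglongrightarrow> 0"], goal_cases)
    case 1
    then have c: "is_end a b c" and r0: "r \<longlonglongrightarrow> 0" by auto
    obtain d where d: "d > 0" "\<And>z. z \<in> D \<Longrightarrow> z \<noteq> of_real c \<Longrightarrow> dist z (of_real c) < d \<Longrightarrow> dist ((z - of_real c) * F z) 0 < \<epsilon>"
      using tendstoD[OF F_fin[OF c] \<epsilon>] unfolding eventually_at by blast
    from order_tendstoD(2)[OF r0 d(1)] show ?case
    proof eventually_elim
      case (elim n)
      show ?case
      proof (intro allI impI)
        fix y assume y: "0 < y" "y < \<theta> n"
        have "?A n y \<noteq> of_real c" using normA[of n y] L(3)[of n] by auto
        then have "dist ((?A n y - of_real c) * F (?A n y)) 0 < \<epsilon>"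
          using L(8)[OF y] normA[of n y] elim by (intro d(2)) (auto simp: dist_norm)
        then show "r n * norm (F (?A n y)) \<le> \<epsilon>" using normA[of n y] by (simp only: dist_norm diff_0_right norm_mult)
      qed
    qed
  next
    case 2
    then have c: "c = 0" and inf: "a = -\<infinity> \<or> b = \<infinity>" and rtop: "filterlim r at_top sequentially" by auto
    obtain R where R: "\<forall>z\<in>D \<inter> swept. R \<le> norm z \<longrightarrow> norm z * norm (F z) \<le> \<epsilon>" using F_inf[OF \<epsilon> inf] by blast
    have "\<forall>\<^sub>F n in sequentially. R \<le> r n" using rtop unfolding filterlim_at_top by blast
    then show ?case
    proof eventually_elim
      case (elim n)
      show ?case
      proof (intro allI impI)
        fix y assume y: "0 < y" "y < \<theta> n"
        have n: "norm (?A n y) = r n" using normA[of n y] c by simp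
        from bspec[OF R L(8)[OF y]] show "r n * norm (F (?A n y)) \<le> \<epsilon>" using elim unfolding n by blast
      qed
    qed
  qed
  have "(\<lambda>n. G (of_real (x n)) - G (H 1 (t n))) \<longlonglongrightarrow> 0"
  proof (rule tendstoI)
    fix e0 :: real assume "e0 > 0"
    define \<epsilon> where "\<epsilon> = e0 / (2 * pi)"
    have \<epsilon>: "\<epsilon> > 0" "\<epsilon> * pi < e0" using \<open>e0 > 0\<close> by (auto simp: \<epsilon>_def)
    from small[OF \<epsilon>(1)] show "\<forall>\<^sub>F n in sequentially. dist (G (of_real (x n)) - G (H 1 (t n))) 0 < e0"
    proof eventually_elim
      case (elim n)
      have "norm (G (of_real (x n)) - G (H 1 (t n))) \<le> \<epsilon> * pi"
        by (rule primitive_along_arc[OF G G0[OF L(1)] L(3) L(9) L(5) L(4) L(6) _ L(7) H_1[OF L(2)]])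
          (use L(8) elim in auto)
      then show ?case using \<epsilon>(2) by (simp add: dist_norm)
    qed
  qed
  with L(1,2,10,11) show ?thesis by blast
qed

lemma \<phi>_tendsto_end:
  assumes t: "\<And>n. t n \<in> I" and lim: "(\<lambda>n::nat. ereal (t n)) \<longlonglongrightarrow> e'" and e': "e' \<in> {a, b}"
  shows "(\<lambda>n. ereal (\<phi> (t n))) \<longlonglongrightarrow> (if e' = a then p else q)"
proof -
  have \<phi>E: "ereal (\<phi> (t n)) < q" "p < ereal (\<phi> (t n))" for n
    using t[of n] \<phi>_image by (auto simp: einterval_def)
  show ?thesis
  proof (cases "e' = a")
    case True
    show ?thesis unfolding if_P[OF True]
    proof (rule order_tendstoI)
      fix y assume "y < p"
      then show "\<forall>\<^sub>F n in sequentially. y < ereal (\<phi> (t n))"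
        using \<phi>E(2) less_trans by (intro always_eventually allI) blast
    next
      fix y assume "p < y"
      then have "p < min y q" using pq by simp
      then obtain s where s: "p < ereal s" "ereal s < min y q" using ereal_dense2 by blast
      then have "s \<in> \<phi> ` I" unfolding \<phi>_image by (auto simp: einterval_def)
      then obtain u where u: "u \<in> I" "s = \<phi> u" by blast
      have "e' < ereal u" using u True by (simp add: einterval_def)
      from order_tendstoD(2)[OF lim this] show "\<forall>\<^sub>F n in sequentially. ereal (\<phi> (t n)) < y"
      proof eventually_elim
        case (elim n)
        then have "\<phi> (t n) < s" using strict_mono_onD[OF \<phi>_mono t u(1)] u(2) by simp
        then show ?case using s by (metis less_ereal.simps(1) less_trans min_less_iff_conj)
      qed
    qed
  next
    case False
    then have eb: "e' = b" using e' by simp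
    show ?thesis unfolding if_not_P[OF False]
    proof (rule order_tendstoI)
      fix y assume "q < y"
      then show "\<forall>\<^sub>F n in sequentially. ereal (\<phi> (t n)) < y"
        using \<phi>E(1) less_trans by (intro always_eventually allI) blast
    next
      fix y assume "y < q"
      then have "max y p < q" using pq by simp
      then obtain s where s: "max y p < ereal s" "ereal s < q" using ereal_dense2 by blast
      then have "s \<in> \<phi> ` I" unfolding \<phi>_image by (auto simp: einterval_def)
      then obtain u where u: "u \<in> I" "s = \<phi> u" by blast
      have "ereal u < e'" using u eb by (simp add: einterval_def)
      from order_tendstoD(1)[OF lim this] show "\<forall>\<^sub>F n in sequentially. y < ereal (\<phi> (t n))"
      proof eventually_elim
        case (elim n)
        then have "s < \<phi> (t n)" using strict_mono_onD[OF \<phi>_mono u(1) t] u(2) by simp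
        then show ?case using s by (metis less_ereal.simps(1) less_trans max_less_iff_conj)
      qed
    qed
  qed
qed

text \<open>
  The factor between the integrals over the interval and over the curve. The value \<open>-1\<close> means
  that the curve runs backwards, the value 0 that both ends of the interval are linked to the same end of the
  curve. A deformation only has to tend to infinity in absolute value at an infinite end, which does not force
  the value 1.
\<close>

definition orientation :: "complex \<Rightarrow> bool" where
  "orientation \<sigma> \<longleftrightarrow> (\<exists>ea\<in>{a, b}. \<exists>eb\<in>{a, b}. linked a ea \<and> linked b eb \<and>
     \<sigma> = (if ea = eb then 0 else if ea = a then 1 else -1))"

lemma orientation_exists: "\<exists>\<sigma>\<in>{0, 1, -1}. orientation \<sigma>"
proof -
  obtain ea eb where "ea \<in> {a, b}" "linked a ea" "eb \<in> {a, b}" "linked b eb"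
    using ends_linked[of a] ends_linked[of b] by blast
  then show ?thesis unfolding orientation_def
    by (intro bexI[of _ "if ea = eb then 0 else if ea = a then 1 else -1"] bexI[of _ ea] bexI[of _ eb] conjI refl) auto
qed

text \<open>
  Both integrals are differences of limits of one primitive at the ends, and the limits at linked ends
  are equal.
\<close>

lemma integral_interval_eq_curve_decaying:
  assumes \<sigma>: "orientation \<sigma>"
    and hol: "F holomorphic_on D" and cont: "continuous_on (D \<union> of_real ` I) F"
    and F_fin: "\<And>c. is_end a b c \<Longrightarrow> ((\<lambda>z. (z - of_real c) * F z) \<longlongrightarrow> 0) (at (of_real c) within D)"
    and F_inf: "\<And>\<epsilon>. \<epsilon> > 0 \<Longrightarrow> a = -\<infinity> \<or> b = \<infinity> \<Longrightarrow> \<exists>R. \<forall>z\<in>D \<inter> swept. R \<le> norm z \<longrightarrow> norm z * norm (F z) \<le> \<epsilon>"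
    and F_I: "(\<lambda>x. F (of_real x)) absolutely_integrable_on I"
    and F_E: "(\<lambda>s. \<gamma>' s * F (\<gamma> s)) absolutely_integrable_on E"
  shows "integral I (\<lambda>x. F (of_real x)) = \<sigma> * integral E (\<lambda>s. \<gamma>' s * F (\<gamma> s))"
proof -
  obtain G where G: "\<And>z. z \<in> D \<Longrightarrow> (G has_field_derivative F z) (at z)"
    "\<And>t. t \<in> I \<Longrightarrow> (G \<longlongrightarrow> G (of_real t)) (at (of_real t) within D)"
    "\<And>s t. s \<in> I \<Longrightarrow> t \<in> I \<Longrightarrow> s \<le> t \<Longrightarrow> ((\<lambda>x. F (of_real x)) has_integral G (of_real t) - G (of_real s)) {s..t}"
    by (rule primitive_up_to_interval[OF hol cont]) blast
  have contF: "continuous_on (\<gamma> ` E) F"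
    by (rule continuous_on_subset[OF cont]) (use curve_in_D in blast)
  have G\<gamma>: "((\<lambda>s. \<gamma>' s * F (\<gamma> s)) has_integral G (\<gamma> t) - G (\<gamma> s)) {s..t}" if "s \<in> E" "t \<in> E" "s \<le> t" for s t
    by (rule has_integral_along_curve[OF G(1) contF that]) (use curve_in_D in blast)
  obtain ga gb where g: "gb - ga = integral I (\<lambda>x. F (of_real x))"
    "\<And>y. (\<And>n::nat. y n \<in> I) \<Longrightarrow> (\<lambda>n. ereal (y n)) \<longlonglongrightarrow> a \<Longrightarrow> (\<lambda>n. G (of_real (y n))) \<longlonglongrightarrow> ga"
    "\<And>y. (\<And>n::nat. y n \<in> I) \<Longrightarrow> (\<lambda>n. ereal (y n)) \<longlonglongrightarrow> b \<Longrightarrow> (\<lambda>n. G (of_real (y n))) \<longlonglongrightarrow> gb"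
  proof (rule improper_integral_limits[OF ab F_I, where g = "\<lambda>x. G (of_real x)"], goal_cases)
    case (1 s t)
    show ?case by (rule G(3)) (fact 1)+
  next
    case (2 gp gq)
    show ?case by (rule that) (fact 2)+
  qed
  obtain hp hq where h: "hq - hp = integral E (\<lambda>s. \<gamma>' s * F (\<gamma> s))"
    "\<And>y. (\<And>n::nat. y n \<in> E) \<Longrightarrow> (\<lambda>n. ereal (y n)) \<longlonglongrightarrow> p \<Longrightarrow> (\<lambda>n. G (\<gamma> (y n))) \<longlonglongrightarrow> hp"
    "\<And>y. (\<And>n::nat. y n \<in> E) \<Longrightarrow> (\<lambda>n. ereal (y n)) \<longlonglongrightarrow> q \<Longrightarrow> (\<lambda>n. G (\<gamma> (y n))) \<longlonglongrightarrow> hq"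
  proof (rule improper_integral_limits[OF pq F_E, where g = "\<lambda>x. G (\<gamma> x)"], goal_cases)
    case (1 s t)
    show ?case by (rule G\<gamma>) (fact 1)+
  next
    case (2 gp gq)
    show ?case by (rule that) (fact 2)+
  qed
  have link: "(if e = a then ga else gb) = (if e' = a then hp else hq)"
    if l: "linked e e'" and e: "e \<in> {a, b}" and e': "e' \<in> {a, b}" for e e'
  proof -
    have "\<exists>x t. (\<forall>n::nat. x n \<in> I \<and> t n \<in> I) \<and> (\<lambda>n. ereal (x n)) \<longlonglongrightarrow> e \<and> (\<lambda>n. ereal (t n)) \<longlonglongrightarrow> e' \<and>
        (\<lambda>n. G (of_real (x n)) - G (H 1 (t n))) \<longlonglongrightarrow> 0"
      by (rule linked_primitive_limit[OF l G(1,2) F_fin F_inf])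
    then obtain x t where xt: "\<And>n::nat. x n \<in> I" "\<And>n. t n \<in> I" "(\<lambda>n. ereal (x n)) \<longlonglongrightarrow> e" "(\<lambda>n. ereal (t n)) \<longlonglongrightarrow> e'"
      "(\<lambda>n. G (of_real (x n)) - G (H 1 (t n))) \<longlonglongrightarrow> 0"
      by blast
    have 1: "(\<lambda>n. G (of_real (x n))) \<longlonglongrightarrow> (if e = a then ga else gb)"
      using e g(2)[of x, OF xt(1)] g(3)[of x, OF xt(1)] xt(3) by auto
    have \<phi>E: "\<phi> (t n) \<in> E" for n using xt(2)[of n] \<phi>_image by blast
    have "(\<lambda>n. G (\<gamma> (\<phi> (t n)))) \<longlonglongrightarrow> (if e' = a then hp else hq)"
      using \<phi>_tendsto_end[OF xt(2,4) e'] h(2)[of "\<lambda>n. \<phi> (t n)", OF \<phi>E] h(3)[of "\<lambda>n. \<phi> (t n)", OF \<phi>E] by (auto split: if_splits)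
    then have 2: "(\<lambda>n. G (H 1 (t n))) \<longlonglongrightarrow> (if e' = a then hp else hq)"
      using H_1_curve[OF xt(2)] by simp
    have "(\<lambda>n. G (of_real (x n)) - G (H 1 (t n))) \<longlonglongrightarrow> (if e = a then ga else gb) - (if e' = a then hp else hq)"
      by (rule tendsto_diff[OF 1 2])
    from LIMSEQ_unique[OF this xt(5)] show ?thesis by simp
  qed
  from \<sigma> obtain ea eb where e: "ea \<in> {a, b}" "eb \<in> {a, b}" "linked a ea" "linked b eb"
    "\<sigma> = (if ea = eb then 0 else if ea = a then 1 else -1)" unfolding orientation_def by blast
  have "a \<noteq> b" using ab by auto
  have 1: "ga = (if ea = a then hp else hq)" using link[OF e(3) _ e(1)] by simp
  have 2: "gb = (if eb = a then hp else hq)" using link[OF e(4) _ e(2)] \<open>a \<noteq> b\<close> by simp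
  show ?thesis unfolding g(1)[symmetric] h(1)[symmetric] 1 2 e(5) using e(1,2) \<open>a \<noteq> b\<close> by auto
qed

end

section \<open>Removing the decay by a Phragmen-Lindelof multiplier\<close>

text \<open>
  For \<open>z\<close> in the closed lower half-plane \<open>1 + i z\<close> has positive real part, so its power with an exponent
  \<open>\<beta> < 1\<close> stays in a sector strictly inside the right half-plane. This makes \<open>exp (- (1 + i z)\<^sup>\<beta> / n)\<close>
  decay.
\<close>

lemma re_powr_lower_half_plane:
  assumes \<beta>: "0 < \<beta>" "\<beta> < 1" and z: "Im z \<le> 0"
  shows "cos (\<beta> * pi / 2) * norm z powr \<beta> \<le> Re ((1 + \<i> * z) powr of_real \<beta>)"
proof -
  define w where "w = 1 + \<i> * z"
  have re: "Re w > 0" using z by (simp add: w_def)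
  then have w0: "w \<noteq> 0" by auto
  have "norm z ^ 2 \<le> norm w ^ 2"
    unfolding cmod_power2 w_def using z by (simp add: power2_eq_square algebra_simps)
  then have norm_le: "norm z \<le> norm w" by (rule power2_le_imp_le) simp
  have "\<bar>Im (Ln w)\<bar> < pi / 2" using Re_Ln_pos_lt[OF w0] re by simp
  then have "\<bar>\<beta> * Im (Ln w)\<bar> \<le> \<beta> * pi / 2" using \<beta> by (simp add: abs_mult)
  moreover have "\<beta> * pi / 2 \<le> pi" using \<beta> by (simp add: field_simps)
  ultimately have "cos (\<beta> * pi / 2) \<le> cos \<bar>\<beta> * Im (Ln w)\<bar>" by (intro cos_monotone_0_pi_le) auto
  then have cos_le: "cos (\<beta> * pi / 2) \<le> cos (\<beta> * Im (Ln w))" by simp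
  have pos: "cos (\<beta> * pi / 2) \<ge> 0" using \<beta> by (intro cos_ge_zero) (auto intro: order_trans[of _ 0])
  have "Re (w powr of_real \<beta>) = norm w powr \<beta> * cos (\<beta> * Im (Ln w))"
    using w0 by (simp add: powr_def exp_eq_polar cis.ctr Re_exp)
  also have "\<dots> \<ge> norm z powr \<beta> * cos (\<beta> * pi / 2)"
    using norm_le \<beta> pos cos_le by (intro mult_mono powr_mono2) auto
  finally show ?thesis by (simp add: w_def mult.commute)
qed

text \<open>
  The decay of order \<open>\<beta>\<close> beats growth of order \<open>\<rho> < \<beta>\<close>.
\<close>

lemma order_less_one_decay:
  fixes M C \<rho> \<beta> \<kappa> :: real
  assumes "0 \<le> \<rho>" "\<rho> < \<beta>" "\<kappa> > 0"
  shows "((\<lambda>x. x * (M * exp (C * x powr \<rho>) * exp (- \<kappa> * x powr \<beta>))) \<longlongrightarrow> 0) at_top"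
proof (rule Lim_null_comparison)
  have "((\<lambda>x::real. \<bar>C\<bar> * x powr (\<rho> - \<beta>)) \<longlongrightarrow> \<bar>C\<bar> * 0) at_top"
    by (intro tendsto_mult tendsto_const) (use assms in real_asymp)
  moreover have "\<bar>C\<bar> * 0 < \<kappa> / 2" using assms by simp
  ultimately have "\<forall>\<^sub>F x in at_top. \<bar>C\<bar> * x powr (\<rho> - \<beta>) < \<kappa> / 2" by (rule order_tendstoD(2))
  then show "\<forall>\<^sub>F x in at_top. norm (x * (M * exp (C * x powr \<rho>) * exp (- \<kappa> * x powr \<beta>))) \<le> \<bar>M\<bar> * (x * exp (- (\<kappa> / 2) * x powr \<beta>))"
    using eventually_gt_at_top[of 0]
  proof eventually_elim
    case (elim x)
    have "C * x powr \<rho> \<le> \<bar>C\<bar> * x powr (\<rho> - \<beta>) * x powr \<beta>"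
      using elim by (simp add: mult.assoc mult_right_mono flip: powr_add)
    also have "\<dots> \<le> \<kappa> / 2 * x powr \<beta>" using elim by (intro mult_right_mono) auto
    finally have "C * x powr \<rho> + - \<kappa> * x powr \<beta> \<le> - (\<kappa> / 2) * x powr \<beta>" by (simp add: algebra_simps)
    then have "exp (C * x powr \<rho>) * exp (- \<kappa> * x powr \<beta>) \<le> exp (- (\<kappa> / 2) * x powr \<beta>)"
      unfolding exp_add[symmetric] by simp
    from mult_left_mono[OF this, of "\<bar>M\<bar> * x"] show ?case using elim by (simp add: abs_mult mult_ac)
  qed
  have "((\<lambda>x::real. x * exp (- (\<kappa> / 2) * x powr \<beta>)) \<longlongrightarrow> 0) at_top"
    using assms by real_asymp
  from tendsto_mult[OF tendsto_const this] show "((\<lambda>x. \<bar>M\<bar> * (x * exp (- (\<kappa> / 2) * x powr \<beta>))) \<longlongrightarrow> 0) at_top" by simp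
qed

context deformed_contour
begin

definition subexponential :: "(complex \<Rightarrow> complex) \<Rightarrow> bool" where
  "subexponential F \<longleftrightarrow>
    (a = -\<infinity> \<longrightarrow> (\<exists>M C \<rho>. \<rho> < 1 \<and> (\<forall>\<^sub>F t in at_bot. \<forall>s\<in>{0..1}. norm (F (H s t)) \<le> M * exp (C * norm (H s t) powr \<rho>)))) \<and>
    (b = \<infinity> \<longrightarrow> (\<exists>M C \<rho>. \<rho> < 1 \<and> (\<forall>\<^sub>F t in at_top. \<forall>s\<in>{0..1}. norm (F (H s t)) \<le> M * exp (C * norm (H s t) powr \<rho>))))"

text \<open>
  The two tails of the deformation and the compact part between them have separate bounds;
  far from 0 they combine into one in terms of the point alone.
\<close>

lemma subexponential_swept:
  assumes "subexponential F"
  obtains R M C \<rho> where "0 \<le> \<rho>" "\<rho> < 1" 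
    "\<And>z. z \<in> swept \<Longrightarrow> R \<le> norm z \<Longrightarrow> norm (F z) \<le> M * exp (C * norm z powr \<rho>)"
proof -
  obtain t0 where t0: "t0 \<in> I" using einterval_nonempty[OF ab] by auto
  have "\<exists>u R M C \<rho>. u \<in> I \<and> u < t0 \<and> \<rho> < 1 \<and> (\<forall>t\<in>I. \<forall>s\<in>{0..1}. t \<le> u \<longrightarrow> R \<le> norm (H s t) \<longrightarrow>
      norm (F (H s t)) \<le> M * exp (C * norm (H s t) powr \<rho>))"
  proof (cases "a = -\<infinity>")
    case True
    then obtain M C \<rho> where \<rho>: "\<rho> < 1" and
      ev: "\<forall>\<^sub>F t in at_bot. \<forall>s\<in>{0..1}. norm (F (H s t)) \<le> M * exp (C * norm (H s t) powr \<rho>)"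
      using assms unfolding subexponential_def by blast
    show ?thesis
    proof (rule left_tail[OF _ ev t0], goal_cases)
      case (1 e)
      then show ?case using True by simp
    next
      case (2 u)
      show ?case
        by (rule exI[of _ u], rule exI[of _ 0], rule exI[of _ M], rule exI[of _ C], rule exI[of _ \<rho>]) (use 2 \<rho> in blast)
    qed
  next
    case False
    show ?thesis
    proof (rule left_tail[OF _ _ t0, where P = "\<lambda>s t. norm (H s t) < \<bar>real_of_ereal a\<bar> + 1"])
      fix e assume e: "ereal e = a"
      have "norm z < \<bar>e\<bar> + 1" if "dist z (complex_of_real e) < 1" for z
        using that norm_triangle_sub[of z "of_real e"] by (simp add: dist_norm)
      then show "\<exists>\<epsilon>>0. \<forall>t\<in>I. \<forall>s\<in>{0..1}. dist (H s t) (complex_of_real e) < \<epsilon> \<longrightarrow> norm (H s t) < \<bar>real_of_ereal a\<bar> + 1"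
        using e by (intro exI[of _ 1]) auto
    next
      fix u assume "u \<in> I" "u < t0" "\<And>t s. t \<in> I \<Longrightarrow> t \<le> u \<Longrightarrow> s \<in> {0..1} \<Longrightarrow> norm (H s t) < \<bar>real_of_ereal a\<bar> + 1"
      note * = this
      show ?thesis
        by (rule exI[of _ u], rule exI[of _ "\<bar>real_of_ereal a\<bar> + 1"], rule exI[of _ 0], rule exI[of _ 0], rule exI[of _ 0]) (use * in force)
    qed (use False in auto)
  qed
  then obtain u R1 M1 C1 \<rho>1 where L: "u \<in> I" "u < t0" "\<rho>1 < 1" "\<And>t s. t \<in> I \<Longrightarrow> s \<in> {0..1} \<Longrightarrow> t \<le> u \<Longrightarrow> R1 \<le> norm (H s t) \<Longrightarrow>
      norm (F (H s t)) \<le> M1 * exp (C1 * norm (H s t) powr \<rho>1)" by blast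
  have "\<exists>v R M C \<rho>. v \<in> I \<and> t0 < v \<and> \<rho> < 1 \<and> (\<forall>t\<in>I. \<forall>s\<in>{0..1}. v \<le> t \<longrightarrow> R \<le> norm (H s t) \<longrightarrow>
      norm (F (H s t)) \<le> M * exp (C * norm (H s t) powr \<rho>))"
  proof (cases "b = \<infinity>")
    case True
    then obtain M C \<rho> where \<rho>: "\<rho> < 1" and
      ev: "\<forall>\<^sub>F t in at_top. \<forall>s\<in>{0..1}. norm (F (H s t)) \<le> M * exp (C * norm (H s t) powr \<rho>)"
      using assms unfolding subexponential_def by blast
    show ?thesis
    proof (rule right_tail[OF _ ev t0], goal_cases)
      case (1 e)
      then show ?case using True by simp
    next
      case (2 v)
      show ?case
        by (rule exI[of _ v], rule exI[of _ 0], rule exI[of _ M], rule exI[of _ C], rule exI[of _ \<rho>]) (use 2 \<rho> in blast)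
    qed
  next
    case False
    show ?thesis
    proof (rule right_tail[OF _ _ t0, where P = "\<lambda>s t. norm (H s t) < \<bar>real_of_ereal b\<bar> + 1"])
      fix e assume e: "ereal e = b"
      have "norm z < \<bar>e\<bar> + 1" if "dist z (complex_of_real e) < 1" for z
        using that norm_triangle_sub[of z "of_real e"] by (simp add: dist_norm)
      then show "\<exists>\<epsilon>>0. \<forall>t\<in>I. \<forall>s\<in>{0..1}. dist (H s t) (complex_of_real e) < \<epsilon> \<longrightarrow> norm (H s t) < \<bar>real_of_ereal b\<bar> + 1"
        using e by (intro exI[of _ 1]) auto
    next
      fix v assume "v \<in> I" "t0 < v" "\<And>t s. t \<in> I \<Longrightarrow> v \<le> t \<Longrightarrow> s \<in> {0..1} \<Longrightarrow> norm (H s t) < \<bar>real_of_ereal b\<bar> + 1"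
      note * = this
      show ?thesis
        by (rule exI[of _ v], rule exI[of _ "\<bar>real_of_ereal b\<bar> + 1"], rule exI[of _ 0], rule exI[of _ 0], rule exI[of _ 0]) (use * in force)
    qed (use False in auto)
  qed
  then obtain v R2 M2 C2 \<rho>2 where R: "v \<in> I" "t0 < v" "\<rho>2 < 1" "\<And>t s. t \<in> I \<Longrightarrow> s \<in> {0..1} \<Longrightarrow> v \<le> t \<Longrightarrow> R2 \<le> norm (H s t) \<Longrightarrow>
      norm (F (H s t)) \<le> M2 * exp (C2 * norm (H s t) powr \<rho>2)" by blast
  have "compact ((\<lambda>(s, t). H s t) ` ({0..1} \<times> {u..v}))"
    by (intro compact_continuous_image cont_sub[OF L(1) R(1)] compact_Times) auto
  from compact_imp_bounded[OF this] obtain K where K: "\<forall>z\<in>(\<lambda>(s, t). H s t) ` ({0..1} \<times> {u..v}). norm z \<le> K"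
    unfolding bounded_iff ..
  define M where "M = \<bar>M1\<bar> + \<bar>M2\<bar>"
  define C where "C = \<bar>C1\<bar> + \<bar>C2\<bar>"
  define \<rho> where "\<rho> = max 0 (max \<rho>1 \<rho>2)"
  define R0 where "R0 = 1 + \<bar>R1\<bar> + \<bar>R2\<bar> + \<bar>K\<bar>"
  have mono: "M' * exp (C' * x powr \<rho>') \<le> M * exp (C * x powr \<rho>)"
    if "\<bar>M'\<bar> \<le> M" "\<bar>C'\<bar> \<le> C" "\<rho>' \<le> \<rho>" "1 \<le> x" for M' C' \<rho>' x
  proof -
    have "C' * x powr \<rho>' \<le> C * x powr \<rho>"
    proof -
      have "C' * x powr \<rho>' \<le> \<bar>C'\<bar> * x powr \<rho>'" by (intro mult_right_mono) auto
      also have "\<dots> \<le> C * x powr \<rho>" using that by (intro mult_mono powr_mono) auto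
      finally show ?thesis .
    qed
    then have e: "exp (C' * x powr \<rho>') \<le> exp (C * x powr \<rho>)" by simp
    have "M' * exp (C' * x powr \<rho>') \<le> \<bar>M'\<bar> * exp (C' * x powr \<rho>')" by (rule mult_right_mono) auto
    also have "\<dots> \<le> M * exp (C * x powr \<rho>)" using that(1) e by (intro mult_mono) auto
    finally show ?thesis .
  qed
  show ?thesis
  proof
    show "0 \<le> \<rho>" "\<rho> < 1" using L(3) R(3) by (auto simp: \<rho>_def)
    fix z assume z: "z \<in> swept" "R0 \<le> norm z"
    then obtain s t where st: "s \<in> {0..1}" "t \<in> I" "z = H s t" by (auto simp: swept_def)
    have "t \<notin> {u..v}"
    proof
      assume "t \<in> {u..v}"
      then have "(s, t) \<in> {0..1} \<times> {u..v}" using st by simp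
      then have "norm (H s t) \<le> K" using K by blast
      then show False using z(2) st(3) by (simp add: R0_def)
    qed
    then consider "t \<le> u" | "v \<le> t" by fastforce
    then show "norm (F z) \<le> M * exp (C * norm z powr \<rho>)"
    proof cases
      case 1
      have "norm (F z) \<le> M1 * exp (C1 * norm z powr \<rho>1)"
        unfolding st(3) by (rule L(4)[OF st(2,1) 1]) (use z(2) st(3) in \<open>simp add: R0_def\<close>)
      also have "\<dots> \<le> M * exp (C * norm z powr \<rho>)"
        by (rule mono) (use z(2) in \<open>auto simp: M_def C_def \<rho>_def R0_def\<close>)
      finally show ?thesis .
    next
      case 2
      have "norm (F z) \<le> M2 * exp (C2 * norm z powr \<rho>2)"
        unfolding st(3) by (rule R(4)[OF st(2,1) 2]) (use z(2) st(3) in \<open>simp add: R0_def\<close>)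
      also have "\<dots> \<le> M * exp (C * norm z powr \<rho>)"
        by (rule mono) (use z(2) in \<open>auto simp: M_def C_def \<rho>_def R0_def\<close>)
      finally show ?thesis .
    qed
  qed
qed

text \<open>
  The integrand is multiplied by \<open>exp (- (1 + i z)\<^sup>\<beta> / (n + 1))\<close> with \<open>\<rho> < \<beta> < 1\<close>. The product
  decays so fast that large arcs contribute nothing, the multiplier is bounded by 1, and it tends to 1
  for \<open>n \<longlonglongrightarrow> \<infinity>\<close>, so dominated convergence on both sides removes it again.
\<close>

theorem integral_interval_eq_curve:
  assumes \<sigma>: "orientation \<sigma>"
    and hol: "F holomorphic_on D" and cont: "continuous_on (D \<union> of_real ` I) F"
    and F_fin: "\<And>c. is_end a b c \<Longrightarrow> ((\<lambda>z. (z - of_real c) * F z) \<longlongrightarrow> 0) (at (of_real c) within D)"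
    and F_inf: "subexponential F"
    and F_I: "(\<lambda>x. F (of_real x)) absolutely_integrable_on I"
    and k: "k integrable_on E" "\<And>s. s \<in> E \<Longrightarrow> norm (F (\<gamma> s)) \<le> k s"
  shows "integral I (\<lambda>x. F (of_real x)) = \<sigma> * integral E (\<lambda>s. \<gamma>' s * F (\<gamma> s))"
proof -
  obtain R M C \<rho> where \<rho>: "0 \<le> \<rho>" "\<rho> < 1" and
    grow: "\<And>z. z \<in> swept \<Longrightarrow> R \<le> norm z \<Longrightarrow> norm (F z) \<le> M * exp (C * norm z powr \<rho>)"
    using subexponential_swept[OF F_inf] by metis
  define \<beta> where "\<beta> = (1 + \<rho>) / 2"
  have \<beta>: "0 < \<beta>" "\<beta> < 1" "\<rho> < \<beta>" using \<rho> by (auto simp: \<beta>_def)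
  define \<kappa> where "\<kappa> = cos (\<beta> * pi / 2)"
  have \<kappa>: "\<kappa> > 0" unfolding \<kappa>_def using \<beta> by (intro cos_gt_zero_pi) (auto intro: less_trans[of _ 0])
  define m where "m n z = exp (- ((1 + \<i> * z) powr of_real \<beta>) / of_real (real n + 1))" for n :: nat and z
  have norm_m: "norm (m n z) \<le> exp (- (\<kappa> / (real n + 1)) * norm z powr \<beta>)" if "Im z \<le> 0" for n z
  proof -
    have "norm (m n z) = exp (- Re ((1 + \<i> * z) powr of_real \<beta>) / (real n + 1))"
      by (simp only: m_def norm_exp_eq_Re Re_divide_of_real uminus_complex.sel)
    moreover have "\<kappa> * norm z powr \<beta> / (real n + 1) \<le> Re ((1 + \<i> * z) powr of_real \<beta>) / (real n + 1)"
      unfolding \<kappa>_def by (intro divide_right_mono re_powr_lower_half_plane \<beta> that) simp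
    ultimately show ?thesis by simp
  qed
  have norm_m1: "norm (m n z) \<le> 1" if "Im z \<le> 0" for n z
  proof -
    have "exp (- (\<kappa> / (real n + 1)) * norm z powr \<beta>) \<le> 1" using \<kappa> by simp
    then show ?thesis using norm_m[OF that, of n] by linarith
  qed
  have D_low: "Im z \<le> 0" if "z \<in> D" for z using D_lower that by auto
  have nonneg: "1 + \<i> * z \<notin> \<real>\<^sub>\<le>\<^sub>0" if "Im z \<le> 0" for z
    using that by (auto simp: complex_nonpos_Reals_iff)
  have m_hol: "m n holomorphic_on D" for n
  proof -
    have "complex_of_real (real n + 1) \<noteq> 0" by (metis of_real_eq_0_iff of_nat_Suc of_nat_neq_0 add.commute)
    then show ?thesis unfolding m_def using nonneg D_low
      by (intro holomorphic_intros) auto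
  qed
  have m_cont: "continuous_on {z. Im z \<le> 0} (m n)" for n
  proof -
    have "complex_of_real (real n + 1) \<noteq> 0" by (metis of_real_eq_0_iff of_nat_Suc of_nat_neq_0 add.commute)
    moreover have "1 + \<i> * z \<noteq> 0" if "Im z \<le> 0" for z using nonneg[OF that] by auto
    ultimately show ?thesis unfolding m_def using nonneg by (intro continuous_intros) (auto simp del: of_real_add)
  qed
  have sub: "D \<union> of_real ` I \<subseteq> {z. Im z \<le> 0}" using D_low by auto
  have Im\<gamma>: "Im (\<gamma> s) \<le> 0" if "s \<in> E" for s using curve_in_D D_low that by blast
  have m_lim: "(\<lambda>n. m n z * w) \<longlonglongrightarrow> w" for z w
  proof -
    have "(\<lambda>n. 1 / (real n + 1)) \<longlonglongrightarrow> 0" by real_asymp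
    from tendsto_mult[OF tendsto_const[of "- ((1 + \<i> * z) powr of_real \<beta>)"] tendsto_of_real[OF this]]
    have "(\<lambda>n. - ((1 + \<i> * z) powr of_real \<beta>) / of_real (real n + 1)) \<longlonglongrightarrow> 0" by simp
    from tendsto_mult[OF tendsto_exp[OF this] tendsto_const[of w]] show ?thesis by (simp add: m_def)
  qed
  have eq: "integral I (\<lambda>x. m n (of_real x) * F (of_real x)) = \<sigma> * integral E (\<lambda>s. \<gamma>' s * (m n (\<gamma> s) * F (\<gamma> s)))" 
    and ai: "(\<lambda>x. m n (of_real x) * F (of_real x)) absolutely_integrable_on I"
      "(\<lambda>s. \<gamma>' s * (m n (\<gamma> s) * F (\<gamma> s))) absolutely_integrable_on E" for n
  proof -
    have bound: "norm (m n z * F z) \<le> norm (F z)" if "Im z \<le> 0" for z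
      using mult_right_mono[OF norm_m1[OF that], of "norm (F z)" n] by (simp add: norm_mult)
    have cont': "continuous_on (D \<union> of_real ` I) (\<lambda>z. m n z * F z)"
      by (intro continuous_on_mult cont continuous_on_subset[OF m_cont sub])
    have "continuous_on I (\<lambda>x. m n (of_real x) * F (of_real x))"
      by (rule continuous_on_compose2[OF cont']) (auto intro: continuous_intros)
    then have "(\<lambda>x. m n (of_real x) * F (of_real x)) \<in> borel_measurable (lebesgue_on I)"
      by (rule continuous_imp_measurable_on_sets_lebesgue) auto
    then show ai1: "(\<lambda>x. m n (of_real x) * F (of_real x)) absolutely_integrable_on I"
      by (rule measurable_bounded_by_integrable_imp_absolutely_integrable[where g = "\<lambda>x. norm (F (of_real x))"])
        (use F_I bound in \<open>auto simp: absolutely_integrable_on_def\<close>)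
    have "continuous_on (\<gamma> ` E) (\<lambda>z. m n z * F z)"
      using curve_in_D by (intro continuous_on_subset[OF cont']) blast
    then show ai2: "(\<lambda>s. \<gamma>' s * (m n (\<gamma> s) * F (\<gamma> s))) absolutely_integrable_on E"
      by (rule curve_integral_bound(1)[OF _ k(1)]) (use bound Im\<gamma> k(2) order_trans in blast)
    show "integral I (\<lambda>x. m n (of_real x) * F (of_real x)) = \<sigma> * integral E (\<lambda>s. \<gamma>' s * (m n (\<gamma> s) * F (\<gamma> s)))"
    proof (rule integral_interval_eq_curve_decaying[OF \<sigma> _ cont' _ _ ai1 ai2])
      show "(\<lambda>z. m n z * F z) holomorphic_on D" by (intro holomorphic_on_mult m_hol hol)
    next
      fix c assume c: "is_end a b c"
      show "((\<lambda>z. (z - of_real c) * (m n z * F z)) \<longlongrightarrow> 0) (at (of_real c) within D)"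
      proof (rule Lim_null_comparison[OF _ tendsto_norm_zero[OF F_fin[OF c]]])
        have "norm ((z - of_real c) * (m n z * F z)) \<le> norm ((z - of_real c) * F z)" if "z \<in> D" for z
        proof -
          have "Im z \<le> 0" using that sub by auto
          from mult_left_mono[OF bound[OF this], of "norm (z - of_real c)"] show ?thesis by (simp add: norm_mult)
        qed
        then show "\<forall>\<^sub>F z in at (of_real c) within D. norm ((z - of_real c) * (m n z * F z)) \<le> norm ((z - of_real c) * F z)"
          by (auto simp: eventually_at_filter)
      qed
    next
      fix \<epsilon> :: real assume \<epsilon>: "\<epsilon> > 0"
      have "\<kappa> / (real n + 1) > 0" using \<kappa> by simp
      from order_tendstoD(2)[OF order_less_one_decay[OF \<rho>(1) \<beta>(3) this, of M C] \<epsilon>]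
      obtain X where X: "\<And>x. X \<le> x \<Longrightarrow> x * (M * exp (C * x powr \<rho>) * exp (- (\<kappa> / (real n + 1)) * x powr \<beta>)) < \<epsilon>"
        unfolding eventually_at_top_linorder by blast
      show "\<exists>R. \<forall>z\<in>D \<inter> swept. R \<le> norm z \<longrightarrow> norm z * norm (m n z * F z) \<le> \<epsilon>"
      proof (intro exI[of _ "max R X"] ballI impI)
        fix z assume z: "z \<in> D \<inter> swept" "max R X \<le> norm z"
        then have im: "Im z \<le> 0" and zs: "z \<in> swept" "R \<le> norm z" "X \<le> norm z" using sub by auto
        have "norm (m n z * F z) \<le> exp (- (\<kappa> / (real n + 1)) * norm z powr \<beta>) * (M * exp (C * norm z powr \<rho>))"
          unfolding norm_mult using norm_m[OF im, of n] grow[OF zs(1,2)] by (intro mult_mono) auto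
        then have "norm z * norm (m n z * F z) \<le> norm z * (M * exp (C * norm z powr \<rho>) * exp (- (\<kappa> / (real n + 1)) * norm z powr \<beta>))"
          by (intro mult_left_mono) (simp_all add: mult.commute)
        also have "\<dots> < \<epsilon>" by (rule X[OF zs(3)])
        finally show "norm z * norm (m n z * F z) \<le> \<epsilon>" by simp
      qed
    qed
  qed
  have "(\<lambda>n. integral I (\<lambda>x. m n (of_real x) * F (of_real x))) \<longlonglongrightarrow> integral I (\<lambda>x. F (of_real x))"
  proof (rule dominated_convergence(2)[where h = "\<lambda>x. norm (F (of_real x))"])
    show "(\<lambda>x. m n (of_real x) * F (of_real x)) integrable_on I" for n
      using ai(1) by (simp add: absolutely_integrable_on_def)
    show "(\<lambda>x. norm (F (of_real x))) integrable_on I" using F_I by (simp add: absolutely_integrable_on_def)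
    show "norm (m n (of_real x) * F (of_real x)) \<le> norm (F (of_real x))" for n x
      using mult_right_mono[OF norm_m1[of "of_real x" n], of "norm (F (of_real x))"] by (simp add: norm_mult)
  qed (rule m_lim)
  moreover have "(\<lambda>n. \<sigma> * integral E (\<lambda>s. \<gamma>' s * (m n (\<gamma> s) * F (\<gamma> s)))) \<longlonglongrightarrow> \<sigma> * integral E (\<lambda>s. \<gamma>' s * F (\<gamma> s))"
  proof (rule tendsto_mult[OF tendsto_const], rule dominated_convergence(2)[where h = "\<lambda>s. norm (\<gamma>' s * F (\<gamma> s))"])
    show "(\<lambda>s. \<gamma>' s * (m n (\<gamma> s) * F (\<gamma> s))) integrable_on E" for n
      using ai(2) by (simp add: absolutely_integrable_on_def)
    have "continuous_on (\<gamma> ` E) F" using curve_in_D by (intro continuous_on_subset[OF cont]) blast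
    from curve_integral_bound(1)[OF this k] show "(\<lambda>s. norm (\<gamma>' s * F (\<gamma> s))) integrable_on E"
      by (simp add: absolutely_integrable_on_def)
    show "norm (\<gamma>' s * (m n (\<gamma> s) * F (\<gamma> s))) \<le> norm (\<gamma>' s * F (\<gamma> s))" if "s \<in> E" for n s
      using mult_right_mono[OF norm_m1[OF Im\<gamma>[OF that], of n], of "norm (\<gamma>' s * F (\<gamma> s))"] by (simp add: norm_mult mult_ac)
    show "(\<lambda>n. \<gamma>' s * (m n (\<gamma> s) * F (\<gamma> s))) \<longlonglongrightarrow> \<gamma>' s * F (\<gamma> s)" for s
      by (intro tendsto_mult tendsto_const m_lim)
  qed
  ultimately show ?thesis unfolding eq by (rule LIMSEQ_unique)
qed

end

section \<open>Operators on a finite-dimensional Hilbert space\<close>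

lemma cinner_add_right: "cinner x (y + z) = cinner x y + cinner x (z :: 'a::complex_hilbert)"
  by (metis cinner_add_left cinner_commute complex_cnj_add)

lemma cinner_scaleC_right: "cinner x (c *\<^sub>C y) = cnj c * cinner x (y :: 'a::complex_hilbert)"
  by (metis cinner_commute cinner_scaleC_left complex_cnj_mult)

lemma scaleC_zero_left [simp]: "0 *\<^sub>C (x :: 'a::complex_normed_vector) = 0"
  by (rule complex_vector.scale_zero_left)

lemma scaleC_zero_right [simp]: "c *\<^sub>C (0 :: 'a::complex_normed_vector) = 0"
  by (rule complex_vector.scale_zero_right)

lemma scaleC_minus1 [simp]: "(-1) *\<^sub>C (x :: 'a::complex_normed_vector) = - x"
  by (metis complex_vector.scale_minus_left scaleC_one)

lemma cinner_zero [simp]: "cinner 0 (x :: 'a::complex_hilbert) = 0" "cinner x 0 = 0"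
  using cinner_scaleC_left[of 0 x x] cinner_scaleC_right[of x 0 x] by simp_all

lemma cinner_minus [simp]: "cinner (- x) (y :: 'a::complex_hilbert) = - cinner x y" "cinner x (- y) = - cinner x y"
  using cinner_scaleC_left[of "-1" x y] cinner_scaleC_right[of x "-1" y] by simp_all

lemma cinner_diff_left: "cinner (x - y) (z :: 'a::complex_hilbert) = cinner x z - cinner y z"
  using cinner_add_left[of x "- y" z] by simp

lemma cinner_diff_right: "cinner x (y - z :: 'a::complex_hilbert) = cinner x y - cinner x z"
  using cinner_add_right[of x y "- z"] by simp

lemma cinner_sum_left: "cinner (\<Sum>i\<in>A. f i) (y :: 'a::complex_hilbert) = (\<Sum>i\<in>A. cinner (f i) y)"
  by (induction A rule: infinite_finite_induct) (auto simp: cinner_add_left)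

lemma cinner_ext:
  assumes "\<And>y. cinner x y = cinner x' (y :: 'a::complex_hilbert)"
  shows "x = x'"
proof -
  have "cinner (x - x') (x - x') = 0" using assms[of "x - x'"] by (simp add: cinner_diff_left)
  then show ?thesis by (simp add: cinner_norm)
qed

lemma Cauchy_Schwarz_cinner: "cmod (cinner x y) \<le> norm x * norm (y :: 'a::complex_hilbert)"
proof (cases "y = 0")
  case False
  define c where "c = cinner x y / of_real ((norm y)\<^sup>2)"
  define z where "z = x - c *\<^sub>C y"
  have n: "norm y > 0" using False by simp
  have zy: "cinner z y = 0"
    using n by (simp add: z_def cinner_diff_left cinner_scaleC_left c_def cinner_norm)
  have "cinner x x = cinner (z + c *\<^sub>C y) (z + c *\<^sub>C y)" by (simp add: z_def)
  also have "\<dots> = cinner z z + c * cnj c * cinner y y"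
    using zy cinner_commute[of y z]
    by (simp add: cinner_add_left cinner_add_right cinner_scaleC_left cinner_scaleC_right mult.assoc)
  finally have "complex_of_real ((norm x)\<^sup>2) = of_real ((norm z)\<^sup>2 + (cmod c)\<^sup>2 * (norm y)\<^sup>2)"
    unfolding cinner_norm by (simp add: complex_norm_square[symmetric])
  then have "(norm x)\<^sup>2 = (norm z)\<^sup>2 + (cmod c)\<^sup>2 * (norm y)\<^sup>2" by (simp only: of_real_eq_iff)
  then have "(cmod c * norm y)\<^sup>2 \<le> (norm x)\<^sup>2" by (simp add: power_mult_distrib)
  then have "cmod c * norm y \<le> norm x" by (rule power2_le_imp_le) simp
  moreover have "cmod c * norm y = cmod (cinner x y) / norm y"
    using n by (simp add: c_def norm_divide power2_eq_square norm_mult)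
  ultimately show ?thesis using n by (simp add: field_simps)
qed simp

lemma cblinfun_clinear:
  "T *\<^sub>V (x + y) = T *\<^sub>V x + T *\<^sub>V y" "T *\<^sub>V (c *\<^sub>C x) = c *\<^sub>C T *\<^sub>V x"
  "T *\<^sub>V (x - y) = T *\<^sub>V x - T *\<^sub>V y" "T *\<^sub>V 0 = 0" "T *\<^sub>V (- x) = - (T *\<^sub>V x)"
  using cblinfun_apply[of T]
  by (auto simp: bounded_clinear_def linear_simps)

lemma cblinfun_apply_simps [simp]:
  "(S + T) *\<^sub>V x = S *\<^sub>V x + T *\<^sub>V x" "(S - T) *\<^sub>V x = S *\<^sub>V x - T *\<^sub>V x" "(- T) *\<^sub>V x = - (T *\<^sub>V x)"
  "(c *\<^sub>C T) *\<^sub>V x = c *\<^sub>C T *\<^sub>V x" "cblinfun_id *\<^sub>V x = x" "0 *\<^sub>V x = 0"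
  by (transfer; simp)+

lemma cblinfun_compose_apply [simp]: "(S \<circ>\<^sub>C T) *\<^sub>V x = S *\<^sub>V T *\<^sub>V x"
  by transfer simp

lemma cblinfun_ext: "(\<And>x. S *\<^sub>V x = T *\<^sub>V x) \<Longrightarrow> S = T"
  by (metis cblinfun_apply_inject ext)

lemma norm_cblinfun_apply: "norm (T *\<^sub>V x) \<le> norm T * norm x"
  by transfer (auto simp: bounded_clinear_def onorm)

lemma norm_cblinfun_bound: "0 \<le> C \<Longrightarrow> (\<And>x. norm (T *\<^sub>V x) \<le> C * norm x) \<Longrightarrow> norm T \<le> C"
  by transfer (rule onorm_bound)

lemma norm_cblinfun_bound_form:
  fixes T :: "('a::complex_hilbert, 'b::complex_hilbert) cblinfun"
  assumes "0 \<le> C" "\<And>x y. cmod (cinner (T *\<^sub>V x) y) \<le> C * norm x * norm y"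
  shows "norm T \<le> C"
proof (rule norm_cblinfun_bound)
  fix x
  have "(norm (T *\<^sub>V x))\<^sup>2 = cmod (cinner (T *\<^sub>V x) (T *\<^sub>V x))" by (simp only: cinner_norm norm_of_real) simp
  also have "\<dots> \<le> C * norm x * norm (T *\<^sub>V x)" by (rule assms(2))
  finally have "norm (T *\<^sub>V x) * norm (T *\<^sub>V x) \<le> (C * norm x) * norm (T *\<^sub>V x)" by (simp add: power2_eq_square)
  then show "norm (T *\<^sub>V x) \<le> C * norm x"
    using assms(1) by (cases "norm (T *\<^sub>V x) = 0") (auto simp: mult_le_cancel_right)
qed fact

lemma norm_cinner_apply:
  fixes T :: "('b::complex_normed_vector, 'c::complex_hilbert) cblinfun"
  shows "cmod (cinner (T *\<^sub>V x) y) \<le> norm T * norm x * norm y"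
proof -
  have "cmod (cinner (T *\<^sub>V x) y) \<le> norm (T *\<^sub>V x) * norm y" by (rule Cauchy_Schwarz_cinner)
  also have "\<dots> \<le> norm T * norm x * norm y" by (intro mult_right_mono norm_cblinfun_apply) simp
  finally show ?thesis .
qed

lemma norm_cblinfun_compose: "norm (S \<circ>\<^sub>C T) \<le> norm S * norm T"
proof (rule norm_cblinfun_bound)
  fix x
  have "norm (S *\<^sub>V T *\<^sub>V x) \<le> norm S * (norm T * norm x)"
    by (rule order_trans[OF norm_cblinfun_apply mult_left_mono[OF norm_cblinfun_apply]]) simp
  then show "norm ((S \<circ>\<^sub>C T) *\<^sub>V x) \<le> norm S * norm T * norm x" by (simp add: mult.assoc)
qed simp

lemma bounded_linear_form:
  fixes x :: "'b::complex_normed_vector" and y :: "'c::complex_hilbert"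
  shows "bounded_linear (\<lambda>T. cinner (T *\<^sub>V x) y)"
  by (rule bounded_linear_intro[of _ "norm x * norm y"])
    (use norm_cinner_apply[of _ x y] in \<open>auto simp: cinner_add_left scaleR_scaleC cinner_scaleC_left mult_ac scaleR_conv_of_real\<close>)

lemma bounded_linear_scaleC_left:
  fixes x :: "'v::complex_normed_vector"
  shows "bounded_linear (\<lambda>c. c *\<^sub>C x)"
  by (rule bounded_linear_intro[of _ "norm x"])
    (auto simp: scaleC_add_left scaleR_scaleC scaleC_scaleC norm_scaleC scaleR_conv_of_real)

text \<open>
  The expansion of an element \<open>e\<close> gives \<open>1 = \<Sum> \<bar>\<langle>e, f\<rangle>\<bar>\<^sup>2\<close>, where the term of \<open>f = e\<close> is already 1, so
  different elements are orthogonal.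
\<close>

definition orthonormal_basis :: "'b::complex_hilbert set \<Rightarrow> bool" where
  "orthonormal_basis B \<longleftrightarrow> finite B \<and> (\<forall>e\<in>B. norm e = 1) \<and> (\<forall>x. x = (\<Sum>e\<in>B. cinner x e *\<^sub>C e))"

lemma cinner_orthonormal_sum:
  fixes B :: "'b::complex_hilbert set"
  assumes "finite B" "\<And>e. e \<in> B \<Longrightarrow> norm e = 1" "\<And>e f. e \<in> B \<Longrightarrow> f \<in> B \<Longrightarrow> e \<noteq> f \<Longrightarrow> cinner e f = 0" "f \<in> B"
  shows "cinner (\<Sum>e\<in>B. c e *\<^sub>C e) f = c f"
proof -
  have "cinner (\<Sum>e\<in>B. c e *\<^sub>C e) f = (\<Sum>e\<in>B. if e = f then c f else 0)"
    unfolding cinner_sum_left using assms by (intro sum.cong) (auto simp: cinner_scaleC_left cinner_norm)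
  then show ?thesis using assms by simp
qed

text \<open>
  An orthonormal set of maximal cardinality exists, as orthonormal sets are independent, and a vector that it does
  not expand would give a further element.
\<close>

lemma orthonormal_basis_exists:
  assumes "finite_cdim (UNIV :: 'b::complex_hilbert set)"
  obtains B :: "'b::complex_hilbert set" where "orthonormal_basis B"
proof -
  obtain S :: "'b set" where S: "finite S" "UNIV \<subseteq> complex_vector.span S"
    using assms by (auto simp: finite_cdim_def)
  define orthonormal where "orthonormal B \<longleftrightarrow> finite B \<and> (\<forall>e\<in>B. norm e = 1) \<and> (\<forall>e\<in>B. \<forall>f\<in>B. e \<noteq> f \<longrightarrow> cinner e f = 0)" for B :: "'b set"
  have indep: "complex_vector.independent B" if "orthonormal B" for B
  proof
    assume "complex_vector.dependent B"
    then obtain c f where c: "(\<Sum>e\<in>B. c e *\<^sub>C e) = 0" "f \<in> B" "c f \<noteq> 0"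
      using \<open>orthonormal B\<close> by (auto simp: orthonormal_def complex_vector.dependent_finite)
    have "cinner (\<Sum>e\<in>B. c e *\<^sub>C e) f = c f"
      by (rule cinner_orthonormal_sum) (use \<open>orthonormal B\<close> c in \<open>auto simp: orthonormal_def\<close>)
    then show False using c by simp
  qed
  have card_le: "card B \<le> card S" if "orthonormal B" for B
    using complex_vector.independent_span_bound[OF S(1) indep[OF that]] S(2) by auto
  have "orthonormal {}" by (simp add: orthonormal_def)
  then obtain B where B: "orthonormal B" "\<And>B'. orthonormal B' \<Longrightarrow> card B' \<le> card B"
    using ex_has_greatest_nat[of orthonormal "{}" card "Suc (card S)"] card_le by (metis le_imp_less_Suc)
  have "x = (\<Sum>e\<in>B. cinner x e *\<^sub>C e)" for x
  proof (rule ccontr)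
    define y where "y = x - (\<Sum>e\<in>B. cinner x e *\<^sub>C e)"
    assume "x \<noteq> (\<Sum>e\<in>B. cinner x e *\<^sub>C e)"
    then have "y \<noteq> 0" by (simp add: y_def)
    have orth: "cinner y f = 0" if "f \<in> B" for f
      using cinner_orthonormal_sum[of B f "\<lambda>e. cinner x e"] B(1) that by (simp add: orthonormal_def y_def cinner_diff_left)
    define u where "u = of_real (inverse (norm y)) *\<^sub>C y"
    have nu: "norm u = 1" using \<open>y \<noteq> 0\<close> by (simp add: u_def norm_scaleC norm_inverse)
    have uorth: "cinner u f = 0" "cinner f u = 0" if "f \<in> B" for f
      using orth[OF that] cinner_commute[of f u] by (auto simp: u_def cinner_scaleC_left)
    have "u \<notin> B" using uorth[of u] nu by (auto simp: cinner_norm)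
    moreover have "orthonormal (insert u B)" using B(1) nu uorth by (auto simp: orthonormal_def)
    ultimately show False using B(2)[of "insert u B"] B(1) by (auto simp: orthonormal_def)
  qed
  then have "orthonormal_basis B" using B(1) unfolding orthonormal_basis_def orthonormal_def by blast
  then show ?thesis by (rule that)
qed

lemma bounded_clinear_finite_dim:
  fixes B :: "'b::complex_hilbert set" and f :: "'b::complex_hilbert \<Rightarrow> 'c::complex_normed_vector"
  assumes B: "orthonormal_basis B" and add: "\<And>x y. f (x + y) = f x + f y" and scale: "\<And>c x. f (c *\<^sub>C x) = c *\<^sub>C f x"
  shows "bounded_clinear f"
proof -
  have f0: "f 0 = 0" using scale[of 0 0] by simp
  have f_sum: "f (\<Sum>e\<in>A. g e) = (\<Sum>e\<in>A. f (g e))" for A :: "'b set" and g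
    by (induction A rule: infinite_finite_induct) (auto simp: add f0)
  have "norm (f x) \<le> norm x * (\<Sum>e\<in>B. norm (f e))" for x
  proof -
    have "f x = (\<Sum>e\<in>B. cinner x e *\<^sub>C f e)"
      using B unfolding orthonormal_basis_def by (metis (no_types, lifting) f_sum scale sum.cong)
    also have "norm \<dots> \<le> (\<Sum>e\<in>B. norm x * norm (f e))"
    proof (rule sum_norm_le)
      fix e assume "e \<in> B"
      then have "cmod (cinner x e) \<le> norm x" using Cauchy_Schwarz_cinner[of x e] B by (simp add: orthonormal_basis_def)
      then show "norm (cinner x e *\<^sub>C f e) \<le> norm x * norm (f e)" by (simp add: norm_scaleC mult_right_mono)
    qed
    finally show ?thesis by (simp add: sum_distrib_left)
  qed
  then have "bounded_linear f"
    by (intro bounded_linear_intro[of f]) (auto simp: add scale scaleR_scaleC)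
  then show ?thesis by (simp add: bounded_clinear_def scale)
qed

lemma injective_cblinfun_invertible:
  fixes B :: "'b::complex_hilbert set" and T :: "('b::complex_hilbert, 'b) cblinfun"
  assumes B: "orthonormal_basis B" and inj: "\<And>x. T *\<^sub>V x = 0 \<Longrightarrow> x = 0"
  obtains S where "S \<circ>\<^sub>C T = cblinfun_id" "T \<circ>\<^sub>C S = cblinfun_id"
proof -
  have "UNIV \<subseteq> complex_vector.span B"
  proof
    fix x :: 'b
    have "(\<Sum>e\<in>B. cinner x e *\<^sub>C e) \<in> complex_vector.span B"
      by (intro complex_vector.span_sum complex_vector.span_scale complex_vector.span_base)
    then show "x \<in> complex_vector.span B" using B by (metis orthonormal_basis_def)
  qed
  moreover obtain B' where B': "B' \<subseteq> B" "complex_vector.independent B'" "B \<subseteq> complex_vector.span B'"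
    using complex_vector.maximal_independent_subset[of B] by blast
  ultimately have span: "complex_vector.span B' = UNIV"
    by (metis complex_vector.span_minimal complex_vector.subspace_span top.extremum_uniqueI)
  have fin: "finite B'" using B B' finite_subset by (auto simp: orthonormal_basis_def)
  interpret fd: finite_dimensional_vector_space "scaleC :: complex \<Rightarrow> 'b \<Rightarrow> 'b" B'
    by unfold_locales (use fin B' span in auto)
  have lin: "Vector_Spaces.linear (*\<^sub>C) (*\<^sub>C) (cblinfun_apply T)"
    by unfold_locales (auto simp: cblinfun_clinear)
  have "inj (cblinfun_apply T)"
  proof (rule injI)
    fix x y assume "T *\<^sub>V x = T *\<^sub>V y"
    then show "x = y" using inj[of "x - y"] by (simp add: cblinfun_clinear)
  qed
  then have bij: "bij (cblinfun_apply T)"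
    using fd.linear_inj_imp_surj[OF lin] by (simp add: bij_def)
  define g where "g = inv (cblinfun_apply T)"
  have Tg: "T *\<^sub>V g x = x" for x using bij by (simp add: g_def bij_is_surj surj_f_inv_f)
  have gT: "g (T *\<^sub>V x) = x" for x using bij by (simp add: g_def bij_is_inj)
  have "bounded_clinear g"
  proof (rule bounded_clinear_finite_dim[OF B])
    show "g (x + y) = g x + g y" for x y by (metis Tg gT cblinfun_clinear(1))
    show "g (c *\<^sub>C x) = c *\<^sub>C g x" for c x by (metis Tg gT cblinfun_clinear(2))
  qed
  then have "cblinfun_apply (Abs_cblinfun g) = g" by (simp add: Abs_cblinfun_inverse)
  then show ?thesis
    by (intro that[of "Abs_cblinfun g"] cblinfun_ext) (simp_all add: Tg gT)
qed

lemma cblinfun_inv_unique: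
  assumes "S \<circ>\<^sub>C T = cblinfun_id" "T \<circ>\<^sub>C S = cblinfun_id"
  shows "cblinfun_inv T = S"
  unfolding cblinfun_inv_def
proof (rule the_equality)
  fix S' assume S': "S' \<circ>\<^sub>C T = cblinfun_id \<and> T \<circ>\<^sub>C S' = cblinfun_id"
  have "S' *\<^sub>V x = S *\<^sub>V x" for x
  proof -
    have "S' *\<^sub>V T *\<^sub>V S *\<^sub>V x = S *\<^sub>V x" using S' by (metis cblinfun_compose_apply cblinfun_apply_simps(5))
    moreover have "T *\<^sub>V S *\<^sub>V x = x" using assms by (metis cblinfun_compose_apply cblinfun_apply_simps(5))
    ultimately show ?thesis by simp
  qed
  then show "S' = S" by (rule cblinfun_ext)
qed (use assms in blast)

text \<open>
  The rank one operators of a basis express an operator through its matrix; the entries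
  reduce integrals and limits of operators to complex-valued ones.
\<close>

definition matrix_unit :: "'b::complex_hilbert \<Rightarrow> 'b \<Rightarrow> ('b, 'b) cblinfun" where
  "matrix_unit f e = Abs_cblinfun (\<lambda>x. cinner x e *\<^sub>C f)"

lemma matrix_unit_apply: "matrix_unit f e *\<^sub>V x = cinner x e *\<^sub>C f"
proof -
  have "bounded_linear (\<lambda>x. cinner x e *\<^sub>C f)"
  proof (rule bounded_linear_intro[of _ "norm e * norm f"])
    fix x
    have "cmod (cinner x e) * norm f \<le> norm x * norm e * norm f"
      by (intro mult_right_mono Cauchy_Schwarz_cinner) simp
    then show "norm (cinner x e *\<^sub>C f) \<le> norm x * (norm e * norm f)" by (simp add: norm_scaleC mult.assoc)
  qed (auto simp: cinner_add_left scaleC_add_left scaleR_scaleC cinner_scaleC_left scaleC_scaleC)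
  then have "bounded_clinear (\<lambda>x. cinner x e *\<^sub>C f)"
    by (simp add: bounded_clinear_def cinner_scaleC_left scaleC_scaleC)
  then show ?thesis by (simp add: matrix_unit_def Abs_cblinfun_inverse)
qed

lemma sum_cblinfun_apply: "(\<Sum>i\<in>A. f i) *\<^sub>V x = (\<Sum>i\<in>A. f i *\<^sub>V x)"
  by (induction A rule: infinite_finite_induct) auto

lemma cblinfun_eq_matrix_sum:
  fixes B :: "'a::complex_hilbert set"
  assumes "orthonormal_basis B"
  shows "T = (\<Sum>e\<in>B. \<Sum>f\<in>B. cinner (T *\<^sub>V e) f *\<^sub>C matrix_unit f e)"
proof (rule cblinfun_ext)
  fix x
  have exp: "y = (\<Sum>f\<in>B. cinner y f *\<^sub>C f)" for y using assms by (simp add: orthonormal_basis_def)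
  have T_sum: "T *\<^sub>V (\<Sum>e\<in>A. g e) = (\<Sum>e\<in>A. T *\<^sub>V g e)" for A :: "'a set" and g
    by (induction A rule: infinite_finite_induct) (auto simp: cblinfun_clinear)
  have "T *\<^sub>V x = T *\<^sub>V (\<Sum>e\<in>B. cinner x e *\<^sub>C e)" using exp[of x] by simp
  also have "\<dots> = (\<Sum>e\<in>B. cinner x e *\<^sub>C T *\<^sub>V e)" by (simp add: T_sum cblinfun_clinear)
  also have "\<dots> = (\<Sum>e\<in>B. cinner x e *\<^sub>C (\<Sum>f\<in>B. cinner (T *\<^sub>V e) f *\<^sub>C f))" using exp by simp
  also have "\<dots> = (\<Sum>e\<in>B. \<Sum>f\<in>B. cinner (T *\<^sub>V e) f *\<^sub>C matrix_unit f e) *\<^sub>V x"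
    by (simp add: sum_cblinfun_apply matrix_unit_apply complex_vector.scale_sum_right scaleC_scaleC mult.commute)
  finally show "T *\<^sub>V x = (\<Sum>e\<in>B. \<Sum>f\<in>B. cinner (T *\<^sub>V e) f *\<^sub>C matrix_unit f e) *\<^sub>V x" .
qed

lemma cblinfun_ext_form:
  fixes S T :: "('b::complex_hilbert, 'c::complex_hilbert) cblinfun"
  shows "(\<And>x y. cinner (S *\<^sub>V x) y = cinner (T *\<^sub>V x) y) \<Longrightarrow> S = T"
  by (intro cblinfun_ext cinner_ext)

lemma has_integral_form:
  fixes f :: "real \<Rightarrow> ('b::complex_normed_vector, 'c::complex_hilbert) cblinfun"
  assumes "(f has_integral T) A"
  shows "((\<lambda>s. cinner (f s *\<^sub>V x) y) has_integral cinner (T *\<^sub>V x) y) A"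
  using has_integral_linear[OF assms bounded_linear_form[of x y]] by (simp add: o_def)

lemma cblinfun_integrable:
  fixes B :: "'b::complex_hilbert set" and f :: "real \<Rightarrow> ('b::complex_hilbert, 'b) cblinfun"
  assumes B: "orthonormal_basis B" and int: "\<And>x y. (\<lambda>s. cinner (f s *\<^sub>V x) y) integrable_on A"
  shows "f integrable_on A"
proof -
  have fin: "finite B" using B by (simp add: orthonormal_basis_def)
  have "((\<lambda>s. \<Sum>e\<in>B. \<Sum>f'\<in>B. cinner (f s *\<^sub>V e) f' *\<^sub>C matrix_unit f' e) has_integral
      (\<Sum>e\<in>B. \<Sum>f'\<in>B. integral A (\<lambda>s. cinner (f s *\<^sub>V e) f') *\<^sub>C matrix_unit f' e)) A"
  proof (intro has_integral_sum fin)
    fix e f'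
    show "((\<lambda>s. cinner (f s *\<^sub>V e) f' *\<^sub>C matrix_unit f' e) has_integral integral A (\<lambda>s. cinner (f s *\<^sub>V e) f') *\<^sub>C matrix_unit f' e) A"
      using has_integral_linear[OF integrable_integral[OF int[of e f']] bounded_linear_scaleC_left[of "matrix_unit f' e"]]
      by (simp add: o_def)
  qed
  then show ?thesis unfolding cblinfun_eq_matrix_sum[OF B, symmetric] by (rule has_integral_integrable)
qed

lemma Cauchy_cblinfun_convergent:
  fixes B :: "'b::complex_hilbert set" and T :: "nat \<Rightarrow> ('b::complex_hilbert, 'b) cblinfun"
  assumes B: "orthonormal_basis B" and C: "Cauchy T"
  shows "convergent T"
proof -
  have "\<exists>l. (\<lambda>n. cinner (T n *\<^sub>V e) f) \<longlonglongrightarrow> l" for e f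
    using bounded_linear.Cauchy[OF bounded_linear_form[of e f] C] by (simp add: Cauchy_convergent_iff convergent_def)
  then obtain l where l: "\<And>e f. (\<lambda>n. cinner (T n *\<^sub>V e) f) \<longlonglongrightarrow> l e f" by metis
  have "(\<lambda>n. \<Sum>e\<in>B. \<Sum>f\<in>B. cinner (T n *\<^sub>V e) f *\<^sub>C matrix_unit f e) \<longlonglongrightarrow> (\<Sum>e\<in>B. \<Sum>f\<in>B. l e f *\<^sub>C matrix_unit f e)"
    by (intro tendsto_sum bounded_linear.tendsto[OF bounded_linear_scaleC_left] l)
  then show ?thesis unfolding cblinfun_eq_matrix_sum[OF B, symmetric] by (auto simp: convergent_def)
qed

lemma cadjoint:
  fixes T :: "('b::complex_hilbert, 'c::complex_hilbert) cblinfun"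
  assumes B: "orthonormal_basis (B :: 'b set)"
  shows "cinner (T *\<^sub>V x) y = cinner x (cadjoint T *\<^sub>V y)"
proof -
  have exp: "z = (\<Sum>f\<in>B. cinner z f *\<^sub>C f)" for z using B by (simp add: orthonormal_basis_def)
  define g where "g y = (\<Sum>e\<in>B. cinner y (T *\<^sub>V e) *\<^sub>C e)" for y
  have T_sum: "T *\<^sub>V (\<Sum>e\<in>A. g e) = (\<Sum>e\<in>A. T *\<^sub>V g e)" for A :: "'b set" and g
    by (induction A rule: infinite_finite_induct) (auto simp: cblinfun_clinear)
  have sum_right: "cinner x (\<Sum>e\<in>A. h e) = (\<Sum>e\<in>A. cinner x (h e))" for x :: 'b and A :: "'b set" and h
    by (induction A rule: infinite_finite_induct) (auto simp: cinner_add_right)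
  have "bounded_linear g"
  proof (rule bounded_linear_intro[of _ "\<Sum>e\<in>B. norm (T *\<^sub>V e) * norm e"])
    fix y
    have "norm (g y) \<le> (\<Sum>e\<in>B. norm y * (norm (T *\<^sub>V e) * norm e))"
      unfolding g_def
    proof (rule sum_norm_le)
      fix e
      show "norm (cinner y (T *\<^sub>V e) *\<^sub>C e) \<le> norm y * (norm (T *\<^sub>V e) * norm e)"
        using mult_right_mono[OF Cauchy_Schwarz_cinner[of y "T *\<^sub>V e"], of "norm e"] by (simp add: norm_scaleC mult.assoc)
    qed
    then show "norm (g y) \<le> norm y * (\<Sum>e\<in>B. norm (T *\<^sub>V e) * norm e)" by (simp add: sum_distrib_left)
  qed (simp_all add: g_def cinner_add_left scaleC_add_left sum.distrib scaleR_scaleC cinner_scaleC_left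
      complex_vector.scale_sum_right scaleC_scaleC)
  then have "bounded_clinear g"
    by (simp add: bounded_clinear_def g_def cinner_scaleC_left complex_vector.scale_sum_right scaleC_scaleC)
  then have app: "Abs_cblinfun g *\<^sub>V y = g y" for y by (simp add: Abs_cblinfun_inverse)
  have g: "cinner (T *\<^sub>V x) y = cinner x (Abs_cblinfun g *\<^sub>V y)" for x y
  proof -
    have "cinner (T *\<^sub>V x) y = cinner (T *\<^sub>V (\<Sum>e\<in>B. cinner x e *\<^sub>C e)) y" using exp[of x] by simp
    also have "\<dots> = (\<Sum>e\<in>B. cinner x e * cinner (T *\<^sub>V e) y)"
      by (simp add: T_sum cinner_sum_left cblinfun_clinear cinner_scaleC_left)
    also have "\<dots> = cinner x (g y)"
      unfolding g_def sum_right cinner_scaleC_right using cinner_commute by (intro sum.cong) (auto simp: mult.commute)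
    finally show ?thesis unfolding app .
  qed
  have "\<exists>!S. \<forall>x y. cinner (T *\<^sub>V x) y = cinner x (S *\<^sub>V y)"
  proof (rule ex1I[of _ "Abs_cblinfun g"])
    fix S assume S: "\<forall>x y. cinner (T *\<^sub>V x) y = cinner x (S *\<^sub>V y)"
    show "S = Abs_cblinfun g"
    proof (rule cblinfun_ext, rule cinner_ext)
      fix y z
      have "cinner z (S *\<^sub>V y) = cinner z (Abs_cblinfun g *\<^sub>V y)" using S g by metis
      then show "cinner (S *\<^sub>V y) z = cinner (Abs_cblinfun g *\<^sub>V y) z" by (metis cinner_commute)
    qed
  qed (use g in blast)
  from theI'[OF this] show ?thesis unfolding cadjoint_def by blast
qed

section \<open>Resolvents and the fixed point equation\<close>

lemma bounded_below_outside_bspectrum: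
  assumes "z \<notin> bspectrum T"
  obtains m where "m > 0" "\<And>x. m * norm x \<le> norm (T *\<^sub>V x - z *\<^sub>C x)"
proof -
  obtain M where M: "\<And>x. norm x \<le> M * norm (T *\<^sub>V x - z *\<^sub>C x)"
    using assms by (auto simp: bspectrum_def spectrum_def)
  show ?thesis
  proof (rule that[of "1 / (\<bar>M\<bar> + 1)"])
    fix x
    have "norm x \<le> M * norm (T *\<^sub>V x - z *\<^sub>C x)" by (rule M)
    also have "\<dots> \<le> (\<bar>M\<bar> + 1) * norm (T *\<^sub>V x - z *\<^sub>C x)" by (intro mult_right_mono) auto
    finally show "1 / (\<bar>M\<bar> + 1) * norm x \<le> norm (T *\<^sub>V x - z *\<^sub>C x)" by (simp add: field_simps)
  qed simp
qed

text \<open>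
  Let \<open>m\<close> be the
  infimum of \<open>\<parallel>(A - \<mu>) y\<parallel>\<^sup>2\<close> over unit vectors and suppose that \<open>m\<close> is less than the square of the
  distance. The positive operator \<open>S = (A - \<mu>\<^sup>*) (A - \<mu>) - m\<close> factors as \<open>(A - \<alpha>) (A - \<beta>)\<close> with \<open>\<alpha>\<close>,
  \<open>\<beta>\<close> outside the spectrum, hence it is bounded below. For a positive operator \<open>\<parallel>S x\<parallel>\<^sup>2 \<le> k \<langle>S x, x\<rangle>\<close>,
  so the quadratic form of \<open>S\<close> is bounded below as well, and \<open>m\<close> is not the infimum.
\<close>

lemma self_adjoint_bounded_below:
  fixes A :: "('b::complex_hilbert, 'b) cblinfun"
  assumes sa: "\<And>x y. cinner (A *\<^sub>V x) y = cinner x (A *\<^sub>V y)"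
    and real: "bspectrum A \<subseteq> \<real>"
  shows "infdist \<mu> (bspectrum A) * norm x \<le> norm (A *\<^sub>V x - \<mu> *\<^sub>C x)"
proof -
  define T where "T y = A *\<^sub>V y - \<mu> *\<^sub>C y" for y
  define Q where "Q = {(norm (T y))\<^sup>2 | y. norm y = 1}"
  have T_scale: "T (c *\<^sub>C y) = c *\<^sub>C T y" for c y
    by (simp add: T_def cblinfun_clinear complex_vector.scale_right_diff_distrib scaleC_scaleC mult.commute)
  have Q_bdd: "bdd_below Q" by (rule bdd_belowI[of _ 0]) (auto simp: Q_def)
  have "infdist \<mu> (bspectrum A) * norm y \<le> norm (T y)" if y: "norm y = 1" for y
  proof (rule ccontr)
    define m where "m = Inf Q"
    define \<delta> where "\<delta> = infdist \<mu> (bspectrum A)"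
    assume "\<not> ?thesis"
    then have less: "norm (T y) < \<delta>" using y by (simp add: \<delta>_def)
    have "(norm (T y))\<^sup>2 \<in> Q" using y by (auto simp: Q_def)
    then have m_le: "m \<le> (norm (T y))\<^sup>2" unfolding m_def by (rule cInf_lower[OF _ Q_bdd])
    have "(norm (T y))\<^sup>2 < \<delta>\<^sup>2" using less by (intro power_strict_mono) auto
    then have m\<delta>: "m < \<delta>\<^sup>2" using m_le by simp
    have below: "m * (norm z)\<^sup>2 \<le> (norm (T z))\<^sup>2" for z
    proof (cases "z = 0")
      case False
      define u where "u = of_real (inverse (norm z)) *\<^sub>C z"
      have "norm u = 1" using False by (simp add: u_def norm_scaleC norm_inverse)
      then have "m \<le> (norm (T u))\<^sup>2" unfolding m_def by (intro cInf_lower[OF _ Q_bdd]) (auto simp: Q_def)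
      also have "norm (T u) = norm (T z) / norm z" using False by (simp add: u_def T_scale norm_scaleC norm_inverse divide_inverse)
      finally show ?thesis using False by (simp add: power_divide field_simps)
    qed (simp add: T_def cblinfun_clinear)
    define d where "d = csqrt (of_real (m - (Im \<mu>)\<^sup>2))"
    have dd: "d * d = of_real (m - (Im \<mu>)\<^sup>2)" unfolding d_def by (metis power2_csqrt power2_eq_square)
    have notin: "of_real (Re \<mu>) + c \<notin> bspectrum A" if c: "c = d \<or> c = - d" for c
    proof
      assume a: "of_real (Re \<mu>) + c \<in> bspectrum A"
      then have "of_real (Re \<mu>) + c \<in> \<real>" using real by blast
      then have "Im c = 0" by (simp add: complex_is_Real_iff)
      then have cr: "c = of_real (Re c)" by (simp add: complex_eq_iff)
      have "c * c = of_real (m - (Im \<mu>)\<^sup>2)" using c dd by auto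
      then have "complex_of_real (Re c * Re c) = of_real (m - (Im \<mu>)\<^sup>2)" using cr by (metis of_real_mult)
      then have cc: "(Re c)\<^sup>2 = m - (Im \<mu>)\<^sup>2" by (simp only: of_real_eq_iff power2_eq_square)
      have "(dist \<mu> (of_real (Re \<mu>) + c))\<^sup>2 = m"
        using cc \<open>Im c = 0\<close> by (simp add: dist_norm cmod_power2)
      moreover have "\<delta>\<^sup>2 \<le> (dist \<mu> (of_real (Re \<mu>) + c))\<^sup>2"
        unfolding \<delta>_def by (intro power_mono infdist_le a infdist_nonneg)
      ultimately show False using m\<delta> by simp
    qed
    define \<alpha> \<beta> where "\<alpha> = of_real (Re \<mu>) + d" and "\<beta> = of_real (Re \<mu>) - d"
    obtain m1 where m1: "m1 > 0" "\<And>x. m1 * norm x \<le> norm (A *\<^sub>V x - \<alpha> *\<^sub>C x)"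
      using bounded_below_outside_bspectrum[OF notin[of d]] unfolding \<alpha>_def by blast
    obtain m2 where m2: "m2 > 0" "\<And>x. m2 * norm x \<le> norm (A *\<^sub>V x - \<beta> *\<^sub>C x)"
      using bounded_below_outside_bspectrum[OF notin[of "- d"]] unfolding \<beta>_def by auto
    define S where "S = (A - cnj \<mu> *\<^sub>C cblinfun_id) \<circ>\<^sub>C (A - \<mu> *\<^sub>C cblinfun_id) - of_real m *\<^sub>C cblinfun_id"
    have S_form: "cinner (S *\<^sub>V x) y = cinner (T x) (T y) - of_real m * cinner x y" for x y
      by (simp add: S_def T_def cinner_diff_left cinner_diff_right cinner_add_left cinner_add_right cblinfun_clinear
          cinner_scaleC_left cinner_scaleC_right sa algebra_simps)
    have S_factor: "S *\<^sub>V x = (A *\<^sub>V (A *\<^sub>V x - \<beta> *\<^sub>C x)) - \<alpha> *\<^sub>C (A *\<^sub>V x - \<beta> *\<^sub>C x)" for x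
    proof -
      have \<alpha>\<beta>: "\<alpha> + \<beta> = cnj \<mu> + \<mu>" "\<alpha> * \<beta> = cnj \<mu> * \<mu> - of_real m"
      proof -
        show "\<alpha> + \<beta> = cnj \<mu> + \<mu>" by (simp add: \<alpha>_def \<beta>_def complex_eq_iff)
        have "\<alpha> * \<beta> = of_real ((Re \<mu>)\<^sup>2) - d * d" by (simp add: \<alpha>_def \<beta>_def algebra_simps power2_eq_square)
        also have "\<dots> = cnj \<mu> * \<mu> - of_real m" unfolding dd by (simp add: complex_eq_iff power2_eq_square)
        finally show "\<alpha> * \<beta> = cnj \<mu> * \<mu> - of_real m" .
      qed
      have "S *\<^sub>V x = A *\<^sub>V A *\<^sub>V x - (cnj \<mu> + \<mu>) *\<^sub>C A *\<^sub>V x + (cnj \<mu> * \<mu> - of_real m) *\<^sub>C x"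
        by (simp add: S_def cblinfun_clinear scaleC_add_left complex_vector.scale_left_diff_distrib
            complex_vector.scale_right_diff_distrib scaleC_scaleC)
      also have "\<dots> = A *\<^sub>V A *\<^sub>V x - (\<alpha> + \<beta>) *\<^sub>C A *\<^sub>V x + (\<alpha> * \<beta>) *\<^sub>C x" unfolding \<alpha>\<beta> ..
      also have "\<dots> = (A *\<^sub>V (A *\<^sub>V x - \<beta> *\<^sub>C x)) - \<alpha> *\<^sub>C (A *\<^sub>V x - \<beta> *\<^sub>C x)"
        by (simp add: cblinfun_clinear scaleC_add_left complex_vector.scale_right_diff_distrib scaleC_scaleC)
      finally show ?thesis .
    qed
    have S_below: "m1 * m2 * norm x \<le> norm (S *\<^sub>V x)" for x
    proof -
      have "m1 * (m2 * norm x) \<le> m1 * norm (A *\<^sub>V x - \<beta> *\<^sub>C x)" using m1 m2 by (intro mult_left_mono) auto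
      also have "\<dots> \<le> norm (S *\<^sub>V x)" unfolding S_factor by (rule m1)
      finally show ?thesis by (simp add: mult.assoc)
    qed
    define k where "k = norm S + 1"
    have k: "k > 0" by (simp add: k_def add_nonneg_pos)
    have S_pos: "0 \<le> Re (cinner (S *\<^sub>V z) z)" for z
      using below[of z] by (simp add: S_form cinner_norm flip: of_real_mult of_real_power of_real_diff)
    have S_sa: "cinner (S *\<^sub>V x) y = cinner x (S *\<^sub>V y)" for x y
      using cinner_commute[of x "S *\<^sub>V y"] cinner_commute[of x y] cinner_commute[of "T x" "T y"] by (simp add: S_form)
    have key: "(norm (S *\<^sub>V x))\<^sup>2 \<le> k * ((norm (T x))\<^sup>2 - m * (norm x)\<^sup>2)" for x
    proof -
      define w where "w = S *\<^sub>V x"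
      \<comment> \<open>The choice of t minimizes the bound for the quadratic form of S at x - t w.\<close>
      define t where "t = 1 / k"
      have "0 \<le> Re (cinner (S *\<^sub>V (x - of_real t *\<^sub>C w)) (x - of_real t *\<^sub>C w))" by (rule S_pos)
      also have "cinner (S *\<^sub>V (x - of_real t *\<^sub>C w)) (x - of_real t *\<^sub>C w)
          = cinner (S *\<^sub>V x) x - of_real t * cinner w w - of_real t * cinner w w + of_real (t * t) * cinner (S *\<^sub>V w) w"
        using S_sa[of w x] by (simp add: cblinfun_clinear cinner_diff_left cinner_diff_right cinner_scaleC_left
            cinner_scaleC_right algebra_simps flip: w_def)
      finally have 1: "0 \<le> Re (cinner (S *\<^sub>V x) x) - 2 * t * (norm w)\<^sup>2 + t * t * Re (cinner (S *\<^sub>V w) w)"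
        by (simp add: cinner_norm flip: of_real_power)
      have "Re (cinner (S *\<^sub>V w) w) \<le> norm S * norm w * norm w"
        using complex_Re_le_cmod norm_cinner_apply order_trans by blast
      also have "\<dots> \<le> k * (norm w)\<^sup>2" by (simp add: k_def power2_eq_square algebra_simps)
      finally have "t * t * Re (cinner (S *\<^sub>V w) w) \<le> t * t * (k * (norm w)\<^sup>2)" by (intro mult_left_mono) auto
      also have "\<dots> = t * (norm w)\<^sup>2" using k by (simp add: t_def)
      finally have "t * (norm w)\<^sup>2 \<le> Re (cinner (S *\<^sub>V x) x)" using 1 by simp
      then have "(norm w)\<^sup>2 \<le> k * Re (cinner (S *\<^sub>V x) x)" using k by (simp add: t_def field_simps)
      also have "Re (cinner (S *\<^sub>V x) x) = (norm (T x))\<^sup>2 - m * (norm x)\<^sup>2"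
        by (simp add: S_form cinner_norm flip: of_real_mult of_real_power of_real_diff)
      finally show ?thesis by (simp add: w_def)
    qed
    define c where "c = (m1 * m2)\<^sup>2 / k"
    have "c > 0" using m1 m2 k by (simp add: c_def)
    have "m + c \<le> Inf Q"
    proof (rule cInf_greatest)
      show "Q \<noteq> {}" using y by (auto simp: Q_def)
      fix v assume "v \<in> Q"
      then obtain x where x: "norm x = 1" "v = (norm (T x))\<^sup>2" by (auto simp: Q_def)
      have "(m1 * m2)\<^sup>2 \<le> (norm (S *\<^sub>V x))\<^sup>2" using S_below[of x] x m1 m2 by (intro power_mono) auto
      also have "\<dots> \<le> k * (v - m)" using key[of x] x by simp
      finally show "m + c \<le> v" using k by (simp add: c_def field_simps)
    qed
    then show False using \<open>c > 0\<close> by (simp add: m_def)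
  qed
  note unit = this
  show ?thesis
  proof (cases "x = 0")
    case False
    define u where "u = of_real (inverse (norm x)) *\<^sub>C x"
    have "norm u = 1" using False by (simp add: u_def norm_scaleC norm_inverse)
    from unit[OF this] have "infdist \<mu> (bspectrum A) \<le> norm (T x) / norm x"
      using \<open>norm u = 1\<close> False by (simp add: u_def T_scale norm_scaleC norm_inverse divide_inverse mult.commute)
    then show ?thesis using False by (simp add: T_def field_simps)
  qed simp
qed

abbreviation resolvent :: "('b::complex_hilbert, 'b) cblinfun \<Rightarrow> complex \<Rightarrow> ('b, 'b) cblinfun" where
  "resolvent Z \<mu> \<equiv> cblinfun_inv (Z - \<mu> *\<^sub>C cblinfun_id)"

lemma resolvent_bounded_below:
  fixes B :: "'b::complex_hilbert set" and Z :: "('b, 'b) cblinfun"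
  assumes B: "orthonormal_basis B" and m: "m > 0" "\<And>x. m * norm x \<le> norm (Z *\<^sub>V x - \<mu> *\<^sub>C x)"
  shows "Z *\<^sub>V resolvent Z \<mu> *\<^sub>V x - \<mu> *\<^sub>C resolvent Z \<mu> *\<^sub>V x = x"
    and "resolvent Z \<mu> *\<^sub>V (Z *\<^sub>V x - \<mu> *\<^sub>C x) = x"
    and "norm (resolvent Z \<mu>) \<le> 1 / m"
proof -
  let ?T = "Z - \<mu> *\<^sub>C cblinfun_id"
  have inj: "x = 0" if "?T *\<^sub>V x = 0" for x
  proof -
    have "m * norm x \<le> 0" using m(2)[of x] that by simp
    then show ?thesis using m(1) by (simp add: mult_le_0_iff)
  qed
  obtain S where S: "S \<circ>\<^sub>C ?T = cblinfun_id" "?T \<circ>\<^sub>C S = cblinfun_id"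
    by (rule injective_cblinfun_invertible[OF B, of ?T], erule inj) blast
  have inv: "resolvent Z \<mu> = S" by (rule cblinfun_inv_unique[OF S])
  have TS: "?T *\<^sub>V S *\<^sub>V x = x" and ST: "S *\<^sub>V ?T *\<^sub>V x = x" for x
    using S by (metis cblinfun_compose_apply cblinfun_apply_simps(5))+
  show "Z *\<^sub>V resolvent Z \<mu> *\<^sub>V x - \<mu> *\<^sub>C resolvent Z \<mu> *\<^sub>V x = x"
    using TS[of x] unfolding inv by simp
  show "resolvent Z \<mu> *\<^sub>V (Z *\<^sub>V x - \<mu> *\<^sub>C x) = x"
    using ST[of x] unfolding inv by simp
  show "norm (resolvent Z \<mu>) \<le> 1 / m" unfolding inv
  proof (rule norm_cblinfun_bound)
    fix x
    have "m * norm (S *\<^sub>V x) \<le> norm x" using m(2)[of "S *\<^sub>V x"] TS[of x] by simp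
    then show "norm (S *\<^sub>V x) \<le> 1 / m * norm x" using m(1) by (simp add: field_simps)
  qed (use m in simp)
qed

locale self_adjoint_finite =
  fixes A :: "('b::complex_hilbert, 'b) cblinfun" and B :: "'b set"
  assumes A_sym: "cinner (A *\<^sub>V x) y = cinner x (A *\<^sub>V y)"
    and A_real: "bspectrum A \<subseteq> \<real>"
    and B: "orthonormal_basis B"
begin

text \<open>
  The spectrum of \<open>A + X\<close> lies within distance \<open>\<parallel>X\<parallel>\<close> of that of \<open>A\<close>, in quantitative form.
\<close>

lemma perturbed_bounded_below:
  assumes "norm X \<le> r"
  shows "(infdist \<mu> (bspectrum A) - r) * norm x \<le> norm ((A + X) *\<^sub>V x - \<mu> *\<^sub>C x)"
proof -
  have "infdist \<mu> (bspectrum A) * norm x \<le> norm (A *\<^sub>V x - \<mu> *\<^sub>C x)"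
    by (rule self_adjoint_bounded_below[OF A_sym A_real])
  also have "\<dots> = norm (((A + X) *\<^sub>V x - \<mu> *\<^sub>C x) - X *\<^sub>V x)" by (simp add: algebra_simps)
  also have "\<dots> \<le> norm ((A + X) *\<^sub>V x - \<mu> *\<^sub>C x) + norm (X *\<^sub>V x)" by (rule norm_triangle_ineq4)
  also have "norm (X *\<^sub>V x) \<le> r * norm x"
    using norm_cblinfun_apply[of X x] mult_right_mono[OF assms, of "norm x"] by simp
  finally show ?thesis by (simp add: algebra_simps)
qed

lemma perturbed_resolvent:
  assumes "norm X \<le> r" "r < infdist \<mu> (bspectrum A)"
  shows "(A + X) *\<^sub>V resolvent (A + X) \<mu> *\<^sub>V x - \<mu> *\<^sub>C resolvent (A + X) \<mu> *\<^sub>V x = x"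
    and "resolvent (A + X) \<mu> *\<^sub>V ((A + X) *\<^sub>V x - \<mu> *\<^sub>C x) = x"
    and "norm (resolvent (A + X) \<mu>) \<le> 1 / (infdist \<mu> (bspectrum A) - r)"
  using resolvent_bounded_below[OF B _ perturbed_bounded_below[OF assms(1)], of \<mu>] assms(2) by auto

text \<open>
  One identity for both uses: \<open>\<mu> = \<nu>\<close> compares two perturbations, \<open>X = Y\<close> two spectral parameters.
\<close>

lemma resolvent_difference:
  assumes "norm X \<le> r" "norm Y \<le> r" "r < infdist \<mu> (bspectrum A)" "r < infdist \<nu> (bspectrum A)"
  shows "resolvent (A + X) \<mu> *\<^sub>V x - resolvent (A + Y) \<nu> *\<^sub>V x =
    resolvent (A + X) \<mu> *\<^sub>V ((Y - X) *\<^sub>V resolvent (A + Y) \<nu> *\<^sub>V x + (\<mu> - \<nu>) *\<^sub>C resolvent (A + Y) \<nu> *\<^sub>V x)"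
proof -
  define w where "w = resolvent (A + Y) \<nu> *\<^sub>V x"
  have "x = (A + Y) *\<^sub>V w - \<nu> *\<^sub>C w" using perturbed_resolvent(1)[OF assms(2,4)] by (simp add: w_def)
  moreover have "w = resolvent (A + X) \<mu> *\<^sub>V ((A + X) *\<^sub>V w - \<mu> *\<^sub>C w)"
    using perturbed_resolvent(2)[OF assms(1,3)] by simp
  ultimately have "resolvent (A + X) \<mu> *\<^sub>V x - w =
      resolvent (A + X) \<mu> *\<^sub>V (((A + Y) *\<^sub>V w - \<nu> *\<^sub>C w) - ((A + X) *\<^sub>V w - \<mu> *\<^sub>C w))"
    by (metis cblinfun_clinear(3))
  also have "((A + Y) *\<^sub>V w - \<nu> *\<^sub>C w) - ((A + X) *\<^sub>V w - \<mu> *\<^sub>C w) = (Y - X) *\<^sub>V w + (\<mu> - \<nu>) *\<^sub>C w"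
    by (simp add: algebra_simps complex_vector.scale_left_diff_distrib)
  finally show ?thesis by (simp add: w_def)
qed

lemma resolvent_holomorphic:
  assumes X: "norm X \<le> r"
  shows "(\<lambda>z. cinner (resolvent (A + X) z *\<^sub>V x) y) holomorphic_on {z. r < infdist z (bspectrum A)}"
proof -
  let ?V = "{z. r < infdist z (bspectrum A)}" and ?R = "resolvent (A + X)"
  have openV: "open ?V" by (intro open_Collect_less continuous_intros)
  have diff: "cinner (?R w *\<^sub>V x) y - cinner (?R z *\<^sub>V x) y = (w - z) * cinner (?R w *\<^sub>V ?R z *\<^sub>V x) y" 
    if "w \<in> ?V" "z \<in> ?V" for w z x y
  proof -
    have "?R w *\<^sub>V x - ?R z *\<^sub>V x = (w - z) *\<^sub>C ?R w *\<^sub>V ?R z *\<^sub>V x"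
      using resolvent_difference[OF X X, of w z x] that by (simp add: cblinfun_clinear)
    then show ?thesis by (metis cinner_diff_left cinner_scaleC_left)
  qed
  have cont: "((\<lambda>w. cinner (?R w *\<^sub>V x) y) \<longlongrightarrow> cinner (?R z *\<^sub>V x) y) (at z)" if z: "z \<in> ?V" for z x y
  proof -
    define m where "m = (infdist z (bspectrum A) - r) / 2"
    have m: "m > 0" using z by (simp add: m_def)
    define C where "C = (1 / m) * norm (?R z *\<^sub>V x) * norm y"
    have ev: "\<forall>\<^sub>F w in at z. dist w z < m" using m by (auto simp: eventually_at)
    have "\<forall>\<^sub>F w in at z. norm (cinner (?R w *\<^sub>V x) y - cinner (?R z *\<^sub>V x) y) \<le> norm (w - z) * C"
      using ev
    proof eventually_elim
      case (elim w)
      have "infdist z (bspectrum A) \<le> infdist w (bspectrum A) + dist z w" by (rule infdist_triangle)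
      then have w: "m < infdist w (bspectrum A) - r" using elim m by (simp add: m_def dist_commute field_simps)
      then have wV: "w \<in> ?V" using m by simp
      have "norm (?R w) \<le> 1 / (infdist w (bspectrum A) - r)" using perturbed_resolvent(3)[OF X] wV by simp
      also have "\<dots> \<le> 1 / m" using w m by (intro divide_left_mono) auto
      finally have "norm (?R w) \<le> 1 / m" .
      then have "cmod (cinner (?R w *\<^sub>V ?R z *\<^sub>V x) y) \<le> C"
        using norm_cinner_apply[of "?R w" "?R z *\<^sub>V x" y] mult_right_mono[of "norm (?R w)" "1 / m" "norm (?R z *\<^sub>V x) * norm y"]
        by (simp add: C_def mult.assoc)
      then show ?case unfolding diff[OF wV z] norm_mult by (intro mult_left_mono) auto
    qed
    moreover have "((\<lambda>w. norm (w - z) * C) \<longlongrightarrow> norm (z - z) * C) (at z)" by (intro tendsto_intros)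
    then have "((\<lambda>w. norm (w - z) * C) \<longlongrightarrow> 0) (at z)" by simp
    ultimately have "((\<lambda>w. cinner (?R w *\<^sub>V x) y - cinner (?R z *\<^sub>V x) y) \<longlongrightarrow> 0) (at z)"
      by (rule Lim_null_comparison)
    then show ?thesis by (simp add: LIM_zero_iff)
  qed
  show ?thesis
  proof (rule holomorphic_onI)
    fix z assume z: "z \<in> ?V"
    have "((\<lambda>w. (cinner (?R w *\<^sub>V x) y - cinner (?R z *\<^sub>V x) y) / (w - z)) \<longlongrightarrow> cinner (?R z *\<^sub>V ?R z *\<^sub>V x) y) (at z)"
    proof (rule Lim_transform_eventually[OF cont[OF z, of "?R z *\<^sub>V x" y]])
      have "\<forall>\<^sub>F w in at z. w \<in> ?V" using openV z by (rule eventually_at_in_open')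
      moreover have "\<forall>\<^sub>F w in at z. w \<noteq> z" by (simp add: eventually_at_filter)
      ultimately show "\<forall>\<^sub>F w in at z. cinner (?R w *\<^sub>V ?R z *\<^sub>V x) y = (cinner (?R w *\<^sub>V x) y - cinner (?R z *\<^sub>V x) y) / (w - z)"
        by eventually_elim (simp add: diff[OF _ z])
    qed
    then have "((\<lambda>z. cinner (?R z *\<^sub>V x) y) has_field_derivative cinner (?R z *\<^sub>V ?R z *\<^sub>V x) y) (at z)"
      by (simp add: has_field_derivative_iff)
    then show "(\<lambda>z. cinner (?R z *\<^sub>V x) y) field_differentiable at z within ?V"
      by (meson field_differentiable_at_within field_differentiable_def)
  qed
qed

text \<open>
  Separates the factor \<open>K\<close>, about which only the integrals against fixed functions are known,
  from the resolvent.
\<close>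

lemma form_expand: "cinner (K *\<^sub>V R *\<^sub>V x) y = (\<Sum>f\<in>B. cinner (K *\<^sub>V f) y * cinner (R *\<^sub>V x) f)"
proof -
  have K_sum: "K *\<^sub>V (\<Sum>e\<in>A. g e) = (\<Sum>e\<in>A. K *\<^sub>V g e)" for A :: "'b set" and g :: "'b \<Rightarrow> 'b"
    by (induction A rule: infinite_finite_induct) (auto simp: cblinfun_clinear)
  have "R *\<^sub>V x = (\<Sum>f\<in>B. cinner (R *\<^sub>V x) f *\<^sub>C f)" using B unfolding orthonormal_basis_def by blast
  then have "cinner (K *\<^sub>V R *\<^sub>V x) y = cinner (K *\<^sub>V (\<Sum>f\<in>B. cinner (R *\<^sub>V x) f *\<^sub>C f)) y" by simp
  also have "\<dots> = (\<Sum>f\<in>B. cinner (K *\<^sub>V f) y * cinner (R *\<^sub>V x) f)"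
    by (simp add: K_sum cblinfun_clinear cinner_sum_left cinner_scaleC_left mult.commute)
  finally show ?thesis .
qed

end

text \<open>
  The data of the equation \<open>X = W\<^sub>1(A + X)\<close> for one contour. \<open>V\<close> is the integral of the norm of the
  kernel and \<open>d\<close> the distance of the contour from the spectrum.
\<close>

locale riccati = unit_speed_curve p q \<gamma> + self_adjoint_finite A B
  for p q \<gamma> and A :: "('b::complex_hilbert, 'b) cblinfun" and B +
  fixes K :: "complex \<Rightarrow> ('b, 'b) cblinfun"
  assumes K_cont: "\<And>x y. continuous_on (\<gamma> ` einterval p q) (\<lambda>z. cinner (K z *\<^sub>V x) y)"
    and K_int: "set_integrable lborel (einterval p q) (\<lambda>s. norm (K (\<gamma> s)))"
    and V_small: "V_0 K p q \<gamma> < 1 / 4 * (d_contour (bspectrum A) p q \<gamma>)\<^sup>2"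
begin

abbreviation "d \<equiv> d_contour (bspectrum A) p q \<gamma>"
abbreviation "V \<equiv> V_0 K p q \<gamma>"
abbreviation "W X \<equiv> W_1 K (A + X) p q \<gamma>"

lemma norm_K_integral: "((\<lambda>s. norm (K (\<gamma> s))) has_integral V) E"
  using set_borel_integral_eq_integral[OF K_int] by (simp add: V_0_def has_integral_iff)

lemma V_nonneg: "V \<ge> 0"
  by (rule has_integral_nonneg[OF norm_K_integral]) simp

lemma d_pos: "d > 0"
proof -
  have "d \<ge> 0" by (simp add: d_contour_def setdist_pos_le)
  moreover have "d \<noteq> 0" using V_small V_nonneg by auto
  ultimately show ?thesis by simp
qed

lemma spectrum_nonempty: "bspectrum A \<noteq> {}"
  using d_pos by (auto simp: d_contour_def)

lemma d_le: "s \<in> E \<Longrightarrow> d \<le> infdist (\<gamma> s) (bspectrum A)"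
  unfolding d_contour_def infdist_eq_setdist
  by (subst setdist_sym, rule setdist_subset_left) auto

lemma curve_form_bound:
  assumes F: "continuous_on (\<gamma> ` E) F" and le: "\<And>s. s \<in> E \<Longrightarrow> norm (F (\<gamma> s)) \<le> norm (K (\<gamma> s)) * C"
  shows "(\<lambda>s. \<gamma>' s * F (\<gamma> s)) absolutely_integrable_on E" "norm (integral E (\<lambda>s. \<gamma>' s * F (\<gamma> s))) \<le> V * C"
proof -
  have "((\<lambda>s. norm (K (\<gamma> s)) * C) has_integral V * C) E" by (rule has_integral_mult_left[OF norm_K_integral])
  then have *: "(\<lambda>s. norm (K (\<gamma> s)) * C) integrable_on E" "integral E (\<lambda>s. norm (K (\<gamma> s)) * C) = V * C"
    by (auto simp: has_integral_iff)
  from curve_integral_bound[OF F *(1) le] *(2)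
  show "(\<lambda>s. \<gamma>' s * F (\<gamma> s)) absolutely_integrable_on E" "norm (integral E (\<lambda>s. \<gamma>' s * F (\<gamma> s))) \<le> V * C" by auto
qed

lemma continuous_form:
  assumes "norm X < d"
  shows "continuous_on (\<gamma> ` E) (\<lambda>z. cinner (K z *\<^sub>V resolvent (A + X) z *\<^sub>V x) y)"
  unfolding form_expand
proof (intro continuous_on_sum continuous_on_mult K_cont)
  fix f
  have "\<gamma> ` E \<subseteq> {z. norm X < infdist z (bspectrum A)}" using d_le assms by fastforce
  then show "continuous_on (\<gamma> ` E) (\<lambda>z. cinner (resolvent (A + X) z *\<^sub>V x) f)"
    using holomorphic_on_imp_continuous_on[OF resolvent_holomorphic[OF order_refl]] continuous_on_subset by blast
qed

lemma norm_resolvent_on_curve: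
  assumes "norm X < d" "s \<in> E"
  shows "norm (resolvent (A + X) (\<gamma> s)) \<le> 1 / (d - norm X)"
proof -
  have "norm X < infdist (\<gamma> s) (bspectrum A)" using d_le[OF assms(2)] assms(1) by simp
  then have "norm (resolvent (A + X) (\<gamma> s)) \<le> 1 / (infdist (\<gamma> s) (bspectrum A) - norm X)"
    by (rule perturbed_resolvent(3)[OF order_refl])
  also have "\<dots> \<le> 1 / (d - norm X)" using d_le[OF assms(2)] assms(1) by (intro divide_left_mono) auto
  finally show ?thesis .
qed

lemma norm_form_le:
  assumes "norm R \<le> C"
  shows "norm (cinner (K z *\<^sub>V R *\<^sub>V x) y) \<le> norm (K z) * (C * norm x * norm y)"
proof -
  have "norm (cinner (K z *\<^sub>V R *\<^sub>V x) y) \<le> norm (K z) * norm (R *\<^sub>V x) * norm y" by (rule norm_cinner_apply)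
  also have "\<dots> \<le> norm (K z) * (C * norm x) * norm y"
    using norm_cblinfun_apply[of R x] mult_right_mono[OF assms, of "norm x"]
    by (intro mult_right_mono mult_left_mono) auto
  finally show ?thesis by (simp add: mult.assoc)
qed

lemma form_absolutely_integrable:
  assumes "norm X < d"
  shows "(\<lambda>s. \<gamma>' s * cinner (K (\<gamma> s) *\<^sub>V resolvent (A + X) (\<gamma> s) *\<^sub>V x) y) absolutely_integrable_on E"
  by (rule curve_form_bound(1)[OF continuous_form[OF assms]])
    (rule norm_form_le[OF norm_resolvent_on_curve[OF assms]])

text \<open>
  The operator integral exists because its matrix entries do, and it can be tested with vectors.
\<close>

lemma W_form:
  assumes "norm X < d"
  shows "cinner (W X *\<^sub>V x) y = - integral E (\<lambda>s. \<gamma>' s * cinner (K (\<gamma> s) *\<^sub>V resolvent (A + X) (\<gamma> s) *\<^sub>V x) y)"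
proof -
  define f where "f s = \<gamma>' s *\<^sub>C (K (\<gamma> s) \<circ>\<^sub>C resolvent (A + X) (\<gamma> s))" for s
  have f: "cinner (f s *\<^sub>V x) y = \<gamma>' s * cinner (K (\<gamma> s) *\<^sub>V resolvent (A + X) (\<gamma> s) *\<^sub>V x) y" for s x y
    by (simp add: f_def cinner_scaleC_left)
  have "f integrable_on E"
    by (rule cblinfun_integrable[OF B])
      (use form_absolutely_integrable[OF assms] in \<open>simp add: f absolutely_integrable_on_def\<close>)
  from has_integral_form[OF integrable_integral[OF this], of x y]
  show ?thesis by (simp add: W_1_def f integral_unique flip: f_def)
qed

lemma norm_W_le:
  assumes "norm X < d"
  shows "norm (W X) \<le> V / (d - norm X)"
proof (rule norm_cblinfun_bound_form)
  show "0 \<le> V / (d - norm X)" using V_nonneg assms by simp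
  fix x y
  have "norm (cinner (W X *\<^sub>V x) y) \<le> V * (1 / (d - norm X) * norm x * norm y)"
    unfolding W_form[OF assms] norm_minus_cancel
    by (rule curve_form_bound(2)[OF continuous_form[OF assms]])
      (rule norm_form_le[OF norm_resolvent_on_curve[OF assms]])
  then show "norm (cinner (W X *\<^sub>V x) y) \<le> V / (d - norm X) * norm x * norm y" by (simp add: field_simps)
qed

lemma norm_W_diff_le:
  assumes X: "norm X \<le> d / 2" and Y: "norm Y \<le> d / 2"
  shows "norm (W X - W Y) \<le> V * (2 / d) * (2 / d) * norm (X - Y)"
proof (rule norm_cblinfun_bound_form)
  show "0 \<le> V * (2 / d) * (2 / d) * norm (X - Y)" using V_nonneg d_pos by simp
  have Xd: "norm X < d" and Yd: "norm Y < d" using X Y d_pos by auto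
  fix x y
  define F where "F z = cinner (K z *\<^sub>V resolvent (A + X) z *\<^sub>V x) y - cinner (K z *\<^sub>V resolvent (A + Y) z *\<^sub>V x) y" for z
  have "cinner ((W X - W Y) *\<^sub>V x) y = - integral E (\<lambda>s. \<gamma>' s * F (\<gamma> s))"
    using form_absolutely_integrable[OF Xd, of x y] form_absolutely_integrable[OF Yd, of x y]
    by (simp add: F_def cinner_diff_left W_form[OF Xd] W_form[OF Yd] absolutely_integrable_on_def right_diff_distrib integral_diff)
  also have "norm \<dots> \<le> V * ((2 / d) * (2 / d) * norm (X - Y) * norm x * norm y)"
    unfolding norm_minus_cancel
  proof (rule curve_form_bound(2))
    show "continuous_on (\<gamma> ` E) F" unfolding F_def
      by (intro continuous_on_diff continuous_form Xd Yd)
    fix s assume s: "s \<in> E"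
    have inf: "d / 2 < infdist (\<gamma> s) (bspectrum A)" using d_le[OF s] d_pos by simp
    let ?RX = "resolvent (A + X) (\<gamma> s)" and ?RY = "resolvent (A + Y) (\<gamma> s)"
    have R: "norm (resolvent (A + X') (\<gamma> s)) \<le> 2 / d" if "norm X' \<le> d / 2" for X'
    proof -
      have "norm (resolvent (A + X') (\<gamma> s)) \<le> 1 / (d - norm X')"
        using norm_resolvent_on_curve[of X', OF _ s] that d_pos by simp
      also have "\<dots> \<le> 1 / (d / 2)" using that d_pos by (intro divide_left_mono) auto
      finally show ?thesis by simp
    qed
    have "F (\<gamma> s) = cinner (K (\<gamma> s) *\<^sub>V (?RX \<circ>\<^sub>C (Y - X) \<circ>\<^sub>C ?RY) *\<^sub>V x) y"
    proof -
      have "?RX *\<^sub>V x - ?RY *\<^sub>V x = (?RX \<circ>\<^sub>C (Y - X) \<circ>\<^sub>C ?RY) *\<^sub>V x"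
        using resolvent_difference[OF X Y inf inf, of x] by simp
      then show ?thesis unfolding F_def by (metis cinner_diff_left cblinfun_clinear(3))
    qed
    moreover have "norm (?RX \<circ>\<^sub>C (Y - X) \<circ>\<^sub>C ?RY) \<le> (2 / d) * (2 / d) * norm (X - Y)"
    proof -
      have "norm (?RX \<circ>\<^sub>C (Y - X) \<circ>\<^sub>C ?RY) \<le> norm ?RX * norm (Y - X) * norm ?RY"
        by (meson norm_cblinfun_compose order_trans mult_right_mono norm_ge_zero)
      also have "\<dots> \<le> (2 / d) * norm (Y - X) * (2 / d)"
        using R[OF X] R[OF Y] d_pos by (intro mult_mono) auto
      finally show ?thesis by (simp add: norm_minus_commute mult_ac)
    qed
    ultimately show "norm (F (\<gamma> s)) \<le> norm (K (\<gamma> s)) * ((2 / d) * (2 / d) * norm (X - Y) * norm x * norm y)"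
      using norm_form_le by metis
  qed
  finally show "norm (cinner ((W X - W Y) *\<^sub>V x) y) \<le> V * (2 / d) * (2 / d) * norm (X - Y) * norm x * norm y"
    by (simp only: mult.assoc)
qed

text \<open>
  The ball of radius \<open>d / 2\<close> is mapped into itself, as \<open>V / (d / 2) < d / 2\<close>, and the map contracts
  with the factor \<open>4 V / d\<^sup>2 < 1\<close>. The unimodular factor \<open>\<tau>\<close> allows for a contour that runs backwards.
\<close>

lemma riccati_solution_unique_existence:
  assumes \<tau>: "cmod \<tau> = 1"
  shows "\<exists>!X\<in>cball 0 (d / 2). \<tau> *\<^sub>C W X = X"
proof (rule Banach_fix[where c = "V * (2 / d) * (2 / d)"])
  show "complete (cball (0 :: ('b, 'b) cblinfun) (d / 2))"
    unfolding complete_def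
  proof (intro allI impI)
    fix f :: "nat \<Rightarrow> ('b, 'b) cblinfun" assume f: "(\<forall>n. f n \<in> cball 0 (d / 2)) \<and> Cauchy f"
    then obtain l where "f \<longlonglongrightarrow> l" using Cauchy_cblinfun_convergent[OF B] by (auto simp: convergent_def)
    moreover have "l \<in> cball 0 (d / 2)"
      by (rule closed_sequentially[OF closed_cball _ \<open>f \<longlonglongrightarrow> l\<close>]) (use f in blast)
    ultimately show "\<exists>l\<in>cball 0 (d / 2). f \<longlonglongrightarrow> l" by blast
  qed
  show "cball (0 :: ('b, 'b) cblinfun) (d / 2) \<noteq> {}" using d_pos by simp
  show "0 \<le> V * (2 / d) * (2 / d)" using V_nonneg d_pos by simp
  show "V * (2 / d) * (2 / d) < 1" using V_small d_pos by (simp add: field_simps power2_eq_square)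
  show "(\<lambda>X. \<tau> *\<^sub>C W X) ` cball 0 (d / 2) \<subseteq> cball 0 (d / 2)"
  proof (rule image_subsetI)
    fix X :: "('b, 'b) cblinfun" assume "X \<in> cball 0 (d / 2)"
    then have X: "norm X \<le> d / 2" by simp
    then have "norm X < d" using d_pos by simp
    then have "norm (W X) \<le> V / (d - norm X)" by (rule norm_W_le)
    also have "\<dots> \<le> V / (d / 2)" using X d_pos V_nonneg by (intro divide_left_mono) auto
    also have "\<dots> \<le> d / 2" using V_small d_pos by (simp add: field_simps power2_eq_square)
    finally show "\<tau> *\<^sub>C W X \<in> cball 0 (d / 2)" using \<tau> by (simp add: norm_scaleC)
  qed
  show "dist (\<tau> *\<^sub>C W X) (\<tau> *\<^sub>C W Y) \<le> V * (2 / d) * (2 / d) * dist X Y"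
    if "X \<in> cball 0 (d / 2)" "Y \<in> cball 0 (d / 2)" for X Y
    using norm_W_diff_le[of X Y] that \<tau>
    by (simp add: dist_norm norm_scaleC flip: complex_vector.scale_right_diff_distrib)
qed

lemma r_min_le: "r_min K (bspectrum A) p q \<gamma> \<le> d / 2" "r_min K (bspectrum A) p q \<gamma> < d / 2"
  using V_small by (auto simp: r_min_def)

text \<open>
  A solution satisfies \<open>\<parallel>X\<parallel> (d - \<parallel>X\<parallel>) \<le> V\<close>, and \<open>r\<^sub>m\<^sub>i\<^sub>n\<close> is the smaller root of this quadratic
  inequality.
\<close>

lemma riccati_solution_bound:
  assumes X: "norm X \<le> d / 2" and eq: "\<tau> *\<^sub>C W X = X" and \<tau>: "cmod \<tau> = 1"
  shows "norm X \<le> r_min K (bspectrum A) p q \<gamma>"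
proof -
  have Xd: "norm X < d" using X d_pos by simp
  have "norm X = norm (W X)" using eq \<tau> by (metis mult_1 norm_scaleC)
  also have "\<dots> \<le> V / (d - norm X)" by (rule norm_W_le[OF Xd])
  finally have "norm X * (d - norm X) \<le> V" using Xd by (simp add: field_simps)
  then have "d\<^sup>2 / 4 - V \<le> (d / 2 - norm X)\<^sup>2" by (simp add: power2_eq_square field_simps)
  then have "sqrt (d\<^sup>2 / 4 - V) \<le> d / 2 - norm X" using X by (intro real_le_lsqrt) auto
  then show ?thesis by (simp add: r_min_def)
qed

lemma X_solution:
  defines "X \<equiv> X_solution K A p q \<gamma>"
  shows "W X = X" "norm X \<le> r_min K (bspectrum A) p q \<gamma>"
proof -
  obtain Y where Y: "Y \<in> cball 0 (d / 2)" "1 *\<^sub>C W Y = Y" and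
    uniq: "\<And>Z. Z \<in> cball 0 (d / 2) \<and> 1 *\<^sub>C W Z = Z \<Longrightarrow> Z = Y"
    using riccati_solution_unique_existence[of 1] by (auto simp del: mem_cball)
  have "Y = W Y \<and> norm Y \<le> r_min K (bspectrum A) p q \<gamma>"
    using riccati_solution_bound[of Y 1] Y by (simp add: scaleC_one)
  then have "X = Y"
    unfolding X_def X_solution_def
  proof (rule the_equality)
    fix Z assume "Z = W Z \<and> norm Z \<le> r_min K (bspectrum A) p q \<gamma>"
    then show "Z = Y" using r_min_le(1) by (intro uniq) (auto simp: scaleC_one)
  qed
  then show "W X = X" "norm X \<le> r_min K (bspectrum A) p q \<gamma>"
    using \<open>Y = W Y \<and> _\<close> by auto
qed

lemma solution_eq_X_solution:
  assumes "norm Y \<le> d / 2" "W Y = Y"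
  shows "Y = X_solution K A p q \<gamma>"
proof -
  have "norm (X_solution K A p q \<gamma>) \<le> d / 2" using X_solution(2) r_min_le(1) by linarith
  then show ?thesis
    using riccati_solution_unique_existence[of 1] X_solution(1) assms by (auto simp: scaleC_one)
qed

end

section \<open>Independence of the contour\<close>

text \<open>
  Uniform over all functions with the same bound, as needed for differentiating under an integral.
\<close>

lemma holomorphic_quadratic_remainder:
  assumes g: "g holomorphic_on ball u \<rho>" and M: "\<And>z. z \<in> ball u \<rho> \<Longrightarrow> norm (g z) \<le> M" and \<rho>: "\<rho> > 0"
    and h: "norm h < \<rho> / 2"
  shows "norm (g (u + h) - g u - deriv g u * h) \<le> 32 * M / \<rho>\<^sup>2 * (norm h)\<^sup>2"
    and "norm (deriv g u) \<le> 4 * M / \<rho>"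
proof -
  have M0: "M \<ge> 0" using M[of u] \<rho> by (meson centre_in_ball norm_ge_zero order_trans)
  have est: "norm ((deriv ^^ n) g z) \<le> fact n * M / (\<rho> / 4) ^ n" if z: "z \<in> ball u (\<rho> / 2)" for z n
  proof (rule Cauchy_inequality)
    have sub: "cball z (\<rho> / 4) \<subseteq> ball u \<rho>"
    proof
      fix w assume "w \<in> cball z (\<rho> / 4)"
      then have "dist u w < \<rho> / 2 + \<rho> / 4" using z dist_triangle[of u w z] by (simp add: dist_commute)
      then show "w \<in> ball u \<rho>" using \<rho> by simp
    qed
    show "g holomorphic_on ball z (\<rho> / 4)"
      using sub ball_subset_cball by (intro holomorphic_on_subset[OF g]) blast
    show "continuous_on (cball z (\<rho> / 4)) g"
      using sub by (intro holomorphic_on_imp_continuous_on holomorphic_on_subset[OF g])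
    show "0 < \<rho> / 4" using \<rho> by simp
    show "norm (g x) \<le> M" if "norm (z - x) = \<rho> / 4" for x
    proof (rule M)
      have "x \<in> cball z (\<rho> / 4)" using that by (simp add: dist_norm)
      then show "x \<in> ball u \<rho>" using sub by blast
    qed
  qed
  have u: "u \<in> ball u (\<rho> / 2)" using \<rho> by simp
  show "norm (deriv g u) \<le> 4 * M / \<rho>" using est[OF u, of 1] by (simp add: field_simps)
  have "norm ((deriv ^^ 0) g (u + h) - (\<Sum>i\<le>1. (deriv ^^ i) g u * ((u + h) - u) ^ i / fact i))
      \<le> (32 * M / \<rho>\<^sup>2) * norm ((u + h) - u) ^ Suc 1 / fact 1"
  proof (rule complex_Taylor[where S = "ball u (\<rho> / 2)"])
    show "convex (ball u (\<rho> / 2))" by simp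
    show "((deriv ^^ i) g has_field_derivative (deriv ^^ Suc i) g x) (at x within ball u (\<rho> / 2))"
      if "x \<in> ball u (\<rho> / 2)" for i x
    proof -
      have "g holomorphic_on ball u (\<rho> / 2)" using \<rho> by (intro holomorphic_on_subset[OF g]) auto
      then have "(deriv ^^ i) g holomorphic_on ball u (\<rho> / 2)" by (intro holomorphic_higher_deriv) auto
      then have "((deriv ^^ i) g has_field_derivative deriv ((deriv ^^ i) g) x) (at x)"
        using that by (intro holomorphic_derivI) auto
      then show ?thesis by (simp add: has_field_derivative_at_within)
    qed
    show "norm ((deriv ^^ Suc 1) g x) \<le> 32 * M / \<rho>\<^sup>2" if "x \<in> ball u (\<rho> / 2)" for x
      using est[OF that, of "Suc 1"] by (simp add: power2_eq_square field_simps)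
    show "u \<in> ball u (\<rho> / 2)" "u + h \<in> ball u (\<rho> / 2)" using \<rho> h by (auto simp: dist_norm)
  qed
  then show "norm (g (u + h) - g u - deriv g u * h) \<le> 32 * M / \<rho>\<^sup>2 * (norm h)\<^sup>2"
    by (simp add: algebra_simps power2_eq_square)
qed

text \<open>
  The interval integral is \<open>\<sigma>\<close> times the contour integral for the kernel times any bounded function
  that is holomorphic a little beyond the half-plane of the contour, whose sign is \<open>l\<close>.
\<close>

definition represented :: "(complex \<Rightarrow> ('b::complex_hilbert, 'b) cblinfun) \<Rightarrow> ereal \<Rightarrow> ereal \<Rightarrow> ereal \<Rightarrow> ereal \<Rightarrow>
    (real \<Rightarrow> complex) \<Rightarrow> real \<Rightarrow> complex \<Rightarrow> bool" where
  "represented K a b p q \<gamma> l \<sigma> \<longleftrightarrow> (\<forall>x y g \<delta> M. \<delta> > 0 \<longrightarrow> g holomorphic_on {z. - \<delta> < l * Im z} \<longrightarrow>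
     (\<forall>z. - \<delta> < l * Im z \<longrightarrow> norm (g z) \<le> M) \<longrightarrow>
     integral (einterval a b) (\<lambda>t. cinner (K (of_real t) *\<^sub>V x) y * g (of_real t)) =
     \<sigma> * integral (einterval p q) (\<lambda>s. vector_derivative \<gamma> (at s) * (cinner (K (\<gamma> s) *\<^sub>V x) y * g (\<gamma> s))))"

lemma Im_le_infdist:
  assumes "S \<noteq> {}" "S \<subseteq> \<real>"
  shows "\<bar>Im z\<bar> \<le> infdist z S"
  unfolding infdist_def if_not_P[OF assms(1)]
proof (rule cINF_greatest[OF assms(1)])
  fix w assume "w \<in> S"
  then have "Im w = 0" using assms(2) by (auto simp: complex_is_Real_iff)
  then show "\<bar>Im z\<bar> \<le> dist z w" using abs_Im_le_cmod[of "z - w"] by (simp add: dist_norm)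
qed

context riccati
begin

lemma form_le: "norm (cinner (K z *\<^sub>V x) y * w) \<le> norm (K z) * (norm x * norm y * norm w)"
  using mult_right_mono[OF norm_cinner_apply[of "K z" x y], of "norm w"] by (simp add: norm_mult mult.assoc)

lemma shifted_bound:
  assumes \<zeta>: "norm \<zeta> < d - r" and s: "s \<in> E" and h: "norm h < (d - r - norm \<zeta>) / 2"
  shows "(d - r - norm \<zeta>) / 2 < infdist (\<gamma> s - \<zeta> + h) (bspectrum A) - r"
proof -
  have "infdist (\<gamma> s) (bspectrum A) \<le> infdist (\<gamma> s - \<zeta> + h) (bspectrum A) + dist (\<gamma> s) (\<gamma> s - \<zeta> + h)"
    by (rule infdist_triangle)
  moreover have "dist (\<gamma> s) (\<gamma> s - \<zeta> + h) \<le> norm \<zeta> + norm h"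
    using norm_triangle_ineq4[of \<zeta> h] by (simp add: dist_norm algebra_simps)
  ultimately have "d - norm \<zeta> - norm h \<le> infdist (\<gamma> s - \<zeta> + h) (bspectrum A)" using d_le[OF s] by linarith
  then show ?thesis using h by (simp add: field_simps)
qed

text \<open>
  A translation by less than \<open>d - r\<close> keeps the contour at a distance more than \<open>r\<close> from the spectrum, so
  \<open>g\<close> may be expanded to second order at every point of the contour with a uniform remainder.
\<close>

lemma translated_integral_holomorphic:
  assumes g: "g holomorphic_on {z. r < infdist z (bspectrum A)}" and C: "C \<ge> 0"
    and g_le: "\<And>z. r < infdist z (bspectrum A) \<Longrightarrow> norm (g z) \<le> C / (infdist z (bspectrum A) - r)"
  shows "(\<lambda>\<zeta>. integral E (\<lambda>s. \<gamma>' s * (cinner (K (\<gamma> s) *\<^sub>V x) y * g (\<gamma> s - \<zeta>)))) holomorphic_on ball (0::complex) (d - r)"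
    (is "?J holomorphic_on _")
proof (rule holomorphic_onI)
  fix \<zeta> :: complex assume "\<zeta> \<in> ball 0 (d - r)"
  then have \<zeta>: "norm \<zeta> < d - r" by simp
  let ?V = "{z. r < infdist z (bspectrum A)}"
  define \<rho> where "\<rho> = (d - r - norm \<zeta>) / 2"
  have \<rho>: "\<rho> > 0" using \<zeta> by (simp add: \<rho>_def)
  define M where "M = C / \<rho>"
  have openV: "open ?V" by (intro open_Collect_less continuous_intros)
  have sub: "ball (\<gamma> s - \<zeta>) \<rho> \<subseteq> ?V" and le: "\<And>z. z \<in> ball (\<gamma> s - \<zeta>) \<rho> \<Longrightarrow> norm (g z) \<le> M" if s: "s \<in> E" for s
  proof -
    have inf: "\<rho> < infdist z (bspectrum A) - r" if "z \<in> ball (\<gamma> s - \<zeta>) \<rho>" for z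
      using shifted_bound[OF \<zeta> s, of "z - (\<gamma> s - \<zeta>)"] that by (simp add: \<rho>_def dist_norm norm_minus_commute)
    then show "ball (\<gamma> s - \<zeta>) \<rho> \<subseteq> ?V" using \<rho> by force
    fix z assume z: "z \<in> ball (\<gamma> s - \<zeta>) \<rho>"
    have "norm (g z) \<le> C / (infdist z (bspectrum A) - r)" using inf[OF z] \<rho> by (intro g_le) simp
    also have "\<dots> \<le> M" unfolding M_def using inf[OF z] \<rho> C by (intro divide_left_mono) auto
    finally show "norm (g z) \<le> M" .
  qed
  let ?k = "\<lambda>z. cinner (K z *\<^sub>V x) y"
  have cont_g: "continuous_on (\<gamma> ` E) (\<lambda>z. g (z - \<zeta> + h))" if h: "norm h < \<rho>" for h
  proof (rule continuous_on_compose2[OF holomorphic_on_imp_continuous_on[OF g]])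
    show "(\<lambda>z. z - \<zeta> + h) ` \<gamma> ` E \<subseteq> ?V"
    proof (safe, goal_cases)
      case (1 _ _ s)
      then show ?case using shifted_bound[OF \<zeta>, of s h] h \<rho> by (simp add: \<rho>_def)
    qed
  qed (intro continuous_intros)
  have cont_g': "continuous_on (\<gamma> ` E) (\<lambda>z. deriv g (z - \<zeta>))"
  proof (rule continuous_on_compose2[OF holomorphic_on_imp_continuous_on[OF holomorphic_deriv[OF g openV]]])
    show "(\<lambda>z. z - \<zeta>) ` \<gamma> ` E \<subseteq> ?V"
    proof (safe, goal_cases)
      case (1 _ _ s)
      then show ?case using shifted_bound[OF \<zeta>, of s 0] \<rho> by (simp add: \<rho>_def)
    qed
  qed (intro continuous_intros)
  have int: "(\<lambda>s. \<gamma>' s * (?k (\<gamma> s) * g (\<gamma> s - \<zeta> + h))) integrable_on E" if h: "norm h < \<rho>" for h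
  proof -
    have "(\<lambda>s. \<gamma>' s * (\<lambda>z. ?k z * g (z - \<zeta> + h)) (\<gamma> s)) absolutely_integrable_on E"
    proof (rule curve_form_bound(1))
      show "continuous_on (\<gamma> ` E) (\<lambda>z. ?k z * g (z - \<zeta> + h))" by (intro continuous_on_mult K_cont cont_g h)
      fix s assume s: "s \<in> E"
      have "norm (g (\<gamma> s - \<zeta> + h)) \<le> M" using h by (intro le[OF s]) (simp add: dist_norm)
      then show "norm (?k (\<gamma> s) * g (\<gamma> s - \<zeta> + h)) \<le> norm (K (\<gamma> s)) * (norm x * norm y * M)"
        by (intro order_trans[OF form_le] mult_left_mono) auto
    qed
    then show ?thesis by (simp add: absolutely_integrable_on_def)
  qed
  have int': "(\<lambda>s. \<gamma>' s * (?k (\<gamma> s) * deriv g (\<gamma> s - \<zeta>))) integrable_on E"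
  proof -
    have "(\<lambda>s. \<gamma>' s * (\<lambda>z. ?k z * deriv g (z - \<zeta>)) (\<gamma> s)) absolutely_integrable_on E"
    proof (rule curve_form_bound(1))
      show "continuous_on (\<gamma> ` E) (\<lambda>z. ?k z * deriv g (z - \<zeta>))" by (intro continuous_on_mult K_cont cont_g')
      fix s assume s: "s \<in> E"
      have "norm (deriv g (\<gamma> s - \<zeta>)) \<le> 4 * M / \<rho>"
        by (rule holomorphic_quadratic_remainder(2)[OF holomorphic_on_subset[OF g sub[OF s]] le[OF s] \<rho>, of 0]) (use \<rho> in auto)
      then show "norm (?k (\<gamma> s) * deriv g (\<gamma> s - \<zeta>)) \<le> norm (K (\<gamma> s)) * (norm x * norm y * (4 * M / \<rho>))"
        by (intro order_trans[OF form_le] mult_left_mono) auto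
    qed
    then show ?thesis by (simp add: absolutely_integrable_on_def)
  qed
  define D where "D = integral E (\<lambda>s. \<gamma>' s * (?k (\<gamma> s) * deriv g (\<gamma> s - \<zeta>)))"
  define L where "L = V * (norm x * norm y * (32 * M / \<rho>\<^sup>2))"
  have remainder: "norm (?J (\<zeta> + h) - ?J \<zeta> + h * D) \<le> L * (norm h)\<^sup>2" if h: "norm h < \<rho> / 2" for h
  proof -
    have h': "norm (- h) < \<rho>" "norm (0 :: complex) < \<rho>" using h \<rho> by auto
    define F where "F z = ?k z * (g (z - \<zeta> - h) - g (z - \<zeta>) - deriv g (z - \<zeta>) * (- h))" for z
    have "?J (\<zeta> + h) - ?J \<zeta> + h * D = integral E (\<lambda>s. \<gamma>' s * F (\<gamma> s))"
    proof -
      have "((\<lambda>s. \<gamma>' s * (?k (\<gamma> s) * g (\<gamma> s - \<zeta> + - h)) - \<gamma>' s * (?k (\<gamma> s) * g (\<gamma> s - \<zeta> + 0)) + h * (\<gamma>' s * (?k (\<gamma> s) * deriv g (\<gamma> s - \<zeta>))))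
          has_integral (?J (\<zeta> + h) - ?J \<zeta> + h * D)) E"
        unfolding D_def
        using integrable_integral[OF int[OF h'(1)]] integrable_integral[OF int[OF h'(2)]] integrable_integral[OF int']
        by (intro has_integral_add has_integral_diff has_integral_mult_right) (simp_all add: diff_diff_eq)
      moreover have "\<gamma>' s * (?k (\<gamma> s) * g (\<gamma> s - \<zeta> + - h)) - \<gamma>' s * (?k (\<gamma> s) * g (\<gamma> s - \<zeta> + 0)) + h * (\<gamma>' s * (?k (\<gamma> s) * deriv g (\<gamma> s - \<zeta>)))
          = \<gamma>' s * F (\<gamma> s)" for s
        by (simp add: F_def algebra_simps)
      ultimately have "((\<lambda>s. \<gamma>' s * F (\<gamma> s)) has_integral (?J (\<zeta> + h) - ?J \<zeta> + h * D)) E" by (simp only:)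
      then show ?thesis by (simp only: integral_unique)
    qed
    also have "norm \<dots> \<le> V * (norm x * norm y * (32 * M / \<rho>\<^sup>2 * (norm h)\<^sup>2))"
    proof (rule curve_form_bound(2))
      show "continuous_on (\<gamma> ` E) F" unfolding F_def
        using cont_g[OF h'(1)] cont_g[OF h'(2)] by (intro continuous_intros K_cont cont_g') simp_all
      fix s assume s: "s \<in> E"
      have "norm (g (\<gamma> s - \<zeta> + - h) - g (\<gamma> s - \<zeta>) - deriv g (\<gamma> s - \<zeta>) * (- h)) \<le> 32 * M / \<rho>\<^sup>2 * (norm (- h))\<^sup>2"
        by (rule holomorphic_quadratic_remainder(1)[OF holomorphic_on_subset[OF g sub[OF s]] le[OF s] \<rho>]) (use h in auto)
      then show "norm (F (\<gamma> s)) \<le> norm (K (\<gamma> s)) * (norm x * norm y * (32 * M / \<rho>\<^sup>2 * (norm h)\<^sup>2))"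
        unfolding F_def by (intro order_trans[OF form_le] mult_left_mono) auto
    qed
    finally show ?thesis by (simp add: L_def mult.assoc)
  qed
  have "((\<lambda>h. (?J (\<zeta> + h) - ?J \<zeta>) / h) \<longlongrightarrow> - D) (at 0)"
  proof (rule LIM_zero_cancel, rule Lim_null_comparison)
    have "\<forall>\<^sub>F h in at (0::complex). norm h < \<rho> / 2" using \<rho> by (auto simp: eventually_at dist_norm intro!: exI[of _ "\<rho> / 2"])
    moreover have "\<forall>\<^sub>F h in at (0::complex). h \<noteq> 0" by (simp add: eventually_at_filter)
    ultimately show "\<forall>\<^sub>F h in at 0. norm ((?J (\<zeta> + h) - ?J \<zeta>) / h - - D) \<le> L * norm h"
    proof eventually_elim
      case (elim h)
      have "(?J (\<zeta> + h) - ?J \<zeta>) / h - - D = (?J (\<zeta> + h) - ?J \<zeta> + h * D) / h"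
        using elim(2) by (simp add: field_simps)
      then have "norm ((?J (\<zeta> + h) - ?J \<zeta>) / h - - D) = norm (?J (\<zeta> + h) - ?J \<zeta> + h * D) / norm h"
        by (simp only: norm_divide)
      also have "\<dots> \<le> L * (norm h)\<^sup>2 / norm h" by (intro divide_right_mono remainder elim) simp
      finally show ?case using elim(2) by (simp add: power2_eq_square)
    qed
    have "((\<lambda>h::complex. L * norm h) \<longlongrightarrow> L * norm (0::complex)) (at 0)" by (intro tendsto_intros)
    then show "((\<lambda>h::complex. L * norm h) \<longlongrightarrow> 0) (at 0)" by simp
  qed
  then have "(?J has_field_derivative - D) (at \<zeta>)" by (simp add: DERIV_def)
  then show "?J field_differentiable at \<zeta> within ball 0 (d - r)"
    by (meson field_differentiable_at_within field_differentiable_def)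
qed

lemma W_form_expand:
  assumes "norm X < d"
  shows "cinner (W X *\<^sub>V x) y = - (\<Sum>f\<in>B. integral E (\<lambda>s. \<gamma>' s * (cinner (K (\<gamma> s) *\<^sub>V f) y * cinner (resolvent (A + X) (\<gamma> s) *\<^sub>V x) f)))"
proof -
  have fin: "finite B" using B by (simp add: orthonormal_basis_def)
  have sub: "\<gamma> ` E \<subseteq> {z. norm X < infdist z (bspectrum A)}" using d_le assms by fastforce
  have int: "(\<lambda>s. \<gamma>' s * (cinner (K (\<gamma> s) *\<^sub>V f) y * cinner (resolvent (A + X) (\<gamma> s) *\<^sub>V x) f)) integrable_on E" for f
  proof -
    have "(\<lambda>s. \<gamma>' s * (\<lambda>z. cinner (K z *\<^sub>V f) y * cinner (resolvent (A + X) z *\<^sub>V x) f) (\<gamma> s)) absolutely_integrable_on E"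
    proof (rule curve_form_bound(1))
      show "continuous_on (\<gamma> ` E) (\<lambda>z. cinner (K z *\<^sub>V f) y * cinner (resolvent (A + X) z *\<^sub>V x) f)"
        using holomorphic_on_imp_continuous_on[OF resolvent_holomorphic[OF order_refl]] continuous_on_subset[OF _ sub]
        by (intro continuous_on_mult K_cont) blast
      fix s assume s: "s \<in> E"
      have "norm (cinner (resolvent (A + X) (\<gamma> s) *\<^sub>V x) f) \<le> norm (resolvent (A + X) (\<gamma> s)) * norm x * norm f"
        by (rule norm_cinner_apply)
      also have "\<dots> \<le> 1 / (d - norm X) * norm x * norm f"
        by (intro mult_right_mono norm_resolvent_on_curve[OF assms s]) auto
      finally show "norm (cinner (K (\<gamma> s) *\<^sub>V f) y * cinner (resolvent (A + X) (\<gamma> s) *\<^sub>V x) f)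
          \<le> norm (K (\<gamma> s)) * (norm f * norm y * (1 / (d - norm X) * norm x * norm f))"
        by (intro order_trans[OF form_le] mult_left_mono) auto
    qed
    then show ?thesis by (simp add: absolutely_integrable_on_def)
  qed
  show ?thesis
    unfolding W_form[OF assms] form_expand sum_distrib_left by (subst integral_sum[OF fin int]) (rule refl)
qed

text \<open>
  Here \<open>\<zeta>\<close> moves the \<open>r\<close>-neighbourhood of the real spectrum, where \<open>g\<close> may be singular, completely to
  the side of the real axis opposite to the contour.
\<close>

lemma represented_translated:
  assumes rep: "represented K a b p q \<gamma> l \<sigma>" and l: "l = 1 \<or> l = -1"
    and g: "g holomorphic_on {z. r < infdist z (bspectrum A)}" and C: "C \<ge> 0" and r: "r \<ge> 0"
    and g_le: "\<And>z. r < infdist z (bspectrum A) \<Longrightarrow> norm (g z) \<le> C / (infdist z (bspectrum A) - r)"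
    and \<zeta>: "r < - l * Im \<zeta>"
  shows "integral (einterval a b) (\<lambda>t. cinner (K (of_real t) *\<^sub>V x) y * g (of_real t - \<zeta>)) =
    \<sigma> * integral E (\<lambda>s. \<gamma>' s * (cinner (K (\<gamma> s) *\<^sub>V x) y * g (\<gamma> s - \<zeta>)))"
proof -
  define \<delta> where "\<delta> = (- l * Im \<zeta> - r) / 2"
  have \<delta>: "\<delta> > 0" using \<zeta> by (simp add: \<delta>_def)
  have far: "\<delta> < infdist (z - \<zeta>) (bspectrum A) - r" if "- \<delta> < l * Im z" for z
  proof -
    have "- l * Im \<zeta> - \<delta> < l * Im (z - \<zeta>)" using that by (simp add: algebra_simps)
    also have "\<dots> \<le> \<bar>Im (z - \<zeta>)\<bar>" using l by auto
    also have "\<dots> \<le> infdist (z - \<zeta>) (bspectrum A)" by (rule Im_le_infdist[OF spectrum_nonempty A_real])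
    finally show ?thesis by (simp add: \<delta>_def field_simps)
  qed
  have "(g \<circ> (\<lambda>z. z - \<zeta>)) holomorphic_on {z. - \<delta> < l * Im z}"
    using far \<delta> by (intro holomorphic_on_compose_gen[OF _ g] holomorphic_intros) force
  then have hol: "(\<lambda>z. g (z - \<zeta>)) holomorphic_on {z. - \<delta> < l * Im z}" by (simp add: o_def)
  have bd: "\<forall>z. - \<delta> < l * Im z \<longrightarrow> norm (g (z - \<zeta>)) \<le> C / \<delta>"
  proof (intro allI impI)
    fix z assume z: "- \<delta> < l * Im z"
    have "norm (g (z - \<zeta>)) \<le> C / (infdist (z - \<zeta>) (bspectrum A) - r)" using far[OF z] \<delta> by (intro g_le) simp
    also have "\<dots> \<le> C / \<delta>" using far[OF z] \<delta> C by (intro divide_left_mono) auto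
    finally show "norm (g (z - \<zeta>)) \<le> C / \<delta>" .
  qed
  show ?thesis using rep[unfolded represented_def, rule_format, OF \<delta> hol bd[rule_format]] .
qed

end

locale riccati_pair = c1: riccati p q \<gamma> A B K + c2: riccati p2 q2 \<gamma>2 A B K
  for p q \<gamma> p2 q2 \<gamma>2 and A :: "('b::complex_hilbert, 'b) cblinfun" and B K
begin

text \<open>
  Identity theorem in the translation \<open>\<zeta>\<close>. The part of the disc where both sides equal the interval
  integral is nonempty because \<open>r\<close> is less than half of both distances.
\<close>

lemma form_integrals_agree:
  assumes rep: "represented K a b p q \<gamma> l \<sigma>1" "represented K a b p2 q2 \<gamma>2 l \<sigma>2" and l: "l = 1 \<or> l = -1"
    and g: "g holomorphic_on {z. r < infdist z (bspectrum A)}" and C: "C \<ge> 0" and r: "r \<ge> 0"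
    and g_le: "\<And>z. r < infdist z (bspectrum A) \<Longrightarrow> norm (g z) \<le> C / (infdist z (bspectrum A) - r)"
    and small: "r < c1.d / 2" "r < c2.d / 2"
  shows "\<sigma>1 * integral c1.E (\<lambda>s. c1.\<gamma>' s * (cinner (K (\<gamma> s) *\<^sub>V x) y * g (\<gamma> s))) =
    \<sigma>2 * integral c2.E (\<lambda>s. c2.\<gamma>' s * (cinner (K (\<gamma>2 s) *\<^sub>V x) y * g (\<gamma>2 s)))"
proof -
  define \<rho> where "\<rho> = min c1.d c2.d - r"
  have \<rho>: "r < \<rho>" using small by (auto simp: \<rho>_def)
  let ?J1 = "\<lambda>\<zeta>. \<sigma>1 * integral c1.E (\<lambda>s. c1.\<gamma>' s * (cinner (K (\<gamma> s) *\<^sub>V x) y * g (\<gamma> s - \<zeta>)))"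
  let ?J2 = "\<lambda>\<zeta>. \<sigma>2 * integral c2.E (\<lambda>s. c2.\<gamma>' s * (cinner (K (\<gamma>2 s) *\<^sub>V x) y * g (\<gamma>2 s - \<zeta>)))"
  let ?S = "ball 0 \<rho> \<inter> {\<zeta>. r < - l * Im \<zeta>}"
  have "?J1 0 = ?J2 0"
  proof (rule analytic_continuation_open[of ?S "ball 0 \<rho>" ?J1 ?J2])
    show "open ?S" by (intro open_Int open_ball open_Collect_less continuous_intros)
    show "connected (ball (0::complex) \<rho>)" by simp
    define \<zeta> where "\<zeta> = \<i> * of_real (- l * (r + \<rho>) / 2)"
    have "norm \<zeta> = (r + \<rho>) / 2" unfolding \<zeta>_def norm_mult norm_ii norm_of_real using l \<rho> r by auto
    moreover have "- l * Im \<zeta> = (r + \<rho>) / 2" using l by (auto simp: \<zeta>_def)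
    ultimately have "\<zeta> \<in> ?S" using \<rho> by simp
    then show "?S \<noteq> {}" by blast
    show "?J1 holomorphic_on ball 0 \<rho>"
      by (intro holomorphic_intros holomorphic_on_subset[OF c1.translated_integral_holomorphic[OF g C g_le]])
        (auto simp: \<rho>_def)
    show "?J2 holomorphic_on ball 0 \<rho>"
      by (intro holomorphic_intros holomorphic_on_subset[OF c2.translated_integral_holomorphic[OF g C g_le]])
        (auto simp: \<rho>_def)
    show "?J1 \<zeta> = ?J2 \<zeta>" if "\<zeta> \<in> ?S" for \<zeta>
      using c1.represented_translated[OF rep(1) l g C r g_le, of \<zeta> x y]
        c2.represented_translated[OF rep(2) l g C r g_le, of \<zeta> x y] that by simp
  qed (use \<rho> r in auto)
  then show ?thesis by simp
qed

text \<open>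
  The previous lemma for the entries of the resolvent of \<open>A + X\<close>, which are holomorphic at distance more than
  \<open>\<parallel>X\<parallel>\<close> from the spectrum.
\<close>

lemma W_agree:
  assumes rep: "represented K a b p q \<gamma> l \<sigma>1" "represented K a b p2 q2 \<gamma>2 l \<sigma>2" and l: "l = 1 \<or> l = -1"
    and small: "norm X < c1.d / 2" "norm X < c2.d / 2"
  shows "\<sigma>1 *\<^sub>C c1.W X = \<sigma>2 *\<^sub>C c2.W X"
proof (rule cblinfun_ext_form)
  fix x y
  have X1: "norm X < c1.d" and X2: "norm X < c2.d" using small c1.d_pos c2.d_pos by auto
  let ?g = "\<lambda>f z. cinner (resolvent (A + X) z *\<^sub>V x) f"
  have g: "?g f holomorphic_on {z. norm X < infdist z (bspectrum A)}" for f
    by (rule c1.resolvent_holomorphic[OF order_refl])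
  have g_le: "norm (?g f z) \<le> norm x * norm f / (infdist z (bspectrum A) - norm X)"
    if "norm X < infdist z (bspectrum A)" for f z
  proof -
    have "norm (?g f z) \<le> norm (resolvent (A + X) z) * norm x * norm f" by (rule norm_cinner_apply)
    also have "\<dots> \<le> 1 / (infdist z (bspectrum A) - norm X) * norm x * norm f"
      by (intro mult_right_mono c1.perturbed_resolvent(3)[OF order_refl that]) auto
    finally show ?thesis by simp
  qed
  have eq: "\<sigma>1 * integral c1.E (\<lambda>s. c1.\<gamma>' s * (cinner (K (\<gamma> s) *\<^sub>V f) y * ?g f (\<gamma> s))) =
     \<sigma>2 * integral c2.E (\<lambda>s. c2.\<gamma>' s * (cinner (K (\<gamma>2 s) *\<^sub>V f) y * ?g f (\<gamma>2 s)))" for f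
    by (rule form_integrals_agree[OF rep l g _ norm_ge_zero g_le small]) simp_all
  show "cinner ((\<sigma>1 *\<^sub>C c1.W X) *\<^sub>V x) y = cinner ((\<sigma>2 *\<^sub>C c2.W X) *\<^sub>V x) y"
    by (simp add: cinner_scaleC_left c1.W_form_expand[OF X1] c2.W_form_expand[OF X2] sum_distrib_left eq)
qed

end

section \<open>Contours in the two half-planes\<close>

lemma contour_unit_speed: "contour K D a b p q \<gamma> \<Longrightarrow> unit_speed_curve p q \<gamma>"
  by (simp add: contour_def unit_speed_curve_def)

lemma contour_deformed:
  assumes c: "contour K D a b p q \<gamma>" and "a < b" "open D" "D \<subseteq> {z. Im z < 0}" "simply_connected D"
  obtains H \<phi> where "deformed_contour D a b H p q \<gamma> \<phi>"
    "a = -\<infinity> \<Longrightarrow> deformation_at_infinity K H at_bot" "b = \<infinity> \<Longrightarrow> deformation_at_infinity K H at_top"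
proof -
  obtain H \<phi> where \<phi>: "continuous_on (einterval a b) \<phi>" "strict_mono_on (einterval a b) \<phi>" "\<phi> ` einterval a b = einterval p q"
    and H: "deformation_of_interval K D a b H (\<lambda>t. \<gamma> (\<phi> t))"
    using c unfolding contour_def by blast
  have H1: "H 1 t = \<gamma> (\<phi> t)" "H 0 t = of_real t" if "t \<in> einterval a b" for t
    using H that by (auto simp: deformation_of_interval_def)
  have \<gamma>D: "\<gamma> ` einterval p q \<subseteq> D" using c by (simp add: contour_def)
  have "deformed_contour D a b H p q \<gamma> \<phi>"
  proof (intro deformed_contour.intro deformed_contour_axioms.intro contour_unit_speed[OF c] swept_interval.intro)
    show "H 1 t \<in> D" if "t \<in> einterval a b" for t using H1(1)[OF that] \<gamma>D \<phi>(3) that by blast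
    show "uniform_limit {0..1} (\<lambda>t s. H s t) (\<lambda>_. complex_of_real c) (at c within einterval a b)" if "is_end a b c" for c
      using H that by (simp add: deformation_of_interval_def)
    show "\<forall>\<^sub>F t in at_bot. \<forall>s\<in>{0..1}. R \<le> cmod (H s t)" if "a = -\<infinity>" for R
      using H that by (simp add: deformation_of_interval_def deformation_at_infinity_def)
    show "\<forall>\<^sub>F t in at_top. \<forall>s\<in>{0..1}. R \<le> cmod (H s t)" if "b = \<infinity>" for R
      using H that by (simp add: deformation_of_interval_def deformation_at_infinity_def)
    show "H s t \<in> D \<union> of_real ` einterval a b" if "s \<in> {0..1}" "t \<in> einterval a b" for s t
      using H that unfolding deformation_of_interval_def by blast
    show "continuous_on ({0..1} \<times> einterval a b) (\<lambda>(s, t). H s t)"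
      using H by (simp add: deformation_of_interval_def)
  qed (use assms H1 \<phi> in auto)
  moreover have "a = -\<infinity> \<Longrightarrow> deformation_at_infinity K H at_bot" "b = \<infinity> \<Longrightarrow> deformation_at_infinity K H at_top"
    using H by (auto simp: deformation_of_interval_def)
  ultimately show ?thesis by (rule that)
qed

lemma contour_near_end:
  assumes c: "contour K D a b p q \<gamma>" "a < b" "open D" "D \<subseteq> {z. Im z < 0}" "simply_connected D"
    and e: "is_end a b e" "\<epsilon> > 0"
  shows "\<exists>s\<in>einterval p q. norm (\<gamma> s - of_real e) < \<epsilon>"
proof -
  obtain H \<phi> where H: "deformed_contour D a b H p q \<gamma> \<phi>"
    by (rule contour_deformed[OF c], rule that, assumption)
  interpret deformed_contour D a b H p q \<gamma> \<phi> by (rule H)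
  obtain t where t: "t \<in> I" "norm (H 1 t - of_real e) < \<epsilon>" using near_finite_end[OF e] by blast
  then have "norm (\<gamma> (\<phi> t) - of_real e) < \<epsilon>" using H_1_curve[OF t(1)] by simp
  moreover have "\<phi> t \<in> E" using t(1) \<phi>_image by blast
  ultimately show ?thesis by blast
qed

text \<open>
  At a finite end point \<open>\<parallel>K(z)\<parallel>\<close> is \<open>O(\<bar>z - c\<bar>\<^sup>\<alpha>)\<close> with \<open>\<alpha> > -1\<close>, so \<open>(z - c) K(z)\<close> tends to 0; at an
  infinite one the deformation controls the growth of \<open>K\<close>.
\<close>

lemma represented_lower:
  fixes K :: "complex \<Rightarrow> ('b::complex_hilbert, 'b) cblinfun"
  assumes c: "contour K D a b p q \<gamma>" "a < b" "open D" "D \<subseteq> {z. Im z < 0}" "simply_connected D"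
    and hol: "\<And>x y. (\<lambda>z. cinner (K z *\<^sub>V x) y) holomorphic_on D"
    and cont: "\<And>x y. continuous_on (D \<union> of_real ` einterval a b) (\<lambda>z. cinner (K z *\<^sub>V x) y)"
    and ends: "\<And>c. is_end a b c \<Longrightarrow> \<exists>C \<alpha>. -1 < \<alpha> \<and>
      (\<forall>\<^sub>F z in at (of_real c) within D. norm (K z) \<le> C * norm (z - of_real c) powr \<alpha>)"
    and int_I: "\<And>x y. (\<lambda>t. cinner (K (of_real t) *\<^sub>V x) y) absolutely_integrable_on einterval a b"
    and int_E: "set_integrable lborel (einterval p q) (\<lambda>s. norm (K (\<gamma> s)))"
  shows "\<exists>\<sigma>\<in>{0, 1, -1}. represented K a b p q \<gamma> (-1) \<sigma>"
proof -
  obtain H \<phi> where H: "deformed_contour D a b H p q \<gamma> \<phi>"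
    "a = -\<infinity> \<Longrightarrow> deformation_at_infinity K H at_bot" "b = \<infinity> \<Longrightarrow> deformation_at_infinity K H at_top"
  proof (rule contour_deformed[OF c], goal_cases)
    case (1 H \<phi>)
    show ?case by (rule that) (fact 1)+
  qed
  interpret deformed_contour D a b H p q \<gamma> \<phi> by (rule H)
  obtain \<sigma> where \<sigma>: "\<sigma> \<in> {0, 1, -1}" "orientation \<sigma>" using orientation_exists by blast
  have "represented K a b p q \<gamma> (-1) \<sigma>"
    unfolding represented_def
  proof (intro allI impI)
    fix x y g \<delta> M
    assume \<delta>: "(\<delta>::real) > 0" and g: "g holomorphic_on {z. - \<delta> < - 1 * Im z}"
      and gM: "\<forall>z. - \<delta> < - 1 * Im z \<longrightarrow> norm (g z) \<le> M"
    have g_le: "norm (g z) \<le> M" if "Im z \<le> 0" for z using gM \<delta> that by simp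
    have M: "M \<ge> 0" using g_le[of 0] norm_ge_zero[of "g 0"] by (simp del: norm_ge_zero)
    let ?k = "\<lambda>z. cinner (K z *\<^sub>V x) y"
    define N where "N = norm x * norm y * M"
    have N: "N \<ge> 0" using M by (simp add: N_def)
    have F_le: "norm (?k z * g z) \<le> norm (K z) * N" if "Im z \<le> 0" for z
    proof -
      have "norm (?k z * g z) \<le> (norm (K z) * norm x * norm y) * M"
        unfolding norm_mult by (intro mult_mono norm_cinner_apply g_le that) auto
      then show ?thesis by (simp add: N_def mult.assoc)
    qed
    have low: "D \<union> of_real ` I \<subseteq> {z. - \<delta> < - 1 * Im z}" "\<And>z. z \<in> D \<union> of_real ` I \<Longrightarrow> Im z \<le> 0"
      using D_lower \<delta> by auto
    have contF: "continuous_on (D \<union> of_real ` I) (\<lambda>z. ?k z * g z)"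
      by (intro continuous_on_mult cont holomorphic_on_imp_continuous_on holomorphic_on_subset[OF g low(1)])
    show "integral I (\<lambda>t. ?k (of_real t) * g (of_real t)) = \<sigma> * integral E (\<lambda>s. \<gamma>' s * (?k (\<gamma> s) * g (\<gamma> s)))"
    proof (rule integral_interval_eq_curve[OF \<sigma>(2), where F = "\<lambda>z. ?k z * g z" and k = "\<lambda>s. norm (K (\<gamma> s)) * N"])
      show "(\<lambda>z. ?k z * g z) holomorphic_on D"
        using low(1) by (intro holomorphic_on_mult hol holomorphic_on_subset[OF g]) blast
      show "continuous_on (D \<union> of_real ` I) (\<lambda>z. ?k z * g z)" by (rule contF)
    next
      fix c assume c: "is_end a b c"
      obtain C \<alpha> where \<alpha>: "-1 < \<alpha>" and ev: "\<forall>\<^sub>F z in at (of_real c) within D. norm (K z) \<le> C * norm (z - of_real c) powr \<alpha>"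
        using ends[OF c] by blast
      show "((\<lambda>z. (z - of_real c) * (?k z * g z)) \<longlongrightarrow> 0) (at (of_real c) within D)"
      proof (rule Lim_null_comparison)
        have "\<forall>\<^sub>F z in at (of_real c) within D. z \<in> D \<and> z \<noteq> of_real c" by (simp add: eventually_at_filter)
        with ev show "\<forall>\<^sub>F z in at (of_real c) within D.
            norm ((z - of_real c) * (?k z * g z)) \<le> norm (z - of_real c) powr (1 + \<alpha>) * (C * N)"
        proof eventually_elim
          case (elim z)
          then have z: "Im z \<le> 0" "norm (z - of_real c) > 0" using low(2) by auto
          have "norm ((z - of_real c) * (?k z * g z)) \<le> norm (z - of_real c) * (norm (K z) * N)"
            unfolding norm_mult[of "z - of_real c"] by (intro mult_left_mono F_le z) simp
          also have "\<dots> \<le> norm (z - of_real c) * ((C * norm (z - of_real c) powr \<alpha>) * N)"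
            using elim N by (intro mult_left_mono mult_right_mono) auto
          also have "\<dots> = norm (z - of_real c) powr (1 + \<alpha>) * (C * N)" using z(2) by (simp add: powr_add)
          finally show ?case .
        qed
        have "((\<lambda>z. norm (z - of_real c)) \<longlongrightarrow> norm (of_real c - complex_of_real c)) (at (of_real c) within D)"
          by (intro tendsto_intros)
        then have "((\<lambda>z. norm (z - of_real c)) \<longlongrightarrow> 0) (at (of_real c) within D)" by simp
        from tendsto_zero_powrI[OF this tendsto_const[of "1 + \<alpha>"]]
        have "((\<lambda>z. norm (z - of_real c) powr (1 + \<alpha>)) \<longlongrightarrow> 0) (at (of_real c) within D)" using \<alpha> by simp
        from tendsto_mult_left_zero[OF this]
        show "((\<lambda>z. norm (z - of_real c) powr (1 + \<alpha>) * (C * N)) \<longlongrightarrow> 0) (at (of_real c) within D)" .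
      qed
    next
      have ex: "\<exists>M C \<rho>. \<rho> < 1 \<and> (\<forall>\<^sub>F t in F. \<forall>s\<in>{0..1}. norm (?k (H s t) * g (H s t)) \<le> M * exp (C * norm (H s t) powr \<rho>))"
        if inf: "deformation_at_infinity K H F" and F: "\<forall>\<^sub>F t in F. t \<in> I" for F
      proof -
        obtain C \<rho> where \<rho>: "\<rho> < 1" "\<forall>\<^sub>F t in F. \<forall>s\<in>{0..1}. norm (K (H s t)) \<le> exp (C * norm (H s t) powr \<rho>)"
          using inf unfolding deformation_at_infinity_def by blast
        have "\<forall>\<^sub>F t in F. \<forall>s\<in>{0..1}. norm (?k (H s t) * g (H s t)) \<le> N * exp (C * norm (H s t) powr \<rho>)"
          using \<rho>(2) F
        proof eventually_elim
          case (elim t)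
          show ?case
          proof
            fix s :: real assume s: "s \<in> {0..1}"
            have "norm (?k (H s t) * g (H s t)) \<le> norm (K (H s t)) * N"
              by (rule F_le[OF H_lower[OF s elim(2)]])
            also have "\<dots> \<le> exp (C * norm (H s t) powr \<rho>) * N"
              using elim(1) s N by (intro mult_right_mono) blast+
            finally show "norm (?k (H s t) * g (H s t)) \<le> N * exp (C * norm (H s t) powr \<rho>)" by (simp add: mult.commute)
          qed
        qed
        then show ?thesis using \<rho>(1) by blast
      qed
      obtain t0 where t0: "t0 \<in> I" using einterval_nonempty[OF ab] by auto
      have bot: "\<forall>\<^sub>F t in at_bot. t \<in> I" if "a = -\<infinity>"
        unfolding eventually_at_bot_linorder
      proof (intro exI[of _ t0] allI impI)
        fix t assume "t \<le> t0"
        then have "ereal t < b" using t0 le_less_trans[of "ereal t" "ereal t0" b] by (simp add: einterval_def)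
        then show "t \<in> I" using that by (simp add: einterval_def)
      qed
      have top: "\<forall>\<^sub>F t in at_top. t \<in> I" if "b = \<infinity>"
        unfolding eventually_at_top_linorder
      proof (intro exI[of _ t0] allI impI)
        fix t assume "t0 \<le> t"
        then have "a < ereal t" using t0 less_le_trans[of a "ereal t0" "ereal t"] by (simp add: einterval_def)
        then show "t \<in> I" using that by (simp add: einterval_def)
      qed
      show "subexponential (\<lambda>z. ?k z * g z)"
        unfolding subexponential_def using ex[OF H(2) bot] ex[OF H(3) top] by blast
    next
      have cI: "continuous_on I (\<lambda>t. ?k (of_real t) * g (of_real t))"
        by (rule continuous_on_compose2[OF contF]) (auto intro: continuous_intros)
      show "(\<lambda>t. ?k (of_real t) * g (of_real t)) absolutely_integrable_on I"
      proof (rule measurable_bounded_by_integrable_imp_absolutely_integrable)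
        show "(\<lambda>t. ?k (of_real t) * g (of_real t)) \<in> borel_measurable (lebesgue_on I)"
          using cI by (rule continuous_imp_measurable_on_sets_lebesgue) auto
        show "(\<lambda>t. norm (?k (of_real t)) * M) integrable_on I"
          using int_I[of x y] by (intro integrable_on_mult_left) (simp add: absolutely_integrable_on_def)
        show "norm (?k (of_real t) * g (of_real t)) \<le> norm (?k (of_real t)) * M" for t
          unfolding norm_mult by (intro mult_left_mono g_le) auto
      qed simp
      show "(\<lambda>s. norm (K (\<gamma> s)) * N) integrable_on E"
        using set_borel_integral_eq_integral(1)[OF int_E] by (rule integrable_on_mult_left)
      show "norm (?k (\<gamma> s) * g (\<gamma> s)) \<le> norm (K (\<gamma> s)) * N" if "s \<in> E" for s
        using curve_in_D low(2) that by (intro F_le) blast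
    qed
  qed
  then show ?thesis using \<sigma>(1) by blast
qed

lemma vector_derivative_cnj:
  assumes "(\<gamma> has_vector_derivative v) (at s)"
  shows "((\<lambda>s. cnj (\<gamma> s)) has_vector_derivative cnj v) (at s)"
  using bounded_linear.has_vector_derivative[OF bounded_linear_cnj assms] .

lemma contour_cnj:
  fixes K :: "complex \<Rightarrow> ('b::complex_hilbert, 'b) cblinfun"
  assumes c: "contour K (cnj ` D) a b p q \<gamma>"
    and K: "\<And>z. z \<in> D \<Longrightarrow> norm (K (cnj z)) = norm (K z)"
  shows "contour K D a b p q (\<lambda>s. cnj (\<gamma> s))"
proof -
  interpret unit_speed_curve p q \<gamma> by (rule contour_unit_speed[OF c])
  obtain H \<phi> where \<phi>: "continuous_on (einterval a b) \<phi>" "strict_mono_on (einterval a b) \<phi>" "\<phi> ` einterval a b = einterval p q"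
    and H: "deformation_of_interval K (cnj ` D) a b H (\<lambda>t. \<gamma> (\<phi> t))"
    using c unfolding contour_def by blast
  have Hin: "H s t \<in> cnj ` D \<union> of_real ` einterval a b" if "s \<in> {0..1}" "t \<in> einterval a b" for s t
    using H that unfolding deformation_of_interval_def by blast
  have normK: "norm (K (cnj z)) = norm (K z)" if "z \<in> cnj ` D \<union> of_real ` einterval a b" for z
    using that K by fastforce
  have ne: "einterval a b \<noteq> {}" using \<phi>(3) einterval_nonempty[OF pq] by auto
  have bot: "\<forall>\<^sub>F t in at_bot. t \<in> einterval a b" if "a = -\<infinity>"
  proof -
    obtain t0 where t0: "t0 \<in> einterval a b" using ne by blast
    show ?thesis
      unfolding eventually_at_bot_linorder
    proof (intro exI[of _ t0] allI impI)
      fix t assume "t \<le> t0"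
      then have "ereal t < b" using t0 le_less_trans[of "ereal t" "ereal t0" b] by (simp add: einterval_def)
      then show "t \<in> einterval a b" using that by (simp add: einterval_def)
    qed
  qed
  have top: "\<forall>\<^sub>F t in at_top. t \<in> einterval a b" if "b = \<infinity>"
  proof -
    obtain t0 where t0: "t0 \<in> einterval a b" using ne by blast
    show ?thesis
      unfolding eventually_at_top_linorder
    proof (intro exI[of _ t0] allI impI)
      fix t assume "t0 \<le> t"
      then have "a < ereal t" using t0 less_le_trans[of a "ereal t0" "ereal t"] by (simp add: einterval_def)
      then show "t \<in> einterval a b" using that by (simp add: einterval_def)
    qed
  qed
  have inf: "deformation_at_infinity K (\<lambda>s t. cnj (H s t)) F"
    if d: "deformation_at_infinity K H F" and F: "\<forall>\<^sub>F t in F. t \<in> einterval a b" for F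
  proof -
    obtain C \<rho> where \<rho>: "\<rho> < 1" "\<forall>\<^sub>F t in F. \<forall>s\<in>{0..1}. norm (K (H s t)) \<le> exp (C * norm (H s t) powr \<rho>)"
      using d unfolding deformation_at_infinity_def by blast
    have "\<forall>\<^sub>F t in F. \<forall>s\<in>{0..1}. norm (K (cnj (H s t))) \<le> exp (C * norm (cnj (H s t)) powr \<rho>)"
      using \<rho>(2) F by eventually_elim (use normK Hin in simp)
    then show ?thesis using d \<rho>(1) unfolding deformation_at_infinity_def complex_mod_cnj by blast
  qed
  have "deformation_of_interval K D a b (\<lambda>s t. cnj (H s t)) (\<lambda>t. cnj (\<gamma> (\<phi> t)))"
    unfolding deformation_of_interval_def
  proof (intro conjI allI impI ballI)
    have "continuous_on ({0..1} \<times> einterval a b) (\<lambda>x. cnj ((\<lambda>(s, t). H s t) x))"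
      using H by (intro continuous_on_cnj) (simp add: deformation_of_interval_def)
    then show "continuous_on ({0..1} \<times> einterval a b) (\<lambda>(s, t). cnj (H s t))" by (simp add: split_def)
  next
    fix t assume "t \<in> einterval a b"
    then show "cnj (H 0 t) = complex_of_real t" "cnj (H 1 t) = cnj (\<gamma> (\<phi> t))"
      using H by (auto simp: deformation_of_interval_def)
  next
    fix s t :: real assume "s \<in> {0..1}" "t \<in> einterval a b"
    from Hin[OF this] show "cnj (H s t) \<in> D \<union> of_real ` einterval a b" by auto
  next
    fix c assume "is_end a b c"
    then have "uniform_limit {0..1} (\<lambda>t s. H s t) (\<lambda>_. complex_of_real c) (at c within einterval a b)"
      using H by (simp add: deformation_of_interval_def)
    from bounded_linear.uniform_limit[OF bounded_linear_cnj this]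
    show "uniform_limit {0..1} (\<lambda>t s. cnj (H s t)) (\<lambda>_. complex_of_real c) (at c within einterval a b)" by simp
  next
    assume "a = -\<infinity>"
    then show "deformation_at_infinity K (\<lambda>s t. cnj (H s t)) at_bot"
      using H inf[OF _ bot] by (simp add: deformation_of_interval_def)
  next
    assume "b = \<infinity>"
    then show "deformation_at_infinity K (\<lambda>s t. cnj (H s t)) at_top"
      using H inf[OF _ top] by (simp add: deformation_of_interval_def)
  qed
  moreover have "1-lipschitz_on E (\<lambda>s. cnj (\<gamma> s))"
    using lipschitz unfolding lipschitz_on_def dist_norm by (simp flip: complex_cnj_diff)
  moreover have "AE s in lborel. s \<in> E \<longrightarrow> (\<exists>v. ((\<lambda>s. cnj (\<gamma> s)) has_vector_derivative v) (at s) \<and> norm v = 1)"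
    using speed
  proof eventually_elim
    case (elim s)
    then show ?case using vector_derivative_cnj complex_mod_cnj by metis
  qed
  moreover have "inj_on (\<lambda>s. cnj (\<gamma> s)) E" using c by (simp add: contour_def inj_on_def)
  moreover have "(\<lambda>s. cnj (\<gamma> s)) ` E \<subseteq> D"
  proof -
    have "\<gamma> s \<in> cnj ` D" if "s \<in> E" for s using c that by (auto simp: contour_def)
    then show ?thesis by fastforce
  qed
  moreover have "(a \<noteq> -\<infinity> \<longrightarrow> p \<noteq> -\<infinity>)" "(b \<noteq> \<infinity> \<longrightarrow> q \<noteq> \<infinity>)" using c by (auto simp: contour_def)
  ultimately show ?thesis unfolding contour_def using pq \<phi> by blast
qed

text \<open>
  Conjugating the integrand exchanges the two vectors in the form and replaces \<open>g\<close> by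
  its reflection at the real axis.
\<close>

lemma represented_cnj:
  fixes K :: "complex \<Rightarrow> ('b::complex_hilbert, 'b) cblinfun"
  assumes curve: "unit_speed_curve p q \<gamma>"
    and rep: "represented K a b p q (\<lambda>s. cnj (\<gamma> s)) (-1) \<sigma>" and \<sigma>: "\<sigma> \<in> {0, 1, -1}"
    and adj: "\<And>s x y. s \<in> einterval p q \<Longrightarrow> cinner (K (\<gamma> s) *\<^sub>V x) y = cnj (cinner (K (cnj (\<gamma> s)) *\<^sub>V y) x)"
    and sa: "\<And>t x y. t \<in> einterval a b \<Longrightarrow> cinner (K (of_real t) *\<^sub>V x) y = cnj (cinner (K (of_real t) *\<^sub>V y) x)"
  shows "represented K a b p q \<gamma> 1 \<sigma>"
  unfolding represented_def
proof (intro allI impI)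
  interpret unit_speed_curve p q \<gamma> by (rule curve)
  fix x y g \<delta> M
  assume \<delta>: "(\<delta>::real) > 0" and g: "g holomorphic_on {z. - \<delta> < 1 * Im z}"
    and gM: "\<forall>z. - \<delta> < 1 * Im z \<longrightarrow> norm (g z) \<le> M"
  define h where "h z = cnj (g (cnj z))" for z
  have im: "cnj ` {z. - \<delta> < - 1 * Im z} = {z. - \<delta> < 1 * Im z}"
    by (force simp: image_iff intro: exI[of _ "cnj _"])
  have "(cnj \<circ> g \<circ> cnj) holomorphic_on {z. - \<delta> < - 1 * Im z}"
    by (rule holomorphic_on_compose_cnj_cnj[of g, unfolded im]) (use g in \<open>auto simp: im intro!: open_Collect_less continuous_intros\<close>)
  moreover have "h = cnj \<circ> g \<circ> cnj" by (simp add: fun_eq_iff h_def)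
  ultimately have hol: "h holomorphic_on {z. - \<delta> < - 1 * Im z}" by simp
  have hM: "norm (h z) \<le> M" if "- \<delta> < - 1 * Im z" for z using gM that by (simp add: h_def)
  have eq: "integral (einterval a b) (\<lambda>t. cinner (K (of_real t) *\<^sub>V y) x * h (of_real t)) =
      \<sigma> * integral E (\<lambda>s. vector_derivative (\<lambda>s. cnj (\<gamma> s)) (at s) * (cinner (K (cnj (\<gamma> s)) *\<^sub>V y) x * h (cnj (\<gamma> s))))"
    using rep[unfolded represented_def, rule_format, OF \<delta> hol hM] .
  have "integral (einterval a b) (\<lambda>t. cinner (K (of_real t) *\<^sub>V x) y * g (of_real t)) =
      integral (einterval a b) (\<lambda>t. cnj (cinner (K (of_real t) *\<^sub>V y) x * h (of_real t)))"
    by (rule integral_cong) (simp add: sa[of _ x y] h_def)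
  also have "\<dots> = cnj (integral (einterval a b) (\<lambda>t. cinner (K (of_real t) *\<^sub>V y) x * h (of_real t)))"
    by (rule integral_cnj[symmetric])
  also have "\<dots> = \<sigma> * cnj (integral E (\<lambda>s. vector_derivative (\<lambda>s. cnj (\<gamma> s)) (at s) * (cinner (K (cnj (\<gamma> s)) *\<^sub>V y) x * h (cnj (\<gamma> s)))))"
    unfolding eq using \<sigma> by auto
  also have "cnj (integral E (\<lambda>s. vector_derivative (\<lambda>s. cnj (\<gamma> s)) (at s) * (cinner (K (cnj (\<gamma> s)) *\<^sub>V y) x * h (cnj (\<gamma> s))))) =
      integral E (\<lambda>s. cnj (vector_derivative (\<lambda>s. cnj (\<gamma> s)) (at s) * (cinner (K (cnj (\<gamma> s)) *\<^sub>V y) x * h (cnj (\<gamma> s)))))"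
    by (rule integral_cnj)
  also have "\<dots> = integral E (\<lambda>s. \<gamma>' s * (cinner (K (\<gamma> s) *\<^sub>V x) y * g (\<gamma> s)))"
  proof -
    obtain N where N: "negligible N" "\<And>s. s \<in> E \<Longrightarrow> s \<notin> N \<Longrightarrow> (\<gamma> has_vector_derivative \<gamma>' s) (at s)"
      using exceptional_set by metis
    show ?thesis
    proof (rule integral_spike[OF N(1)])
      fix s assume s: "s \<in> E - N"
      then have "vector_derivative (\<lambda>s. cnj (\<gamma> s)) (at s) = cnj (\<gamma>' s)"
        by (intro vector_derivative_at vector_derivative_cnj N(2)) auto
      then show "\<gamma>' s * (cinner (K (\<gamma> s) *\<^sub>V x) y * g (\<gamma> s)) =
          cnj (vector_derivative (\<lambda>s. cnj (\<gamma> s)) (at s) * (cinner (K (cnj (\<gamma> s)) *\<^sub>V y) x * h (cnj (\<gamma> s))))"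
        using adj[of s x y] s by (simp add: h_def)
    qed
  qed
  finally show "integral (einterval a b) (\<lambda>t. cinner (K (of_real t) *\<^sub>V x) y * g (of_real t)) =
      \<sigma> * integral E (\<lambda>s. \<gamma>' s * (cinner (K (\<gamma> s) *\<^sub>V x) y * g (\<gamma> s)))" .
qed

section \<open>Positivity of the spectral density and the Poisson kernel\<close>

lemma pvm_form:
  assumes "projection_valued_measure E" "M \<in> sets borel"
  shows "cinner (E M *\<^sub>V x) y = cinner x (E M *\<^sub>V y)" "cinner (E M *\<^sub>V x) x = of_real ((norm (E M *\<^sub>V x))\<^sup>2)"
proof -
  show sym: "cinner (E M *\<^sub>V x) y = cinner x (E M *\<^sub>V y)" for x y
    using assms by (simp add: projection_valued_measure_def)
  have "E M \<circ>\<^sub>C E M = E M" using assms by (simp add: projection_valued_measure_def)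
  then have "E M *\<^sub>V E M *\<^sub>V x = E M *\<^sub>V x" by (metis cblinfun_compose_apply)
  then have "cinner (E M *\<^sub>V x) x = cinner (E M *\<^sub>V x) (E M *\<^sub>V x)" using sym[of "E M *\<^sub>V x" x] by simp
  then show "cinner (E M *\<^sub>V x) x = of_real ((norm (E M *\<^sub>V x))\<^sup>2)" by (simp add: cinner_norm)
qed

lemma pvm_additive:
  assumes E: "projection_valued_measure E" and M: "M \<in> sets borel" "N \<in> sets borel" "M \<inter> N = {}"
  shows "E (M \<union> N) *\<^sub>V x = E M *\<^sub>V x + E N *\<^sub>V x"
proof -
  have ca: "(\<lambda>n. E (F n) *\<^sub>V x) sums (E (\<Union>n. F n) *\<^sub>V x)"
    if "range F \<subseteq> sets borel" "disjoint_family F" for F :: "nat \<Rightarrow> real set"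
    using E that unfolding projection_valued_measure_def by blast
  have "(\<lambda>n::nat. E {} *\<^sub>V x) sums (E (\<Union>n::nat. {}) *\<^sub>V x)" by (rule ca) (auto simp: disjoint_family_on_def)
  then have "(\<lambda>n::nat. E {} *\<^sub>V x) \<longlonglongrightarrow> 0" by (intro summable_LIMSEQ_zero sums_summable)
  then have empty: "E {} *\<^sub>V x = 0" by (simp add: LIMSEQ_const_iff)
  define F where "F n = (if n = 0 then M else if n = 1 then N else {})" for n :: nat
  have "(\<lambda>n. E (F n) *\<^sub>V x) sums (E (\<Union>n. F n) *\<^sub>V x)"
    by (rule ca) (use M in \<open>auto simp: F_def disjoint_family_on_def\<close>)
  moreover have "(\<Union>n. F n) = M \<union> N" by (auto simp: F_def split: if_splits)
  moreover have "(\<lambda>n. E (F n) *\<^sub>V x) sums (\<Sum>n\<in>{0, 1}. E (F n) *\<^sub>V x)"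
    by (rule sums_finite) (auto simp: F_def empty)
  ultimately show ?thesis using sums_unique2 by (force simp: F_def)
qed

lemma pvm_norm_mono:
  assumes E: "projection_valued_measure E" and M: "M \<in> sets borel" "N \<in> sets borel" "M \<subseteq> N"
  shows "(norm (E M *\<^sub>V x))\<^sup>2 \<le> (norm (E N *\<^sub>V x))\<^sup>2"
proof -
  have "E N *\<^sub>V x = E M *\<^sub>V x + E (N - M) *\<^sub>V x"
    using pvm_additive[OF E M(1), of "N - M" x] M by (simp add: Un_absorb1)
  then have "cinner (E N *\<^sub>V x) x = cinner (E M *\<^sub>V x) x + cinner (E (N - M) *\<^sub>V x) x" by (simp add: cinner_add_left)
  then have "complex_of_real ((norm (E N *\<^sub>V x))\<^sup>2) = of_real ((norm (E M *\<^sub>V x))\<^sup>2 + (norm (E (N - M) *\<^sub>V x))\<^sup>2)"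
    using pvm_form(2)[OF E] M by simp
  then show ?thesis unfolding of_real_eq_iff by simp
qed

lemma K_B_form:
  fixes Q :: "'b::complex_hilbert set" and B :: "('b, 'a::complex_hilbert) cblinfun"
  assumes "orthonormal_basis Q"
  shows "cinner (K_B E B t *\<^sub>V x) y = cinner (E {..<t} *\<^sub>V B *\<^sub>V x) (B *\<^sub>V y)"
proof -
  have "cinner (cadjoint B *\<^sub>V z) y = cnj (cinner y (cadjoint B *\<^sub>V z))" for z by (rule cinner_commute)
  also have "\<dots> z = cinner z (B *\<^sub>V y)" for z using cadjoint[OF assms, of B y z] cinner_commute by metis
  finally show ?thesis by (simp add: K_B_def)
qed

lemma K_B_derivative:
  fixes Q :: "'b::complex_hilbert set" and B :: "('b, 'a::complex_hilbert) cblinfun"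
  assumes Q: "orthonormal_basis Q" and E: "projection_valued_measure E"
    and der: "(K_B E B has_vector_derivative K') (at t)"
  shows "cinner (K' *\<^sub>V x) y = cnj (cinner (K' *\<^sub>V y) x)"
    and "((\<lambda>t. (norm (E {..<t} *\<^sub>V B *\<^sub>V x))\<^sup>2) has_real_derivative Re (cinner (K' *\<^sub>V x) x)) (at t)"
    and "0 \<le> Re (cinner (K' *\<^sub>V x) x)"
proof -
  have form: "((\<lambda>t. cinner (E {..<t} *\<^sub>V B *\<^sub>V x) (B *\<^sub>V y)) has_vector_derivative cinner (K' *\<^sub>V x) y) (at t)" for x y
    using bounded_linear.has_vector_derivative[OF bounded_linear_form der, of x y] by (simp add: K_B_form[OF Q])
  have "cnj (cinner (E {..<t} *\<^sub>V B *\<^sub>V y) (B *\<^sub>V x)) = cinner (E {..<t} *\<^sub>V B *\<^sub>V x) (B *\<^sub>V y)" for t x y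
    using pvm_form(1)[OF E, of "{..<t}" "B *\<^sub>V x" "B *\<^sub>V y"] cinner_commute[of "B *\<^sub>V x"] by simp
  with bounded_linear.has_vector_derivative[OF bounded_linear_cnj form[of y x]]
  have "((\<lambda>t. cinner (E {..<t} *\<^sub>V B *\<^sub>V x) (B *\<^sub>V y)) has_vector_derivative cnj (cinner (K' *\<^sub>V y) x)) (at t)" by simp
  then show "cinner (K' *\<^sub>V x) y = cnj (cinner (K' *\<^sub>V y) x)" by (rule vector_derivative_unique_at[OF form])
  have "((\<lambda>t. Re (cinner (E {..<t} *\<^sub>V B *\<^sub>V x) (B *\<^sub>V x))) has_vector_derivative Re (cinner (K' *\<^sub>V x) x)) (at t)"
    by (rule bounded_linear.has_vector_derivative[OF bounded_linear_Re form])
  moreover have "Re (cinner (E {..<t} *\<^sub>V B *\<^sub>V x) (B *\<^sub>V x)) = (norm (E {..<t} *\<^sub>V B *\<^sub>V x))\<^sup>2" for t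
    by (subst pvm_form(2)[OF E]) simp_all
  ultimately show der': "((\<lambda>t. (norm (E {..<t} *\<^sub>V B *\<^sub>V x))\<^sup>2) has_real_derivative Re (cinner (K' *\<^sub>V x) x)) (at t)"
    by (simp add: has_real_derivative_iff_has_vector_derivative)
  have "mono_on UNIV (\<lambda>t. (norm (E {..<t} *\<^sub>V B *\<^sub>V x))\<^sup>2)"
    by (intro mono_onI pvm_norm_mono[OF E]) auto
  then show "0 \<le> Re (cinner (K' *\<^sub>V x) x)"
    by (rule mono_on_imp_deriv_nonneg[OF _ der']) simp
qed

text \<open>
  The integrals over compact subintervals are increments of \<open>f\<close>, hence bounded, and monotone convergence
  applies.
\<close>

lemma bounded_nondecreasing_derivative_integrable:
  fixes f f' :: "real \<Rightarrow> real"
  assumes ab: "a < b"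
    and der: "\<And>t. t \<in> einterval a b \<Longrightarrow> (f has_real_derivative f' t) (at t)"
    and nonneg: "\<And>t. t \<in> einterval a b \<Longrightarrow> 0 \<le> f' t"
    and bound: "\<And>t. t \<in> einterval a b \<Longrightarrow> \<bar>f t\<bar> \<le> M"
  shows "f' integrable_on einterval a b"
proof -
  let ?I = "einterval a b"
  obtain u l :: "nat \<Rightarrow> real" where ul: "?I = (\<Union>i. {l i .. u i})" "incseq u" "decseq l" "\<And>i. l i < u i"
    by (rule einterval_Icc_approximation[OF ab]) blast
  have sub: "{l i..u i} \<subseteq> ?I" for i using ul(1) by blast
  have int: "(f' has_integral f (u i) - f (l i)) {l i..u i}" for i
  proof (rule fundamental_theorem_of_calculus[where f = f, OF less_imp_le[OF ul(4)]])
    fix t assume "t \<in> {l i..u i}"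
    then have t: "t \<in> ?I" by (rule subsetD[OF sub])
    have "(f has_real_derivative f' t) (at t within {l i..u i})"
      by (rule has_field_derivative_at_within[OF der[OF t]])
    then show "(f has_vector_derivative f' t) (at t within {l i..u i})"
      by (simp add: has_real_derivative_iff_has_vector_derivative)
  qed
  define g where "g i t = (if t \<in> {l i..u i} then f' t else 0)" for i t
  have gi: "(g i has_integral f (u i) - f (l i)) ?I" for i
    unfolding g_def using has_integral_restrict[OF sub[of i], of f'] int[of i] by simp
  have "f' integrable_on ?I \<and> (\<lambda>i. integral ?I (g i)) \<longlonglongrightarrow> integral ?I f'"
  proof (rule monotone_convergence_increasing)
    show "g i integrable_on ?I" for i using gi by blast
    show "g i t \<le> g (Suc i) t" if "t \<in> ?I" for i t
    proof -
      have "l (Suc i) \<le> l i" "u i \<le> u (Suc i)" using ul(2,3) by (auto simp: incseq_SucD decseq_SucD)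
      then show ?thesis using nonneg[OF that] by (auto simp: g_def)
    qed
    show "(\<lambda>i. g i t) \<longlonglongrightarrow> f' t" if "t \<in> ?I" for t
    proof -
      have "t \<in> (\<Union>i. {l i..u i})" using that by (simp only: ul(1))
      then obtain i where i: "t \<in> {l i..u i}" by (rule UN_E)
      have "t \<in> {l j..u j}" if "j \<ge> i" for j
        using i incseqD[OF ul(2) that] decseqD[OF ul(3) that] by simp
      then show ?thesis by (intro tendsto_eventually eventually_sequentiallyI[of i]) (simp add: g_def)
    qed
    show "bounded (range (\<lambda>i. integral ?I (g i)))"
      unfolding bounded_iff
    proof (intro exI[of _ "2 * M"] ballI)
      fix v assume "v \<in> range (\<lambda>i. integral ?I (g i))"
      then obtain i where "v = integral ?I (g i)" by (rule rangeE)
      then have "v = f (u i) - f (l i)" using integral_unique[OF gi[of i]] by simp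
      moreover have "\<bar>f (u i)\<bar> \<le> M" "\<bar>f (l i)\<bar> \<le> M"
        using ul(4)[of i] by (intro bound subsetD[OF sub[of i]], simp)+
      ultimately show "norm v \<le> 2 * M" by simp
    qed
  qed
  then show ?thesis by (rule conjunct1)
qed

text \<open>
  For a positive form the polarization identity bounds the entries by diagonal values, which are the
  derivatives of nondecreasing functions.
\<close>

lemma polarization_bound:
  fixes K :: "('b::complex_hilbert, 'b) cblinfun"
  assumes herm: "\<And>x y. cinner (K *\<^sub>V x) y = cnj (cinner (K *\<^sub>V y) x)" and pos: "\<And>x. 0 \<le> Re (cinner (K *\<^sub>V x) x)"
  shows "cmod (cinner (K *\<^sub>V x) y) \<le> Re (cinner (K *\<^sub>V (x + y)) (x + y)) + Re (cinner (K *\<^sub>V (x - y)) (x - y))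
    + Re (cinner (K *\<^sub>V (x + \<i> *\<^sub>C y)) (x + \<i> *\<^sub>C y)) + Re (cinner (K *\<^sub>V (x - \<i> *\<^sub>C y)) (x - \<i> *\<^sub>C y))"
proof -
  let ?q = "\<lambda>z. Re (cinner (K *\<^sub>V z) z)"
  let ?w = "cinner (K *\<^sub>V x) y"
  have yx: "cinner (K *\<^sub>V y) x = cnj ?w" by (rule herm)
  have e1: "?q (x + y) - ?q (x - y) = 4 * Re ?w"
    using yx by (simp add: cblinfun_clinear cinner_add_left cinner_add_right cinner_diff_left cinner_diff_right)
  have e2: "?q (x + \<i> *\<^sub>C y) - ?q (x - \<i> *\<^sub>C y) = 4 * Im ?w"
    using yx by (simp add: cblinfun_clinear cinner_add_left cinner_add_right cinner_diff_left cinner_diff_right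
        cinner_scaleC_left cinner_scaleC_right)
  have "cmod ?w \<le> \<bar>Re ?w\<bar> + \<bar>Im ?w\<bar>" by (rule cmod_le)
  then show ?thesis using e1 e2 pos[of "x + y"] pos[of "x - y"] pos[of "x + \<i> *\<^sub>C y"] pos[of "x - \<i> *\<^sub>C y"] by linarith
qed

text \<open>
  The imaginary part of \<open>1 / (L - i l y - t)\<close> is \<open>l y / ((L - t)\<^sup>2 + y\<^sup>2)\<close>. On the interval
  from \<open>L - y\<close> to \<open>L + y\<close> this kernel is at least \<open>1 / (2 y)\<close>, and for small \<open>y\<close> the density is
  at least \<open>\<kappa> / 2\<close> there.
\<close>

lemma poisson_lower_bound:
  fixes k :: "real \<Rightarrow> real"
  assumes int: "k integrable_on einterval a b" and cont: "continuous_on (einterval a b) k"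
    and nonneg: "\<And>t. t \<in> einterval a b \<Longrightarrow> 0 \<le> k t"
    and L: "L \<in> einterval a b" "\<kappa> \<le> k L" "\<kappa> > 0" and l: "l = 1 \<or> l = -1"
  obtains \<eta> where "\<eta> > 0" "\<And>y. 0 < y \<Longrightarrow> y < \<eta> \<Longrightarrow>
    \<kappa> / 2 \<le> l * Im (integral (einterval a b) (\<lambda>t. of_real (k t) * (1 / (of_real L - \<i> * of_real (l * y) - of_real t))))"
proof -
  let ?I = "einterval a b"
  have "isCont k L" using cont L(1) by (simp add: continuous_on_eq_continuous_at)
  moreover have "\<kappa> / 2 < k L" using L(2,3) by simp
  ultimately have "\<forall>\<^sub>F t in at L. \<kappa> / 2 < k t" unfolding isCont_def by (rule order_tendstoD(1))
  then obtain \<eta>1 where \<eta>1: "\<eta>1 > 0" "\<And>t. t \<noteq> L \<Longrightarrow> dist t L < \<eta>1 \<Longrightarrow> \<kappa> / 2 < k t" unfolding eventually_at by blast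
  obtain \<eta>2 where \<eta>2: "\<eta>2 > 0" "ball L \<eta>2 \<subseteq> ?I" using open_contains_ball[of ?I] L(1) open_einterval by blast
  show ?thesis
  proof
    show "min \<eta>1 \<eta>2 > 0" using \<eta>1 \<eta>2 by simp
    fix y assume y: "0 < y" "y < min \<eta>1 \<eta>2"
    let ?w = "\<lambda>t. of_real L - \<i> * of_real (l * y) - complex_of_real t"
    let ?F = "\<lambda>t. of_real (k t) * (1 / ?w t)"
    let ?h = "\<lambda>t. k t * (y / ((L - t)\<^sup>2 + y\<^sup>2))"
    have sq: "(l * y)\<^sup>2 = y\<^sup>2" using l by auto
    have w_norm: "norm (?w t) \<ge> y" for t
      using abs_Im_le_cmod[of "?w t"] l y by auto
    then have w0: "?w t \<noteq> 0" for t using y by (metis norm_zero not_le)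
    have im: "l * Im (?F t) = ?h t" for t
    proof -
      have "Im (1 / ?w t) = l * y / ((L - t)\<^sup>2 + y\<^sup>2)" using sq by (simp add: Im_divide)
      then have "l * Im (?F t) = k t * (l * l * y / ((L - t)\<^sup>2 + y\<^sup>2))" by (simp only: Im_complex_of_real Re_complex_of_real times_complex.sel) simp
      also have "l * l = 1" using l by auto
      finally show ?thesis by simp
    qed
    have "?F absolutely_integrable_on ?I"
    proof (rule measurable_bounded_by_integrable_imp_absolutely_integrable)
      have "continuous_on ?I ?F" using w0 by (intro continuous_intros cont) auto
      then show "?F \<in> borel_measurable (lebesgue_on ?I)" by (rule continuous_imp_measurable_on_sets_lebesgue) auto
      show "(\<lambda>t. k t * (1 / y)) integrable_on ?I" using int by (rule integrable_on_mult_left)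
      fix t assume t: "t \<in> ?I"
      have "norm (?w t) > 0" using w_norm[of t] y by linarith
      then have "1 / norm (?w t) \<le> 1 / y" using y by (intro divide_left_mono w_norm mult_pos_pos) auto
      then show "norm (?F t) \<le> k t * (1 / y)"
        unfolding norm_mult norm_divide using nonneg[OF t] by (intro mult_mono) auto
    qed simp
    then have "(?F has_integral integral ?I ?F) ?I" by (simp add: absolutely_integrable_on_def has_integral_iff)
    from has_integral_mult_right[OF has_integral_linear[OF this bounded_linear_Im], of l]
    have h: "(?h has_integral l * Im (integral ?I ?F)) ?I" by (simp only: o_def im)
    have sub: "{L - y..L + y} \<subseteq> ?I"
    proof
      fix t assume "t \<in> {L - y..L + y}"
      then show "t \<in> ?I" using y by (intro subsetD[OF \<eta>2(2)]) (auto simp: dist_real_def)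
    qed
    have h_nonneg: "?h t \<ge> 0" if "t \<in> ?I" for t using nonneg[OF that] y by (simp add: sum_power2_ge_zero)
    have h_abs: "?h absolutely_integrable_on ?I"
      using h h_nonneg by (intro nonnegative_absolutely_integrable_1) (auto simp: has_integral_iff)
    then have h_sub: "?h integrable_on {L - y..L + y}"
      using sub by (meson absolutely_integrable_on_subinterval set_lebesgue_integral_eq_integral(1))
    have "\<kappa> / (4 * y) * (2 * y) \<le> integral {L - y..L + y} ?h"
    proof (rule has_integral_le[OF _ integrable_integral[OF h_sub]])
      show "((\<lambda>t. \<kappa> / (4 * y)) has_integral \<kappa> / (4 * y) * (2 * y)) {L - y..L + y}"
        using has_integral_const_real[of "\<kappa> / (4 * y)" "L - y" "L + y"] y by (simp add: mult.commute)
      fix t assume t: "t \<in> {L - y..L + y}"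
      have "\<kappa> / 2 \<le> k t"
      proof (cases "t = L")
        case False
        have "dist t L < \<eta>1" using t y unfolding dist_real_def atLeastAtMost_iff by linarith
        then show ?thesis using \<eta>1(2)[OF False] by simp
      qed (use \<open>\<kappa> / 2 < k L\<close> in simp)
      moreover have "1 / (2 * y) \<le> y / ((L - t)\<^sup>2 + y\<^sup>2)"
      proof -
        have "\<bar>L - t\<bar> \<le> \<bar>y\<bar>" using t y by auto
        then have "(L - t)\<^sup>2 \<le> y\<^sup>2" by (simp only: abs_le_square_iff)
        moreover have "(L - t)\<^sup>2 + y\<^sup>2 > 0" using y by (simp add: add_nonneg_pos)
        ultimately show ?thesis using y by (simp add: field_simps power2_eq_square)
      qed
      ultimately have "\<kappa> / 2 * (1 / (2 * y)) \<le> ?h t" using L(3) y by (intro mult_mono) auto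
      then show "\<kappa> / (4 * y) \<le> ?h t" by simp
    qed
    also have "\<dots> \<le> integral ?I ?h"
      using h h_nonneg h_sub sub by (intro integral_subset_le) (auto simp: has_integral_iff)
    also have "\<dots> = l * Im (integral ?I ?F)" using h by (rule integral_unique)
    finally show "\<kappa> / 2 \<le> l * Im (integral ?I ?F)" using y by simp
  qed
qed

lemma bspectrum_eigenvalue:
  fixes Q :: "'b::complex_hilbert set" and Z :: "('b, 'b) cblinfun"
  assumes Q: "orthonormal_basis Q" and z: "z \<in> bspectrum Z"
  shows "eigenvalue Z z"
proof (rule ccontr)
  assume "\<not> eigenvalue Z z"
  let ?T = "Z - z *\<^sub>C cblinfun_id"
  have inj: "x = 0" if "?T *\<^sub>V x = 0" for x using \<open>\<not> eigenvalue Z z\<close> that by (auto simp: eigenvalue_def)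
  obtain S where S: "S \<circ>\<^sub>C ?T = cblinfun_id" "?T \<circ>\<^sub>C S = cblinfun_id"
    by (rule injective_cblinfun_invertible[OF Q, of ?T], erule inj) blast
  have TS: "?T *\<^sub>V S *\<^sub>V x = x" and ST: "S *\<^sub>V ?T *\<^sub>V x = x" for x
    using S by (metis cblinfun_compose_apply cblinfun_apply_simps(5))+
  have "bij_betw (\<lambda>x. Z *\<^sub>V x - z *\<^sub>C x) UNIV UNIV"
    by (rule bij_betw_byWitness[of _ "cblinfun_apply S"]) (use TS ST in auto)
  moreover have "norm x \<le> norm S * norm (Z *\<^sub>V x - z *\<^sub>C x)" for x
    using norm_cblinfun_apply[of S "?T *\<^sub>V x"] ST[of x] by simp
  ultimately have "z \<notin> bspectrum Z" by (auto simp: bspectrum_def spectrum_def)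
  then show False using z by blast
qed

text \<open>
  Applying \<open>Z - u\<close> to a relation removes the term of \<open>u\<close> and multiplies the others by nonzero factors.
\<close>

lemma eigenvectors_independent:
  assumes "finite S" "\<And>z. z \<in> S \<Longrightarrow> v z \<noteq> 0 \<and> Z *\<^sub>V v z = z *\<^sub>C v z" "(\<Sum>z\<in>S. c z *\<^sub>C v z) = 0" "w \<in> S"
  shows "c w = 0"
  using assms
proof (induction S arbitrary: c w rule: finite_induct)
  case (insert u S)
  have Z_sum: "Z *\<^sub>V (\<Sum>e\<in>A. g e) = (\<Sum>e\<in>A. Z *\<^sub>V g e)" for A :: "complex set" and g
    by (induction A rule: infinite_finite_induct) (auto simp: cblinfun_clinear)
  have sum0: "c u *\<^sub>C v u + (\<Sum>z\<in>S. c z *\<^sub>C v z) = 0" using insert by simp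
  have "(\<Sum>z\<in>S. (c z * (z - u)) *\<^sub>C v z) = (\<Sum>z\<in>S. c z *\<^sub>C (Z *\<^sub>V v z)) - u *\<^sub>C (\<Sum>z\<in>S. c z *\<^sub>C v z)"
    unfolding complex_vector.scale_sum_right sum_subtractf[symmetric]
    by (rule sum.cong) (use insert.prems(1) in \<open>auto simp: scaleC_scaleC right_diff_distrib complex_vector.scale_left_diff_distrib mult.commute\<close>)
  also have "\<dots> = Z *\<^sub>V (\<Sum>z\<in>S. c z *\<^sub>C v z) - u *\<^sub>C (\<Sum>z\<in>S. c z *\<^sub>C v z)" by (simp add: Z_sum cblinfun_clinear)
  also have "(\<Sum>z\<in>S. c z *\<^sub>C v z) = - (c u *\<^sub>C v u)" using sum0 by (simp add: eq_neg_iff_add_eq_0 add.commute)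
  also have "Z *\<^sub>V (- (c u *\<^sub>C v u)) - u *\<^sub>C (- (c u *\<^sub>C v u)) = 0"
    using insert.prems(1)[of u] by (simp add: cblinfun_clinear scaleC_scaleC mult.commute)
  finally have S0: "c z * (z - u) = 0" if "z \<in> S" for z
    using insert.IH[of "\<lambda>z. c z * (z - u)" z] insert.prems(1) that by auto
  have cS: "c z = 0" if "z \<in> S" for z using S0[OF that] insert.hyps that by auto
  then have "c u *\<^sub>C v u = 0" using sum0 by simp
  then have "c u = 0" using insert.prems(1)[of u] by simp
  then show ?case using cS insert.prems(3) by auto
qed simp

lemma finite_bspectrum:
  fixes Q :: "'b::complex_hilbert set" and Z :: "('b, 'b) cblinfun"
  assumes Q: "orthonormal_basis Q"
  shows "finite (bspectrum Z)"
proof (rule ccontr)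
  assume "infinite (bspectrum Z)"
  then obtain S where S: "S \<subseteq> bspectrum Z" "finite S" "card S = Suc (card Q)"
    using infinite_arbitrarily_large by blast
  have "\<forall>z\<in>S. \<exists>x. x \<noteq> 0 \<and> Z *\<^sub>V x = z *\<^sub>C x"
    using bspectrum_eigenvalue[OF Q] S(1) unfolding eigenvalue_def by blast
  from bchoice[OF this] obtain v where "\<forall>z\<in>S. v z \<noteq> 0 \<and> Z *\<^sub>V v z = z *\<^sub>C v z" ..
  then have v: "v z \<noteq> 0 \<and> Z *\<^sub>V v z = z *\<^sub>C v z" if "z \<in> S" for z using that by blast
  have inj: "inj_on v S"
  proof (rule inj_onI)
    fix z w assume zw: "z \<in> S" "w \<in> S" "v z = v w"
    have "z *\<^sub>C v z = w *\<^sub>C v z" using v[OF zw(1)] v[OF zw(2)] zw(3) by metis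
    then have "(z - w) *\<^sub>C v z = 0" by (simp add: complex_vector.scale_left_diff_distrib)
    then show "z = w" using v[OF zw(1)] by simp
  qed
  have "complex_vector.independent (v ` S)"
  proof
    assume "complex_vector.dependent (v ` S)"
    then obtain c x where c: "(\<Sum>e\<in>v ` S. c e *\<^sub>C e) = 0" "x \<in> v ` S" "c x \<noteq> 0"
      using S(2) by (auto simp: complex_vector.dependent_finite)
    then obtain w where w: "w \<in> S" "x = v w" by blast
    have "(\<Sum>z\<in>S. c (v z) *\<^sub>C v z) = 0" using c(1) by (simp add: sum.reindex[OF inj])
    from eigenvectors_independent[OF S(2) v this w(1)] show False using c(3) w(2) by simp
  qed
  moreover have "v ` S \<subseteq> complex_vector.span Q"
  proof
    fix x assume "x \<in> v ` S"
    have "(\<Sum>e\<in>Q. cinner x e *\<^sub>C e) \<in> complex_vector.span Q"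
      by (intro complex_vector.span_sum complex_vector.span_scale complex_vector.span_base)
    then show "x \<in> complex_vector.span Q" using Q by (metis orthonormal_basis_def)
  qed
  ultimately have "card (v ` S) \<le> card Q"
    using complex_vector.independent_span_bound[of Q "v ` S"] Q by (auto simp: orthonormal_basis_def)
  then show False using S(3) by (simp add: card_image[OF inj])
qed

section \<open>Absence of real eigenvalues\<close>

text \<open>
  What is needed of the derivative of \<open>K\<^sub>B\<close> and its continuation, in terms of quadratic forms.
\<close>

locale continued_kernel =
  fixes K :: "complex \<Rightarrow> ('b::complex_hilbert, 'b) cblinfun" and D :: "complex set" and a b :: ereal
  assumes ab: "a < b" and D: "open D" "D \<subseteq> {z. Im z < 0}" "simply_connected D"
    and hol: "\<And>x y. (\<lambda>z. cinner (K z *\<^sub>V x) y) holomorphic_on D"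
    and cont: "\<And>x y. continuous_on (D \<union> of_real ` einterval a b) (\<lambda>z. cinner (K z *\<^sub>V x) y)"
    and ends: "\<And>c. is_end a b c \<Longrightarrow> \<exists>C \<alpha>. -1 < \<alpha> \<and>
      (\<forall>\<^sub>F z in at (of_real c) within D. norm (K z) \<le> C * norm (z - of_real c) powr \<alpha>)"
    and sym: "\<And>z x y. z \<in> D \<Longrightarrow> cinner (K (cnj z) *\<^sub>V x) y = cnj (cinner (K z *\<^sub>V y) x)"
    and herm: "\<And>t x y. t \<in> einterval a b \<Longrightarrow> cinner (K (of_real t) *\<^sub>V x) y = cnj (cinner (K (of_real t) *\<^sub>V y) x)"
    and nonneg: "\<And>t x. t \<in> einterval a b \<Longrightarrow> 0 \<le> Re (cinner (K (of_real t) *\<^sub>V x) x)"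
    and int_I: "\<And>x y. (\<lambda>t. cinner (K (of_real t) *\<^sub>V x) y) absolutely_integrable_on einterval a b"
begin

lemma norm_K_cnj:
  assumes z: "z \<in> D"
  shows "norm (K (cnj z)) = norm (K z)"
proof (rule antisym)
  show "norm (K (cnj z)) \<le> norm (K z)"
  proof (rule norm_cblinfun_bound_form)
    fix x y
    have "cmod (cinner (K (cnj z) *\<^sub>V x) y) = cmod (cinner (K z *\<^sub>V y) x)" unfolding sym[OF z] by simp
    also have "\<dots> \<le> norm (K z) * norm y * norm x" by (rule norm_cinner_apply)
    finally show "cmod (cinner (K (cnj z) *\<^sub>V x) y) \<le> norm (K z) * norm x * norm y" by (simp add: mult_ac)
  qed simp
  show "norm (K z) \<le> norm (K (cnj z))"
  proof (rule norm_cblinfun_bound_form)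
    fix x y
    have "cmod (cinner (K z *\<^sub>V x) y) = cmod (cinner (K (cnj z) *\<^sub>V y) x)" unfolding sym[OF z] by simp
    also have "\<dots> \<le> norm (K (cnj z)) * norm y * norm x" by (rule norm_cinner_apply)
    finally show "cmod (cinner (K z *\<^sub>V x) y) \<le> norm (K (cnj z)) * norm x * norm y" by (simp add: mult_ac)
  qed simp
qed

lemma contour_image: "contour K S a b p q \<gamma> \<Longrightarrow> s \<in> einterval p q \<Longrightarrow> \<gamma> s \<in> S"
  by (auto simp: contour_def)

lemma admissible_lower:
  assumes adm: "admissible K D a b p q \<gamma>"
  shows "\<exists>\<sigma>\<in>{0, 1, -1}. represented K a b p q \<gamma> (-1) \<sigma>"
proof -
  have "contour K D a b p q \<gamma>" "set_integrable lborel (einterval p q) (\<lambda>s. norm (K (\<gamma> s)))"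
    using adm by (simp_all add: admissible_def)
  then show ?thesis using ab D hol cont ends int_I by (intro represented_lower)
qed

lemma admissible_cnj:
  assumes adm: "admissible K (cnj ` D) a b p q \<gamma>"
  shows "admissible K D a b p q (\<lambda>s. cnj (\<gamma> s))"
proof -
  have c: "contour K (cnj ` D) a b p q \<gamma>" using adm by (simp add: admissible_def)
  have "norm (K (cnj (\<gamma> s))) = norm (K (\<gamma> s))" if s: "s \<in> einterval p q" for s
    using contour_image[OF c s] norm_K_cnj by auto
  then have "set_integrable lborel (einterval p q) (\<lambda>s. norm (K (cnj (\<gamma> s)))) =
      set_integrable lborel (einterval p q) (\<lambda>s. norm (K (\<gamma> s)))"
    by (intro set_integrable_cong) auto
  then show ?thesis using adm contour_cnj[OF c norm_K_cnj] by (simp add: admissible_def)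
qed

text \<open>
  Contours in the upper domain are conjugated into the lower one.
\<close>

lemma admissible_facts:
  assumes l: "l \<in> {1, -1}" and adm: "admissible K (domain_of_sign D l) a b p q \<gamma>"
  shows "unit_speed_curve p q \<gamma>"
    and "continuous_on (\<gamma> ` einterval p q) (\<lambda>z. cinner (K z *\<^sub>V x) y)"
    and "\<exists>\<sigma>\<in>{0, 1, -1}. represented K a b p q \<gamma> (real_of_int l) \<sigma>"
    and "is_end a b e \<Longrightarrow> \<epsilon> > 0 \<Longrightarrow> \<exists>s\<in>einterval p q. norm (\<gamma> s - of_real e) < \<epsilon>"
proof -
  have c: "contour K (domain_of_sign D l) a b p q \<gamma>" using adm by (simp add: admissible_def)
  show curve: "unit_speed_curve p q \<gamma>" by (rule contour_unit_speed[OF c])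
  have lower: "continuous_on (\<gamma> ` einterval p q) (\<lambda>z. cinner (K z *\<^sub>V x) y)"
    if "\<gamma> ` einterval p q \<subseteq> D" for \<gamma> :: "real \<Rightarrow> complex" and x y
    using that by (intro continuous_on_subset[OF cont]) auto
  consider "l = -1" | "l = 1" using l by blast
  then have "continuous_on (\<gamma> ` einterval p q) (\<lambda>z. cinner (K z *\<^sub>V x) y) \<and>
    (\<exists>\<sigma>\<in>{0, 1, -1}. represented K a b p q \<gamma> (real_of_int l) \<sigma>) \<and>
    (is_end a b e \<longrightarrow> \<epsilon> > 0 \<longrightarrow> (\<exists>s\<in>einterval p q. norm (\<gamma> s - of_real e) < \<epsilon>))"
  proof cases
    case 1
    then have adm: "admissible K D a b p q \<gamma>" and c: "contour K D a b p q \<gamma>"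
      using adm c by (simp_all add: domain_of_sign_def)
    have "\<gamma> ` einterval p q \<subseteq> D" using contour_image[OF c] by blast
    then show ?thesis
      using admissible_lower[OF adm] 1 lower contour_near_end[OF c ab D(1,2,3), of e \<epsilon>] by simp
  next
    case 2
    then have adm: "admissible K (cnj ` D) a b p q \<gamma>" and c: "contour K (cnj ` D) a b p q \<gamma>"
      using adm c by (simp_all add: domain_of_sign_def)
    let ?\<gamma> = "\<lambda>s. cnj (\<gamma> s)"
    have c': "contour K D a b p q ?\<gamma>" by (rule contour_cnj[OF c norm_K_cnj])
    have in_D: "cnj (\<gamma> s) \<in> D" if "s \<in> einterval p q" for s by (rule contour_image[OF c' that])
    have adj: "cinner (K (\<gamma> s) *\<^sub>V x) y = cnj (cinner (K (cnj (\<gamma> s)) *\<^sub>V y) x)" if "s \<in> einterval p q" for s x y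
      using sym[OF in_D[OF that], of x y] by simp
    have "continuous_on (\<gamma> ` einterval p q) (\<lambda>z. cnj (cinner (K (cnj z) *\<^sub>V y) x))"
    proof (intro continuous_on_cnj continuous_on_compose2[OF lower[of ?\<gamma>]])
      show "?\<gamma> ` einterval p q \<subseteq> D" using in_D by blast
    qed (auto intro!: continuous_intros)
    then have 1: "continuous_on (\<gamma> ` einterval p q) (\<lambda>z. cinner (K z *\<^sub>V x) y)"
      by (rule continuous_on_eq) (use adj in auto)
    obtain \<sigma> where \<sigma>: "\<sigma> \<in> {0, 1, -1}" "represented K a b p q ?\<gamma> (-1) \<sigma>"
      using admissible_lower[OF admissible_cnj[OF adm]] ..
    have "represented K a b p q \<gamma> 1 \<sigma>"
      by (rule represented_cnj[OF curve \<sigma>(2,1) adj herm])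
    moreover have "\<exists>s\<in>einterval p q. norm (\<gamma> s - of_real e) < \<epsilon>" if e: "is_end a b e" "\<epsilon> > 0"
    proof -
      obtain s where s: "s \<in> einterval p q" "norm (cnj (\<gamma> s) - of_real e) < \<epsilon>"
        using contour_near_end[OF c' ab D(1,2,3) e] ..
      have "norm (\<gamma> s - of_real e) = norm (cnj (\<gamma> s - of_real e))" by (rule complex_mod_cnj[symmetric])
      then show ?thesis using s(2) by (intro bexI[OF _ s(1)]) simp
    qed
    ultimately show ?thesis using 1 2 \<sigma>(1) by auto
  qed
  then show "continuous_on (\<gamma> ` einterval p q) (\<lambda>z. cinner (K z *\<^sub>V x) y)"
    and "\<exists>\<sigma>\<in>{0, 1, -1}. represented K a b p q \<gamma> (real_of_int l) \<sigma>"
    and "is_end a b e \<Longrightarrow> \<epsilon> > 0 \<Longrightarrow> \<exists>s\<in>einterval p q. norm (\<gamma> s - of_real e) < \<epsilon>"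
    by simp_all
qed

lemma poisson_form_lower_bound:
  assumes L: "L \<in> einterval a b" "\<kappa> \<le> Re (cinner (K (of_real L) *\<^sub>V x) x)" "\<kappa> > 0" and l: "l = 1 \<or> l = -1"
  obtains \<eta> where "\<eta> > 0" "\<And>y. 0 < y \<Longrightarrow> y < \<eta> \<Longrightarrow> \<kappa> / 2 \<le> l * Im (integral (einterval a b)
    (\<lambda>t. cinner (K (of_real t) *\<^sub>V x) x * (1 / (of_real L - \<i> * of_real (l * y) - of_real t))))"
proof -
  let ?k = "\<lambda>t. Re (cinner (K (complex_of_real t) *\<^sub>V x) x)"
  have real: "cinner (K (of_real t) *\<^sub>V x) x = of_real (?k t)" if "t \<in> einterval a b" for t
    using herm[OF that, of x x] by (simp add: complex_eq_iff)
  have int: "?k integrable_on einterval a b"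
    using integrable_linear[OF _ bounded_linear_Re] int_I[of x x]
    by (fastforce simp: o_def absolutely_integrable_on_def)
  have "continuous_on (einterval a b) (\<lambda>t. cinner (K (complex_of_real t) *\<^sub>V x) x)"
    by (rule continuous_on_compose2[OF cont]) (auto intro!: continuous_intros)
  then have cont: "continuous_on (einterval a b) ?k" by (intro continuous_intros)
  show ?thesis
  proof (rule poisson_lower_bound[where k = ?k, OF int cont _ L l])
    show "0 \<le> ?k t" if "t \<in> einterval a b" for t by (rule nonneg[OF that])
  next
    fix \<eta> :: real
    assume "\<eta> > 0" and \<eta>: "\<And>y. 0 < y \<Longrightarrow> y < \<eta> \<Longrightarrow>
      \<kappa> / 2 \<le> l * Im (integral (einterval a b) (\<lambda>t. of_real (?k t) * (1 / (of_real L - \<i> * of_real (l * y) - of_real t))))"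
    show thesis
    proof (rule that[OF \<open>\<eta> > 0\<close>])
    fix y :: real assume y: "0 < y" "y < \<eta>"
    have "integral (einterval a b) (\<lambda>t. cinner (K (of_real t) *\<^sub>V x) x * (1 / (of_real L - \<i> * of_real (l * y) - of_real t))) =
      integral (einterval a b) (\<lambda>t. of_real (?k t) * (1 / (of_real L - \<i> * of_real (l * y) - of_real t)))"
      by (rule integral_cong) (rule arg_cong[where f = "\<lambda>z. z * _", OF real])
    then show "\<kappa> / 2 \<le> l * Im (integral (einterval a b)
        (\<lambda>t. cinner (K (of_real t) *\<^sub>V x) x * (1 / (of_real L - \<i> * of_real (l * y) - of_real t))))"
      using \<eta>[OF y] by (simp only:)
    qed
  qed
qed

end

text \<open>
  The pole \<open>L - i l y\<close> lies on the side of the real axis without the contour, so \<open>1 / (L - i l y - z)\<close>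
  is an admissible test function, with \<open>\<delta> = y / 2\<close>.
\<close>

lemma represented_pole:
  assumes rep: "represented K a b p q \<gamma> l \<sigma>" and l: "l = 1 \<or> l = -1" and y: "(y::real) > 0"
  shows "integral (einterval a b) (\<lambda>t. cinner (K (of_real t) *\<^sub>V x) x * (1 / (of_real L - \<i> * of_real (l * y) - of_real t))) =
    \<sigma> * integral (einterval p q) (\<lambda>s. vector_derivative \<gamma> (at s) *
      (cinner (K (\<gamma> s) *\<^sub>V x) x * (1 / (of_real L - \<i> * of_real (l * y) - \<gamma> s))))"
proof -
  let ?w = "\<lambda>z. complex_of_real L - \<i> * of_real (l * y) - z"
  let ?S = "{z. - (y / 2) < l * Im z}"
  have w: "y / 2 \<le> norm (?w z)" if "z \<in> ?S" for z
    using that l y abs_Im_le_cmod[of "?w z"] by auto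
  have w0: "?w z \<noteq> 0" if "z \<in> ?S" for z using w[OF that] y by (metis half_gt_zero norm_zero not_le)
  have "(\<lambda>z. 1 / ?w z) holomorphic_on ?S" using w0 by (intro holomorphic_intros) auto
  moreover have "norm (1 / ?w z) \<le> 2 / y" if "z \<in> ?S" for z
  proof -
    have "1 / norm (?w z) \<le> 1 / (y / 2)" using w[OF that] y by (intro divide_left_mono mult_pos_pos) auto
    then show ?thesis by (simp add: norm_divide)
  qed
  ultimately show ?thesis using rep[unfolded represented_def, rule_format, of "y / 2" "\<lambda>z. 1 / ?w z" "2 / y" x x] y by simp
qed

locale coercive_kernel = continued_kernel K D a b + self_adjoint_finite A Q
  for K :: "complex \<Rightarrow> ('b::complex_hilbert, 'b) cblinfun" and D a b
    and A :: "('b, 'b) cblinfun" and Q +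
  fixes l :: int and c0 :: real
  assumes l: "l \<in> {1, -1}" and c0: "c0 > 0"
    and spectrum_inside: "bspectrum A \<subseteq> complex_of_real ` einterval a b"
    and coercive: "\<And>t x. t \<in> einterval a b \<Longrightarrow>
      infdist (of_real t) (bspectrum A) \<le> r_0 K (domain_of_sign D l) a b (bspectrum A) \<Longrightarrow>
      c0 * (norm x)\<^sup>2 \<le> Re (cinner (K (of_real t) *\<^sub>V x) x)"
begin

abbreviation "r\<^sub>0 \<equiv> r_0 K (domain_of_sign D l) a b (bspectrum A)"

text \<open>
  The contours over which the infimum defining \<open>r\<^sub>0\<close> is taken.
\<close>

definition close_contour :: "ereal \<Rightarrow> ereal \<Rightarrow> (real \<Rightarrow> complex) \<Rightarrow> bool" where
  "close_contour p q \<gamma> \<longleftrightarrow> admissible K (domain_of_sign D l) a b p q \<gamma> \<and>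
     V_0 K p q \<gamma> < 1 / 4 * (d_contour (bspectrum A) p q \<gamma>)\<^sup>2"

lemma l_real: "real_of_int l = 1 \<or> real_of_int l = -1"
  using l by auto

lemma close_contour_riccati: "close_contour p q \<gamma> \<Longrightarrow> riccati p q \<gamma> A Q K"
  using admissible_facts(1,2)[OF l, of p q \<gamma>] self_adjoint_finite_axioms
  by (auto simp: close_contour_def admissible_def intro!: riccati.intro riccati_axioms.intro)

lemma r_0_greatest:
  assumes "close_contour p q \<gamma>" and le: "\<And>p' q' \<gamma>'. close_contour p' q' \<gamma>' \<Longrightarrow> m \<le> r_min K (bspectrum A) p' q' \<gamma>'"
  shows "m \<le> r\<^sub>0"
  unfolding r_0_def
proof (rule cInf_greatest)
  show "{r_min K (bspectrum A) p q \<gamma> |p q \<gamma>. admissible K (domain_of_sign D l) a b p q \<gamma> \<and>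
      0 < (d_contour (bspectrum A) p q \<gamma>)\<^sup>2 - 4 * V_0 K p q \<gamma>} \<noteq> {}"
    using assms(1) by (fastforce simp: close_contour_def)
qed (use le in \<open>fastforce simp: close_contour_def\<close>)

lemma r_0_nonneg:
  assumes "close_contour p q \<gamma>"
  shows "0 \<le> r\<^sub>0"
proof (rule r_0_greatest[OF assms])
  fix p' q' \<gamma>' assume "close_contour p' q' \<gamma>'"
  then interpret riccati p' q' \<gamma>' A Q K by (rule close_contour_riccati)
  show "0 \<le> r_min K (bspectrum A) p' q' \<gamma>'" using X_solution(2) norm_ge_zero by (rule order_trans[rotated])
qed

text \<open>
  If the factor were 0, the Poisson integral at a point of the spectrum would vanish for all \<open>y\<close>,
  but there the kernel is coercive, as \<open>r\<^sub>0 \<ge> 0\<close>.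
\<close>

lemma close_contour_represented:
  assumes good: "close_contour p q \<gamma>"
  shows "\<exists>\<sigma>. (\<sigma> = 1 \<or> \<sigma> = -1) \<and> represented K a b p q \<gamma> (real_of_int l) \<sigma>"
proof -
  interpret riccati p q \<gamma> A Q K by (rule close_contour_riccati[OF good])
  obtain \<sigma> where \<sigma>: "\<sigma> \<in> {0, 1, -1}" and rep: "represented K a b p q \<gamma> (real_of_int l) \<sigma>"
    using admissible_facts(3)[OF l] good unfolding close_contour_def by meson
  have "\<sigma> \<noteq> 0"
  proof
    assume "\<sigma> = 0"
    obtain z where z: "z \<in> bspectrum A" using spectrum_nonempty by blast
    then obtain L where L: "z = of_real L" "L \<in> einterval a b" using spectrum_inside by blast
    obtain x :: 'b where x: "x \<noteq> 0" using bspectrum_eigenvalue[OF B z] by (auto simp: eigenvalue_def)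
    have "infdist z (bspectrum A) \<le> r\<^sub>0" using r_0_nonneg[OF good] z by simp
    then have "c0 * (norm x)\<^sup>2 \<le> Re (cinner (K (of_real L) *\<^sub>V x) x)" unfolding L(1) by (rule coercive[OF L(2)])
    note c = this
    have \<kappa>: "0 < c0 * (norm x)\<^sup>2" using c0 x by simp
    obtain \<eta> where \<eta>: "\<eta> > 0" "\<And>y. 0 < y \<Longrightarrow> y < \<eta> \<Longrightarrow> c0 * (norm x)\<^sup>2 / 2 \<le> real_of_int l *
        Im (integral (einterval a b) (\<lambda>t. cinner (K (of_real t) *\<^sub>V x) x * (1 / (of_real L - \<i> * of_real (real_of_int l * y) - of_real t))))"
    proof (rule poisson_form_lower_bound[OF L(2) c \<kappa> l_real], goal_cases)
      case (1 \<eta>)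
      show ?case by (rule that) (fact 1)+
    qed
    have y: "0 < \<eta> / 2" "\<eta> / 2 < \<eta>" using \<eta>(1) by auto
    show False using \<eta>(2)[OF y] \<kappa> unfolding represented_pole[OF rep l_real y(1)] \<open>\<sigma> = 0\<close> by simp
  qed
  then show ?thesis using \<sigma> rep by auto
qed

text \<open>
  The solution for the contour with the smaller distance from the spectrum also solves the
  equation of the other one, up to a sign: its norm is less than half of either distance, so \<open>W_agree\<close>
  applies to it. By uniqueness both equations have this same solution, and its norm is bounded by
  \<open>r\<^sub>m\<^sub>i\<^sub>n\<close> of each contour.
\<close>

lemma X_solution_le_r_min:
  assumes good: "close_contour p q \<gamma>" "close_contour p2 q2 \<gamma>2"
  shows "norm (X_solution K A p q \<gamma>) \<le> r_min K (bspectrum A) p2 q2 \<gamma>2"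
proof -
  interpret riccati_pair p q \<gamma> p2 q2 \<gamma>2 A Q K
    using close_contour_riccati good by (simp add: riccati_pair_def)
  obtain \<sigma>1 where \<sigma>1: "\<sigma>1 = 1 \<or> \<sigma>1 = -1" and rep1: "represented K a b p q \<gamma> (real_of_int l) \<sigma>1"
    using close_contour_represented[OF good(1)] by blast
  obtain \<sigma>2 where \<sigma>2: "\<sigma>2 = 1 \<or> \<sigma>2 = -1" and rep2: "represented K a b p2 q2 \<gamma>2 (real_of_int l) \<sigma>2"
    using close_contour_represented[OF good(2)] by blast
  have \<tau>: "cmod (\<sigma>1 * \<sigma>2) = 1" using \<sigma>1 \<sigma>2 by auto
  have W: "c1.W X = (\<sigma>1 * \<sigma>2) *\<^sub>C c2.W X" if "norm X < c1.d / 2" "norm X < c2.d / 2" for X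
  proof -
    have "\<sigma>1 *\<^sub>C \<sigma>1 *\<^sub>C c1.W X = \<sigma>1 *\<^sub>C \<sigma>2 *\<^sub>C c2.W X"
      using W_agree[OF rep1 rep2 l_real that] by simp
    moreover have "\<sigma>1 * \<sigma>1 = 1" using \<sigma>1 by auto
    ultimately show ?thesis by (simp add: scaleC_scaleC scaleC_one)
  qed
  let ?X = "X_solution K A p q \<gamma>"
  show ?thesis
  proof (cases "c1.d \<le> c2.d")
    case True
    have "norm ?X < c1.d / 2" using c1.X_solution(2) c1.r_min_le(2) by linarith
    then have "c1.W ?X = (\<sigma>1 * \<sigma>2) *\<^sub>C c2.W ?X" and "norm ?X \<le> c2.d / 2" using True by (auto intro!: W)
    then show ?thesis using c1.X_solution(1) by (intro c2.riccati_solution_bound[OF _ _ \<tau>]) auto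
  next
    case False
    obtain Y where Y: "norm Y \<le> c2.d / 2" "(\<sigma>1 * \<sigma>2) *\<^sub>C c2.W Y = Y"
      using c2.riccati_solution_unique_existence[OF \<tau>] by auto
    have Y_le: "norm Y \<le> r_min K (bspectrum A) p2 q2 \<gamma>2" by (rule c2.riccati_solution_bound[OF Y \<tau>])
    then have "norm Y < c2.d / 2" using c2.r_min_le(2) by linarith
    then have "c1.W Y = Y" using W[of Y] Y(2) False by simp
    then have "Y = ?X" using Y(1) False by (intro c1.solution_eq_X_solution) auto
    then show ?thesis using Y_le by simp
  qed
qed

lemma X_solution_le_r_0: "close_contour p q \<gamma> \<Longrightarrow> norm (X_solution K A p q \<gamma>) \<le> r\<^sub>0"
  by (rule r_0_greatest) (auto intro: X_solution_le_r_min)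

text \<open>
  A contour comes arbitrarily close to every finite end point. So the distance of an end point
  from a point of the spectrum is at least \<open>d\<close>, and no end point lies between the spectrum and a
  real point closer to it than \<open>d\<close>.
\<close>

lemma point_near_spectrum_inside:
  assumes good: "close_contour p q \<gamma>" and L: "infdist (of_real L) (bspectrum A) < d_contour (bspectrum A) p q \<gamma>"
  shows "L \<in> einterval a b"
proof -
  interpret riccati p q \<gamma> A Q K by (rule close_contour_riccati[OF good])
  obtain z where z: "z \<in> bspectrum A" "dist (of_real L) z < d"
  proof (rule ccontr)
    assume "\<not> thesis"
    then have "d \<le> dist (of_real L) z" if "z \<in> bspectrum A" for z
      using \<open>\<And>z. z \<in> bspectrum A \<Longrightarrow> dist (of_real L) z < d \<Longrightarrow> thesis\<close>[OF that] by linarith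
    then have "d \<le> infdist (of_real L) (bspectrum A)"
      unfolding infdist_def if_not_P[OF spectrum_nonempty] by (rule cINF_greatest[OF spectrum_nonempty])
    then show False using L by simp
  qed
  then obtain \<alpha> where \<alpha>: "z = of_real \<alpha>" "\<alpha> \<in> einterval a b" using spectrum_inside by blast
  have near: "\<bar>L - \<alpha>\<bar> < d" using z(2) unfolding \<alpha>(1) by (simp add: dist_norm flip: of_real_diff)
  have no_end: "d \<le> \<bar>e - \<alpha>\<bar>" if e: "is_end a b e" for e
  proof (rule ccontr)
    assume "\<not> d \<le> \<bar>e - \<alpha>\<bar>"
    then have "0 < d - \<bar>e - \<alpha>\<bar>" by simp
    then obtain s where s: "s \<in> E" "norm (\<gamma> s - of_real e) < d - \<bar>e - \<alpha>\<bar>"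
      using admissible_facts(4)[OF l _ e] good unfolding close_contour_def by meson
    have "norm (\<gamma> s - of_real \<alpha>) \<le> norm (\<gamma> s - of_real e) + norm (of_real e - complex_of_real \<alpha>)"
      using norm_triangle_ineq[of "\<gamma> s - of_real e" "of_real e - of_real \<alpha>"] by simp
    also have "norm (of_real e - complex_of_real \<alpha>) = \<bar>e - \<alpha>\<bar>" by (simp flip: of_real_diff)
    finally have "dist (\<gamma> s) z < d" using s(2) by (simp add: \<alpha>(1) dist_norm)
    then show False using d_le[OF s(1)] infdist_le[OF z(1), of "\<gamma> s"] by simp
  qed
  show ?thesis
  proof (rule ccontr)
    assume "L \<notin> einterval a b"
    then consider "ereal L \<le> a" | "b \<le> ereal L" by (auto simp: einterval_def not_less)
    then show False
    proof cases
      case 1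
      then obtain e where e: "a = ereal e" using \<alpha>(2) by (cases a) (auto simp: einterval_def)
      then show False using no_end[of e] 1 near \<alpha>(2) by (auto simp: is_end_def einterval_def)
    next
      case 2
      then obtain e where e: "b = ereal e" using \<alpha>(2) by (cases b) (auto simp: einterval_def)
      then show False using no_end[of e] 2 near \<alpha>(2) by (auto simp: is_end_def einterval_def)
    qed
  qed
qed

text \<open>
  \<open>J y\<close> is the contour integral with the pole at \<open>L - i l y\<close>. As \<open>\<langle>X x, x\<rangle> = - J 0\<close> is real and
  \<open>J y\<close> differs from \<open>J 0\<close> by \<open>O(y)\<close>, its imaginary part tends to 0. But it equals, up to a sign, the
  Poisson integral over the interval, which stays above \<open>c0 \<parallel>x\<parallel>\<^sup>2 / 2\<close>.
\<close>

theorem no_real_eigenvalue: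
  assumes good: "close_contour p q \<gamma>" and x: "x \<noteq> 0"
    and eig: "(A + X_solution K A p q \<gamma>) *\<^sub>V x = of_real L *\<^sub>C x"
  shows False
proof -
  interpret riccati p q \<gamma> A Q K by (rule close_contour_riccati[OF good])
  let ?X = "X_solution K A p q \<gamma>"
  have X_small: "norm ?X < d / 2" using X_solution(2) r_min_le(2) by linarith
  have "(infdist (of_real L) (bspectrum A) - norm ?X) * norm x \<le> 0"
    using perturbed_bounded_below[OF order_refl, of "of_real L" ?X x] unfolding eig by simp
  then have dist_L: "infdist (of_real L) (bspectrum A) \<le> norm ?X" using x by (simp add: mult_le_0_iff)
  have "L \<in> einterval a b" using dist_L X_small d_pos by (intro point_near_spectrum_inside[OF good]) simp
  then have "c0 * (norm x)\<^sup>2 \<le> Re (cinner (K (of_real L) *\<^sub>V x) x)"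
    using dist_L X_solution_le_r_0[OF good] by (intro coercive) auto
  note c = this
  have \<kappa>: "0 < c0 * (norm x)\<^sup>2" using c0 x by simp
  obtain \<eta> where \<eta>: "\<eta> > 0" "\<And>y. 0 < y \<Longrightarrow> y < \<eta> \<Longrightarrow> c0 * (norm x)\<^sup>2 / 2 \<le> real_of_int l *
      Im (integral (einterval a b) (\<lambda>t. cinner (K (of_real t) *\<^sub>V x) x * (1 / (of_real L - \<i> * of_real (real_of_int l * y) - of_real t))))"
  proof (rule poisson_form_lower_bound[OF \<open>L \<in> einterval a b\<close> c \<kappa> l_real], goal_cases)
    case (1 \<eta>)
    show ?case by (rule that) (fact 1)+
  qed
  obtain \<sigma> where \<sigma>: "\<sigma> = 1 \<or> \<sigma> = -1" and rep: "represented K a b p q \<gamma> (real_of_int l) \<sigma>"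
    using close_contour_represented[OF good] by blast
  define w where "w y z = of_real L - \<i> * complex_of_real (real_of_int l * y) - z" for y z
  define J where "J y = integral E (\<lambda>s. \<gamma>' s * (cinner (K (\<gamma> s) *\<^sub>V x) x * (1 / w y (\<gamma> s))))" for y
  have w_ge: "d / 2 \<le> norm (w 0 (\<gamma> s))" if s: "s \<in> E" for s
  proof -
    have "d \<le> infdist (\<gamma> s) (bspectrum A)" by (rule d_le[OF s])
    also have "\<dots> \<le> infdist (of_real L) (bspectrum A) + dist (\<gamma> s) (of_real L)" by (rule infdist_triangle)
    also have "dist (\<gamma> s) (of_real L) = norm (w 0 (\<gamma> s))" by (simp add: w_def dist_norm norm_minus_commute)
    finally show ?thesis using dist_L X_small by simp
  qed
  have w_diff: "norm (w y z - w 0 z) = \<bar>y\<bar>" for y z using l_real by (auto simp: w_def norm_mult)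
  have wy_ge: "d / 4 \<le> norm (w y (\<gamma> s))" if s: "s \<in> E" and y: "0 \<le> y" "y \<le> d / 4" for s y
    using w_ge[OF s] norm_triangle_ineq2[of "w 0 (\<gamma> s)" "w y (\<gamma> s)"] w_diff[of y "\<gamma> s"] y
    by (simp add: norm_minus_commute)
  have kernel_cont: "continuous_on (\<gamma> ` E) (\<lambda>z. 1 / w y z)" if "0 \<le> y" "y \<le> d / 4" for y
  proof -
    have "w y z \<noteq> 0" if z: "z \<in> \<gamma> ` E" for z
    proof -
      obtain s where "s \<in> E" "z = \<gamma> s" using z by blast
      then have "d / 4 \<le> norm (w y z)" using wy_ge \<open>0 \<le> y\<close> \<open>y \<le> d / 4\<close> by blast
      then show ?thesis using d_pos by auto
    qed
    then show ?thesis unfolding w_def by (intro continuous_intros) auto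
  qed
  have J_int: "(\<lambda>s. \<gamma>' s * (cinner (K (\<gamma> s) *\<^sub>V x) x * (1 / w y (\<gamma> s)))) integrable_on E" if y: "0 \<le> y" "y \<le> d / 4" for y
  proof -
    have "(\<lambda>s. \<gamma>' s * (cinner (K (\<gamma> s) *\<^sub>V x) x * (1 / w y (\<gamma> s)))) absolutely_integrable_on E"
    proof (rule curve_form_bound(1)[where C = "norm x * norm x * (4 / d)"])
      show "continuous_on (\<gamma> ` E) (\<lambda>z. cinner (K z *\<^sub>V x) x * (1 / w y z))"
        by (intro continuous_on_mult K_cont kernel_cont y)
      fix s assume s: "s \<in> E"
      have "1 / norm (w y (\<gamma> s)) \<le> 1 / (d / 4)"
        using wy_ge[OF s y] d_pos by (intro divide_left_mono mult_pos_pos) auto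
      then have "norm (1 / w y (\<gamma> s)) \<le> 4 / d" by (simp add: norm_divide)
      then have "norm (K (\<gamma> s)) * (norm x * norm x * norm (1 / w y (\<gamma> s))) \<le> norm (K (\<gamma> s)) * (norm x * norm x * (4 / d))"
        by (intro mult_left_mono) auto
      with form_le[of "\<gamma> s" x x "1 / w y (\<gamma> s)"]
      show "norm (cinner (K (\<gamma> s) *\<^sub>V x) x * (1 / w y (\<gamma> s))) \<le> norm (K (\<gamma> s)) * (norm x * norm x * (4 / d))" by linarith
    qed
    then show ?thesis by (simp add: absolutely_integrable_on_def)
  qed
  have J_close: "norm (J y - J 0) \<le> V * (norm x * norm x * (8 / d\<^sup>2 * y))" if y: "0 < y" "y \<le> d / 4" for y
  proof -
    let ?F = "\<lambda>z. cinner (K z *\<^sub>V x) x * (1 / w y z - 1 / w 0 z)"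
    have d4: "0 \<le> d / 4" using d_pos by simp
    have "norm (integral E (\<lambda>s. \<gamma>' s * ?F (\<gamma> s))) \<le> V * (norm x * norm x * (8 / d\<^sup>2 * y))"
    proof (rule curve_form_bound(2))
      show "continuous_on (\<gamma> ` E) ?F"
        using y d4 by (intro continuous_on_mult continuous_on_diff K_cont kernel_cont) auto
      fix s assume s: "s \<in> E"
      have ge: "d / 4 \<le> norm (w y (\<gamma> s))" "d / 2 \<le> norm (w 0 (\<gamma> s))" using wy_ge[OF s] w_ge[OF s] y by auto
      then have nz: "w y (\<gamma> s) \<noteq> 0" "w 0 (\<gamma> s) \<noteq> 0" using d_pos by auto
      have "d / 4 * (d / 2) \<le> norm (w y (\<gamma> s)) * norm (w 0 (\<gamma> s))" using ge d_pos by (intro mult_mono) auto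
      moreover have "d / 4 * (d / 2) = d\<^sup>2 / 8" by (simp add: power2_eq_square)
      ultimately have prod: "d\<^sup>2 / 8 \<le> norm (w y (\<gamma> s) * w 0 (\<gamma> s))" by (simp add: norm_mult)
      have "1 / w y (\<gamma> s) - 1 / w 0 (\<gamma> s) = - (w y (\<gamma> s) - w 0 (\<gamma> s)) / (w y (\<gamma> s) * w 0 (\<gamma> s))"
        using nz by (simp add: field_simps)
      then have "norm (1 / w y (\<gamma> s) - 1 / w 0 (\<gamma> s)) = y / norm (w y (\<gamma> s) * w 0 (\<gamma> s))"
        using w_diff[of y "\<gamma> s"] y by (simp only: norm_divide norm_minus_cancel abs_of_pos)
      also have "\<dots> \<le> y / (d\<^sup>2 / 8)" using prod y d_pos by (intro divide_left_mono mult_pos_pos) auto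
      finally have "norm (1 / w y (\<gamma> s) - 1 / w 0 (\<gamma> s)) \<le> 8 / d\<^sup>2 * y" by (simp add: mult.commute)
      then have "norm (K (\<gamma> s)) * (norm x * norm x * norm (1 / w y (\<gamma> s) - 1 / w 0 (\<gamma> s))) \<le>
          norm (K (\<gamma> s)) * (norm x * norm x * (8 / d\<^sup>2 * y))"
        by (intro mult_left_mono) auto
      with form_le[of "\<gamma> s" x x "1 / w y (\<gamma> s) - 1 / w 0 (\<gamma> s)"]
      show "norm (?F (\<gamma> s)) \<le> norm (K (\<gamma> s)) * (norm x * norm x * (8 / d\<^sup>2 * y))" by linarith
    qed
    also have "integral E (\<lambda>s. \<gamma>' s * ?F (\<gamma> s)) = J y - J 0"
      unfolding J_def using J_int[of y] J_int[of 0] y d4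
      by (subst integral_diff[symmetric]) (auto simp: right_diff_distrib)
    finally show ?thesis .
  qed
  have J0: "Im (J 0) = 0"
  proof -
    have res: "resolvent (A + ?X) (\<gamma> s) *\<^sub>V x = (1 / w 0 (\<gamma> s)) *\<^sub>C x" if s: "s \<in> E" for s
    proof -
      have "norm ?X < infdist (\<gamma> s) (bspectrum A)" using d_le[OF s] X_small d_pos by simp
      from perturbed_resolvent(2)[OF order_refl this, of x]
      have "resolvent (A + ?X) (\<gamma> s) *\<^sub>V (w 0 (\<gamma> s) *\<^sub>C x) = x"
        unfolding eig by (simp add: w_def complex_vector.scale_left_diff_distrib)
      then have "(1 / w 0 (\<gamma> s)) *\<^sub>C (w 0 (\<gamma> s) *\<^sub>C resolvent (A + ?X) (\<gamma> s) *\<^sub>V x) = (1 / w 0 (\<gamma> s)) *\<^sub>C x"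
        by (simp add: cblinfun_clinear)
      moreover have "w 0 (\<gamma> s) \<noteq> 0" using w_ge[OF s] d_pos by auto
      ultimately show ?thesis by (simp add: scaleC_scaleC scaleC_one)
    qed
    have "cinner (?X *\<^sub>V x) x = cinner (W ?X *\<^sub>V x) x" by (simp only: X_solution(1))
    also have "\<dots> = - integral E (\<lambda>s. \<gamma>' s * cinner (K (\<gamma> s) *\<^sub>V resolvent (A + ?X) (\<gamma> s) *\<^sub>V x) x)"
      using X_small d_pos by (intro W_form) simp
    also have "\<dots> = - J 0"
      unfolding J_def
      by (intro arg_cong[where f = uminus] integral_cong) (simp add: res cblinfun_clinear cinner_scaleC_left)
    finally have X_form: "cinner (?X *\<^sub>V x) x = - J 0" .
    have "?X *\<^sub>V x = of_real L *\<^sub>C x - A *\<^sub>V x" using eig by (simp add: algebra_simps)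
    then have "cinner (?X *\<^sub>V x) x = of_real L * cinner x x - cinner (A *\<^sub>V x) x"
      by (simp add: cinner_diff_left cinner_scaleC_left)
    moreover have "cinner (A *\<^sub>V x) x = cnj (cinner (A *\<^sub>V x) x)"
      using A_sym[of x x] cinner_commute[of x "A *\<^sub>V x"] by simp
    then have "Im (cinner (A *\<^sub>V x) x) = 0" by (simp add: complex_eq_iff)
    ultimately have "Im (cinner (A *\<^sub>V x) x) = 0" "- J 0 = of_real (L * (norm x)\<^sup>2) - cinner (A *\<^sub>V x) x"
      using X_form by (simp_all add: cinner_norm)
    then have "Im (- J 0) = 0" by (simp only: minus_complex.sel Im_complex_of_real)
    then show ?thesis by simp
  qed
  let ?C = "V * (norm x * norm x * (8 / d\<^sup>2))"
  have "c0 * (norm x)\<^sup>2 / 2 \<le> ?C * y" if y: "0 < y" "y < min \<eta> (d / 4)" for y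
  proof -
    have "c0 * (norm x)\<^sup>2 / 2 \<le> real_of_int l * Im (\<sigma> * J y)"
      using \<eta>(2)[of y] y unfolding represented_pole[OF rep l_real y(1)] J_def w_def by simp
    also have "\<dots> \<le> \<bar>Im (J y - J 0)\<bar>" using l_real \<sigma> J0 by auto
    also have "\<dots> \<le> norm (J y - J 0)" by (rule abs_Im_le_cmod)
    also have "\<dots> \<le> ?C * y" using J_close[of y] y by (simp add: mult_ac)
    finally show ?thesis .
  qed
  then have "\<forall>\<^sub>F y in at_right 0. c0 * (norm x)\<^sup>2 / 2 \<le> ?C * y"
    using \<eta>(1) d_pos by (auto simp: eventually_at_right intro!: exI[of _ "min \<eta> (d / 4)"])
  moreover have "((\<lambda>y. ?C * y) \<longlongrightarrow> ?C * 0) (at_right 0)" by (intro tendsto_intros)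
  ultimately have "c0 * (norm x)\<^sup>2 / 2 \<le> ?C * 0" by (intro tendsto_lowerbound[where F = "at_right 0"]) auto
  then show False using \<kappa> by simp
qed

end

lemma vholomorphic_form:
  assumes "vholomorphic_on F S"
  shows "(\<lambda>z. cinner (F z *\<^sub>V x) y) holomorphic_on S"
proof (rule holomorphic_onI)
  fix z assume "z \<in> S"
  then obtain F' where F': "(F has_derivative (\<lambda>h. h *\<^sub>C F')) (at z)" using assms by (auto simp: vholomorphic_on_def)
  have "((\<lambda>z. cinner (F z *\<^sub>V x) y) has_derivative (\<lambda>h. cinner ((h *\<^sub>C F') *\<^sub>V x) y)) (at z)"
    by (rule bounded_linear.has_derivative[OF bounded_linear_form F'])
  then have "((\<lambda>z. cinner (F z *\<^sub>V x) y) has_field_derivative cinner (F' *\<^sub>V x) y) (at z)"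
    unfolding has_field_derivative_def by (simp add: cinner_scaleC_left mult.commute[of _ "cinner (F' *\<^sub>V x) y"])
  then show "(\<lambda>z. cinner (F z *\<^sub>V x) y) field_differentiable at z within S"
    by (meson field_differentiable_at_within field_differentiable_def)
qed

text \<open>
  \<open>\<langle>K\<^sub>B(t) x, x\<rangle> = \<parallel>E((-\<infinity>, t)) B x\<parallel>\<^sup>2\<close> is nondecreasing and bounded.
\<close>

lemma derivative_form_absolutely_integrable:
  fixes Q :: "'b::complex_hilbert set" and B :: "('b, 'a::complex_hilbert) cblinfun"
  assumes Q: "orthonormal_basis Q" and E: "projection_valued_measure E" and ab: "a < b"
    and der: "\<And>t. t \<in> einterval a b \<Longrightarrow> (K_B E B has_vector_derivative K (complex_of_real t)) (at t)"
    and cont: "\<And>x y. continuous_on (einterval a b) (\<lambda>t. cinner (K (complex_of_real t) *\<^sub>V x) y)"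
  shows "(\<lambda>t. cinner (K (complex_of_real t) *\<^sub>V x) y) absolutely_integrable_on einterval a b"
proof -
  let ?q = "\<lambda>x t. Re (cinner (K (complex_of_real t) *\<^sub>V x) x)"
  have q_int: "?q x integrable_on einterval a b" for x
  proof (rule bounded_nondecreasing_derivative_integrable[OF ab, where f = "\<lambda>t. (norm (E {..<t} *\<^sub>V B *\<^sub>V x))\<^sup>2"])
    fix t assume t: "t \<in> einterval a b"
    show "((\<lambda>t. (norm (E {..<t} *\<^sub>V B *\<^sub>V x))\<^sup>2) has_real_derivative ?q x t) (at t)" and "0 \<le> ?q x t"
      by (rule K_B_derivative[OF Q E der[OF t]])+
    show "\<bar>(norm (E {..<t} *\<^sub>V B *\<^sub>V x))\<^sup>2\<bar> \<le> (norm (E UNIV *\<^sub>V B *\<^sub>V x))\<^sup>2"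
      using pvm_norm_mono[OF E, of "{..<t}" UNIV "B *\<^sub>V x"] by simp
  qed
  show ?thesis
  proof (rule measurable_bounded_by_integrable_imp_absolutely_integrable)
    show "(\<lambda>t. cinner (K (complex_of_real t) *\<^sub>V x) y) \<in> borel_measurable (lebesgue_on (einterval a b))"
      by (rule continuous_imp_measurable_on_sets_lebesgue[OF cont]) simp
    show "(\<lambda>t. ?q (x + y) t + ?q (x - y) t + ?q (x + \<i> *\<^sub>C y) t + ?q (x - \<i> *\<^sub>C y) t) integrable_on einterval a b"
      by (intro integrable_add q_int)
    fix t assume t: "t \<in> einterval a b"
    show "norm (cinner (K (complex_of_real t) *\<^sub>V x) y) \<le>
        ?q (x + y) t + ?q (x - y) t + ?q (x + \<i> *\<^sub>C y) t + ?q (x - \<i> *\<^sub>C y) t"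
      by (rule polarization_bound) (rule K_B_derivative[OF Q E der[OF t]])+
  qed simp
qed

lemma continued_kernel_of_spectral_measure:
  fixes Q :: "'b::complex_hilbert set" and B :: "('b, 'a::complex_hilbert) cblinfun"
  assumes Q: "orthonormal_basis Q" and E: "projection_valued_measure E" and ab: "a < b"
    and D: "open D" "D \<subseteq> {z. Im z < 0}" "simply_connected D"
    and der: "\<And>t. t \<in> einterval a b \<Longrightarrow> (K_B E B has_vector_derivative K (complex_of_real t)) (at t)"
    and hol: "vholomorphic_on K D" and cont: "continuous_on (D \<union> complex_of_real ` einterval a b) K"
    and sym: "\<And>z. z \<in> D \<Longrightarrow> K (cnj z) = cadjoint (K z)"
    and ends: "\<And>c. is_end a b c \<Longrightarrow> \<exists>C \<gamma>. -1 < \<gamma> \<and> (\<forall>\<^sub>F z in at (complex_of_real c) within (D \<union> cnj ` D).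
      norm (K z) \<le> C * norm (z - complex_of_real c) powr \<gamma>)"
  shows "continued_kernel K D a b"
proof
  show form_cont: "continuous_on (D \<union> of_real ` einterval a b) (\<lambda>z. cinner (K z *\<^sub>V x) y)" for x y
    by (rule bounded_linear.continuous_on[OF bounded_linear_form cont])
  have "continuous_on (einterval a b) (\<lambda>t. cinner (K (complex_of_real t) *\<^sub>V x) y)" for x y
    by (rule continuous_on_compose2[OF form_cont]) (auto intro!: continuous_intros)
  then show "(\<lambda>t. cinner (K (of_real t) *\<^sub>V x) y) absolutely_integrable_on einterval a b" for x y
    by (intro derivative_form_absolutely_integrable[OF Q E ab der])
  show "cinner (K (cnj z) *\<^sub>V x) y = cnj (cinner (K z *\<^sub>V y) x)" if "z \<in> D" for z x y
    unfolding sym[OF that] cadjoint[OF Q, of "K z" y x] by (rule cinner_commute)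
  show "\<exists>C \<alpha>. -1 < \<alpha> \<and> (\<forall>\<^sub>F z in at (of_real c) within D. norm (K z) \<le> C * norm (z - of_real c) powr \<alpha>)"
    if c: "is_end a b c" for c
  proof -
    obtain C \<alpha> where "-1 < \<alpha>" and ev: "\<forall>\<^sub>F z in at (complex_of_real c) within (D \<union> cnj ` D).
        norm (K z) \<le> C * norm (z - complex_of_real c) powr \<alpha>" using ends[OF c] by auto
    have "at (complex_of_real c) within D \<le> at (of_real c) within (D \<union> cnj ` D)" by (rule at_le) simp
    then have "\<forall>\<^sub>F z in at (of_real c) within D. norm (K z) \<le> C * norm (z - of_real c) powr \<alpha>"
      by (rule filter_leD) (rule ev)
    with \<open>-1 < \<alpha>\<close> show ?thesis by blast
  qed
  show "cinner (K (of_real t) *\<^sub>V x) y = cnj (cinner (K (of_real t) *\<^sub>V y) x)" if "t \<in> einterval a b" for t x y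
    by (rule K_B_derivative(1)[OF Q E der[OF that]])
  show "0 \<le> Re (cinner (K (of_real t) *\<^sub>V x) x)" if "t \<in> einterval a b" for t x
    by (rule K_B_derivative(3)[OF Q E der[OF that]])
  show "(\<lambda>z. cinner (K z *\<^sub>V x) y) holomorphic_on D" for x y by (rule vholomorphic_form[OF hol])
qed (fact ab D)+

lemma finite_isolated:
  fixes S :: "'a::t1_space set"
  assumes "finite S" "z \<in> S"
  shows "z isolated_in S"
  unfolding isolated_in_def
  using assms by (intro conjI exI[of _ "- (S - {z})"]) (auto simp del: Compl_Diff_eq intro!: open_Compl finite_imp_closed)

theorem lemma5p2:
  fixes D0 :: "'a::complex_hilbert set" and A0 :: "'a \<Rightarrow> 'a"
    and E :: "real set \<Rightarrow> ('a, 'a) cblinfun"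
    and A1 :: "('b::complex_hilbert, 'b) cblinfun"
    and B :: "('b, 'a) cblinfun"
    and \<mu>1 \<mu>2 :: ereal
    and Dm :: "complex set"
    and K' :: "complex \<Rightarrow> ('b, 'b) cblinfun"
    and c0 :: real and l :: int
    and p q :: ereal and \<Gamma> :: "real \<Rightarrow> complex"
  assumes A0_self_adjoint: "self_adjoint D0 A0"
    and A1_self_adjoint: "self_adjoint UNIV (cblinfun_apply A1)"
    and E_spectral: "spectral_measure D0 A0 E"
    and interval: "\<mu>1 < \<mu>2"
    and spectrum_ac: "purely_absolutely_continuous E"
    and spectrum_A0: "spectrum D0 A0 = complex_of_real ` closure (einterval \<mu>1 \<mu>2)"
    and Dm_domain: "open Dm" "connected Dm" "simply_connected Dm" "Dm \<subseteq> {z. Im z < 0}"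
    and Dm_boundary: "complex_of_real ` einterval \<mu>1 \<mu>2 \<subseteq> frontier Dm"
    and K'_derivative: "\<And>t. t \<in> einterval \<mu>1 \<mu>2 \<Longrightarrow>
        (K_B E B has_vector_derivative K' (complex_of_real t)) (at t)"
    and K'_continuation: "vholomorphic_on K' Dm"
        "continuous_on (Dm \<union> complex_of_real ` einterval \<mu>1 \<mu>2) K'"
    and K'_symmetric: "\<And>z. z \<in> Dm \<Longrightarrow> K' (cnj z) = cadjoint (K' z)"
    and K'_ends: "\<And>c. is_end \<mu>1 \<mu>2 c \<Longrightarrow>
        \<exists>C \<gamma>. C > 0 \<and> -1 < \<gamma> \<and> \<gamma> \<le> 0 \<and>
          (\<forall>\<^sub>F z in at (complex_of_real c) within (Dm \<union> cnj ` Dm).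
             norm (K' z) \<le> C * norm (z - complex_of_real c) powr \<gamma>)"
    and finite_dim: "finite_cdim (UNIV :: 'b set)"
    and spectrum_A1: "bspectrum A1 \<subseteq> complex_of_real ` einterval \<mu>1 \<mu>2"
    and contour_exists: "\<exists>l'\<in>{1, -1}. \<exists>p' q' \<Gamma>'.
        admissible K' (domain_of_sign Dm l') \<mu>1 \<mu>2 p' q' \<Gamma>' \<and>
        V_0 K' p' q' \<Gamma>' < 1 / 4 * (d_contour (bspectrum A1) p' q' \<Gamma>')\<^sup>2"
    and c0_pos: "c0 > 0"
    and l_sign: "l \<in> {1, -1}"
    and K'_positive: "\<And>t x. t \<in> einterval \<mu>1 \<mu>2 \<Longrightarrow>
        complex_of_real t \<in>
          closed_nbhd (r_0 K' (domain_of_sign Dm l) \<mu>1 \<mu>2 (bspectrum A1)) (bspectrum A1) \<Longrightarrow>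
        Re (cinner (K' (complex_of_real t) *\<^sub>V x) x) \<ge> c0 * (norm x)\<^sup>2"
    and \<Gamma>_admissible: "admissible K' (domain_of_sign Dm l) \<mu>1 \<mu>2 p q \<Gamma>"
    and \<Gamma>_small: "V_0 K' p q \<Gamma> < 1 / 4 * (d_contour (bspectrum A1) p q \<Gamma>)\<^sup>2"
  defines "Z \<equiv> A1 + X_solution K' A1 p q \<Gamma>"
  shows "finite (bspectrum Z) \<and>
    (\<forall>z\<in>bspectrum Z. eigenvalue Z z \<and> z isolated_in bspectrum Z \<and>
       finite_cdim (root_subspace Z z) \<and> z \<notin> \<real>)"
proof -
  obtain Q :: "'b set" where Q: "orthonormal_basis Q"
    by (rule orthonormal_basis_exists[OF finite_dim])
  have E: "projection_valued_measure E" using E_spectral by (simp add: spectral_measure_def)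
  have A1_sym: "cinner (A1 *\<^sub>V x) y = cinner x (A1 *\<^sub>V y)" for x y
    using A1_self_adjoint unfolding self_adjoint_def by blast
  have "continued_kernel K' Dm \<mu>1 \<mu>2"
    by (rule continued_kernel_of_spectral_measure[OF Q E interval Dm_domain(1,4,3) K'_derivative K'_continuation K'_symmetric])
      (use K'_ends in blast)+
  moreover have "self_adjoint_finite A1 Q"
    by standard (use A1_sym spectrum_A1 Q in auto)
  ultimately interpret coercive_kernel K' Dm \<mu>1 \<mu>2 A1 Q l c0
    using l_sign c0_pos spectrum_A1 K'_positive
    by (auto simp: coercive_kernel_def coercive_kernel_axioms_def closed_nbhd_def)
  have good: "close_contour p q \<Gamma>" using \<Gamma>_admissible \<Gamma>_small by (simp add: close_contour_def)
  have fin: "finite (bspectrum Z)" by (rule finite_bspectrum[OF Q])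
  moreover have "eigenvalue Z z \<and> z isolated_in bspectrum Z \<and> finite_cdim (root_subspace Z z) \<and> z \<notin> \<real>"
    if z: "z \<in> bspectrum Z" for z
  proof (intro conjI notI)
    show ev: "eigenvalue Z z" by (rule bspectrum_eigenvalue[OF Q z])
    show "z isolated_in bspectrum Z" by (rule finite_isolated[OF fin z])
    show "finite_cdim (root_subspace Z z)" using finite_dim by (auto simp: finite_cdim_def)
    assume "z \<in> \<real>"
    then obtain L where L: "z = of_real L" by (rule Reals_cases)
    obtain x where "x \<noteq> 0" "Z *\<^sub>V x = z *\<^sub>C x" using ev by (auto simp: eigenvalue_def)
    then show False using no_real_eigenvalue[OF good, of x L] unfolding L Z_def by blast
  qed
  ultimately show ?thesis by blast
qed

end
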